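(* Let $d\ge 3$, let $\Omega\subseteq\mathbb{R}^d$ be a bounded Lipschitz domain and let $\mathcal{W}\subseteq L^\infty(\Omega)$ be a finite dimensional subspace. There exists $N\in\mathbb{N}$ such that for any $R>0$ and any $q_1\in\mathcal{W}$ such that $\|q_1\|_{L^\infty(\Omega)}\le R$ and $0$ is not a Dirichlet eigenvalue of $-\Delta+q_1$ in $\Omega$, the following is true. There exist $\{f_l\}_{l=1}^N\subseteq H^{1/2}(\partial\Omega)$ such that for any $q_2\in\mathcal{W}$ such that $\|q_2\|_{L^\infty(\Omega)}\le R$ and $0$ is not a Dirichlet eigenvalue of $-\Delta+q_2$ in $\Omega$: $$\text{if }\Lambda_{q_1}f_l=\Lambda_{q_2}f_l\ \text{ for } l=1,\dots,N,\ \text{ then } q_1=q_2.$$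
   Context: For $q\in L^\infty(\Omega)$ such that $0$ is not a Dirichlet eigenvalue of $-\Delta+q$ in $\Omega$, the Dirichlet-to-Neumann (DN) map $\Lambda_q\colon H^{1/2}(\partial\Omega)\to H^{-1/2}(\partial\Omega)$ is defined by $\Lambda_q f=\frac{\partial u}{\partial\nu}\big|_{\partial\Omega}$, where $u\in H^1(\Omega)$ is the unique solution of $(-\Delta+q)u=0$ in $\Omega$ with $u|_{\partial\Omega}=f$, and $\nu$ is the unit outward normal to $\partial\Omega$ (the normal derivative being understood in the usual weak sense). *)

theory Defs
  imports "HOL-Analysis.Analysis" "HOL-Probability.Essential_Supremum"
begin

section \<open>Lipschitz domains\<close>

text \<open>
  Near each boundary point \<Omega> is the region above the graph of a Lipschitz function:
  \<open>\<gamma>\<close> does not depend on the coordinate \<open>x \<bullet> e\<close>, so it is a function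
  on the hyperplane orthogonal to \<open>e\<close>.
\<close>

definition lipschitz_domain :: "'a::euclidean_space set \<Rightarrow> bool" where
  "lipschitz_domain \<Omega> \<longleftrightarrow>
     open \<Omega> \<and> connected \<Omega> \<and> \<Omega> \<noteq> {} \<and>
     (\<forall>p\<in>frontier \<Omega>. \<exists>U e \<gamma> L.
        open U \<and> p \<in> U \<and> norm e = 1 \<and>
        L-lipschitz_on UNIV \<gamma> \<and> (\<forall>x t. \<gamma> (x + t *\<^sub>R e) = \<gamma> x) \<and>
        \<Omega> \<inter> U = {x \<in> U. \<gamma> x < x \<bullet> e})"


section \<open>Hausdorff measure and surface measure\<close>

text \<open>
  The normalization makes the \<open>s\<close>-dimensional measure agree with \<open>s\<close>-dimensional
  Lebesgue measure. The definition is only meant for \<open>s > 0\<close>: since \<open>0 ^ 0 = 1\<close>,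
  for \<open>s = 0\<close> the empty members of a cover would be counted.
\<close>

definition hausdorff_pre :: "nat \<Rightarrow> real \<Rightarrow> 'a::euclidean_space set \<Rightarrow> ennreal" where
  "hausdorff_pre s \<delta> A =
     (INF C \<in> {C :: nat \<Rightarrow> 'a set. A \<subseteq> (\<Union>i. C i) \<and> (\<forall>i. bounded (C i) \<and> diameter (C i) \<le> \<delta>)}.
        \<Sum>i. ennreal (unit_ball_vol (real s) * (diameter (C i) / 2) ^ s))"

definition hausdorff_outer :: "nat \<Rightarrow> 'a::euclidean_space set \<Rightarrow> ennreal" where
  "hausdorff_outer s A = (SUP \<delta>\<in>{0<..}. hausdorff_pre s \<delta> A)"

definition hausdorff_measure :: "nat \<Rightarrow> 'a::euclidean_space measure" where
  "hausdorff_measure s = measure_of UNIV (sets borel) (hausdorff_outer s)"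

text \<open>The Hausdorff outer measure is a measure on the Borel sets.\<close>

lemma hausdorff_pre_mono: "A \<subseteq> B \<Longrightarrow> hausdorff_pre s \<delta> A \<le> hausdorff_pre s \<delta> B"
  unfolding hausdorff_pre_def by (rule INF_superset_mono) auto

lemma hausdorff_pre_antimono: "\<delta> \<le> \<delta>' \<Longrightarrow> hausdorff_pre s \<delta>' A \<le> hausdorff_pre s \<delta> A"
  unfolding hausdorff_pre_def by (rule INF_superset_mono) (auto intro: order_trans)

lemma hausdorff_pre_empty: "s > 0 \<Longrightarrow> \<delta> > 0 \<Longrightarrow> hausdorff_pre s \<delta> {} = 0"
  unfolding hausdorff_pre_def
  by (rule antisym[OF INF_lower2[of "\<lambda>_. {}"]]) (auto simp: power_0_left)

lemma hausdorff_pre_countably_subadditive: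
  "hausdorff_pre s \<delta> (\<Union>i. A i) \<le> (\<Sum>i. hausdorff_pre s \<delta> (A i))"
proof (cases "(\<Sum>i. hausdorff_pre s \<delta> (A i)) = top")
  case False
  let ?w = "\<lambda>S::'a set. ennreal (unit_ball_vol (real s) * (diameter S / 2) ^ s)"
  show ?thesis
  proof (rule ennreal_le_epsilon)
    fix e :: real assume e: "0 < e"
    have "\<exists>C. A i \<subseteq> (\<Union>j. C j) \<and> (\<forall>j. bounded (C j) \<and> diameter (C j) \<le> \<delta>) \<and>
            (\<Sum>j. ?w (C j)) \<le> hausdorff_pre s \<delta> (A i) + ennreal (e * (1/2) ^ Suc i)" for i
    proof -
      have fin: "hausdorff_pre s \<delta> (A i) < top"
        using False ennreal_suminf_lessD[of "\<lambda>i. hausdorff_pre s \<delta> (A i)" top i]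
        by (simp add: less_top)
      have "hausdorff_pre s \<delta> (A i) < hausdorff_pre s \<delta> (A i) + ennreal (e * (1/2) ^ Suc i)"
        using fin e
        by (cases "hausdorff_pre s \<delta> (A i)" rule: ennreal_cases)
           (auto simp: ennreal_plus[symmetric] ennreal_less_iff simp del: ennreal_plus)
      then show ?thesis
        unfolding hausdorff_pre_def[of s \<delta> "A i"] INF_less_iff by (auto intro: less_imp_le)
    qed
    then obtain C where C: "\<And>i. A i \<subseteq> (\<Union>j. C i j)"
        "\<And>i j. bounded (C i j) \<and> diameter (C i j) \<le> \<delta>"
        "\<And>i. (\<Sum>j. ?w (C i j)) \<le> hausdorff_pre s \<delta> (A i) + ennreal (e * (1/2) ^ Suc i)"
      by metis
    let ?D = "\<lambda>n. case prod_decode n of (i, j) \<Rightarrow> C i j"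
    have cov: "(\<Union>i. A i) \<subseteq> (\<Union>n. ?D n)"
    proof
      fix x assume "x \<in> (\<Union>i. A i)"
      then obtain i j where "x \<in> C i j" using C(1) by blast
      then have "x \<in> ?D (prod_encode (i, j))" by simp
      then show "x \<in> (\<Union>n. ?D n)" by (rule UN_I[OF UNIV_I])
    qed
    have "hausdorff_pre s \<delta> (\<Union>i. A i) \<le> (\<Sum>n. ?w (?D n))"
      unfolding hausdorff_pre_def[of s \<delta> "\<Union>i. A i"]
      by (rule INF_lower) (use cov C(2) in \<open>auto split: prod.splits\<close>)
    also have "\<dots> = (\<Sum>i. \<Sum>j. ?w (C i j))"
      using suminf_ennreal_2dimen[of "\<lambda>i. \<Sum>j. ?w (C i j)" "\<lambda>(i,j). ?w (C i j)"]
      by (simp add: case_prod_beta' o_def)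
    also have "\<dots> \<le> (\<Sum>i. hausdorff_pre s \<delta> (A i) + ennreal (e * (1/2) ^ Suc i))"
      by (intro suminf_le C(3)) auto
    also have "\<dots> = (\<Sum>i. hausdorff_pre s \<delta> (A i)) + (\<Sum>i. ennreal (e * (1/2) ^ Suc i))"
      by (intro suminf_add[symmetric]) auto
    also have "(\<Sum>i. ennreal (e * (1/2) ^ Suc i)) = ennreal e"
      using sums_mult[OF power_half_series, of e] e
      by (intro suminf_ennreal_eq) auto
    finally show "hausdorff_pre s \<delta> (\<Union>i. A i) \<le> (\<Sum>i. hausdorff_pre s \<delta> (A i)) + ennreal e" .
  qed
qed simp

lemma hausdorff_outer_empty: "s > 0 \<Longrightarrow> hausdorff_outer s {} = 0"
  unfolding hausdorff_outer_def by (simp add: hausdorff_pre_empty)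

lemma hausdorff_outer_mono: "A \<subseteq> B \<Longrightarrow> hausdorff_outer s A \<le> hausdorff_outer s B"
  unfolding hausdorff_outer_def by (intro SUP_mono') (rule hausdorff_pre_mono)

lemma hausdorff_outer_countably_subadditive:
  "hausdorff_outer s (\<Union>i. A i) \<le> (\<Sum>i. hausdorff_outer s (A i))"
  unfolding hausdorff_outer_def[of s "\<Union>i. A i"]
proof (rule SUP_least)
  fix \<delta> :: real assume "\<delta> \<in> {0<..}"
  then have "(\<Sum>i. hausdorff_pre s \<delta> (A i)) \<le> (\<Sum>i. hausdorff_outer s (A i))"
    by (intro suminf_le) (auto simp: hausdorff_outer_def intro: SUP_upper)
  with hausdorff_pre_countably_subadditive
  show "hausdorff_pre s \<delta> (\<Union>i. A i) \<le> (\<Sum>i. hausdorff_outer s (A i))"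
    by (rule order_trans)
qed

lemma hausdorff_outer_space:
  "s > 0 \<Longrightarrow> outer_measure_space UNIV (hausdorff_outer s)"
  unfolding outer_measure_space_def positive_def increasing_def countably_subadditive_def
  by (auto simp: hausdorff_outer_empty hausdorff_outer_mono hausdorff_outer_countably_subadditive)

lemma hausdorff_outer_Un:
  assumes "s > 0" shows "hausdorff_outer s (A \<union> B :: 'a::euclidean_space set) \<le> hausdorff_outer s A + hausdorff_outer s B"
proof -
  interpret sigma_algebra UNIV "UNIV :: 'a set set"
    using sigma_algebra_Pow[of "UNIV :: 'a set"] by simp
  have sa: "subadditive UNIV (hausdorff_outer s :: 'a set \<Rightarrow> ennreal)"
    using hausdorff_outer_space[OF assms, where 'a='a]
    by (intro countably_subadditive_subadditive) (auto simp: outer_measure_space_def)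
  have "A \<union> B = A \<union> (B - A)" by auto
  then have "hausdorff_outer s (A \<union> B) \<le> hausdorff_outer s A + hausdorff_outer s (B - A)"
    using subadditiveD[OF sa, of A "B - A"] by auto
  also have "\<dots> \<le> hausdorff_outer s A + hausdorff_outer s B"
    by (intro add_left_mono hausdorff_outer_mono) auto
  finally show ?thesis .
qed

lemma hausdorff_outer_separated:
  assumes s: "s > 0" and d: "d > 0" and AB: "\<And>a b. a \<in> A \<Longrightarrow> b \<in> B \<Longrightarrow> d \<le> dist a b"
  shows "hausdorff_outer s A + hausdorff_outer s B \<le> hausdorff_outer s (A \<union> B)"
proof -
  let ?w = "\<lambda>S::'a set. ennreal (unit_ball_vol (real s) * (diameter S / 2) ^ s)"
  have pre: "hausdorff_pre s \<delta> A + hausdorff_pre s \<delta> B \<le> hausdorff_pre s \<delta> (A \<union> B)"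
    if \<delta>: "0 < \<delta>" "\<delta> < d" for \<delta>
    unfolding hausdorff_pre_def[of s \<delta> "A \<union> B"]
  proof (rule INF_greatest)
    fix C :: "nat \<Rightarrow> 'a set"
    assume "C \<in> {C. A \<union> B \<subseteq> (\<Union>i. C i) \<and> (\<forall>i. bounded (C i) \<and> diameter (C i) \<le> \<delta>)}"
    then have C: "A \<union> B \<subseteq> (\<Union>i. C i)" "\<And>i. bounded (C i)" "\<And>i. diameter (C i) \<le> \<delta>" by auto
    let ?CA = "\<lambda>i. if C i \<inter> A \<noteq> {} then C i else {}"
    let ?CB = "\<lambda>i. if C i \<inter> B \<noteq> {} then C i else {}"
    have dj: "C i \<inter> A = {} \<or> C i \<inter> B = {}" for i
    proof (rule ccontr)
      assume "\<not> ?thesis"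
      then obtain a b where "a \<in> C i" "a \<in> A" "b \<in> C i" "b \<in> B" by auto
      then have "d \<le> diameter (C i)"
        using AB[of a b] diameter_bounded_bound[OF C(2), of a i b] by simp
      then show False using C(3)[of i] \<delta> by simp
    qed
    have "hausdorff_pre s \<delta> A \<le> (\<Sum>i. ?w (?CA i))"
      unfolding hausdorff_pre_def using C \<delta> by (intro INF_lower) (auto, blast)
    moreover have "hausdorff_pre s \<delta> B \<le> (\<Sum>i. ?w (?CB i))"
      unfolding hausdorff_pre_def using C \<delta> by (intro INF_lower) (auto, blast)
    ultimately have "hausdorff_pre s \<delta> A + hausdorff_pre s \<delta> B \<le> (\<Sum>i. ?w (?CA i)) + (\<Sum>i. ?w (?CB i))"
      by (rule add_mono)
    also have "\<dots> = (\<Sum>i. ?w (?CA i) + ?w (?CB i))"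
      by (intro suminf_add) auto
    also have "\<dots> \<le> (\<Sum>i. ?w (C i))"
    proof (intro suminf_le)
      show "?w (?CA i) + ?w (?CB i) \<le> ?w (C i)" for i
        using dj[of i] s by (auto simp: power_0_left)
    qed auto
    finally show "hausdorff_pre s \<delta> A + hausdorff_pre s \<delta> B \<le> (\<Sum>i. ?w (C i))" .
  qed
  have "hausdorff_outer s A + hausdorff_outer s B
      = (SUP \<delta>\<in>{0<..}. hausdorff_pre s \<delta> A + hausdorff_pre s \<delta> B)"
    unfolding hausdorff_outer_def
  proof (rule SUP_add_directed_ennreal[symmetric])
    fix i j :: real assume ij: "i \<in> {0<..}" "j \<in> {0<..}"
    show "\<exists>k\<in>{0<..}. hausdorff_pre s i A + hausdorff_pre s j B \<le> hausdorff_pre s k A + hausdorff_pre s k B"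
      using ij by (intro bexI[of _ "min i j"] add_mono hausdorff_pre_antimono) auto
  qed
  also have "\<dots> \<le> hausdorff_outer s (A \<union> B)"
  proof (rule SUP_least)
    fix \<delta> :: real assume \<delta>: "\<delta> \<in> {0<..}"
    let ?m = "min \<delta> (d / 2)"
    have "hausdorff_pre s \<delta> A + hausdorff_pre s \<delta> B \<le> hausdorff_pre s ?m A + hausdorff_pre s ?m B"
      by (intro add_mono hausdorff_pre_antimono) auto
    also have "\<dots> \<le> hausdorff_pre s ?m (A \<union> B)" using \<delta> d by (intro pre) auto
    also have "\<dots> \<le> hausdorff_outer s (A \<union> B)"
      unfolding hausdorff_outer_def using \<delta> d by (intro SUP_upper) auto
    finally show "hausdorff_pre s \<delta> A + hausdorff_pre s \<delta> B \<le> hausdorff_outer s (A \<union> B)" .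
  qed
  finally show ?thesis .
qed

lemma hausdorff_outer_closed:
  fixes F :: "'a::euclidean_space set"
  assumes s: "s > 0" and F: "closed F"
  shows "hausdorff_outer s (X \<inter> F) + hausdorff_outer s (X - F) \<le> hausdorff_outer s X"
proof (cases "F = {} \<or> hausdorff_outer s X = top")
  case True
  then show ?thesis using s by (auto simp: hausdorff_outer_empty)
next
  case False
  then have ne: "F \<noteq> {}" and fin: "hausdorff_outer s X \<noteq> top" by auto
  let ?H = "hausdorff_outer s"
  let ?r = "\<lambda>k. inverse (real (Suc k))"
  define Y where "Y n = {x\<in>X. ?r n \<le> infdist x F}" for n
  define R where "R k = {x\<in>X. ?r (Suc k) \<le> infdist x F \<and> infdist x F < ?r k}" for k
  have sep: "d \<le> dist a b" if "a \<in> {x. t + d \<le> infdist x F}" "b \<in> {x. infdist x F \<le> t}" for a b t d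
    using that infdist_triangle[of a F b] by auto
  have A: "?H (X \<inter> F) + ?H (Y n) \<le> ?H X" for n
  proof -
    have "?H (Y n) + ?H (X \<inter> F) \<le> ?H (Y n \<union> X \<inter> F)"
      by (rule hausdorff_outer_separated[OF s, of "?r n"])
         (auto intro!: sep[of _ 0] simp: Y_def)
    also have "\<dots> \<le> ?H X" by (rule hausdorff_outer_mono) (auto simp: Y_def)
    finally show ?thesis by (simp add: add.commute)
  qed
  have par: "(\<Sum>k<n. ?H (R (2 * k + c))) \<le> ?H X" for n c
  proof -
    have "(\<Sum>k<n. ?H (R (2 * k + c))) \<le> ?H (\<Union>k<n. R (2 * k + c))"
    proof (induction n)
      case (Suc n)
      have "(\<Sum>k<Suc n. ?H (R (2 * k + c))) \<le> ?H (\<Union>k<n. R (2 * k + c)) + ?H (R (2 * n + c))"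
        using Suc by (simp add: add_right_mono)
      also have "\<dots> \<le> ?H ((\<Union>k<n. R (2 * k + c)) \<union> R (2 * n + c))"
      proof (rule hausdorff_outer_separated[OF s])
        let ?m = "2 * n + c"
        show "0 < (if ?m = 0 then 1 else ?r (?m - 1) - ?r ?m)" by (auto simp: field_simps)
        fix a b assume a: "a \<in> (\<Union>k<n. R (2 * k + c))" and b: "b \<in> R ?m"
        then obtain k where k: "k < n" "a \<in> R (2 * k + c)" by auto
        then have m: "?m \<noteq> 0" "Suc (2 * k + c) \<le> ?m - 1" by auto
        from m(2) have "?r (?m - 1) \<le> ?r (Suc (2 * k + c))" by (intro le_imp_inverse_le) auto
        also have "\<dots> \<le> infdist a F" using k(2) unfolding R_def by blast
        finally have "?r (?m - 1) \<le> infdist a F" .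
        moreover have "infdist b F \<le> ?r ?m" using b by (auto simp: R_def)
        ultimately show "(if ?m = 0 then 1 else ?r (?m - 1) - ?r ?m) \<le> dist a b"
          using sep[of a "?r ?m" "?r (?m - 1) - ?r ?m" b] m by auto
      qed
      also have "(\<Union>k<n. R (2 * k + c)) \<union> R (2 * n + c) = (\<Union>k<Suc n. R (2 * k + c))"
        by (auto simp: lessThan_Suc)
      finally show ?case .
    qed simp
    also have "\<dots> \<le> ?H X" by (rule hausdorff_outer_mono) (auto simp: R_def)
    finally show ?thesis .
  qed
  have "(\<Sum>k<n. ?H (R k)) \<le> ?H X + ?H X" for n
  proof -
    have "(\<Sum>k<n. ?H (R k)) \<le> (\<Sum>k<2*n. ?H (R k))" by (rule sum_mono2) auto
    also have "\<dots> = (\<Sum>k<n. ?H (R (2 * k + 0))) + (\<Sum>k<n. ?H (R (2 * k + 1)))"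
      by (induction n) (simp_all add: ac_simps)
    also have "\<dots> \<le> ?H X + ?H X" by (intro add_mono par)
    finally show ?thesis .
  qed
  then have "(\<Sum>k. ?H (R k)) \<le> ?H X + ?H X"
    by (intro suminf_le_const) auto
  then have sumfin: "(\<Sum>k. ?H (R k)) \<noteq> top" using fin by (auto simp: top_unique)
  have tail: "(\<lambda>n. \<Sum>k. ?H (R (k + n))) \<longlonglongrightarrow> 0"
  proof -
    have "?H (R k) \<noteq> top" for k
      using sumfin ennreal_suminf_lessD[of "\<lambda>k. ?H (R k)" top k] by (simp add: less_top)
    then have h: "?H (R k) = ennreal (enn2real (?H (R k)))" for k by (simp add: less_top)
    have sm: "summable (\<lambda>k. enn2real (?H (R k)))"
      using sumfin by (intro summable_suminf_not_top) (simp_all flip: h)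
    have "(\<lambda>n. ennreal (\<Sum>k. enn2real (?H (R (k + n))))) \<longlonglongrightarrow> ennreal 0"
      by (intro tendsto_ennrealI suminf_exist_split2 sm)
    moreover have "ennreal (\<Sum>k. enn2real (?H (R (k + n)))) = (\<Sum>k. ?H (R (k + n)))" for n
      using summable_ignore_initial_segment[OF sm, of n]
      by (subst suminf_ennreal2[symmetric]) (simp_all flip: h)
    ultimately show ?thesis by simp
  qed
  have "?H (X \<inter> F) + ?H (X - F) \<le> ?H X + (\<Sum>k. ?H (R (k + n)))" for n
  proof -
    have "X - F \<subseteq> Y n \<union> (\<Union>k. R (k + n))"
    proof
      fix x assume x: "x \<in> X - F"
      then have pos: "0 < infdist x F"
        using F ne in_closed_iff_infdist_zero[of F x] infdist_nonneg[of x F] by force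
      show "x \<in> Y n \<union> (\<Union>k. R (k + n))"
      proof (cases "x \<in> Y n")
        case False
        define m where "m = (LEAST m. ?r m \<le> infdist x F)"
        have ex: "\<exists>m. ?r m \<le> infdist x F"
          using reals_Archimedean[OF pos] by (auto intro: less_imp_le)
        then have m: "?r m \<le> infdist x F" unfolding m_def by (rule LeastI_ex)
        have nm: "n < m"
        proof (rule ccontr)
          assume "\<not> n < m"
          then have "?r n \<le> ?r m" by (intro le_imp_inverse_le) auto
          also note m
          finally show False using False x by (simp add: Y_def)
        qed
        then obtain k where k: "m = Suc (k + n)" using less_imp_Suc_add[of n m] by (auto simp: add.commute)
        have "\<not> ?r (k + n) \<le> infdist x F"
          using not_less_Least[of "k + n" "\<lambda>m. ?r m \<le> infdist x F"] k by (simp add: m_def)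
        then have "x \<in> R (k + n)" using m x k by (auto simp: R_def)
        then show ?thesis by blast
      qed simp
    qed
    then have "?H (X - F) \<le> ?H (Y n \<union> (\<Union>k. R (k + n)))" by (rule hausdorff_outer_mono)
    also have "\<dots> \<le> ?H (Y n) + ?H (\<Union>k. R (k + n))" by (rule hausdorff_outer_Un[OF s])
    also have "\<dots> \<le> ?H (Y n) + (\<Sum>k. ?H (R (k + n)))"
      by (intro add_left_mono hausdorff_outer_countably_subadditive)
    finally have "?H (X \<inter> F) + ?H (X - F) \<le> (?H (X \<inter> F) + ?H (Y n)) + (\<Sum>k. ?H (R (k + n)))"
      by (simp add: add_left_mono add.assoc)
    also have "\<dots> \<le> ?H X + (\<Sum>k. ?H (R (k + n)))" by (intro add_right_mono A)
    finally show ?thesis .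
  qed
  moreover have "(\<lambda>n. ?H X + (\<Sum>k. ?H (R (k + n)))) \<longlonglongrightarrow> ?H X + 0"
    by (intro tendsto_add tendsto_const tail)
  ultimately show ?thesis
    by (intro LIMSEQ_le_const[where X = "\<lambda>n. ?H X + (\<Sum>k. ?H (R (k + n)))"]) auto
qed

lemma measure_space_hausdorff_outer:
  assumes s: "s > 0"
  shows "measure_space UNIV (sets (borel :: 'a::euclidean_space measure)) (hausdorff_outer s)"
proof -
  interpret sigma_algebra UNIV "UNIV :: 'a set set"
    using sigma_algebra_Pow[of "UNIV :: 'a set"] by simp
  let ?L = "lambda_system UNIV UNIV (hausdorff_outer s) :: 'a set set"
  have L: "measure_space UNIV ?L (hausdorff_outer s)"
    by (rule caratheodory_lemma[OF hausdorff_outer_space[OF s]])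
  then interpret L: sigma_algebra UNIV ?L by (simp add: measure_space_def)
  have "F \<in> ?L" if "closed F" for F :: "'a set"
  proof -
    have "hausdorff_outer s X \<le> hausdorff_outer s (X \<inter> F) + hausdorff_outer s (X - F)" for X :: "'a set"
      using hausdorff_outer_Un[OF s, of "X \<inter> F" "X - F"] by (simp add: Int_Diff_Un)
    then show ?thesis
      using hausdorff_outer_closed[OF s that] by (auto simp: lambda_system_eq intro: antisym)
  qed
  then have "sigma_sets UNIV {F. closed F} \<subseteq> ?L"
    by (intro L.sigma_sets_subset) auto
  then have "sets (borel :: 'a measure) \<subseteq> ?L"
    by (simp add: borel_eq_closed)
  then show ?thesis
    by (rule measure_down[OF L sets.sigma_algebra_axioms[of borel, unfolded space_borel]])
qed

lemma space_hausdorff_measure [simp]: "space (hausdorff_measure s) = UNIV"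
  unfolding hausdorff_measure_def by (simp add: space_measure_of_conv)

lemma sets_hausdorff_measure [simp, measurable_cong]: "sets (hausdorff_measure s) = sets borel"
  unfolding hausdorff_measure_def using sets.sigma_sets_eq[of borel] by simp

lemma emeasure_hausdorff_measure:
  assumes "s > 0" "A \<in> sets borel"
  shows "emeasure (hausdorff_measure s) A = hausdorff_outer s A"
  using measure_space_hausdorff_outer[OF assms(1), where 'a='a] assms
  by (intro emeasure_measure_of[OF hausdorff_measure_def])
     (auto simp: measure_space_def)

definition surface_measure :: "'a::euclidean_space set \<Rightarrow> 'a measure" where
  "surface_measure \<Omega> = restrict_space (hausdorff_measure (DIM('a) - 1)) (frontier \<Omega>)"


section \<open>Lebesgue spaces of complex-valued functions\<close>

text \<open>
  Elements of \<open>L\<^sup>2\<close>, \<open>L\<^sup>\<infinity>\<close>, \<open>H\<^sup>1\<close> and \<open>H\<^sup>1\<^sup>/\<^sup>2\<close> are represented by functions; equality in these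
  spaces is equality almost everywhere. Values outside of \<Omega> (or of its boundary) are irrelevant.
\<close>

definition L2 :: "'a measure \<Rightarrow> ('a \<Rightarrow> complex) set" where
  "L2 M = {u \<in> borel_measurable M. integrable M (\<lambda>x. (cmod (u x))\<^sup>2)}"

definition Linf_norm :: "'a::euclidean_space set \<Rightarrow> ('a \<Rightarrow> complex) \<Rightarrow> ereal" where
  "Linf_norm \<Omega> q = esssup (lebesgue_on \<Omega>) (\<lambda>x. ereal (cmod (q x)))"

definition Linf :: "'a::euclidean_space set \<Rightarrow> ('a \<Rightarrow> complex) set" where
  "Linf \<Omega> = {q \<in> borel_measurable (lebesgue_on \<Omega>). Linf_norm \<Omega> q < \<infinity>}"

text \<open>
  \<open>W\<close> is a set of representatives of a finite-dimensional subspace of \<open>L\<^sup>\<infinity>(\<Omega>)\<close>.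
  Only closure under real scalars is required: this covers complex subspaces (spanned over the
  reals by \<open>B \<union> \<i> B\<close>) as well as real subspaces of real-valued functions.
\<close>

definition finite_dim_subspace_Linf ::
    "'a::euclidean_space set \<Rightarrow> ('a \<Rightarrow> complex) set \<Rightarrow> bool" where
  "finite_dim_subspace_Linf \<Omega> W \<longleftrightarrow>
     W \<subseteq> Linf \<Omega> \<and>
     (\<lambda>x. 0) \<in> W \<and>
     (\<forall>u\<in>W. \<forall>v\<in>W. (\<lambda>x. u x + v x) \<in> W) \<and>
     (\<forall>c::real. \<forall>u\<in>W. (\<lambda>x. c *\<^sub>R u x) \<in> W) \<and>
     (\<exists>B. finite B \<and> B \<subseteq> W \<and>
        (\<forall>w\<in>W. \<exists>c::('a \<Rightarrow> complex) \<Rightarrow> real.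
           AE x in lebesgue_on \<Omega>. w x = (\<Sum>b\<in>B. c b *\<^sub>R b x)))"


section \<open>Smooth functions, weak derivatives and \<open>H\<^sup>1(\<Omega>)\<close>\<close>

primrec C_k :: "nat \<Rightarrow> ('a::euclidean_space \<Rightarrow> complex) \<Rightarrow> bool" where
  "C_k 0 f \<longleftrightarrow> continuous_on UNIV f"
| "C_k (Suc k) f \<longleftrightarrow>
     (\<forall>x. f differentiable (at x)) \<and>
     (\<forall>b\<in>Basis. C_k k (\<lambda>x. frechet_derivative f (at x) b))"

definition smooth :: "('a::euclidean_space \<Rightarrow> complex) \<Rightarrow> bool" where
  "smooth f \<longleftrightarrow> (\<forall>k. C_k k f)"

definition test_fun :: "'a::euclidean_space set \<Rightarrow> ('a \<Rightarrow> complex) \<Rightarrow> bool" where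
  "test_fun \<Omega> \<phi> \<longleftrightarrow> smooth \<phi> \<and> (\<exists>K. compact K \<and> K \<subseteq> \<Omega> \<and> (\<forall>x. x \<notin> K \<longrightarrow> \<phi> x = 0))"

definition has_weak_deriv ::
    "'a::euclidean_space set \<Rightarrow> 'a \<Rightarrow> ('a \<Rightarrow> complex) \<Rightarrow> ('a \<Rightarrow> complex) \<Rightarrow> bool" where
  "has_weak_deriv \<Omega> b u g \<longleftrightarrow>
     (\<forall>\<phi>. test_fun \<Omega> \<phi> \<longrightarrow>
        (LINT x|lebesgue_on \<Omega>. u x * frechet_derivative \<phi> (at x) b)
          = - (LINT x|lebesgue_on \<Omega>. g x * \<phi> x))"

definition H1 :: "'a::euclidean_space set \<Rightarrow> ('a \<Rightarrow> complex) set" where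
  "H1 \<Omega> = {u \<in> L2 (lebesgue_on \<Omega>).
     \<forall>b\<in>Basis. \<exists>g\<in>L2 (lebesgue_on \<Omega>). has_weak_deriv \<Omega> b u g}"

definition weak_deriv ::
    "'a::euclidean_space set \<Rightarrow> 'a \<Rightarrow> ('a \<Rightarrow> complex) \<Rightarrow> 'a \<Rightarrow> complex" where
  "weak_deriv \<Omega> b u = (SOME g. g \<in> L2 (lebesgue_on \<Omega>) \<and> has_weak_deriv \<Omega> b u g)"

definition H1_norm :: "'a::euclidean_space set \<Rightarrow> ('a \<Rightarrow> complex) \<Rightarrow> real" where
  "H1_norm \<Omega> u = sqrt ((LINT x|lebesgue_on \<Omega>. (cmod (u x))\<^sup>2) +
     (\<Sum>b\<in>Basis. LINT x|lebesgue_on \<Omega>. (cmod (weak_deriv \<Omega> b u x))\<^sup>2))"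


section \<open>Traces and \<open>H\<^sup>1\<^sup>/\<^sup>2(\<partial>\<Omega>)\<close>\<close>

text \<open>
  The graph of the trace operator \<open>H\<^sup>1(\<Omega>) \<rightarrow> L\<^sup>2(\<partial>\<Omega>)\<close>, the continuous extension of
  \<open>\<phi> \<mapsto> \<phi>|\<^bsub>\<partial>\<Omega>\<^esub>\<close> from functions smooth up to the boundary; \<open>H\<^sup>1\<^sup>/\<^sup>2(\<partial>\<Omega>)\<close> is its range.
\<close>

definition has_trace ::
    "'a::euclidean_space set \<Rightarrow> ('a \<Rightarrow> complex) \<Rightarrow> ('a \<Rightarrow> complex) \<Rightarrow> bool" where
  "has_trace \<Omega> u f \<longleftrightarrow>
     u \<in> H1 \<Omega> \<and> f \<in> L2 (surface_measure \<Omega>) \<and>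
     (\<exists>\<phi>. (\<forall>n. smooth (\<phi> n)) \<and>
        (\<lambda>n. H1_norm \<Omega> (\<lambda>x. \<phi> n x - u x)) \<longlonglongrightarrow> 0 \<and>
        (\<lambda>n. \<integral>\<^sup>+ x. ennreal ((cmod (\<phi> n x - f x))\<^sup>2) \<partial>surface_measure \<Omega>) \<longlonglongrightarrow> 0)"

definition H_half :: "'a::euclidean_space set \<Rightarrow> ('a \<Rightarrow> complex) set" where
  "H_half \<Omega> = {f. \<exists>u\<in>H1 \<Omega>. has_trace \<Omega> u f}"


section \<open>The Schroedinger equation and the Dirichlet-to-Neumann map\<close>

definition schroedinger_form ::
    "'a::euclidean_space set \<Rightarrow> ('a \<Rightarrow> complex) \<Rightarrow> ('a \<Rightarrow> complex) \<Rightarrow> ('a \<Rightarrow> complex) \<Rightarrow> complex" where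
  "schroedinger_form \<Omega> q u v =
     (LINT x|lebesgue_on \<Omega>.
        (\<Sum>b\<in>Basis. weak_deriv \<Omega> b u x * weak_deriv \<Omega> b v x) + q x * u x * v x)"

text \<open>\<open>(-\<Delta> + q) u = 0\<close> in \<Omega>, in the sense of distributions.\<close>

definition solves_schroedinger ::
    "'a::euclidean_space set \<Rightarrow> ('a \<Rightarrow> complex) \<Rightarrow> ('a \<Rightarrow> complex) \<Rightarrow> bool" where
  "solves_schroedinger \<Omega> q u \<longleftrightarrow>
     u \<in> H1 \<Omega> \<and> (\<forall>\<phi>. test_fun \<Omega> \<phi> \<longrightarrow> schroedinger_form \<Omega> q u \<phi> = 0)"

definition dirichlet_eigenvalue ::
    "'a::euclidean_space set \<Rightarrow> ('a \<Rightarrow> complex) \<Rightarrow> complex \<Rightarrow> bool" where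
  "dirichlet_eigenvalue \<Omega> q \<mu> \<longleftrightarrow>
     (\<exists>u. solves_schroedinger \<Omega> (\<lambda>x. q x - \<mu>) u \<and> has_trace \<Omega> u (\<lambda>x. 0) \<and>
          \<not> (AE x in lebesgue_on \<Omega>. u x = 0))"

definition dirichlet_solution ::
    "'a::euclidean_space set \<Rightarrow> ('a \<Rightarrow> complex) \<Rightarrow> ('a \<Rightarrow> complex) \<Rightarrow> 'a \<Rightarrow> complex" where
  "dirichlet_solution \<Omega> q f = (SOME u. solves_schroedinger \<Omega> q u \<and> has_trace \<Omega> u f)"

text \<open>
  \<open>dn_map \<Omega> q f\<close> is the normal derivative of the solution \<open>u\<close> with boundary value \<open>f\<close>, as a
  functional on \<open>H\<^sup>1\<^sup>/\<^sup>2(\<partial>\<Omega>)\<close>: by Green's formula the pairing of \<open>\<partial>u/\<partial>\<nu>\<close> with \<open>g\<close> is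
  \<open>\<integral> \<nabla>u \<cdot> \<nabla>v + q u v\<close> for any \<open>v \<in> H\<^sup>1(\<Omega>)\<close> with \<open>v|\<^bsub>\<partial>\<Omega>\<^esub> = g\<close>. The pairing is
  bilinear, without complex conjugation. Being restricted to \<open>H_half \<Omega>\<close>, two values of
  \<open>dn_map\<close> are equal iff they are equal as functionals.
\<close>

definition dn_map ::
    "'a::euclidean_space set \<Rightarrow> ('a \<Rightarrow> complex) \<Rightarrow> ('a \<Rightarrow> complex) \<Rightarrow> ('a \<Rightarrow> complex) \<Rightarrow> complex" where
  "dn_map \<Omega> q f =
     (\<lambda>g\<in>H_half \<Omega>. schroedinger_form \<Omega> q (dirichlet_solution \<Omega> q f) (SOME v. has_trace \<Omega> v g))"

end

theory Submission
  imports Defs "HOL-Library.Function_Algebras" "HOL-Real_Asymp.Real_Asymp"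
begin

text \<open>
  Let \<open>w = q2 - q1\<close> and let \<open>u\<close> be the solution for \<open>q1\<close> with Dirichlet data \<open>f\<close>. If both potentials
  have the same Neumann data for \<open>f\<close>, the difference \<open>z\<close> of the two solutions has zero Cauchy data, so
  \<open>z\<close>, extended by zero, satisfies \<open>(-\<Delta> + q2) z = w u\<close> in the whole space
  (\<open>dn_map_eq_imp_difference_equation\<close>). Testing this equation with exponentials \<open>exp ((a + \<i> c) \<bullet> x)\<close>
  turns it into a relation between Fourier coefficients. On a lattice of frequencies that is shifted so that
  \<open>a \<bullet> k\<close> stays away from zero, Parseval's identity yields a Carleman estimate for \<open>z\<close> which gains a
  factor \<open>1 / |a|\<close> (\<open>carleman_estimate\<close>). It follows that the moment of \<open>w u\<close> against
  \<open>exp ((a + \<i> c) \<bullet> x)\<close> is \<open>O(1 / |a|)\<close> whenever the square of the vector \<open>a + \<i> c\<close> is zero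
  (\<open>exponential_moment_bound\<close>).

  The same bound provides, by duality, solutions for \<open>q1\<close> which behave like
  \<open>exp ((-a + \<i> c') \<bullet> x)\<close>: a function that annihilates all solutions with smooth Dirichlet data is the
  right-hand side of an equation of the same kind, so it nearly annihilates this exponential. So the
  exponential is approximated by such solutions with a relative error \<open>O(1 / |a|)\<close> in \<open>L\<^sup>2(\<Omega>)\<close>
  (\<open>approximate_cgo_solution\<close>). In dimension at least three, every lattice frequency \<open>\<xi>\<close> is a sum
  \<open>c + c'\<close> for suitable \<open>a\<close>, \<open>c\<close>, \<open>c'\<close> with \<open>a\<close> as large as desired (\<open>phase_vectors\<close>). Taking
  for \<open>f\<close> the boundary values of the approximating solution, equality of the Neumann data implies that the
  Fourier coefficient of \<open>w\<close> at \<open>\<xi>\<close> is at most \<open>O(1 / |a|)\<close> times the norm of \<open>w\<close> in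
  \<open>L\<^sup>\<infinity>\<close> (\<open>fourier_coefficient_bound\<close>). On the finite-dimensional space \<open>W\<close> this norm is
  controlled by the Fourier coefficients at finitely many frequencies
  (\<open>Linf_norm_le_finitely_many_fourier_coefficients\<close>); hence \<open>w = 0\<close> once \<open>|a|\<close> is large. The number
  \<open>N\<close> of measurements is the number of these frequencies and depends on \<open>W\<close> only, while \<open>a\<close> and the Dirichlet data
  depend on \<open>R\<close> and \<open>q1\<close>.

  The Dirichlet problems are solved in the closure of the test functions by the Fredholm alternative
  (\<open>fredholm_alternative\<close>), where Parseval's identity supplies the compactness
  (\<open>low_frequency_bound\<close>). All Dirichlet data are smooth functions; they are square-integrable on
  the boundary because a bounded Lipschitz domain has finite surface measure
  (\<open>hausdorff_outer_frontier_finite\<close>). That functions with zero trace are limits of test functions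
  is deduced from the hypothesis that \<open>0\<close> is not a Dirichlet eigenvalue (\<open>zero_trace_imp_H10\<close>).
\<close>

section \<open>Hilbert spaces of functions and the Fredholm alternative\<close>

text \<open>
  With the pointwise operations, spaces of functions are subspaces of a real vector space.
\<close>

instantiation "fun" :: (type, real_vector) real_vector
begin
definition "scaleR_fun c f = (\<lambda>x. c *\<^sub>R f x)"
instance
  by standard (auto simp: scaleR_fun_def fun_eq_iff scaleR_add_right scaleR_add_left)
end

lemma scaleR_fun_apply [simp]: "(c *\<^sub>R f) x = c *\<^sub>R f x"
  by (simp add: scaleR_fun_def)

text \<open>
  The form \<open>ip\<close> may be degenerate: in the applications its null vectors are the functions that
  vanish almost everywhere. Elements of \<open>L\<^sup>2\<close> and \<open>H\<^sup>1\<close> can then remain functions. Scalars are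
  real; complex spaces are used with the real part of their inner product.
\<close>

locale hilbert_on =
  fixes V :: "'v::real_vector set" and ip :: "'v \<Rightarrow> 'v \<Rightarrow> real"
  assumes V: "subspace V"
    and ip_add: "\<And>u v w. u \<in> V \<Longrightarrow> v \<in> V \<Longrightarrow> w \<in> V \<Longrightarrow> ip (u + v) w = ip u w + ip v w"
    and ip_scale: "\<And>c u w. u \<in> V \<Longrightarrow> w \<in> V \<Longrightarrow> ip (c *\<^sub>R u) w = c * ip u w"
    and ip_commute: "\<And>u w. u \<in> V \<Longrightarrow> w \<in> V \<Longrightarrow> ip u w = ip w u"
    and ip_nonneg: "\<And>u. u \<in> V \<Longrightarrow> 0 \<le> ip u u"
    and complete: "\<And>X. (\<And>n. X n \<in> V) \<Longrightarrow>
        (\<And>e. e > 0 \<Longrightarrow> \<exists>N. \<forall>m\<ge>N. \<forall>n\<ge>N. ip (X m - X n) (X m - X n) < e) \<Longrightarrow>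
        \<exists>l\<in>V. (\<lambda>n::nat. ip (X n - l) (X n - l)) \<longlonglongrightarrow> 0"
begin

definition nrm :: "'v \<Rightarrow> real" where "nrm u = sqrt (ip u u)"

lemma V_add [simp]: "u \<in> V \<Longrightarrow> v \<in> V \<Longrightarrow> u + v \<in> V"
  and V_diff [simp]: "u \<in> V \<Longrightarrow> v \<in> V \<Longrightarrow> u - v \<in> V"
  and V_scale [simp]: "u \<in> V \<Longrightarrow> c *\<^sub>R u \<in> V"
  and V_0 [simp]: "0 \<in> V"
  using V by (auto intro: subspace_add subspace_diff subspace_scale subspace_0)

lemma ip_add_right: "u \<in> V \<Longrightarrow> v \<in> V \<Longrightarrow> w \<in> V \<Longrightarrow> ip w (u + v) = ip w u + ip w v"
  using ip_add[of u v w] by (simp add: ip_commute)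

lemma ip_scale_right: "u \<in> V \<Longrightarrow> w \<in> V \<Longrightarrow> ip w (c *\<^sub>R u) = c * ip w u"
  using ip_scale[of u w c] by (simp add: ip_commute)

lemma ip_diff: "u \<in> V \<Longrightarrow> v \<in> V \<Longrightarrow> w \<in> V \<Longrightarrow> ip (u - v) w = ip u w - ip v w"
  using ip_add[of "u - v" v w] by simp

lemma ip_diff_right: "u \<in> V \<Longrightarrow> v \<in> V \<Longrightarrow> w \<in> V \<Longrightarrow> ip w (u - v) = ip w u - ip w v"
  using ip_add_right[of "u - v" v w] by simp

lemmas ip_simps = ip_add ip_add_right ip_scale ip_scale_right ip_diff ip_diff_right

lemma nrm_nonneg [simp]: "u \<in> V \<Longrightarrow> 0 \<le> nrm u"
  by (simp add: nrm_def ip_nonneg)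

lemma nrm_sq: "u \<in> V \<Longrightarrow> (nrm u)\<^sup>2 = ip u u"
  by (simp add: nrm_def ip_nonneg)

lemma nrm_scale: "u \<in> V \<Longrightarrow> nrm (c *\<^sub>R u) = \<bar>c\<bar> * nrm u"
  by (simp add: nrm_def ip_simps real_sqrt_mult flip: mult.assoc)

lemma nrm_minus_commute: "u \<in> V \<Longrightarrow> v \<in> V \<Longrightarrow> nrm (u - v) = nrm (v - u)"
  using nrm_scale[of "u - v" "-1"] by simp

lemma quad_nonneg_imp:
  fixes a b c :: real
  assumes "\<And>t. 0 \<le> a + 2 * t * b + t\<^sup>2 * c" "c \<ge> 0"
  shows "b\<^sup>2 \<le> a * c"
proof (cases "c = 0")
  case True
  have "b = 0"
  proof (rule ccontr)
    assume "b \<noteq> 0"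
    then show False using assms(1)[of "- (a + 1) / (2 * b)"] True by (simp add: field_simps)
  qed
  then show ?thesis using True by simp
next
  case False
  then have "c > 0" using assms(2) by simp
  have "0 \<le> c * (a + 2 * (-b/c) * b + (-b/c)\<^sup>2 * c)"
    using assms(1)[of "-b/c"] \<open>c > 0\<close> by simp
  also have "\<dots> = a * c - b\<^sup>2" using False by (simp add: field_simps power2_eq_square)
  finally show ?thesis by simp
qed

lemma cauchy_schwarz:
  assumes "u \<in> V" "v \<in> V" shows "\<bar>ip u v\<bar> \<le> nrm u * nrm v"
proof -
  have "0 \<le> ip u u + 2 * t * ip u v + t\<^sup>2 * ip v v" for t
    using ip_nonneg[of "u + t *\<^sub>R v"] assms ip_commute[of u v]
    by (simp add: ip_simps algebra_simps power2_eq_square)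
  then have "(ip u v)\<^sup>2 \<le> ip u u * ip v v"
    using ip_nonneg assms by (intro quad_nonneg_imp) auto
  then have "sqrt ((ip u v)\<^sup>2) \<le> sqrt (ip u u * ip v v)" by (rule real_sqrt_le_mono)
  then show ?thesis by (simp add: nrm_def real_sqrt_mult)
qed

lemma nrm_triangle:
  assumes "u \<in> V" "v \<in> V" shows "nrm (u + v) \<le> nrm u + nrm v"
proof (rule power2_le_imp_le)
  have "ip u v \<le> nrm u * nrm v" using cauchy_schwarz[OF assms] by simp
  then show "(nrm (u + v))\<^sup>2 \<le> (nrm u + nrm v)\<^sup>2"
    using assms ip_commute[of u v] by (simp add: power2_sum nrm_sq ip_simps)
qed (use assms in simp)

lemma complete_nrm:
  assumes X: "\<And>n. X n \<in> V" and C: "\<And>e. e > 0 \<Longrightarrow> \<exists>N. \<forall>m\<ge>N. \<forall>n\<ge>N. nrm (X m - X n) < e"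
  shows "\<exists>l\<in>V. (\<lambda>n::nat. nrm (X n - l)) \<longlonglongrightarrow> 0"
proof -
  have "\<exists>l\<in>V. (\<lambda>n::nat. ip (X n - l) (X n - l)) \<longlonglongrightarrow> 0"
  proof (rule complete[OF X])
    fix e :: real assume "e > 0"
    then obtain N where N: "\<forall>m\<ge>N. \<forall>n\<ge>N. nrm (X m - X n) < sqrt e" using C[of "sqrt e"] by auto
    show "\<exists>N. \<forall>m\<ge>N. \<forall>n\<ge>N. ip (X m - X n) (X m - X n) < e"
      using N by (intro exI[of _ N]) (auto simp: nrm_def)
  qed
  then obtain l where l: "l \<in> V" "(\<lambda>n. ip (X n - l) (X n - l)) \<longlonglongrightarrow> 0" by blast
  have "(\<lambda>n. nrm (X n - l)) \<longlonglongrightarrow> 0"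
    unfolding nrm_def using tendsto_real_sqrt[OF l(2)] by simp
  then show ?thesis using l(1) by blast
qed

lemma tendsto_ip:
  assumes X: "\<And>n. X n \<in> V" and l: "l \<in> V" and v: "v \<in> V" and lim: "(\<lambda>n::nat. nrm (X n - l)) \<longlonglongrightarrow> 0"
  shows "(\<lambda>n. ip (X n) v) \<longlonglongrightarrow> ip l v"
proof -
  have "(\<lambda>n. ip (X n) v - ip l v) \<longlonglongrightarrow> 0"
  proof (rule Lim_null_comparison)
    show "\<forall>\<^sub>F n in sequentially. norm (ip (X n) v - ip l v) \<le> nrm (X n - l) * nrm v"
      using cauchy_schwarz[of "X _ - l" v] X l v by (simp add: ip_simps)
    show "(\<lambda>n. nrm (X n - l) * nrm v) \<longlonglongrightarrow> 0"
      using tendsto_mult_right[OF lim, of "nrm v"] by simp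
  qed
  then show ?thesis by (rule LIM_zero_cancel)
qed

text \<open>
  Riesz representation and orthogonal projection at once. A minimizing sequence of
  \<open>ip u u - 2 * F u\<close> over \<open>U\<close> is Cauchy by the parallelogram law, and its limit, which lies only in the
  closure of \<open>U\<close>, satisfies the Euler equation of this functional.
\<close>

lemma bounded_linear_represented_in_closure:
  assumes U: "subspace U" "U \<subseteq> V"
    and F_add: "\<And>u v. u \<in> U \<Longrightarrow> v \<in> U \<Longrightarrow> F (u + v) = F u + F v"
    and F_scale: "\<And>c u. u \<in> U \<Longrightarrow> F (c *\<^sub>R u) = c * F u"
    and F_bound: "\<And>u. u \<in> U \<Longrightarrow> \<bar>F u\<bar> \<le> C * nrm u"
  obtains p X where "p \<in> V" "\<And>n::nat. X n \<in> U" "(\<lambda>n. nrm (X n - p)) \<longlonglongrightarrow> 0"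
    "\<And>u. u \<in> U \<Longrightarrow> ip p u = F u"
proof -
  define J where "J u = ip u u - 2 * F u" for u
  define d where "d = Inf (J ` U)"
  have UV: "u \<in> V" if "u \<in> U" for u using that U(2) by blast
  have U_closed: "u + v \<in> U" "c *\<^sub>R u \<in> U" if "u \<in> U" "v \<in> U" for u v c
    using that U(1) by (auto intro: subspace_add subspace_scale)
  have J_lower: "- (C\<^sup>2) \<le> J u" if "u \<in> U" for u
  proof -
    have "0 \<le> (nrm u - C)\<^sup>2" by simp
    then show ?thesis
      using F_bound[OF that] UV[OF that] nrm_sq[of u] by (simp add: J_def power2_diff abs_le_iff mult.commute)
  qed
  have bdd: "bdd_below (J ` U)" using J_lower by (auto simp: bdd_below_def)
  have ne: "U \<noteq> {}" using subspace_0[OF U(1)] by blast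
  have d_le: "d \<le> J u" if "u \<in> U" for u
    unfolding d_def using that bdd by (auto intro: cInf_lower)
  have "\<exists>u\<in>U. J u < d + inverse (real (Suc n))" for n
    using cInf_lessD[of "J ` U" "d + inverse (real (Suc n))"] ne by (auto simp: d_def)
  then obtain X where X: "\<And>n. X n \<in> U" "\<And>n. J (X n) < d + inverse (real (Suc n))"
    by metis
  have para: "ip (x - y) (x - y) \<le> 2 * (J x - d) + 2 * (J y - d)" if "x \<in> U" "y \<in> U" for x y
  proof -
    have "d \<le> J ((1/2) *\<^sub>R (x + y))" using that by (intro d_le U_closed) auto
    also have "\<dots> = (ip x x + 2 * ip x y + ip y y) / 4 - F x - F y"
    proof -
      have "F ((1/2) *\<^sub>R (x + y)) = (F x + F y) / 2"
        using that U_closed(1) by (simp add: F_add F_scale del: scaleR_right_distrib scaleR_add_right)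
      moreover have "ip ((1/2) *\<^sub>R (x + y)) ((1/2) *\<^sub>R (x + y)) = (ip x x + 2 * ip x y + ip y y) / 4"
        using that UV[of x] UV[of y] ip_commute[of x y] by (simp add: ip_simps add_divide_distrib)
      ultimately show ?thesis by (simp add: J_def add_divide_distrib)
    qed
    finally have le: "d \<le> (ip x x + 2 * ip x y + ip y y) / 4 - F x - F y" .
    have eq: "ip (x - y) (x - y) = ip x x - 2 * ip x y + ip y y"
      using that UV[of x] UV[of y] ip_commute[of x y] by (simp add: ip_simps)
    have lin: "r \<le> 2 * (a - 2 * f - d) + 2 * (c - 2 * g - d)"
      if "d \<le> (a + 2 * b + c) / 4 - f - g" "r = a - 2 * b + c" for a b c f g r :: real
      using that by (simp add: field_simps)
    show ?thesis unfolding J_def by (rule lin[OF le eq])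
  qed
  have "\<exists>l\<in>V. (\<lambda>n::nat. ip (X n - l) (X n - l)) \<longlonglongrightarrow> 0"
  proof (rule complete)
    show "X n \<in> V" for n using X(1) UV by blast
    fix e :: real assume "e > 0"
    then obtain N where N: "inverse (real (Suc N)) < e / 4" using reals_Archimedean[of "e/4"] by auto
    show "\<exists>N. \<forall>m\<ge>N. \<forall>n\<ge>N. ip (X m - X n) (X m - X n) < e"
    proof (intro exI[of _ N] allI impI)
      fix m n assume mn: "m \<ge> N" "n \<ge> N"
      have "inverse (real (Suc m)) \<le> inverse (real (Suc N))" "inverse (real (Suc n)) \<le> inverse (real (Suc N))"
        using mn by (auto intro!: le_imp_inverse_le)
      then show "ip (X m - X n) (X m - X n) < e"
        using para[OF X(1) X(1), of m n] X(2)[of m] X(2)[of n] N by argo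
    qed
  qed
  then obtain p where p: "p \<in> V" "(\<lambda>n. ip (X n - p) (X n - p)) \<longlonglongrightarrow> 0" by blast
  have lim: "(\<lambda>n. nrm (X n - p)) \<longlonglongrightarrow> 0"
    unfolding nrm_def using tendsto_real_sqrt[OF p(2)] by simp
  have eq: "ip p u = F u" if u: "u \<in> U" for u
  proof -
    have ge: "0 \<le> 0 + 2 * t * (ip p u - F u) + t\<^sup>2 * ip u u" for t
    proof (rule LIMSEQ_le_const)
      show "(\<lambda>n. inverse (real (Suc n)) + 2 * t * (ip (X n) u - F u) + t\<^sup>2 * ip u u)
          \<longlonglongrightarrow> 0 + 2 * t * (ip p u - F u) + t\<^sup>2 * ip u u"
        using X(1) UV u p(1) by (intro tendsto_intros LIMSEQ_inverse_real_of_nat tendsto_ip lim) auto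
      show "\<exists>N. \<forall>n\<ge>N. 0 \<le> inverse (real (Suc n)) + 2 * t * (ip (X n) u - F u) + t\<^sup>2 * ip u u"
      proof (intro exI[of _ 0] allI impI)
        fix n
        have "d \<le> J (X n + t *\<^sub>R u)" using X(1) u by (intro d_le U_closed) auto
        also have "\<dots> = J (X n) + 2 * t * (ip (X n) u - F u) + t\<^sup>2 * ip u u"
          using X(1)[of n] u UV[OF u] UV[OF X(1)[of n]] ip_commute[of u "X n"] U_closed
          by (simp add: J_def ip_simps F_add F_scale algebra_simps power2_eq_square)
        finally show "0 \<le> inverse (real (Suc n)) + 2 * t * (ip (X n) u - F u) + t\<^sup>2 * ip u u"
          using X(2)[of n] by linarith
      qed
    qed
    have "(ip p u - F u)\<^sup>2 \<le> 0 * ip u u"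
      using ge ip_nonneg[OF UV[OF u]] by (intro quad_nonneg_imp) auto
    then show ?thesis by simp
  qed
  show ?thesis using that[OF p(1) X(1) lim eq] by blast
qed

lemma riesz:
  assumes "\<And>u v. u \<in> V \<Longrightarrow> v \<in> V \<Longrightarrow> F (u + v) = F u + F v"
    and "\<And>c u. u \<in> V \<Longrightarrow> F (c *\<^sub>R u) = c * F u"
    and "\<And>u. u \<in> V \<Longrightarrow> \<bar>F u\<bar> \<le> C * nrm u"
  obtains p where "p \<in> V" "\<And>u. u \<in> V \<Longrightarrow> ip p u = F u"
  by (rule bounded_linear_represented_in_closure[OF V order_refl, of F C]) (use assms in auto)

text \<open>
  The Hahn-Banach argument in a Hilbert space: the component of \<open>a\<close> orthogonal to \<open>U\<close> is one of
  the vectors \<open>g\<close> of the hypothesis, so that its own norm is at most \<open>\<delta>\<close>.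
\<close>

lemma approximable_by_annihilator_bound:
  assumes U: "subspace U" "U \<subseteq> V" and a: "a \<in> V" and "\<delta> \<ge> 0"
    and orth: "\<And>g. g \<in> V \<Longrightarrow> (\<And>u. u \<in> U \<Longrightarrow> ip g u = 0) \<Longrightarrow> \<bar>ip a g\<bar> \<le> \<delta> * nrm g"
    and "e > 0"
  obtains u where "u \<in> U" "nrm (a - u) < \<delta> + e"
proof -
  obtain p X where p: "p \<in> V" and X: "\<And>n::nat. X n \<in> U" "(\<lambda>n. nrm (X n - p)) \<longlonglongrightarrow> 0"
    and eq: "\<And>u. u \<in> U \<Longrightarrow> ip p u = ip a u"
  proof (rule bounded_linear_represented_in_closure[OF U, of "ip a" "nrm a"])
    fix u v c assume "u \<in> U" "v \<in> U"
    then show "ip a (u + v) = ip a u + ip a v" using U(2) a by (intro ip_add_right) auto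
  next
    fix u c assume "u \<in> U"
    then show "ip a (c *\<^sub>R u) = c * ip a u" "\<bar>ip a u\<bar> \<le> nrm a * nrm u"
      using U(2) a by (auto intro: ip_scale_right cauchy_schwarz)
  qed (use that in blast)
  have XV: "X n \<in> V" for n using X U by blast
  define g where "g = a - p"
  have g: "g \<in> V" using a p by (simp add: g_def)
  have g0: "ip g u = 0" if "u \<in> U" for u
    using eq[OF that] that U(2) a p by (auto simp: g_def ip_simps)
  have "(\<lambda>n. ip (X n) g) \<longlonglongrightarrow> ip p g" by (rule tendsto_ip[OF XV p g X(2)])
  moreover have "ip (X n) g = 0" for n using g0[OF X(1)] ip_commute[OF XV g] by simp
  ultimately have "ip p g = 0" by (simp add: LIMSEQ_const_iff)
  then have "(nrm g)\<^sup>2 = ip a g"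
    using nrm_sq[OF g] a p g ip_diff[of a p g] by (simp add: g_def)
  also have "\<dots> \<le> \<delta> * nrm g" using orth[OF g g0] by simp
  finally have "nrm g \<le> \<delta>"
    using nrm_nonneg[OF g] \<open>\<delta> \<ge> 0\<close> by (cases "nrm g = 0") (auto simp: power2_eq_square mult_le_cancel_right)
  moreover obtain n where n: "nrm (X n - p) < e"
    using order_tendstoD(2)[OF X(2) \<open>e > 0\<close>] by (auto simp: eventually_sequentially)
  moreover have "nrm (a - X n) \<le> nrm g + nrm (p - X n)"
    using nrm_triangle[of g "p - X n"] g p XV by (simp add: g_def)
  ultimately have "nrm (a - X n) < \<delta> + e" using nrm_minus_commute[OF p XV, of n] by simp
  then show ?thesis using that X(1) by blast
qed

text \<open>
  Compactness enters through the Garding inequality alone, whose error term consists of finitely many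
  bounded functionals. A normalized sequence along which \<open>B\<close> tends to \<open>0\<close> has a subsequence along
  which these functionals converge; the inequality makes it Cauchy, and its limit contradicts
  injectivity. Hence \<open>B\<close> is bounded below, so its range is closed, and by symmetry and injectivity the range
  has no annihilator. The map \<open>S\<close> is complex conjugation in the application.
\<close>

lemma fredholm_alternative:
  assumes B_add: "\<And>u v w. u \<in> V \<Longrightarrow> v \<in> V \<Longrightarrow> w \<in> V \<Longrightarrow> B (u + v) w = B u w + B v w"
    and B_scale: "\<And>c u w. u \<in> V \<Longrightarrow> w \<in> V \<Longrightarrow> B (c *\<^sub>R u) w = c * B u w"
    and B_commute: "\<And>u w. u \<in> V \<Longrightarrow> w \<in> V \<Longrightarrow> B u w = B w u"
    and B_bound: "\<And>u w. u \<in> V \<Longrightarrow> w \<in> V \<Longrightarrow> \<bar>B u w\<bar> \<le> \<beta> * nrm u * nrm w"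
    and S: "\<And>u. u \<in> V \<Longrightarrow> S u \<in> V" "\<And>u. u \<in> V \<Longrightarrow> nrm (S u) \<le> nrm u"
    and J: "finite J" and C: "C \<ge> 0"
    and l_diff: "\<And>j u v. u \<in> V \<Longrightarrow> v \<in> V \<Longrightarrow> l j (u - v) = l j u - l j v"
    and l_bound: "\<And>j u. u \<in> V \<Longrightarrow> \<bar>l j u\<bar> \<le> K * nrm u"
    and garding: "\<And>u. u \<in> V \<Longrightarrow> (nrm u)\<^sup>2 \<le> C * \<bar>B u (S u)\<bar> + C * (\<Sum>j\<in>J. (l j u)\<^sup>2)"
    and inj: "\<And>u. u \<in> V \<Longrightarrow> (\<And>v. v \<in> V \<Longrightarrow> B u v = 0) \<Longrightarrow> nrm u = 0"
    and F_add: "\<And>u v. u \<in> V \<Longrightarrow> v \<in> V \<Longrightarrow> F (u + v) = F u + F v"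
    and F_scale: "\<And>c u. u \<in> V \<Longrightarrow> F (c *\<^sub>R u) = c * F u"
    and F_bound: "\<And>u. u \<in> V \<Longrightarrow> \<bar>F u\<bar> \<le> D * nrm u"
  obtains w where "w \<in> V" "\<And>v. v \<in> V \<Longrightarrow> B w v = F v"
proof -
  have B_diff: "B (u - v) w = B u w - B v w" if "u \<in> V" "v \<in> V" "w \<in> V" for u v w
    using B_add[of "u - v" v w] that by simp
  have B_tendsto: "(\<lambda>n. B (X n) v) \<longlonglongrightarrow> B x v"
    if "\<And>n. X n \<in> V" "x \<in> V" "v \<in> V" "(\<lambda>n::nat. nrm (X n - x)) \<longlonglongrightarrow> 0" for X x v
  proof -
    have "(\<lambda>n. B (X n) v - B x v) \<longlonglongrightarrow> 0"
    proof (rule Lim_null_comparison)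
      show "\<forall>\<^sub>F n in sequentially. norm (B (X n) v - B x v) \<le> \<beta> * nrm (X n - x) * nrm v"
        using B_bound[of "X _ - x" v] that by (simp add: B_diff)
      show "(\<lambda>n. \<beta> * nrm (X n - x) * nrm v) \<longlonglongrightarrow> 0"
        using tendsto_mult_right[OF tendsto_mult_left[OF that(4), of \<beta>], of "nrm v"] by simp
    qed
    then show ?thesis by (rule LIM_zero_cancel)
  qed
  \<comment> \<open>\<open>B\<close> is bounded below, with \<open>t\<close> any bound for the norm of the functional \<open>B u\<close>.\<close>
  have "\<exists>c>0. \<forall>u\<in>V. \<forall>t\<ge>0. (\<forall>v\<in>V. \<bar>B u v\<bar> \<le> t * nrm v) \<longrightarrow> c * nrm u \<le> t"
  proof (rule ccontr)
    assume neg: "\<not> ?thesis"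
    have "\<exists>u\<in>V. nrm u = 1 \<and> (\<forall>v\<in>V. \<bar>B u v\<bar> \<le> inverse (real (Suc n)) * nrm v)" for n
    proof -
      have "inverse (real (Suc n)) > 0" by simp
      then obtain u t where u: "u \<in> V" "\<forall>v\<in>V. \<bar>B u v\<bar> \<le> t * nrm v" "t < inverse (real (Suc n)) * nrm u"
        and "0 \<le> t" using neg by (meson not_le)
      then have "0 < inverse (real (Suc n)) * nrm u" by simp
      then have pos: "nrm u > 0" by (simp add: zero_less_mult_iff)
      let ?w = "(1 / nrm u) *\<^sub>R u"
      have "\<bar>B ?w v\<bar> \<le> inverse (real (Suc n)) * nrm v" if v: "v \<in> V" for v
      proof -
        have "\<bar>B ?w v\<bar> = \<bar>B u v\<bar> / nrm u" using u(1) v pos by (simp add: B_scale abs_mult)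
        also have "\<dots> \<le> t * nrm v / nrm u" using u(2) v pos by (simp add: divide_right_mono)
        also have "\<dots> = (t / nrm u) * nrm v" by simp
        also have "\<dots> \<le> inverse (real (Suc n)) * nrm v"
          using u(3) pos v by (intro mult_right_mono) (auto simp: divide_simps)
        finally show ?thesis .
      qed
      then show ?thesis using u(1) pos by (intro bexI[of _ ?w]) (auto simp: nrm_scale)
    qed
    then obtain X where X: "\<And>n. X n \<in> V" "\<And>n. nrm (X n) = 1"
      "\<And>n v. v \<in> V \<Longrightarrow> \<bar>B (X n) v\<bar> \<le> inverse (real (Suc n)) * nrm v"
      by metis
    have "\<exists>r. strict_mono r \<and> (\<forall>j\<in>J. convergent (\<lambda>n::nat. l j (X (r n))))"
      using J
    proof (induction rule: finite_induct)
      case empty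
      show ?case by (intro exI[of _ id]) (auto simp: strict_mono_def)
    next
      case (insert i J)
      then obtain r :: "nat \<Rightarrow> nat" where r: "strict_mono r" "\<forall>j\<in>J. convergent (\<lambda>n. l j (X (r n)))" by blast
      have "bounded (range (\<lambda>n. l i (X (r n))))"
        using l_bound[OF X(1), of i] X(2) by (auto simp: bounded_iff)
      then obtain c s where s: "strict_mono (s::nat\<Rightarrow>nat)" "((\<lambda>n. l i (X (r n))) \<circ> s) \<longlonglongrightarrow> c"
        using bounded_imp_convergent_subsequence by blast
      have "convergent (\<lambda>n. l j (X ((r \<circ> s) n)))" if "j \<in> insert i J" for j
      proof (cases "j = i")
        case True
        then show ?thesis using s(2) by (auto simp: convergent_def o_def)
      next
        case False
        then show ?thesis
          using that r(2) convergent_subseq_convergent[OF _ s(1), of "\<lambda>n. l j (X (r n))"] by (auto simp: o_def)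
      qed
      moreover have "strict_mono (r \<circ> s)" using r(1) s(1) by (rule strict_mono_o)
      ultimately show ?case by blast
    qed
    then obtain r where r: "strict_mono r" "\<And>j. j \<in> J \<Longrightarrow> convergent (\<lambda>n::nat. l j (X (r n)))" by blast
    have X_r: "\<bar>B (X (r n)) v\<bar> \<le> inverse (real (Suc n)) * nrm v" if "v \<in> V" for n v
    proof -
      have "inverse (real (Suc (r n))) \<le> inverse (real (Suc n))"
        using seq_suble[OF r(1), of n] by (intro le_imp_inverse_le) auto
      then show ?thesis
        using X(3)[OF that, of "r n"] mult_right_mono[OF _ nrm_nonneg[OF that]] by (meson order_trans)
    qed
    have "\<exists>x\<in>V. (\<lambda>n. nrm (X (r n) - x)) \<longlonglongrightarrow> 0"
    proof (rule complete_nrm)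
      show "X (r n) \<in> V" for n by (rule X)
      fix e :: real assume "e > 0"
      define a where "a = e\<^sup>2 / (8 * C + 8)"
      have a: "a > 0" using \<open>e > 0\<close> C by (simp add: a_def)
      define b where "b = a / (real (card J) + 1)"
      have b: "b > 0" using a by (simp add: b_def)
      have "\<forall>j\<in>J. \<exists>N. \<forall>m\<ge>N. \<forall>n\<ge>N. \<bar>l j (X (r m)) - l j (X (r n))\<bar> < sqrt b"
      proof
        fix j assume "j \<in> J"
        then have "Cauchy (\<lambda>n. l j (X (r n)))" using r(2) by (simp add: Cauchy_convergent_iff)
        then show "\<exists>N. \<forall>m\<ge>N. \<forall>n\<ge>N. \<bar>l j (X (r m)) - l j (X (r n))\<bar> < sqrt b"
          using b unfolding Cauchy_iff real_norm_def by (auto dest: spec[of _ "sqrt b"])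
      qed
      then obtain N where N: "\<And>j m n. j \<in> J \<Longrightarrow> m \<ge> N j \<Longrightarrow> n \<ge> N j \<Longrightarrow> \<bar>l j (X (r m)) - l j (X (r n))\<bar> < sqrt b"
        by metis
      obtain M where M: "inverse (real (Suc M)) < a" using reals_Archimedean[OF a] by blast
      show "\<exists>N. \<forall>m\<ge>N. \<forall>n\<ge>N. nrm (X (r m) - X (r n)) < e"
      proof (intro exI allI impI)
        fix m n assume mn: "m \<ge> M + (\<Sum>j\<in>J. N j)" "n \<ge> M + (\<Sum>j\<in>J. N j)"
        let ?u = "X (r m) - X (r n)"
        have u: "?u \<in> V" using X by simp
        have nu: "nrm (S ?u) \<le> 2"
        proof -
          have "nrm ?u \<le> nrm (X (r m)) + nrm ((-1) *\<^sub>R X (r n))"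
            using nrm_triangle[OF X(1) V_scale[OF X(1)], of "r m" "-1" "r n"] by simp
          then show ?thesis using S(2)[OF u] nrm_scale[OF X(1), of "-1"] X(2) by simp
        qed
        have inv: "inverse (real (Suc k)) \<le> a" if "k \<ge> M" for k
        proof -
          have "inverse (real (Suc k)) \<le> inverse (real (Suc M))" using that by (intro le_imp_inverse_le) auto
          then show ?thesis using M by linarith
        qed
        have BX: "\<bar>B (X (r k)) (S ?u)\<bar> \<le> 2 * a" if "k \<ge> M" for k
        proof -
          have "\<bar>B (X (r k)) (S ?u)\<bar> \<le> inverse (real (Suc k)) * nrm (S ?u)" by (rule X_r[OF S(1)[OF u]])
          also have "\<dots> \<le> a * 2" using inv[OF that] nu nrm_nonneg[OF S(1)[OF u]] a by (intro mult_mono) auto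
          finally show ?thesis by simp
        qed
        have "\<bar>B ?u (S ?u)\<bar> \<le> 4 * a"
          using BX[of m] BX[of n] mn X(1) S(1)[OF u] by (simp add: B_diff)
        moreover have "(\<Sum>j\<in>J. (l j ?u)\<^sup>2) \<le> a"
        proof -
          have "(l j ?u)\<^sup>2 \<le> b" if "j \<in> J" for j
          proof -
            have "N j \<le> (\<Sum>j\<in>J. N j)" using J that by (simp add: member_le_sum)
            then have "\<bar>l j ?u\<bar> \<le> sqrt b" using N[of j m n] that mn X(1) by (simp add: l_diff less_imp_le)
            then have "\<bar>l j ?u\<bar>\<^sup>2 \<le> (sqrt b)\<^sup>2" by (intro power_mono) auto
            then show ?thesis using b by simp
          qed
          then have "(\<Sum>j\<in>J. (l j ?u)\<^sup>2) \<le> real (card J) * b" by (rule sum_bounded_above)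
          also have "\<dots> \<le> a" using a by (simp add: b_def divide_simps)
          finally show ?thesis .
        qed
        ultimately have "(nrm ?u)\<^sup>2 \<le> C * (4 * a) + C * a"
          using garding[OF u] C by (meson add_mono mult_left_mono order_trans)
        also have "\<dots> < (8 * C + 8) * a" using a C by (simp add: algebra_simps add_strict_increasing2)
        also have "\<dots> = e\<^sup>2" using C by (simp add: a_def)
        finally show "nrm ?u < e" using \<open>e > 0\<close> by (simp add: power_less_imp_less_base)
      qed
    qed
    then obtain x where x: "x \<in> V" "(\<lambda>n. nrm (X (r n) - x)) \<longlonglongrightarrow> 0" by blast
    have "B x v = 0" if v: "v \<in> V" for v
    proof -
      have "(\<lambda>n. B (X (r n)) v) \<longlonglongrightarrow> B x v" using X x v by (intro B_tendsto)
      moreover have "(\<lambda>n. B (X (r n)) v) \<longlonglongrightarrow> 0"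
      proof (rule Lim_null_comparison)
        show "\<forall>\<^sub>F n in sequentially. norm (B (X (r n)) v) \<le> inverse (real (Suc n)) * nrm v"
          using X_r[OF v] by simp
        show "(\<lambda>n. inverse (real (Suc n)) * nrm v) \<longlonglongrightarrow> 0"
          using tendsto_mult_right[OF LIMSEQ_inverse_real_of_nat, of "nrm v"] by simp
      qed
      ultimately show ?thesis by (rule LIMSEQ_unique)
    qed
    then have "nrm x = 0" by (rule inj[OF x(1)])
    have "1 \<le> nrm (X (r n) - x)" for n
      using nrm_triangle[of "X (r n) - x" x] X x(1) \<open>nrm x = 0\<close> by simp
    then have "(1::real) \<le> 0" using x(2) by (intro LIMSEQ_le_const) auto
    then show False by simp
  qed
  then obtain c where c: "c > 0" "\<And>u t. u \<in> V \<Longrightarrow> 0 \<le> t \<Longrightarrow> (\<And>v. v \<in> V \<Longrightarrow> \<bar>B u v\<bar> \<le> t * nrm v) \<Longrightarrow> c * nrm u \<le> t"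
    by blast
  have "\<exists>a. \<forall>u\<in>V. a u \<in> V \<and> (\<forall>v\<in>V. ip (a u) v = B u v)"
  proof (rule choice[THEN exE])
    show "\<forall>u. \<exists>p. u \<in> V \<longrightarrow> p \<in> V \<and> (\<forall>v\<in>V. ip p v = B u v)"
    proof (intro allI)
      fix u
      show "\<exists>p. u \<in> V \<longrightarrow> p \<in> V \<and> (\<forall>v\<in>V. ip p v = B u v)"
      proof (cases "u \<in> V")
        case True
        have "B u (v + w) = B u v + B u w" if "v \<in> V" "w \<in> V" for v w
          using B_add[OF that True] that True by (simp add: B_commute)
        moreover have "B u (t *\<^sub>R v) = t * B u v" if "v \<in> V" for v t
          using B_scale[OF that True] that True by (simp add: B_commute)
        ultimately obtain p where "p \<in> V" "\<And>v. v \<in> V \<Longrightarrow> ip p v = B u v"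
          using riesz[of "B u" "\<beta> * nrm u"] B_bound[OF True] by blast
        then show ?thesis by blast
      qed simp
    qed
  qed blast
  then obtain a where a: "\<And>u. u \<in> V \<Longrightarrow> a u \<in> V" "\<And>u v. u \<in> V \<Longrightarrow> v \<in> V \<Longrightarrow> ip (a u) v = B u v" by blast
  obtain f where f: "f \<in> V" "\<And>v. v \<in> V \<Longrightarrow> ip f v = F v" using riesz[OF F_add F_scale F_bound] by blast
  \<comment> \<open>The images \<open>a u\<close> represent \<open>B u\<close> only up to vectors of norm zero, so the range of \<open>a\<close>
    is replaced by the set of all representing vectors.\<close>
  define U where "U = {p \<in> V. \<exists>u\<in>V. \<forall>v\<in>V. ip p v = B u v}"
  have U: "subspace U" "U \<subseteq> V"
  proof (auto simp: subspace_def U_def)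
    show "\<exists>u\<in>V. \<forall>v\<in>V. ip 0 v = B u v"
      using ip_scale[of 0 _ 0] B_scale[of 0 _ 0] by (intro bexI[of _ 0]) auto
    fix x y u w assume "x \<in> V" "y \<in> V" "u \<in> V" "w \<in> V" "\<forall>v\<in>V. ip x v = B u v" "\<forall>v\<in>V. ip y v = B w v"
    then show "\<exists>u\<in>V. \<forall>v\<in>V. ip (x + y) v = B u v"
      by (intro bexI[of _ "u + w"]) (auto simp: ip_add B_add)
  next
    fix c x u assume "x \<in> V" "u \<in> V" "\<forall>v\<in>V. ip x v = B u v"
    then show "\<exists>u\<in>V. \<forall>v\<in>V. ip (c *\<^sub>R x) v = B u v"
      by (intro bexI[of _ "c *\<^sub>R u"]) (auto simp: ip_scale B_scale)
  qed
  have orth: "\<bar>ip f g\<bar> \<le> 0 * nrm g" if g: "g \<in> V" "\<And>u. u \<in> U \<Longrightarrow> ip g u = 0" for g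
  proof -
    have "B g u = 0" if "u \<in> V" for u
    proof -
      have "a u \<in> U" using a that by (auto simp: U_def)
      then have "ip (a u) g = 0" using g ip_commute[OF a(1)[OF that] g(1)] by simp
      then show ?thesis using a(2)[OF that g(1)] B_commute[OF that g(1)] by simp
    qed
    then have "nrm g = 0" using inj[OF g(1)] by blast
    then show ?thesis using cauchy_schwarz[OF f(1) g(1)] by simp
  qed
  have "\<exists>u\<in>V. \<forall>v\<in>V. \<bar>F v - B u v\<bar> \<le> inverse (real (Suc n)) * nrm v" for n
  proof -
    obtain p where p: "p \<in> U" "nrm (f - p) < 0 + inverse (real (Suc n))"
      using approximable_by_annihilator_bound[OF U f(1) order_refl orth, of "inverse (real (Suc n))"] by auto
    obtain u where u: "p \<in> V" "u \<in> V" "\<And>v. v \<in> V \<Longrightarrow> ip p v = B u v" using p(1) by (auto simp: U_def)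
    have "\<bar>F v - B u v\<bar> \<le> inverse (real (Suc n)) * nrm v" if v: "v \<in> V" for v
    proof -
      have "\<bar>F v - B u v\<bar> = \<bar>ip (f - p) v\<bar>" using f u v by (simp add: ip_diff)
      also have "\<dots> \<le> nrm (f - p) * nrm v" using f u v by (intro cauchy_schwarz) auto
      also have "\<dots> \<le> inverse (real (Suc n)) * nrm v" using p v by (intro mult_right_mono) auto
      finally show ?thesis .
    qed
    then show ?thesis using u by blast
  qed
  then obtain Y where Y: "\<And>n. Y n \<in> V" "\<And>n v. v \<in> V \<Longrightarrow> \<bar>F v - B (Y n) v\<bar> \<le> inverse (real (Suc n)) * nrm v"
    by metis
  have "\<exists>w\<in>V. (\<lambda>n. nrm (Y n - w)) \<longlonglongrightarrow> 0"
  proof (rule complete_nrm[OF Y(1)])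
    fix e :: real assume "e > 0"
    then have "c * e / 2 > 0" using c by simp
    then obtain N where N: "inverse (real (Suc N)) < c * e / 2" using reals_Archimedean by blast
    show "\<exists>N. \<forall>m\<ge>N. \<forall>n\<ge>N. nrm (Y m - Y n) < e"
    proof (intro exI[of _ N] allI impI)
      fix m n assume mn: "m \<ge> N" "n \<ge> N"
      have inv: "inverse (real (Suc k)) \<le> inverse (real (Suc N))" if "k \<ge> N" for k
        using that by (intro le_imp_inverse_le) auto
      have "c * nrm (Y m - Y n) \<le> 2 * inverse (real (Suc N))"
      proof (rule c(2))
        fix v assume v: "v \<in> V"
        have "\<bar>F v - B (Y k) v\<bar> \<le> inverse (real (Suc N)) * nrm v" if "k \<ge> N" for k
          using Y(2)[OF v, of k] mult_right_mono[OF inv[OF that] nrm_nonneg[OF v]] by linarith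
        from this[OF mn(1)] this[OF mn(2)]
        show "\<bar>B (Y m - Y n) v\<bar> \<le> 2 * inverse (real (Suc N)) * nrm v"
          using Y(1) v by (simp add: B_diff)
      qed (use Y in auto)
      also have "\<dots> < c * e" using N by simp
      finally show "nrm (Y m - Y n) < e" using c(1) by simp
    qed
  qed
  then obtain w where w: "w \<in> V" "(\<lambda>n. nrm (Y n - w)) \<longlonglongrightarrow> 0" by blast
  have "B w v = F v" if v: "v \<in> V" for v
  proof -
    have "(\<lambda>n. B (Y n) v) \<longlonglongrightarrow> B w v" by (rule B_tendsto[OF Y(1) w(1) v w(2)])
    moreover have "(\<lambda>n. F v - B (Y n) v) \<longlonglongrightarrow> 0"
    proof (rule Lim_null_comparison)
      show "\<forall>\<^sub>F n in sequentially. norm (F v - B (Y n) v) \<le> inverse (real (Suc n)) * nrm v"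
        using Y(2)[OF v] by simp
      show "(\<lambda>n. inverse (real (Suc n)) * nrm v) \<longlonglongrightarrow> 0"
        using tendsto_mult_right[OF LIMSEQ_inverse_real_of_nat, of "nrm v"] by simp
    qed
    ultimately have "(\<lambda>n. F v - B (Y n) v + B (Y n) v) \<longlonglongrightarrow> 0 + B w v" by (intro tendsto_add)
    then show ?thesis by (simp add: LIMSEQ_const_iff)
  qed
  then show ?thesis using that w(1) by blast
qed

end

text \<open>
  Induction on the number of generators. If some functional does not vanish on a generator, normalize
  this generator to \<open>w\<close> with \<open>l i w = 1\<close>; the projections \<open>x - l i x * w\<close> are spanned by one generator
  fewer, and the functional \<open>l i\<close> controls the part that was split off.
\<close>

lemma seminorm_le_finitely_many_functionals:
  fixes p :: "'v::real_vector \<Rightarrow> real" and l :: "'i \<Rightarrow> 'v \<Rightarrow> real"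
  assumes X: "subspace X"
    and p_triangle: "\<And>x y. x \<in> X \<Longrightarrow> y \<in> X \<Longrightarrow> p (x + y) \<le> p x + p y"
    and p_scale: "\<And>c x. x \<in> X \<Longrightarrow> p (c *\<^sub>R x) = \<bar>c\<bar> * p x"
    and l_add: "\<And>i x y. x \<in> X \<Longrightarrow> y \<in> X \<Longrightarrow> l i (x + y) = l i x + l i y"
    and l_scale: "\<And>i c x. x \<in> X \<Longrightarrow> l i (c *\<^sub>R x) = c * l i x"
    and sep: "\<And>x. x \<in> X \<Longrightarrow> (\<And>i. l i x = 0) \<Longrightarrow> p x = 0"
    and B: "finite B" "B \<subseteq> X"
  shows "\<exists>J C. finite J \<and> C \<ge> 0 \<and> (\<forall>x\<in>span B. p x \<le> C * (\<Sum>i\<in>J. \<bar>l i x\<bar>))"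
  using B
proof (induction "card B" arbitrary: B rule: less_induct)
  case less
  have p_nonneg: "0 \<le> p x" if "x \<in> X" for x
    using p_triangle[of x "(-1) *\<^sub>R x"] p_scale[of x "-1"] p_scale[of x 0] that X
    by (auto simp: subspace_neg)
  have spanX: "x \<in> X" if "x \<in> span B" for x
    using that less.prems(2) X span_minimal by blast
  show ?case
  proof (cases "\<forall>b\<in>B. p b = 0")
    case True
    have "x \<in> X \<and> p x = 0" if "x \<in> span B" for x
      using that
    proof (induction rule: span_induct_alt)
      case base
      show ?case using p_scale[of 0 0] subspace_0[OF X] by simp
    next
      case (step c b y)
      have "b \<in> X" "y \<in> X" using step less.prems(2) by auto
      then have "p (c *\<^sub>R b + y) \<le> 0" "c *\<^sub>R b + y \<in> X"
        using p_triangle[of "c *\<^sub>R b" y] p_scale[of b c] step True X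
        by (auto simp: subspace_scale subspace_add)
      then show ?case using p_nonneg[of "c *\<^sub>R b + y"] by auto
    qed
    then show ?thesis by (intro exI[of _ "{}"] exI[of _ 0]) auto
  next
    case False
    then obtain b0 where b0: "b0 \<in> B" "p b0 \<noteq> 0" by blast
    then have b0X: "b0 \<in> X" using less.prems by blast
    then obtain i where i: "l i b0 \<noteq> 0" using sep b0 by blast
    define w where "w = (1 / l i b0) *\<^sub>R b0"
    define P where "P x = x - l i x *\<^sub>R w" for x
    have wX: "w \<in> X" using b0X X by (simp add: w_def subspace_scale)
    have l_diff: "l j (x - c *\<^sub>R y) = l j x - c * l j y" if "x \<in> X" "y \<in> X" for j c x y
      using l_add[of x "(- c) *\<^sub>R y" j] l_scale[of y j "- c"] that X by (simp add: subspace_scale subspace_neg)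
    let ?B = "P ` (B - {b0})"
    have "card ?B \<le> card (B - {b0})" using less.prems by (intro card_image_le) auto
    also have "\<dots> < card B" using less.prems b0 by (meson card_Diff1_less)
    finally have "card ?B < card B" .
    moreover have "finite ?B" "?B \<subseteq> X"
      using less.prems wX X by (auto simp: P_def intro!: subspace_diff subspace_scale)
    ultimately obtain J C where J: "finite J" "C \<ge> 0" "\<And>x. x \<in> span ?B \<Longrightarrow> p x \<le> C * (\<Sum>j\<in>J. \<bar>l j x\<bar>)"
      using less.hyps by meson
    have P_span: "x \<in> X \<and> P x \<in> span ?B" if "x \<in> span B" for x
      using that
    proof (induction rule: span_induct_alt)
      case base
      have "l i 0 = 0" using l_scale[of 0 i 0] subspace_0[OF X] by simp
      then show ?case using subspace_0[OF X] by (simp add: P_def span_zero)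
    next
      case (step c b y)
      have bX: "b \<in> X" "y \<in> X" using step less.prems(2) by auto
      have "P (c *\<^sub>R b + y) = c *\<^sub>R P b + P y"
        using bX X by (simp add: P_def l_add l_scale subspace_scale algebra_simps)
      moreover have "P b \<in> span ?B"
      proof (cases "b = b0")
        case True
        then have "P b = 0" using i by (simp add: P_def w_def)
        then show ?thesis by (simp add: span_zero)
      qed (use step in \<open>auto intro: span_base\<close>)
      ultimately show ?case using step bX X by (auto intro: span_add span_scale subspace_add subspace_scale)
    qed
    define K where "K = C * (\<Sum>j\<in>J. \<bar>l j w\<bar>) + p w"
    have "p x \<le> (C + K) * (\<Sum>j\<in>insert i J. \<bar>l j x\<bar>)" if x: "x \<in> span B" for x
    proof -
      have xX: "x \<in> X" by (rule spanX[OF x])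
      have K: "K \<ge> 0" using J(2) p_nonneg[OF wX] by (auto simp: K_def intro!: add_nonneg_nonneg mult_nonneg_nonneg sum_nonneg)
      have "p x \<le> p (P x) + p (l i x *\<^sub>R w)"
        using p_triangle[of "P x" "l i x *\<^sub>R w"] xX wX X by (simp add: P_def subspace_diff subspace_scale)
      also have "p (l i x *\<^sub>R w) = \<bar>l i x\<bar> * p w" by (rule p_scale[OF wX])
      also have "p (P x) \<le> C * (\<Sum>j\<in>J. \<bar>l j (P x)\<bar>)" using J(3) P_span[OF x] by blast
      also have "\<dots> \<le> C * (\<Sum>j\<in>J. \<bar>l j x\<bar> + \<bar>l i x\<bar> * \<bar>l j w\<bar>)"
        unfolding P_def l_diff[OF xX wX] using J(2)
        by (intro mult_left_mono sum_mono) (auto simp: abs_mult[symmetric] intro: order_trans[OF abs_triangle_ineq4])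
      also have "\<dots> + \<bar>l i x\<bar> * p w = C * (\<Sum>j\<in>J. \<bar>l j x\<bar>) + K * \<bar>l i x\<bar>"
        by (simp add: K_def sum.distrib sum_distrib_left algebra_simps)
      also have "\<dots> \<le> C * (\<Sum>j\<in>insert i J. \<bar>l j x\<bar>) + K * (\<Sum>j\<in>insert i J. \<bar>l j x\<bar>)"
        using J(1,2) K by (intro add_mono mult_left_mono sum_mono2 member_le_sum) auto
      finally show ?thesis by (simp add: algebra_simps)
    qed
    moreover have "C + K \<ge> 0"
      using J(2) p_nonneg[OF wX] by (auto simp: K_def intro!: add_nonneg_nonneg mult_nonneg_nonneg sum_nonneg)
    ultimately show ?thesis using J(1) by (intro exI[of _ "insert i J"] exI[of _ "C + K"]) auto
  qed
qed

section \<open>Square-integrable functions\<close>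

definition L2_norm :: "'a measure \<Rightarrow> ('a \<Rightarrow> complex) \<Rightarrow> real" where
  "L2_norm M u = sqrt (LINT x|M. (cmod (u x))\<^sup>2)"

lemma L2_measurable [measurable_dest]: "u \<in> L2 M \<Longrightarrow> u \<in> borel_measurable M"
  by (simp add: L2_def)

lemma L2_integrable_square: "u \<in> L2 M \<Longrightarrow> integrable M (\<lambda>x. (cmod (u x))\<^sup>2)"
  by (simp add: L2_def)

lemma L2I_bound:
  assumes "integrable M g" "u \<in> borel_measurable M" "AE x in M. (cmod (u x))\<^sup>2 \<le> g x"
  shows "u \<in> L2 M"
  unfolding L2_def
proof (intro CollectI conjI)
  show "integrable M (\<lambda>x. (cmod (u x))\<^sup>2)"
    by (rule Bochner_Integration.integrable_bound[OF assms(1)]) (use assms in auto)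
qed (rule assms)

lemma L2_mult_bounded:
  assumes u: "u \<in> L2 M" and f: "f \<in> borel_measurable M" "AE x in M. cmod (f x) \<le> C"
  shows "(\<lambda>x. f x * u x) \<in> L2 M"
proof (rule L2I_bound)
  show "integrable M (\<lambda>x. C\<^sup>2 * (cmod (u x))\<^sup>2)" using L2_integrable_square[OF u] by simp
  show "AE x in M. (cmod (f x * u x))\<^sup>2 \<le> C\<^sup>2 * (cmod (u x))\<^sup>2"
    using f(2) by eventually_elim (auto simp: norm_mult power_mult_distrib intro!: mult_right_mono power_mono)
qed (use u f in measurable)

lemma L2_add: assumes "u \<in> L2 M" "v \<in> L2 M" shows "(\<lambda>x. u x + v x) \<in> L2 M"
proof (rule L2I_bound)
  show "integrable M (\<lambda>x. 2 * (cmod (u x))\<^sup>2 + 2 * (cmod (v x))\<^sup>2)"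
    using assms by (auto intro!: L2_integrable_square)
  have "(cmod (a + b))\<^sup>2 \<le> 2 * (cmod a)\<^sup>2 + 2 * (cmod b)\<^sup>2" for a b :: complex
  proof -
    have "(cmod (a + b))\<^sup>2 \<le> (cmod a + cmod b)\<^sup>2" by (intro power_mono norm_triangle_ineq) auto
    also have "\<dots> \<le> 2 * (cmod a)\<^sup>2 + 2 * (cmod b)\<^sup>2"
      using sum_squares_bound[of "cmod a" "cmod b"] by (simp add: power2_sum)
    finally show ?thesis .
  qed
  then show "AE x in M. (cmod (u x + v x))\<^sup>2 \<le> 2 * (cmod (u x))\<^sup>2 + 2 * (cmod (v x))\<^sup>2" by simp
qed (use assms in measurable)

lemma L2_cmult: "u \<in> L2 M \<Longrightarrow> (\<lambda>x. c * u x) \<in> L2 M"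
  by (rule L2_mult_bounded[where C = "cmod c"]) auto

lemma L2_scaleR: "u \<in> L2 M \<Longrightarrow> (\<lambda>x. c *\<^sub>R u x) \<in> L2 M"
  using L2_cmult[of u M "complex_of_real c"] by (simp add: scaleR_conv_of_real)

lemma L2_uminus: "u \<in> L2 M \<Longrightarrow> (\<lambda>x. - u x) \<in> L2 M"
  using L2_cmult[of u M "-1"] by simp

lemma L2_diff: "u \<in> L2 M \<Longrightarrow> v \<in> L2 M \<Longrightarrow> (\<lambda>x. u x - v x) \<in> L2 M"
  using L2_add[of u M "\<lambda>x. - v x"] L2_uminus[of v M] by simp

lemma L2_cnj: "u \<in> L2 M \<Longrightarrow> (\<lambda>x. cnj (u x)) \<in> L2 M"
  by (auto simp: L2_def intro!: borel_measurable_continuous_on[where f = cnj] continuous_intros)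

lemma L2_zero: "(\<lambda>x. 0) \<in> L2 M"
  by (simp add: L2_def)

lemma L2_sum: "(\<And>i. i \<in> I \<Longrightarrow> f i \<in> L2 M) \<Longrightarrow> (\<lambda>x. \<Sum>i\<in>I. f i x) \<in> L2 M"
  by (induction I rule: infinite_finite_induct) (auto intro: L2_add L2_zero)

lemma L2_bounded: 
  assumes "finite_measure M" "u \<in> borel_measurable M" "AE x in M. cmod (u x) \<le> C" shows "u \<in> L2 M"
proof -
  interpret finite_measure M by fact
  show ?thesis
  proof (rule L2I_bound)
    show "integrable M (\<lambda>x. C\<^sup>2)" by simp
    show "AE x in M. (cmod (u x))\<^sup>2 \<le> C\<^sup>2"
      using assms(3) by eventually_elim (auto intro!: power_mono)
  qed fact
qed

lemma L2_integrable_mult: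
  assumes "u \<in> L2 M" "v \<in> L2 M" shows "integrable M (\<lambda>x. u x * v x)"
proof (rule Bochner_Integration.integrable_bound)
  show "integrable M (\<lambda>x. (cmod (u x))\<^sup>2 + (cmod (v x))\<^sup>2)"
    using assms by (auto intro!: L2_integrable_square)
  have "cmod (a * b) \<le> (cmod a)\<^sup>2 + (cmod b)\<^sup>2" for a b :: complex
  proof -
    have "2 * (cmod a * cmod b) \<le> (cmod a)\<^sup>2 + (cmod b)\<^sup>2"
      using sum_squares_bound[of "cmod a" "cmod b"] by (simp add: mult.assoc)
    moreover have "0 \<le> cmod a * cmod b" by simp
    ultimately show ?thesis unfolding norm_mult by linarith
  qed
  then show "AE x in M. norm (u x * v x) \<le> norm ((cmod (u x))\<^sup>2 + (cmod (v x))\<^sup>2)" by simp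
qed (use assms in measurable)

lemma L2_integrable:
  assumes "finite_measure M" "u \<in> L2 M" shows "integrable M u"
  using L2_integrable_mult[OF assms(2) L2_bounded[OF assms(1), of "\<lambda>_. 1" 1]] by simp

lemma L2_norm_nonneg [simp]: "0 \<le> L2_norm M u"
  by (simp add: L2_norm_def)

lemma L2_norm_square: "(L2_norm M u)\<^sup>2 = (LINT x|M. (cmod (u x))\<^sup>2)"
  by (simp add: L2_norm_def)

lemma L2_norm_cong_AE:
  assumes "u \<in> borel_measurable M" "v \<in> borel_measurable M" "AE x in M. cmod (u x) = cmod (v x)"
  shows "L2_norm M u = L2_norm M v"
  unfolding L2_norm_def using assms by (intro arg_cong[where f = sqrt] integral_cong_AE) auto

lemma L2_norm_cmult: "L2_norm M (\<lambda>x. c * u x) = cmod c * L2_norm M u"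
  by (simp add: L2_norm_def norm_mult power_mult_distrib real_sqrt_mult)

lemma L2_norm_mult_bounded:
  assumes u: "u \<in> L2 M" and f: "f \<in> borel_measurable M" "AE x in M. cmod (f x) \<le> C" and "C \<ge> 0"
  shows "L2_norm M (\<lambda>x. f x * u x) \<le> C * L2_norm M u"
proof -
  have "(LINT x|M. (cmod (f x * u x))\<^sup>2) \<le> (LINT x|M. C\<^sup>2 * (cmod (u x))\<^sup>2)"
  proof (rule integral_mono_AE)
    show "AE x in M. (cmod (f x * u x))\<^sup>2 \<le> C\<^sup>2 * (cmod (u x))\<^sup>2"
      using f(2) by eventually_elim (auto simp: norm_mult power_mult_distrib intro!: mult_right_mono power_mono)
  qed (use L2_integrable_square[OF L2_mult_bounded[OF u f]] L2_integrable_square[OF u] in auto)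
  then show ?thesis
    unfolding L2_norm_def using \<open>C \<ge> 0\<close> real_sqrt_le_mono by (fastforce simp: real_sqrt_mult)
qed

text \<open>
  Orthogonality for the complex inner product is recovered by testing with \<open>u\<close> and \<open>\<i> u\<close>.
\<close>

definition L2_ip :: "'a measure \<Rightarrow> ('a \<Rightarrow> complex) \<Rightarrow> ('a \<Rightarrow> complex) \<Rightarrow> real" where
  "L2_ip M u v = Re (LINT x|M. u x * cnj (v x))"

lemma L2_ip_self: "u \<in> L2 M \<Longrightarrow> L2_ip M u u = (LINT x|M. (cmod (u x))\<^sup>2)"
proof -
  have "(\<lambda>x. u x * cnj (u x)) = (\<lambda>x. complex_of_real ((cmod (u x))\<^sup>2))"
    by (simp only: complex_norm_square)
  then show "L2_ip M u u = (LINT x|M. (cmod (u x))\<^sup>2)"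
    by (simp only: L2_ip_def integral_complex_of_real Re_complex_of_real)
qed

lemma L2_ip_add: "u \<in> L2 M \<Longrightarrow> v \<in> L2 M \<Longrightarrow> w \<in> L2 M \<Longrightarrow> L2_ip M (\<lambda>x. u x + v x) w = L2_ip M u w + L2_ip M v w"
  unfolding L2_ip_def by (simp add: distrib_right L2_integrable_mult L2_cnj)

lemma L2_ip_scaleR: "L2_ip M (\<lambda>x. c *\<^sub>R u x) w = c * L2_ip M u w"
  unfolding L2_ip_def by simp

lemma L2_ip_commute:
  assumes "u \<in> L2 M" "v \<in> L2 M" shows "L2_ip M u v = L2_ip M v u"
proof -
  have "(LINT x|M. v x * cnj (u x)) = (LINT x|M. cnj (u x * cnj (v x)))" by (simp add: mult.commute)
  also have "\<dots> = cnj (LINT x|M. u x * cnj (v x))" by (rule Bochner_Integration.integral_cnj)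
  finally show ?thesis by (simp add: L2_ip_def)
qed

text \<open>
  The Riesz-Fischer theorem. Since the measure is finite, the increments of a rapidly converging
  subsequence are also summable in \<open>L\<^sup>1\<close>; so this subsequence converges almost everywhere, and Fatou's lemma
  transfers the Cauchy estimates to the limit.
\<close>

lemma L2_complete:
  assumes M: "finite_measure M" and X: "\<And>n. X n \<in> L2 M"
    and C: "\<And>e. e > 0 \<Longrightarrow> \<exists>N. \<forall>m\<ge>N. \<forall>n\<ge>N. (LINT x|M. (cmod (X m x - X n x))\<^sup>2) < e"
  shows "\<exists>l\<in>L2 M. (\<lambda>n::nat. LINT x|M. (cmod (X n x - l x))\<^sup>2) \<longlonglongrightarrow> 0"
proof -
  interpret finite_measure M by fact
  have [measurable]: "X n \<in> borel_measurable M" for n using X by measurable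
  have int: "integrable M (\<lambda>x. (cmod (X m x - X n x))\<^sup>2)" for m n
    by (rule L2_integrable_square[OF L2_diff[OF X X]])
  have "\<exists>N. \<forall>m\<ge>N. \<forall>n\<ge>N. (LINT x|M. (cmod (X m x - X n x))\<^sup>2) < (1/4) ^ k" for k :: nat
    by (rule C) simp
  then obtain N where N: "\<And>k m n. m \<ge> N k \<Longrightarrow> n \<ge> N k \<Longrightarrow> (LINT x|M. (cmod (X m x - X n x))\<^sup>2) < (1/4) ^ k"
    by metis
  define r where "r k = (\<Sum>i\<le>k. N i) + k" for k
  have r_ge: "N k \<le> r k" for k unfolding r_def by (metis atMost_iff finite_atMost member_le_sum order_refl trans_le_add1 zero_le)
  have r_mono: "r k \<le> r (Suc k)" for k by (simp add: r_def)
  have r_id: "k \<le> r k" for k by (simp add: r_def)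
  define g where "g k x = X (r (Suc k)) x - X (r k) x" for k x
  have [measurable]: "g k \<in> borel_measurable M" for k unfolding g_def by measurable
  have g2: "g k \<in> L2 M" for k unfolding g_def by (rule L2_diff[OF X X])
  have gint: "integrable M (\<lambda>x. cmod (g k x))" for k using L2_integrable[OF M g2] by (rule integrable_norm)
  define A where "A = (measure M (space M) + 1) / 2"
  have g_le: "(LINT x|M. cmod (g k x)) \<le> A * (1/2) ^ k" for k
  proof -
    \<comment> \<open>The inequality \<open>2 s t \<le> s\<^sup>2 + t\<^sup>2\<close>, with weights \<open>2\<^sup>-\<^sup>k\<close> and \<open>2\<^sup>k\<close> that balance the two terms.\<close>
    have "(LINT x|M. cmod (g k x)) \<le> (LINT x|M. (1/2) ^ k / 2 + 2 ^ k / 2 * (cmod (g k x))\<^sup>2)"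
    proof (rule integral_mono[OF gint])
      show "integrable M (\<lambda>x. (1/2) ^ k / 2 + 2 ^ k / 2 * (cmod (g k x))\<^sup>2)"
        using L2_integrable_square[OF g2] by simp
      fix x
      have "0 \<le> (1 - 2 ^ k * cmod (g k x))\<^sup>2" by simp
      then have "2 * (2 ^ k * cmod (g k x)) \<le> 1 + 2 ^ k * 2 ^ k * (cmod (g k x))\<^sup>2"
        by (simp add: power2_eq_square algebra_simps)
      then show "cmod (g k x) \<le> (1/2) ^ k / 2 + 2 ^ k / 2 * (cmod (g k x))\<^sup>2"
        by (simp add: power_one_over field_simps)
    qed
    also have "\<dots> = measure M (space M) * ((1/2) ^ k / 2) + 2 ^ k / 2 * (LINT x|M. (cmod (g k x))\<^sup>2)"
      using L2_integrable_square[OF g2] by simp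
    also have "\<dots> \<le> measure M (space M) * ((1/2) ^ k / 2) + 2 ^ k / 2 * (1/4) ^ k"
      using N[where m = "r (Suc k)" and n = "r k" and k = k] r_ge[of k] r_mono[of k]
      by (intro add_left_mono mult_left_mono) (auto simp: g_def)
    also have "(2::real) ^ k / 2 * (1/4) ^ k = (1/2) ^ k / 2"
      by (simp add: power_mult_distrib[symmetric])
    finally show ?thesis by (simp add: A_def field_simps)
  qed
  have "(\<integral>\<^sup>+x. (\<Sum>k. ennreal (cmod (g k x))) \<partial>M) = (\<Sum>k. \<integral>\<^sup>+x. ennreal (cmod (g k x)) \<partial>M)"
    by (rule nn_integral_suminf) simp
  also have "\<dots> \<le> (\<Sum>k. ennreal (A * (1/2) ^ k))"
    using g_le by (intro suminf_le) (auto simp: nn_integral_eq_integral[OF gint] intro!: ennreal_leI)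
  also have "\<dots> = ennreal (\<Sum>k. A * (1/2) ^ k)"
    by (intro suminf_ennreal2) (auto simp: A_def intro!: summable_mult summable_geometric)
  also have "\<dots> < \<infinity>" by simp
  finally have "(\<integral>\<^sup>+x. (\<Sum>k. ennreal (cmod (g k x))) \<partial>M) \<noteq> \<infinity>" by simp
  then have "AE x in M. (\<Sum>k. ennreal (cmod (g k x))) \<noteq> \<infinity>"
    by (intro nn_integral_PInf_AE) auto
  then have conv: "AE x in M. convergent (\<lambda>k. X (r k) x)"
  proof eventually_elim
    case (elim x)
    have "summable (\<lambda>k. cmod (g k x))" using elim by (intro summable_suminf_not_top) auto
    then have "summable (\<lambda>k. g k x)" by (rule summable_norm_cancel)
    then have "convergent (\<lambda>n. X (r 0) x + (\<Sum>k<n. g k x))"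
      by (intro convergent_add convergent_const) (simp add: summable_iff_convergent)
    then show ?case using sum_lessThan_telescope[of "\<lambda>k. X (r k) x"] by (simp add: g_def)
  qed
  define l where "l x = lim (\<lambda>k. X (r k) x)" for x
  have [measurable]: "l \<in> borel_measurable M" unfolding l_def by measurable
  have key: "(\<integral>\<^sup>+x. ennreal ((cmod (X n x - l x))\<^sup>2) \<partial>M) \<le> ennreal ((1/4) ^ j)" if n: "n \<ge> N j" for n j
  proof -
    have "(\<integral>\<^sup>+x. ennreal ((cmod (X n x - l x))\<^sup>2) \<partial>M)
        = (\<integral>\<^sup>+x. liminf (\<lambda>k. ennreal ((cmod (X n x - X (r k) x))\<^sup>2)) \<partial>M)"
    proof (rule nn_integral_cong_AE, use conv in eventually_elim)
      case (elim x)
      then have "(\<lambda>k. X (r k) x) \<longlonglongrightarrow> l x" by (simp add: l_def convergent_LIMSEQ_iff)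
      then have "(\<lambda>k. ennreal ((cmod (X n x - X (r k) x))\<^sup>2)) \<longlonglongrightarrow> ennreal ((cmod (X n x - l x))\<^sup>2)"
        by (intro tendsto_intros)
      then show ?case using lim_imp_Liminf[OF sequentially_bot] by metis
    qed
    also have "\<dots> \<le> liminf (\<lambda>k. \<integral>\<^sup>+x. ennreal ((cmod (X n x - X (r k) x))\<^sup>2) \<partial>M)"
      by (rule nn_integral_liminf) measurable
    also have "\<dots> \<le> ennreal ((1/4) ^ j)"
    proof -
      have "\<forall>\<^sub>F k in sequentially. (\<integral>\<^sup>+x. ennreal ((cmod (X n x - X (r k) x))\<^sup>2) \<partial>M) \<le> ennreal ((1/4) ^ j)"
        unfolding eventually_sequentially
      proof (intro exI[of _ "N j"] allI impI)
        fix k assume "N j \<le> k"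
        then have "N j \<le> r k" using r_id[of k] by simp
        then show "(\<integral>\<^sup>+x. ennreal ((cmod (X n x - X (r k) x))\<^sup>2) \<partial>M) \<le> ennreal ((1/4) ^ j)"
          using N[OF n] by (simp add: nn_integral_eq_integral[OF int] ennreal_leI less_imp_le)
      qed
      then have "liminf (\<lambda>k. \<integral>\<^sup>+x. ennreal ((cmod (X n x - X (r k) x))\<^sup>2) \<partial>M) \<le> liminf (\<lambda>k::nat. ennreal ((1/4) ^ j))"
        by (rule Liminf_mono)
      then show ?thesis by (simp add: Liminf_const)
    qed
    finally show ?thesis .
  qed
  have D: "(\<lambda>x. X (N 0) x - l x) \<in> L2 M"
  proof -
    have "(\<integral>\<^sup>+x. ennreal ((cmod (X (N 0) x - l x))\<^sup>2) \<partial>M) < \<infinity>"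
      using key[of 0 "N 0"] by (auto intro: le_less_trans)
    then show ?thesis by (auto simp: L2_def integrable_iff_bounded)
  qed
  have l: "l \<in> L2 M" using L2_diff[OF X[of "N 0"] D] by simp
  have "(\<lambda>n. LINT x|M. (cmod (X n x - l x))\<^sup>2) \<longlonglongrightarrow> 0"
  proof (rule LIMSEQ_I)
    fix e :: real assume "e > 0"
    then obtain j where j: "(1/4) ^ j < e" using real_arch_pow_inv[of e "1/4"] by auto
    show "\<exists>no. \<forall>n\<ge>no. norm ((LINT x|M. (cmod (X n x - l x))\<^sup>2) - 0) < e"
    proof (intro exI[of _ "N j"] allI impI)
      fix n assume "n \<ge> N j"
      from key[OF this] have "(LINT x|M. (cmod (X n x - l x))\<^sup>2) \<le> (1/4) ^ j"
        by (simp add: nn_integral_eq_integral[OF L2_integrable_square[OF L2_diff[OF X l]]])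
      then show "norm ((LINT x|M. (cmod (X n x - l x))\<^sup>2) - 0) < e" using j by simp
    qed
  qed
  then show ?thesis using l by blast
qed

lemma hilbert_on_L2:
  assumes M: "finite_measure M" shows "hilbert_on (L2 M) (L2_ip M)"
proof
  show "subspace (L2 M)"
    unfolding subspace_def using L2_zero L2_add L2_scaleR
    by (auto simp: plus_fun_def zero_fun_def scaleR_fun_def)
  show "L2_ip M (u + v) w = L2_ip M u w + L2_ip M v w" if "u \<in> L2 M" "v \<in> L2 M" "w \<in> L2 M" for u v w
    using L2_ip_add[OF that] by (simp add: plus_fun_def)
  show "L2_ip M (c *\<^sub>R u) w = c * L2_ip M u w" for c u w
    using L2_ip_scaleR by (simp add: scaleR_fun_def)
  show "L2_ip M u w = L2_ip M w u" if "u \<in> L2 M" "w \<in> L2 M" for u w using L2_ip_commute[OF that] .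
  show "0 \<le> L2_ip M u u" if "u \<in> L2 M" for u using that by (simp add: L2_ip_self)
  fix X :: "nat \<Rightarrow> _" assume X: "\<And>n. X n \<in> L2 M"
    and C: "\<And>e. e > 0 \<Longrightarrow> \<exists>N. \<forall>m\<ge>N. \<forall>n\<ge>N. L2_ip M (X m - X n) (X m - X n) < e"
  have d: "L2_ip M (f - h) (f - h) = (LINT x|M. (cmod (f x - h x))\<^sup>2)" if "f \<in> L2 M" "h \<in> L2 M" for f h
    using L2_ip_self[OF L2_diff[OF that]] by (simp add: fun_diff_def)
  show "\<exists>l\<in>L2 M. (\<lambda>n. L2_ip M (X n - l) (X n - l)) \<longlonglongrightarrow> 0"
    using L2_complete[OF M X] C by (auto simp: d X)
qed

lemma L2_cauchy_schwarz:
  assumes M: "finite_measure M" and u: "u \<in> L2 M" and v: "v \<in> L2 M"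
  shows "cmod (LINT x|M. u x * v x) \<le> L2_norm M u * L2_norm M v"
proof -
  interpret hilbert_on "L2 M" "L2_ip M" by (rule hilbert_on_L2[OF M])
  have nrm: "nrm f = L2_norm M f" if "f \<in> L2 M" for f using that by (simp add: nrm_def L2_norm_def L2_ip_self)
  define I where "I = (LINT x|M. u x * v x)"
  show ?thesis
  proof (cases "I = 0")
    case True
    then show ?thesis by (simp add: I_def)
  next
    case False
    define c where "c = cnj I / cmod I"
    have "cmod c = 1" using False by (simp add: c_def norm_divide)
    have cu: "(\<lambda>x. c * u x) \<in> L2 M" "(\<lambda>x. cnj (v x)) \<in> L2 M" using u v by (auto intro: L2_cmult L2_cnj)
    have "L2_ip M (\<lambda>x. c * u x) (\<lambda>x. cnj (v x)) = Re (c * I)"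
      by (simp add: L2_ip_def I_def mult.assoc)
    also have "c * I = cmod I"
      using False complex_norm_square[of I] by (simp add: c_def field_simps power2_eq_square)
    finally have "cmod I \<le> \<bar>L2_ip M (\<lambda>x. c * u x) (\<lambda>x. cnj (v x))\<bar>" by simp
    also have "\<dots> \<le> L2_norm M (\<lambda>x. c * u x) * L2_norm M (\<lambda>x. cnj (v x))"
      using cauchy_schwarz[OF cu] cu by (simp add: nrm)
    also have "\<dots> = L2_norm M u * L2_norm M v"
      using \<open>cmod c = 1\<close> by (simp add: L2_norm_cmult) (simp add: L2_norm_def)
    finally show ?thesis by (simp add: I_def)
  qed
qed

lemma L2_norm_triangle:
  assumes "u \<in> L2 M" "v \<in> L2 M" "finite_measure M"
  shows "L2_norm M (\<lambda>x. u x + v x) \<le> L2_norm M u + L2_norm M v"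
proof -
  interpret hilbert_on "L2 M" "L2_ip M" by (rule hilbert_on_L2[OF assms(3)])
  have nrm: "nrm f = L2_norm M f" if "f \<in> L2 M" for f using that by (simp add: nrm_def L2_norm_def L2_ip_self)
  show ?thesis using nrm_triangle[OF assms(1,2)] assms L2_add[OF assms(1,2)]
    by (simp add: nrm plus_fun_def)
qed

lemma tendsto_integral_mult_L2:
  assumes M: "finite_measure M" and X: "\<And>n. X n \<in> L2 M" and l: "l \<in> L2 M" and v: "v \<in> L2 M"
    and lim: "(\<lambda>n::nat. L2_norm M (\<lambda>x. X n x - l x)) \<longlonglongrightarrow> 0"
  shows "(\<lambda>n. LINT x|M. X n x * v x) \<longlonglongrightarrow> (LINT x|M. l x * v x)"
proof (rule LIM_zero_cancel, rule Lim_null_comparison)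
  show "\<forall>\<^sub>F n in sequentially. norm ((LINT x|M. X n x * v x) - (LINT x|M. l x * v x))
      \<le> L2_norm M (\<lambda>x. X n x - l x) * L2_norm M v"
  proof (rule always_eventually, rule allI)
    fix n
    have "(LINT x|M. X n x * v x) - (LINT x|M. l x * v x) = (LINT x|M. (X n x - l x) * v x)"
      by (simp add: left_diff_distrib L2_integrable_mult X l v)
    then show "norm ((LINT x|M. X n x * v x) - (LINT x|M. l x * v x)) \<le> L2_norm M (\<lambda>x. X n x - l x) * L2_norm M v"
      using L2_cauchy_schwarz[OF M L2_diff[OF X l] v] by simp
  qed
  show "(\<lambda>n. L2_norm M (\<lambda>x. X n x - l x) * L2_norm M v) \<longlonglongrightarrow> 0"
    using tendsto_mult_right[OF lim, of "L2_norm M v"] by simp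
qed

section \<open>Smooth functions, exponentials and bump functions\<close>

abbreviation pd :: "'a::euclidean_space \<Rightarrow> ('a \<Rightarrow> complex) \<Rightarrow> 'a \<Rightarrow> complex" where
  "pd b f x \<equiv> frechet_derivative f (at x) b"

lemma pd_eqI: "(f has_derivative D) (at x) \<Longrightarrow> pd b f x = D b"
  using frechet_derivative_at by metis

lemma C_k_SucI:
  assumes "\<And>x. (f has_derivative D x) (at x)" "\<And>b. b \<in> Basis \<Longrightarrow> C_k k (\<lambda>x. D x b)"
  shows "C_k (Suc k) f"
proof -
  have "(\<lambda>x. pd b f x) = (\<lambda>x. D x b)" for b
    using pd_eqI[OF assms(1)] by auto
  then show ?thesis using assms by (auto simp: differentiable_def)
qed

lemma C_k_SucD: "C_k (Suc k) f \<Longrightarrow> C_k k f"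
proof (induction k arbitrary: f)
  case 0
  then have "\<forall>x. f differentiable (at x)" by simp
  then show ?case
    by (simp add: continuous_on_eq_continuous_within differentiable_imp_continuous_within)
qed auto

lemma C_k_has_derivative: "C_k (Suc k) f \<Longrightarrow> (f has_derivative frechet_derivative f (at x)) (at x)"
  by (simp add: frechet_derivative_works)

lemma C_k_const: "C_k k (\<lambda>x. c)"
proof (induction k arbitrary: c)
  case (Suc k)
  show ?case by (rule C_k_SucI[where D = "\<lambda>x b. 0"]) (use Suc in auto)
qed simp

lemma C_k_add: "C_k k f \<Longrightarrow> C_k k g \<Longrightarrow> C_k k (\<lambda>x. f x + g x)"
proof (induction k arbitrary: f g)
  case 0
  then show ?case by (auto intro: continuous_intros)
next
  case (Suc k)
  show ?case
  proof (rule C_k_SucI)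
    show "((\<lambda>x. f x + g x) has_derivative (\<lambda>b. pd b f x + pd b g x)) (at x)" for x
      using Suc.prems by (intro has_derivative_add C_k_has_derivative)
    show "C_k k (\<lambda>x. pd b f x + pd b g x)" if "b \<in> Basis" for b
      using Suc that by auto
  qed
qed

lemma C_k_mult: "C_k k f \<Longrightarrow> C_k k g \<Longrightarrow> C_k k (\<lambda>x. f x * g x)"
proof (induction k arbitrary: f g)
  case 0
  then show ?case by (auto intro: continuous_intros)
next
  case (Suc k)
  show ?case
  proof (rule C_k_SucI)
    show "((\<lambda>x. f x * g x) has_derivative (\<lambda>b. f x * pd b g x + pd b f x * g x)) (at x)" for x
      using Suc.prems by (intro has_derivative_mult C_k_has_derivative)
    show "C_k k (\<lambda>x. f x * pd b g x + pd b f x * g x)" if "b \<in> Basis" for b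
      using Suc that C_k_SucD[OF Suc.prems(1)] C_k_SucD[OF Suc.prems(2)] by (intro C_k_add Suc.IH) auto
  qed
qed

lemma C_k_cnj: "C_k k f \<Longrightarrow> C_k k (\<lambda>x. cnj (f x))"
proof (induction k arbitrary: f)
  case 0
  then show ?case by (auto intro: continuous_intros)
next
  case (Suc k)
  show ?case
  proof (rule C_k_SucI)
    show "((\<lambda>x. cnj (f x)) has_derivative (\<lambda>b. cnj (pd b f x))) (at x)" for x
      using Suc.prems by (intro has_derivative_cnj C_k_has_derivative)
    show "C_k k (\<lambda>x. cnj (pd b f x))" if "b \<in> Basis" for b
      using Suc that by auto
  qed
qed

lemma C_k_inner: "C_k k (\<lambda>x. complex_of_real (x \<bullet> a))"
proof (cases k)
  case 0
  then show ?thesis by (auto intro: continuous_intros)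
next
  case (Suc k)
  have "((\<lambda>x. complex_of_real (x \<bullet> a)) has_derivative (\<lambda>b. complex_of_real (b \<bullet> a))) (at x)" for x
    by (auto intro!: derivative_eq_intros)
  then show ?thesis unfolding Suc by (rule C_k_SucI) (rule C_k_const)
qed

lemma smooth_add: "smooth f \<Longrightarrow> smooth g \<Longrightarrow> smooth (\<lambda>x. f x + g x)"
  and smooth_mult: "smooth f \<Longrightarrow> smooth g \<Longrightarrow> smooth (\<lambda>x. f x * g x)"
  and smooth_cnj: "smooth f \<Longrightarrow> smooth (\<lambda>x. cnj (f x))"
  and smooth_const: "smooth (\<lambda>x. c)"
  by (auto simp: smooth_def intro: C_k_add C_k_mult C_k_cnj C_k_const)

lemma smooth_cmult: "smooth f \<Longrightarrow> smooth (\<lambda>x. c * f x)"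
  by (rule smooth_mult[OF smooth_const])

lemma smooth_pd: "smooth f \<Longrightarrow> b \<in> Basis \<Longrightarrow> smooth (pd b f)"
  unfolding smooth_def by (metis C_k.simps(2))

lemma smooth_has_derivative: "smooth f \<Longrightarrow> (f has_derivative frechet_derivative f (at x)) (at x)"
  unfolding smooth_def using C_k_has_derivative by blast

lemma smooth_continuous: "smooth f \<Longrightarrow> continuous_on S f"
  unfolding smooth_def using C_k.simps(1) continuous_on_subset by (metis subset_UNIV)

lemma smooth_measurable: "smooth f \<Longrightarrow> f \<in> borel_measurable borel"
  by (intro borel_measurable_continuous_onI smooth_continuous)

lemma pd_mult: "smooth f \<Longrightarrow> smooth g \<Longrightarrow> pd b (\<lambda>x. f x * g x) x = f x * pd b g x + pd b f x * g x"
  by (rule pd_eqI[where D = "\<lambda>b. f x * pd b g x + pd b f x * g x"], rule has_derivative_mult)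
     (auto intro: smooth_has_derivative)

lemma pd_cnj: "smooth f \<Longrightarrow> pd b (\<lambda>x. cnj (f x)) x = cnj (pd b f x)"
  by (rule pd_eqI, rule has_derivative_cnj) (auto intro: smooth_has_derivative)

text \<open>
  A complex frequency is given by its real part \<open>a\<close> and its imaginary part \<open>c\<close>, both real vectors:
  this is \<open>exp ((a + \<i> c) \<bullet> x)\<close>. Its modulus is \<open>exp (a \<bullet> x)\<close>.
\<close>

definition cexp :: "'a::euclidean_space \<Rightarrow> 'a \<Rightarrow> 'a \<Rightarrow> complex" where
  "cexp a c x = exp (Complex (a \<bullet> x) (c \<bullet> x))"

lemma cexp_has_derivative:
  "(cexp a c has_derivative (\<lambda>b. Complex (a \<bullet> b) (c \<bullet> b) * cexp a c x)) (at x)"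
proof -
  have "((\<lambda>x. complex_of_real (a \<bullet> x) + \<i> * complex_of_real (c \<bullet> x)) has_derivative
     (\<lambda>b. complex_of_real (a \<bullet> b) + \<i> * complex_of_real (c \<bullet> b))) (at x)"
    by (auto intro!: derivative_eq_intros)
  then have "((\<lambda>x. exp (complex_of_real (a \<bullet> x) + \<i> * complex_of_real (c \<bullet> x))) has_derivative
     (\<lambda>b. (complex_of_real (a \<bullet> b) + \<i> * complex_of_real (c \<bullet> b)) * exp (complex_of_real (a \<bullet> x) + \<i> * complex_of_real (c \<bullet> x)))) (at x)"
    using has_derivative_compose[OF _ DERIV_exp[unfolded has_field_derivative_def]]
    by (fastforce simp: mult.commute)
  then show ?thesis unfolding cexp_def[abs_def] Complex_eq by simp
qed

lemma pd_cexp: "pd b (cexp a c) x = Complex (a \<bullet> b) (c \<bullet> b) * cexp a c x"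
  by (rule pd_eqI[OF cexp_has_derivative])

lemma smooth_cexp: "smooth (cexp a c)"
proof -
  have "C_k k (cexp a c)" for k
  proof (induction k)
    case 0
    have "continuous_on UNIV (cexp a c)"
      by (intro continuous_at_imp_continuous_on ballI has_derivative_continuous[OF cexp_has_derivative])
    then show ?case by simp
  next
    case (Suc k)
    show ?case by (rule C_k_SucI[OF cexp_has_derivative]) (intro C_k_mult C_k_const Suc)
  qed
  then show ?thesis by (simp add: smooth_def)
qed

lemma cexp_mult: "cexp a c x * cexp a' c' x = cexp (a + a') (c + c') x"
  by (simp add: cexp_def exp_add[symmetric] inner_add_left complex_eq_iff plus_complex.code)

lemma cexp_0 [simp]: "cexp 0 0 x = 1"
  by (simp add: cexp_def complex_eq_iff flip: zero_complex.code)

lemma cexp_nonzero [simp]: "cexp a c x \<noteq> 0"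
  by (simp add: cexp_def)

lemma norm_cexp: "cmod (cexp a c x) = exp (a \<bullet> x)"
  by (simp add: cexp_def)

lemma norm_cexp_0 [simp]: "cmod (cexp 0 c x) = 1"
  by (simp add: norm_cexp)

lemma cnj_cexp: "cnj (cexp a c x) = cexp a (- c) x"
  by (simp add: cexp_def exp_cnj complex_cnj)

lemma test_fun_smooth: "test_fun \<Omega> \<phi> \<Longrightarrow> smooth \<phi>"
  by (simp add: test_fun_def)

lemma test_fun_0: "test_fun \<Omega> (\<lambda>x. 0)"
  by (auto simp: test_fun_def smooth_const intro: exI[of _ "{}"])

lemma test_fun_add: "test_fun \<Omega> f \<Longrightarrow> test_fun \<Omega> g \<Longrightarrow> test_fun \<Omega> (\<lambda>x. f x + g x)"
  unfolding test_fun_def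
proof (intro conjI; elim conjE exE)
  fix K L assume "compact K" "K \<subseteq> \<Omega>" "\<forall>x. x \<notin> K \<longrightarrow> f x = 0" "compact L" "L \<subseteq> \<Omega>" "\<forall>x. x \<notin> L \<longrightarrow> g x = 0"
  then show "\<exists>K. compact K \<and> K \<subseteq> \<Omega> \<and> (\<forall>x. x \<notin> K \<longrightarrow> f x + g x = 0)"
    by (intro exI[of _ "K \<union> L"]) auto
qed (rule smooth_add)

lemma test_fun_mult: "test_fun \<Omega> f \<Longrightarrow> smooth g \<Longrightarrow> test_fun \<Omega> (\<lambda>x. g x * f x)"
  unfolding test_fun_def by (auto intro!: smooth_mult)

lemma test_fun_cmult: "test_fun \<Omega> f \<Longrightarrow> test_fun \<Omega> (\<lambda>x. c * f x)"
  by (rule test_fun_mult[OF _ smooth_const])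

lemma test_fun_cnj: "test_fun \<Omega> f \<Longrightarrow> test_fun \<Omega> (\<lambda>x. cnj (f x))"
  unfolding test_fun_def by (auto intro!: smooth_cnj)

lemma test_fun_pd: 
  assumes "test_fun \<Omega> f" "b \<in> Basis" shows "test_fun \<Omega> (pd b f)"
proof -
  obtain K where K: "compact K" "K \<subseteq> \<Omega>" "\<And>x. x \<notin> K \<Longrightarrow> f x = 0"
    using assms by (auto simp: test_fun_def)
  have "pd b f x = 0" if "x \<notin> K" for x
  proof -
    have "((\<lambda>x. 0) has_derivative (\<lambda>x. 0)) (at x)" by simp
    then have "(f has_derivative (\<lambda>x. 0)) (at x)"
      by (rule has_derivative_transform_within_open[of _ _ _ _ "- K"]) (use that K in \<open>auto simp: compact_imp_closed open_Compl\<close>)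
    then show ?thesis by (rule pd_eqI)
  qed
  then show ?thesis using K smooth_pd[OF test_fun_smooth[OF assms(1)] assms(2)]
    by (auto simp: test_fun_def)
qed

text \<open>
  The derivative of one of these functions is a combination of two others. Hence smoothness of the
  bump function, which is \<open>flat_exp 0\<close> of \<open>r\<^sup>2 - |x - a|\<^sup>2\<close>, follows by induction for all \<open>n\<close> at once.
\<close>

definition flat_exp :: "nat \<Rightarrow> real \<Rightarrow> real" where
  "flat_exp n t = (if t > 0 then inverse t ^ n * exp (- inverse t) else 0)"

lemma flat_exp_deriv:
  "(flat_exp n has_real_derivative flat_exp (n + 2) t - real n * flat_exp (n + 1) t) (at t)"
proof (cases t "0::real" rule: linorder_cases)
  case less
  have "((\<lambda>t. 0) has_real_derivative 0) (at t)" by simp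
  then have "(flat_exp n has_real_derivative 0) (at t)"
    by (rule has_field_derivative_transform_within_open[where S = "{..<0}"]) (use less in \<open>auto simp: flat_exp_def\<close>)
  then show ?thesis using less by (simp add: flat_exp_def)
next
  case greater
  have "((\<lambda>t. inverse t ^ n * exp (- inverse t)) has_real_derivative
      (flat_exp (n + 2) t - real n * flat_exp (n + 1) t)) (at t)"
  proof -
    have p: "((\<lambda>t. inverse t ^ n) has_real_derivative - real n * inverse t ^ (n + 1)) (at t)"
    proof (cases n)
      case (Suc m)
      show ?thesis
        unfolding Suc using greater
        by (intro DERIV_cong[OF DERIV_power[OF DERIV_inverse]]) (auto simp: algebra_simps power2_eq_square)
    qed simp
    have e: "((\<lambda>t. exp (- inverse t)) has_real_derivative exp (- inverse t) * inverse t ^ 2) (at t)"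
      using greater by (auto intro!: derivative_eq_intros simp: power2_eq_square)
    show ?thesis
      by (rule DERIV_cong[OF DERIV_mult[OF p e]])
         (use greater in \<open>simp add: flat_exp_def power_add power2_eq_square algebra_simps\<close>)
  qed
  then show ?thesis
    by (rule has_field_derivative_transform_within_open[where S = "{0<..}"]) (use greater in \<open>auto simp: flat_exp_def\<close>)
next
  case equal
  have "((\<lambda>h. flat_exp n h / h) \<longlongrightarrow> 0) (at_right 0)"
  proof (rule Lim_transform_eventually)
    show "((\<lambda>t::real. inverse t ^ Suc n * exp (- inverse t)) \<longlongrightarrow> 0) (at_right 0)" by real_asymp
    show "\<forall>\<^sub>F t in at_right 0. inverse t ^ Suc n * exp (- inverse t) = flat_exp n t / t"
      by (rule eventually_at_right_less[THEN eventually_mono]) (simp add: flat_exp_def field_simps)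
  qed
  moreover have "((\<lambda>h. flat_exp n h / h) \<longlongrightarrow> 0) (at_left 0)"
  proof (rule Lim_transform_eventually[OF tendsto_const])
    show "\<forall>\<^sub>F t in at_left 0. 0 = flat_exp n t / t"
      by (rule eventually_at_leftI[of "-1"]) (auto simp: flat_exp_def)
  qed
  ultimately have "((\<lambda>h. flat_exp n h / h) \<longlongrightarrow> 0) (at 0)" by (simp add: filterlim_split_at)
  then show ?thesis using equal by (simp add: DERIV_def flat_exp_def)
qed

lemma C_k_flat_exp: "C_k k (\<lambda>x::'a::euclidean_space. complex_of_real (flat_exp n (r\<^sup>2 - (x - a) \<bullet> (x - a))))"
proof (induction k arbitrary: n)
  case 0
  have "continuous_on UNIV (flat_exp n)"
    using DERIV_isCont[OF flat_exp_deriv] by (simp add: continuous_on_eq_continuous_within)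
  then have "continuous_on UNIV (\<lambda>x::'a. flat_exp n (r\<^sup>2 - (x - a) \<bullet> (x - a)))"
    by (rule continuous_on_compose2) (auto intro!: continuous_intros)
  then show ?case by (auto intro!: continuous_intros)
next
  case (Suc k)
  let ?g = "\<lambda>x::'a. r\<^sup>2 - (x - a) \<bullet> (x - a)"
  show ?case
  proof (rule C_k_SucI)
    fix x :: 'a
    have g: "(?g has_derivative (\<lambda>b. - 2 * (b \<bullet> (x - a)))) (at x)"
      by (auto intro!: derivative_eq_intros simp: inner_commute)
    have "((\<lambda>x. flat_exp n (?g x)) has_derivative
        (\<lambda>b. (- 2 * (b \<bullet> (x - a))) * (flat_exp (n + 2) (?g x) - real n * flat_exp (n + 1) (?g x)))) (at x)"
      using has_derivative_compose[OF g flat_exp_deriv[unfolded has_field_derivative_def]]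
      by (simp add: mult.commute)
    then show "((\<lambda>x. complex_of_real (flat_exp n (?g x))) has_derivative
        (\<lambda>b. complex_of_real ((- 2 * (b \<bullet> (x - a))) * (flat_exp (n + 2) (?g x) - real n * flat_exp (n + 1) (?g x))))) (at x)"
      by (rule has_derivative_of_real)
  next
    fix b :: 'a assume "b \<in> Basis"
    have eq: "complex_of_real ((- 2 * (b \<bullet> (x - a))) * (flat_exp (n + 2) (?g x) - real n * flat_exp (n + 1) (?g x)))
       = (complex_of_real (x \<bullet> (-2 *\<^sub>R b)) + complex_of_real (2 * (a \<bullet> b))) *
         (complex_of_real (flat_exp (n + 2) (?g x)) + (- of_nat n) * complex_of_real (flat_exp (n + 1) (?g x)))" for x
      by (simp add: inner_commute inner_diff_right algebra_simps)
    show "C_k k (\<lambda>x. complex_of_real ((- 2 * (b \<bullet> (x - a))) * (flat_exp (n + 2) (?g x) - real n * flat_exp (n + 1) (?g x))))"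
      unfolding eq by (intro C_k_mult C_k_add C_k_const C_k_inner Suc)
  qed
qed

lemma test_fun_bump:
  fixes a :: "'a::euclidean_space"
  assumes "0 < r" "cball a r \<subseteq> \<Omega>"
  obtains \<theta> where "test_fun \<Omega> \<theta>" "\<And>x. x \<in> ball a r \<Longrightarrow> \<theta> x \<noteq> 0"
proof
  let ?t = "\<lambda>x. complex_of_real (flat_exp 0 (r\<^sup>2 - (x - a) \<bullet> (x - a)))"
  have n: "(x - a) \<bullet> (x - a) = (dist a x)\<^sup>2" for x
    unfolding dist_commute[of a x] by (simp add: dist_norm power2_norm_eq_inner)
  show "test_fun \<Omega> ?t"
    unfolding test_fun_def
  proof (intro conjI exI[of _ "cball a r"] allI impI)
    show "smooth ?t" by (simp add: smooth_def C_k_flat_exp)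
    show "?t x = 0" if "x \<notin> cball a r" for x
    proof -
      have "r\<^sup>2 \<le> (dist a x)\<^sup>2" using that assms(1) by (intro power_mono) auto
      then show ?thesis by (simp add: n flat_exp_def)
    qed
  qed (use assms in auto)
  show "?t x \<noteq> 0" if "x \<in> ball a r" for x
  proof -
    have "(dist a x)\<^sup>2 < r\<^sup>2" using that assms(1) by (intro power_strict_mono) auto
    then show ?thesis by (simp add: n flat_exp_def)
  qed
qed

section \<open>Fourier series on a cube\<close>

lemma smooth_measurable_lebesgue_on: "smooth f \<Longrightarrow> f \<in> borel_measurable (lebesgue_on S)"
  by (intro measurable_restrict_space1 measurable_completion) (simp add: smooth_measurable)

lemma continuous_measurable_lebesgue_on:
  "continuous_on UNIV f \<Longrightarrow> f \<in> borel_measurable (lebesgue_on S)"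
  by (intro measurable_restrict_space1 measurable_completion) (simp add: borel_measurable_continuous_onI)

text \<open>
  The frequencies \<open>k\<close> for which \<open>exp (\<i> k \<bullet> x)\<close> has period \<open>2 L\<close> in every coordinate.
\<close>

definition torus_lattice :: "real \<Rightarrow> 'a::euclidean_space set" where
  "torus_lattice L = {k. \<forall>b\<in>Basis. \<exists>n::int. k \<bullet> b = pi / L * of_int n}"

definition cube :: "real \<Rightarrow> 'a::euclidean_space set" where
  "cube L = cbox (- L *\<^sub>R One) (L *\<^sub>R One)"

lemma mem_cube: "x \<in> cube L \<longleftrightarrow> (\<forall>b\<in>Basis. - L \<le> x \<bullet> b \<and> x \<bullet> b \<le> L)"
  by (simp add: cube_def mem_box)

lemma torus_lattice_0: "0 \<in> torus_lattice L"
  by (auto simp: torus_lattice_def intro!: exI[of _ 0])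

lemma torus_lattice_diff:
  assumes "k \<in> torus_lattice L" "l \<in> torus_lattice L" shows "k - l \<in> torus_lattice L"
  unfolding torus_lattice_def
proof (intro CollectI ballI)
  fix b :: 'a assume "b \<in> Basis"
  then obtain n m :: int where "k \<bullet> b = pi / L * of_int n" "l \<bullet> b = pi / L * of_int m"
    using assms unfolding torus_lattice_def by blast
  then show "\<exists>n::int. (k - l) \<bullet> b = pi / L * of_int n"
    by (intro exI[of _ "n - m"]) (simp add: inner_diff_left algebra_simps)
qed

lemma torus_lattice_uminus: "k \<in> torus_lattice L \<Longrightarrow> - k \<in> torus_lattice L"
  using torus_lattice_diff[OF torus_lattice_0, of k] by simp

lemma torus_lattice_add: "k \<in> torus_lattice L \<Longrightarrow> l \<in> torus_lattice L \<Longrightarrow> k + l \<in> torus_lattice L"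
  using torus_lattice_diff[OF _ torus_lattice_uminus, of k L l] by simp

lemma torus_lattice_Basis: "b \<in> Basis \<Longrightarrow> (pi / L) *\<^sub>R b \<in> torus_lattice L"
  unfolding torus_lattice_def
  by (auto simp: inner_Basis intro!: exI[of _ "if _ = _ then 1 else 0"])

lemma integral_cis_period:
  assumes "L > 0"
  shows "(LINT t|lborel. indicator {-L..L} t *\<^sub>R cis (pi / L * of_int n * t)) = (if n = 0 then complex_of_real (2 * L) else 0)"
proof (cases "n = 0")
  case True
  then show ?thesis using assms by (simp add: scaleR_conv_of_real)
next
  case False
  define a where "a = pi / L * of_int n"
  have a: "a \<noteq> 0" using False assms by (simp add: a_def)
  have aL: "a * L = pi * of_int n" using assms by (simp add: a_def)
  have "(LINT t|lborel. indicator {-L..L} t *\<^sub>R cis (a * t)) = cis (a * L) / (\<i> * a) - cis (a * (- L)) / (\<i> * a)"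
  proof (rule integral_FTC_atLeastAtMost[where F = "\<lambda>t. cis (a * t) / (\<i> * a)"])
    fix t
    have "((\<lambda>t. exp (\<i> * a * t) / (\<i> * a)) has_field_derivative exp (\<i> * a * t)) (at (of_real t) within of_real ` {-L..L})"
      using a by (auto intro!: derivative_eq_intros)
    then have "(((\<lambda>t. exp (\<i> * a * t) / (\<i> * a)) \<circ> of_real) has_vector_derivative 1 * exp (\<i> * a * of_real t)) (at t within {-L..L})"
      by (intro field_vector_diff_chain_within) (auto intro!: derivative_eq_intros)
    then show "((\<lambda>t. cis (a * t) / (\<i> * a)) has_vector_derivative cis (a * t)) (at t within {-L..L})"
      by (simp add: o_def cis_conv_exp mult.assoc)
  qed (use assms in \<open>auto intro!: continuous_intros\<close>)
  also have "cis (a * L) = cis (a * (- L))"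
    by (simp add: aL complex_eq_iff sin_zero_iff_int2)
  finally show ?thesis using False by (simp add: a_def)
qed

lemma integral_cexp_cube:
  fixes k :: "'a::euclidean_space"
  assumes L: "L > 0" and k: "k \<in> torus_lattice L"
  shows "(LINT x|lebesgue_on (cube L). cexp 0 k x) = (if k = 0 then complex_of_real ((2 * L) ^ DIM('a)) else 0)"
proof -
  obtain n :: "'a \<Rightarrow> int" where n: "\<And>b. b \<in> Basis \<Longrightarrow> k \<bullet> b = pi / L * of_int (n b)"
    using k unfolding torus_lattice_def mem_Collect_eq by metis
  have ex: "cexp 0 k x = (\<Prod>b\<in>Basis. cis ((k \<bullet> b) * (x \<bullet> b)))" for x
  proof -
    have "cexp 0 k x = exp (\<Sum>b\<in>Basis. \<i> * complex_of_real ((k \<bullet> b) * (x \<bullet> b)))"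
      unfolding cexp_def by (subst euclidean_inner[of k]) (simp add: Complex_eq sum_distrib_left)
    also have "\<dots> = (\<Prod>b\<in>Basis. cis ((k \<bullet> b) * (x \<bullet> b)))"
      by (subst exp_sum) (auto simp: cis_conv_exp)
    finally show ?thesis .
  qed
  have ind: "indicator (cube L) x *\<^sub>R cexp 0 k x = (\<Prod>b\<in>Basis. indicator {-L..L} (x \<bullet> b) *\<^sub>R cis (pi / L * of_int (n b) * (x \<bullet> b)))" for x
  proof (cases "x \<in> cube L")
    case True
    then show ?thesis unfolding ex by (auto simp: mem_cube n intro!: prod.cong)
  next
    case False
    then obtain b where "b \<in> Basis" "x \<bullet> b \<notin> {-L..L}" unfolding mem_cube by auto
    then have "(\<Prod>b\<in>Basis. indicator {-L..L} (x \<bullet> b) *\<^sub>R cis (pi / L * of_int (n b) * (x \<bullet> b))) = 0"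
      by (intro prod_zero bexI[of _ b]) auto
    then show ?thesis using False by simp
  qed
  have meas: "(\<lambda>x. indicator (cube L) x *\<^sub>R cexp 0 k x) \<in> borel_measurable borel"
    unfolding cube_def using smooth_measurable[OF smooth_cexp, of 0 k] by measurable
  interpret product_sigma_finite "\<lambda>b::'a. lborel :: real measure" by standard
  have "(LINT x|lebesgue_on (cube L). cexp 0 k x) = (LINT x|lborel. indicator (cube L) x *\<^sub>R cexp 0 k x)"
    using meas by (subst integral_restrict_space) (auto simp: integral_completion cube_def)
  also have "\<dots> = (LINT f|(\<Pi>\<^sub>M b\<in>Basis. lborel). indicator (cube L) (\<Sum>b\<in>Basis. f b *\<^sub>R b) *\<^sub>R cexp 0 k (\<Sum>b\<in>Basis. f b *\<^sub>R b))"
    by (subst lborel_eq, rule integral_distr) (use meas in auto)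
  also have "\<dots> = (LINT f|(\<Pi>\<^sub>M b\<in>Basis. lborel). (\<Prod>b\<in>Basis. indicator {-L..L} (f b) *\<^sub>R cis (pi / L * of_int (n b) * f b)))"
    unfolding ind by (intro Bochner_Integration.integral_cong prod.cong refl) auto
  also have "\<dots> = (\<Prod>b\<in>Basis. LINT t|lborel. indicator {-L..L} t *\<^sub>R cis (pi / L * of_int (n b) * t))"
  proof (intro product_integral_prod finite_Basis)
    fix b :: 'a
    have "continuous_on {-L..L} (\<lambda>t. cis (pi / L * of_int (n b) * t))" by (intro continuous_intros)
    from borel_integrable_atLeastAtMost'[OF this]
    show "integrable lborel (\<lambda>t. indicat_real {-L..L} t *\<^sub>R cis (pi / L * of_int (n b) * t))"
      by (simp add: set_integrable_def)
  qed
  also have "\<dots> = (\<Prod>b\<in>(Basis::'a set). if n b = 0 then complex_of_real (2 * L) else 0)"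
    by (simp only: integral_cis_period[OF L])
  also have "\<dots> = (if k = 0 then complex_of_real ((2 * L) ^ DIM('a)) else 0)"
  proof (cases "k = 0")
    case True
    then have "n b = 0" if "b \<in> Basis" for b using n[OF that] L by simp
    then show ?thesis using True by simp
  next
    case False
    then obtain b where b: "b \<in> Basis" "k \<bullet> b \<noteq> 0" using euclidean_eq_iff[of k 0] by auto
    then have "n b \<noteq> 0" using n[of b] by auto
    then have "(\<Prod>b\<in>(Basis::'a set). if n b = 0 then complex_of_real (2 * L) else 0) = 0"
      using b by (intro prod_zero) auto
    then show ?thesis using False by simp
  qed
  finally show ?thesis .
qed

lemma cube_lmeasurable [simp]: "cube L \<in> lmeasurable"
  by (simp add: cube_def)

lemma compact_cube: "compact (cube L)"
  by (simp add: cube_def)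

text \<open>
  The quotient map from the cube to the torus, embedded in a Euclidean space. Its coordinates are the
  real and imaginary parts of the basic exponentials, so polynomials on the torus are trigonometric
  polynomials on the cube.
\<close>

definition torus_map :: "real \<Rightarrow> 'a::euclidean_space \<Rightarrow> 'a \<times> 'a" where
  "torus_map L x = (\<Sum>b\<in>Basis. cos (pi / L * (x \<bullet> b)) *\<^sub>R b, \<Sum>b\<in>Basis. sin (pi / L * (x \<bullet> b)) *\<^sub>R b)"

lemma continuous_torus_map: "continuous_on S (torus_map L)"
  unfolding torus_map_def by (intro continuous_intros)

lemma torus_map_inj:
  assumes L: "L > 0" and x: "x \<in> cube L" and y: "y \<in> box (- L *\<^sub>R One) (L *\<^sub>R One)"
    and eq: "torus_map L x = torus_map L y"
  shows "x = y"
proof (rule euclidean_eqI)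
  fix b :: 'a assume b: "b \<in> Basis"
  have "fst (torus_map L x) \<bullet> b = fst (torus_map L y) \<bullet> b" "snd (torus_map L x) \<bullet> b = snd (torus_map L y) \<bullet> b"
    using eq by auto
  then have "cos (pi / L * (x \<bullet> b)) = cos (pi / L * (y \<bullet> b))" "sin (pi / L * (x \<bullet> b)) = sin (pi / L * (y \<bullet> b))"
    using b by (simp_all add: torus_map_def)
  then obtain n :: int where n: "pi / L * (x \<bullet> b) = pi / L * (y \<bullet> b) + 2 * pi * of_int n"
    using sin_cos_eq_iff[of "pi / L * (x \<bullet> b)" "pi / L * (y \<bullet> b)"] by blast
  then have "pi / L * (x \<bullet> b - y \<bullet> b) = pi / L * (2 * L * of_int n)"
    using L by (simp add: right_diff_distrib)
  then have d: "x \<bullet> b - y \<bullet> b = 2 * L * of_int n"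
    using L by (subst (asm) mult_cancel_left) auto
  have "\<bar>x \<bullet> b - y \<bullet> b\<bar> < 2 * L"
  proof -
    have "- L \<le> x \<bullet> b" "x \<bullet> b \<le> L" "- L < y \<bullet> b" "y \<bullet> b < L"
      using x y b by (auto simp: mem_cube mem_box)
    then show ?thesis by (simp add: abs_less_iff)
  qed
  then have "\<bar>real_of_int n\<bar> < 1" using L by (simp add: d abs_mult)
  then have "n = 0" by linarith
  then show "x \<bullet> b = y \<bullet> b" using d by simp
qed

definition annihilates_exponentials :: "real \<Rightarrow> ('a::euclidean_space \<Rightarrow> complex) \<Rightarrow> bool" where
  "annihilates_exponentials L g \<longleftrightarrow> integrable (lebesgue_on (cube L)) g \<and>
     (\<forall>k\<in>torus_lattice L. (LINT x|lebesgue_on (cube L). g x * cexp 0 k x) = 0)"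

lemma integrable_mult_continuous_cube:
  fixes h :: "'a::euclidean_space \<Rightarrow> complex"
  assumes g: "integrable (lebesgue_on (cube L)) g" and h: "continuous_on UNIV h"
  shows "integrable (lebesgue_on (cube L)) (\<lambda>x. g x * h x)"
proof -
  have "bounded (h ` cube L)"
    using compact_continuous_image[OF continuous_on_subset[OF h subset_UNIV] compact_cube] by (rule compact_imp_bounded)
  then obtain C where C: "\<And>x. x \<in> cube L \<Longrightarrow> cmod (h x) \<le> C" unfolding bounded_iff by auto
  show ?thesis
  proof (rule Bochner_Integration.integrable_bound)
    show "integrable (lebesgue_on (cube L)) (\<lambda>x. C * cmod (g x))" using g by simp
    show "(\<lambda>x. g x * h x) \<in> borel_measurable (lebesgue_on (cube L))"
      using g continuous_measurable_lebesgue_on[OF h] by auto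
    have "cmod (g x * h x) \<le> \<bar>C\<bar> * cmod (g x)" if "x \<in> cube L" for x
    proof -
      have "cmod (h x) \<le> \<bar>C\<bar>" using C[OF that] by simp
      then show ?thesis unfolding norm_mult mult.commute[of "cmod (g x)"] by (rule mult_right_mono) simp
    qed
    then show "AE x in lebesgue_on (cube L). cmod (g x * h x) \<le> norm (C * cmod (g x))"
      by (intro AE_I2) (auto simp: abs_mult)
  qed
qed

text \<open>
  Since this condition is stable under sums and products, it passes from the basic exponentials to all
  polynomials in the coordinates of the torus map.
\<close>

definition torus_multiplier :: "real \<Rightarrow> ('a::euclidean_space \<Rightarrow> complex) \<Rightarrow> bool" where
  "torus_multiplier L h \<longleftrightarrow> continuous_on UNIV h \<and>
     (\<forall>g. annihilates_exponentials L g \<longrightarrow> annihilates_exponentials L (\<lambda>x. g x * h x))"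

lemma torus_multiplier_const: "torus_multiplier L (\<lambda>x. c)"
  by (auto simp: torus_multiplier_def annihilates_exponentials_def mult.assoc[of _ c] mult.commute[of c] simp flip: mult.assoc)

lemma torus_multiplier_mult: "torus_multiplier L f \<Longrightarrow> torus_multiplier L h \<Longrightarrow> torus_multiplier L (\<lambda>x. f x * h x)"
  unfolding torus_multiplier_def by (auto intro!: continuous_intros simp flip: mult.assoc)

lemma torus_multiplier_add:
  fixes f h :: "'a::euclidean_space \<Rightarrow> complex"
  assumes "torus_multiplier L f" "torus_multiplier L h" shows "torus_multiplier L (\<lambda>x. f x + h x)"
  unfolding torus_multiplier_def
proof (intro conjI allI impI)
  show "continuous_on UNIV (\<lambda>x. f x + h x)" using assms by (auto simp: torus_multiplier_def intro: continuous_intros)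
  fix g :: "'a \<Rightarrow> complex" assume "annihilates_exponentials L g"
  then have fh: "annihilates_exponentials L (\<lambda>x. g x * f x)" "annihilates_exponentials L (\<lambda>x. g x * h x)"
    using assms by (auto simp: torus_multiplier_def)
  have c: "continuous_on UNIV (cexp 0 k)" for k :: 'a by (rule smooth_continuous[OF smooth_cexp])
  have i: "integrable (lebesgue_on (cube L)) (\<lambda>x. g x * f x)" "integrable (lebesgue_on (cube L)) (\<lambda>x. g x * h x)"
    using fh by (auto simp: annihilates_exponentials_def)
  then show "annihilates_exponentials L (\<lambda>x. g x * (f x + h x))"
    using fh integrable_mult_continuous_cube[OF i(1) c] integrable_mult_continuous_cube[OF i(2) c]
    unfolding annihilates_exponentials_def by (auto simp: distrib_left distrib_right)
qed

lemma torus_multiplier_cexp: 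
  assumes "k \<in> torus_lattice L" shows "torus_multiplier L (cexp 0 k)"
  unfolding torus_multiplier_def annihilates_exponentials_def
  using assms
  by (auto simp: mult.assoc cexp_mult torus_lattice_add smooth_continuous[OF smooth_cexp]
      intro!: integrable_mult_continuous_cube)

lemma torus_multiplier_sum:
  "finite I \<Longrightarrow> (\<And>i. i \<in> I \<Longrightarrow> torus_multiplier L (f i)) \<Longrightarrow> torus_multiplier L (\<lambda>x. \<Sum>i\<in>I. f i x)"
  by (induction I rule: finite_induct) (auto intro: torus_multiplier_add torus_multiplier_const)

lemma torus_multiplier_cos_sin:
  assumes b: "b \<in> Basis"
  shows "torus_multiplier L (\<lambda>x. complex_of_real (cos (pi / L * (x \<bullet> b))))"
    and "torus_multiplier L (\<lambda>x. complex_of_real (sin (pi / L * (x \<bullet> b))))"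
proof -
  let ?k = "(pi / L) *\<^sub>R b"
  have e: "cexp 0 ?k x = cis (pi / L * (x \<bullet> b))" "cexp 0 (- ?k) x = cis (- (pi / L * (x \<bullet> b)))" for x
    by (simp_all add: cexp_def cis_conv_exp Complex_eq inner_commute)
  have k: "?k \<in> torus_lattice L" "- ?k \<in> torus_lattice L"
    using torus_lattice_Basis[OF b] torus_lattice_uminus by auto
  have "torus_multiplier L (\<lambda>x. (1/2) * (cexp 0 ?k x + cexp 0 (- ?k) x))"
    by (intro torus_multiplier_mult torus_multiplier_add torus_multiplier_const torus_multiplier_cexp k)
  also have "(\<lambda>x. (1/2) * (cexp 0 ?k x + cexp 0 (- ?k) x)) = (\<lambda>x. complex_of_real (cos (pi / L * (x \<bullet> b))))"
    unfolding e by (simp add: fun_eq_iff complex_eq_iff)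
  finally show "torus_multiplier L (\<lambda>x. complex_of_real (cos (pi / L * (x \<bullet> b))))" .
  have "torus_multiplier L (\<lambda>x. (1/(2*\<i>)) * (cexp 0 ?k x + (-1) * cexp 0 (- ?k) x))"
    by (intro torus_multiplier_mult torus_multiplier_add torus_multiplier_const torus_multiplier_cexp k)
  also have "(\<lambda>x. (1/(2*\<i>)) * (cexp 0 ?k x + (-1) * cexp 0 (- ?k) x)) = (\<lambda>x. complex_of_real (sin (pi / L * (x \<bullet> b))))"
    unfolding e by (simp add: fun_eq_iff complex_eq_iff)
  finally show "torus_multiplier L (\<lambda>x. complex_of_real (sin (pi / L * (x \<bullet> b))))" .
qed

lemma torus_multiplier_polynomial:
  assumes "real_polynomial_function p"
  shows "torus_multiplier L (\<lambda>x::'a::euclidean_space. complex_of_real (p (torus_map L x)))"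
  using assms
proof (induction rule: real_polynomial_function.induct)
  case (linear f)
  interpret bounded_linear f by fact
  have "f (torus_map L x) = (\<Sum>b\<in>Basis. cos (pi / L * (x \<bullet> b)) * f (b, 0)) + (\<Sum>b\<in>Basis. sin (pi / L * (x \<bullet> b)) * f (0, b))" for x
  proof -
    have "torus_map L x = (\<Sum>b\<in>Basis. cos (pi / L * (x \<bullet> b)) *\<^sub>R (b, 0)) + (\<Sum>b\<in>Basis. sin (pi / L * (x \<bullet> b)) *\<^sub>R (0, b))"
      by (simp add: torus_map_def prod_eq_iff fst_sum snd_sum)
    then show ?thesis by (simp only: add sum scaleR real_scaleR_def)
  qed
  moreover have "torus_multiplier L (\<lambda>x. (\<Sum>b\<in>Basis. complex_of_real (cos (pi / L * (x \<bullet> b))) * complex_of_real (f (b, 0)))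
     + (\<Sum>b\<in>Basis. complex_of_real (sin (pi / L * (x \<bullet> b))) * complex_of_real (f (0, b))))"
    by (intro torus_multiplier_add torus_multiplier_sum torus_multiplier_mult torus_multiplier_const
        torus_multiplier_cos_sin finite_Basis)
  ultimately show ?case by simp
next
  case (const c)
  show ?case by (rule torus_multiplier_const)
next
  case (add f g)
  then show ?case using torus_multiplier_add by fastforce
next
  case (mult f g)
  then show ?case using torus_multiplier_mult by fastforce
qed

text \<open>
  By the Stone-Weierstrass theorem on the torus, \<open>F\<close> is a uniform limit of polynomials.
\<close>

lemma annihilates_exponentials_continuous:
  fixes g :: "'a::euclidean_space \<Rightarrow> complex" and F :: "'a \<times> 'a \<Rightarrow> real"
  assumes g: "annihilates_exponentials L g" and F: "continuous_on UNIV F"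
  shows "(LINT x|lebesgue_on (cube L). g x * complex_of_real (F (torus_map L x))) = 0"
proof -
  let ?M = "lebesgue_on (cube L :: 'a set)"
  have gi: "integrable ?M g" using g by (simp add: annihilates_exponentials_def)
  have cont: "continuous_on UNIV (\<lambda>x::'a. complex_of_real (F (torus_map L x)))"
    by (intro continuous_intros continuous_on_compose2[OF F continuous_torus_map]) auto
  define A where "A = (LINT x|?M. cmod (g x))"
  have A: "A \<ge> 0" by (simp add: A_def)
  have "cmod (LINT x|?M. g x * complex_of_real (F (torus_map L x))) \<le> 0 + e" if "e > 0" for e
  proof -
    obtain p where p: "real_polynomial_function p" "\<And>y. y \<in> torus_map L ` (cube L :: 'a set) \<Longrightarrow> \<bar>F y - p y\<bar> < e / (A + 1)"
      using Stone_Weierstrass_real_polynomial_function[of "torus_map L ` (cube L :: 'a set)" F "e / (A + 1)"]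
        compact_continuous_image[OF continuous_torus_map compact_cube] continuous_on_subset[OF F] \<open>e > 0\<close> A
      by (metis add_nonneg_pos divide_pos_pos subset_UNIV zero_less_one)
    have pm: "torus_multiplier L (\<lambda>x::'a. complex_of_real (p (torus_map L x)))" by (rule torus_multiplier_polynomial[OF p(1)])
    then have "annihilates_exponentials L (\<lambda>x. g x * complex_of_real (p (torus_map L x)))"
      using g by (simp add: torus_multiplier_def)
    then have p0: "(LINT x|?M. g x * complex_of_real (p (torus_map L x))) = 0" and
      pi: "integrable ?M (\<lambda>x. g x * complex_of_real (p (torus_map L x)))"
      using torus_lattice_0[of L] by (force simp: annihilates_exponentials_def)+
    have Fi: "integrable ?M (\<lambda>x. g x * complex_of_real (F (torus_map L x)))"
      by (rule integrable_mult_continuous_cube[OF gi cont])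
    have "cmod (LINT x|?M. g x * complex_of_real (F (torus_map L x)))
       = cmod (LINT x|?M. g x * complex_of_real (F (torus_map L x)) - g x * complex_of_real (p (torus_map L x)))"
      using p0 pi Fi by simp
    also have "\<dots> \<le> (LINT x|?M. e / (A + 1) * cmod (g x))"
    proof (rule Bochner_Integration.integral_norm_bound_integral)
      fix x assume "x \<in> space ?M"
      then have "\<bar>F (torus_map L x) - p (torus_map L x)\<bar> \<le> e / (A + 1)" using p(2)[of "torus_map L x"] by auto
      then have "cmod (g x) * \<bar>F (torus_map L x) - p (torus_map L x)\<bar> \<le> cmod (g x) * (e / (A + 1))"
        by (rule mult_left_mono) simp
      then show "cmod (g x * complex_of_real (F (torus_map L x)) - g x * complex_of_real (p (torus_map L x))) \<le> e / (A + 1) * cmod (g x)"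
        unfolding right_diff_distrib[symmetric] of_real_diff[symmetric] norm_mult norm_of_real by (simp add: mult.commute)
    qed (use gi pi Fi in auto)
    also have "\<dots> = e / (A + 1) * A" by (simp add: A_def)
    also have "\<dots> \<le> e" using A \<open>e > 0\<close> by (simp add: divide_simps)
    finally show ?thesis by simp
  qed
  then have "cmod (LINT x|?M. g x * complex_of_real (F (torus_map L x))) \<le> 0"
    by (rule field_le_epsilon)
  then show ?thesis by simp
qed

text \<open>
  The torus map does not identify a point of \<open>C\<close> with any other point of the cube, so the indicator
  of \<open>C\<close> is the indicator of the closed set \<open>torus_map L ` C\<close> composed with the torus map; the
  indicator of a closed set is a limit of continuous functions.
\<close>

lemma annihilates_exponentials_compact:
  fixes g :: "'a::euclidean_space \<Rightarrow> complex"
  assumes L: "L > 0" and g: "annihilates_exponentials L g"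
    and C: "compact C" "C \<subseteq> box (- L *\<^sub>R One) (L *\<^sub>R One)"
  shows "(LINT x|lebesgue_on (cube L). g x * indicator C x) = 0"
proof (cases "C = {}")
  case False
  let ?M = "lebesgue_on (cube L :: 'a set)"
  let ?T = "torus_map L ` C"
  have gi: "integrable ?M g" using g by (simp add: annihilates_exponentials_def)
  have T: "closed ?T" "?T \<noteq> {}"
    using compact_continuous_image[OF continuous_torus_map C(1)] False by (auto simp: compact_imp_closed)
  define F where "F n y = max 0 (1 - real n * infdist y ?T)" for n y
  have F01: "\<bar>F n y\<bar> \<le> 1" for n y using infdist_nonneg[of y ?T] by (auto simp: F_def)
  have Fc: "continuous_on S (F n)" for n S unfolding F_def by (intro continuous_intros)
  have lim: "(\<lambda>n. F n (torus_map L x)) \<longlonglongrightarrow> indicator C x" if x: "x \<in> cube L" for x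
  proof (cases "x \<in> C")
    case True
    then have "infdist (torus_map L x) ?T = 0" by simp
    then show ?thesis using True by (simp add: F_def)
  next
    case xC: False
    have "torus_map L x \<notin> ?T" using torus_map_inj[OF L x] C(2) xC by blast
    then have pos: "infdist (torus_map L x) ?T > 0"
      using in_closed_iff_infdist_zero[OF T, of "torus_map L x"] infdist_nonneg[of "torus_map L x" ?T] by linarith
    obtain N where N: "1 < real N * infdist (torus_map L x) ?T" using reals_Archimedean3[OF pos] by blast
    have "F n (torus_map L x) = 0" if "n \<ge> N" for n
    proof -
      have "real N * infdist (torus_map L x) ?T \<le> real n * infdist (torus_map L x) ?T"
        using that pos by (intro mult_right_mono) auto
      then show ?thesis using N by (simp add: F_def)
    qed
    then show ?thesis using xC by (intro tendsto_eventually) (auto simp: eventually_sequentially)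
  qed
  have "(\<lambda>n. LINT x|?M. g x * complex_of_real (F n (torus_map L x))) \<longlonglongrightarrow> (LINT x|?M. g x * indicator C x)"
  proof (rule integral_dominated_convergence[where w = "\<lambda>x. cmod (g x)"])
    show "(\<lambda>x. g x * indicator C x) \<in> borel_measurable ?M"
    proof (intro borel_measurable_times borel_measurable_indicator)
      show "C \<in> sets ?M"
        using C by (auto simp: sets_restrict_space_iff compact_imp_closed cube_def intro: subsetD[OF box_subset_cbox])
    qed (use gi in auto)
    show "AE x in ?M. (\<lambda>n. g x * complex_of_real (F n (torus_map L x))) \<longlonglongrightarrow> g x * indicator C x"
    proof (rule AE_I2)
      fix x assume "x \<in> space ?M"
      then have "(\<lambda>n. F n (torus_map L x)) \<longlonglongrightarrow> indicator C x" using lim by simp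
      then have "(\<lambda>n. complex_of_real (F n (torus_map L x))) \<longlonglongrightarrow> complex_of_real (indicator C x)" by (rule tendsto_of_real)
      then show "(\<lambda>n. g x * complex_of_real (F n (torus_map L x))) \<longlonglongrightarrow> g x * indicator C x"
        by (intro tendsto_mult_left) (simp add: indicator_def of_bool_def split: if_splits)
    qed
    show "AE x in ?M. norm (g x * complex_of_real (F n (torus_map L x))) \<le> cmod (g x)" for n
      using F01 by (intro AE_I2) (simp add: norm_mult mult_left_le)
    show "(\<lambda>x. g x * complex_of_real (F n (torus_map L x))) \<in> borel_measurable ?M" for n
    proof (intro borel_measurable_times)
      show "(\<lambda>x. complex_of_real (F n (torus_map L x))) \<in> borel_measurable ?M"
        by (intro continuous_measurable_lebesgue_on continuous_intros
          continuous_on_compose2[OF Fc continuous_torus_map]) auto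
    qed (use gi in auto)
  qed (use gi in auto)
  moreover have "(LINT x|?M. g x * complex_of_real (F n (torus_map L x))) = 0" for n
    by (rule annihilates_exponentials_continuous[OF g Fc])
  ultimately show ?thesis by (simp add: LIMSEQ_const_iff)
qed simp

text \<open>
  By inner regularity the integral over every measurable subset of \<open>U\<close> vanishes, in particular over the
  subsets where \<open>f\<close> is positive or negative.
\<close>

lemma AE_zero_if_integrals_over_compacts_zero:
  fixes f :: "'a::euclidean_space \<Rightarrow> real"
  assumes S: "S \<in> sets lebesgue" and f: "integrable (lebesgue_on S) f"
    and U: "open U" "U \<subseteq> S" "S - U \<in> null_sets lebesgue"
    and C: "\<And>C. compact C \<Longrightarrow> C \<subseteq> U \<Longrightarrow> (LINT x|lebesgue_on S. f x * indicator C x) = 0"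
  shows "AE x in lebesgue_on S. f x = 0"
proof -
  let ?M = "lebesgue_on S"
  have sub: "A \<in> sets ?M" if "A \<in> sets lebesgue" "A \<subseteq> S" for A
    using that S by (auto simp: sets_restrict_space_iff)
  have zero: "(LINT x|?M. f x * indicator A x) = 0" if A: "A \<in> sets lebesgue" "A \<subseteq> U" for A
  proof -
    obtain D T where D: "fsigma D" "T \<in> null_sets lebesgue" "D \<union> T = A" "disjnt D T"
      using lebesgue_set_almost_fsigma[OF A(1)] .
    obtain F :: "nat \<Rightarrow> 'a set" where F: "range F \<subseteq> Collect compact" "D = \<Union>(F ` UNIV)"
      using D(1) fsigma_Union_compact by blast
    define E where "E n = (\<Union>i\<le>n. F i)" for n
    have E: "compact (E n)" "E n \<subseteq> U" for n
      using F A D(3) unfolding E_def by (auto intro!: compact_UN)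
    have EM: "E n \<in> sets ?M" for n
      using E[of n] U by (intro sub) (auto simp: lmeasurable_compact fmeasurableD)
    have "(\<lambda>n. LINT x|?M. f x * indicator (E n) x) \<longlonglongrightarrow> (LINT x|?M. f x * indicator A x)"
    proof (rule integral_dominated_convergence[where w = "\<lambda>x. norm (f x)"])
      have "T \<in> null_sets ?M"
        using D A U S by (auto simp: null_sets_restrict_space)
      then have "AE x in ?M. x \<notin> T" by (rule AE_not_in)
      then show "AE x in ?M. (\<lambda>n. f x * indicator (E n) x) \<longlonglongrightarrow> f x * indicator A x"
      proof eventually_elim
        case (elim x)
        show ?case
        proof (cases "x \<in> D")
          case True
          then obtain i where "x \<in> F i" using F(2) by blast
          then have "x \<in> E n" if "n \<ge> i" for n using that by (auto simp: E_def)
          then have "\<forall>\<^sub>F n in sequentially. f x * indicator (E n) x = f x * indicator A x"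
            using True D(3) by (auto simp: eventually_sequentially intro!: exI[of _ i])
          then show ?thesis by (rule tendsto_eventually)
        next
          case False
          then have "x \<notin> A" "\<And>n. x \<notin> E n" using elim D(3) F(2) by (auto simp: E_def)
          then show ?thesis by simp
        qed
      qed
      show "AE x in ?M. norm (f x * indicator (E n) x) \<le> norm (f x)" for n
        by (intro AE_I2) (simp add: indicator_def)
      show "(\<lambda>x. f x * indicator A x) \<in> borel_measurable ?M" "(\<lambda>x. f x * indicator (E n) x) \<in> borel_measurable ?M" for n
        using f EM sub[of A] A U by (auto intro!: borel_measurable_times borel_measurable_indicator)
    qed (use f in auto)
    moreover have "(LINT x|?M. f x * indicator (E n) x) = 0" for n using C E by blast
    ultimately show ?thesis by (simp add: LIMSEQ_const_iff)
  qed
  have fm: "f \<in> borel_measurable ?M" using f by simp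
  have Ul: "U \<in> sets lebesgue" using U by simp
  have P: "{x \<in> S. f x > 0} \<inter> U \<in> sets lebesgue" "{x \<in> S. f x < 0} \<inter> U \<in> sets lebesgue"
  proof -
    have "{x \<in> space ?M. f x > 0} \<in> sets ?M" "{x \<in> space ?M. f x < 0} \<in> sets ?M" using fm by measurable
    then have "{x \<in> S. f x > 0} \<in> sets lebesgue" "{x \<in> S. f x < 0} \<in> sets lebesgue"
      using S by (auto simp: sets_restrict_space_iff)
    then show "{x \<in> S. f x > 0} \<inter> U \<in> sets lebesgue" "{x \<in> S. f x < 0} \<inter> U \<in> sets lebesgue" using Ul by auto
  qed
  let ?P = "{x \<in> S. f x > 0} \<inter> U" and ?N = "{x \<in> S. f x < 0} \<inter> U"
  have int: "integrable ?M (\<lambda>x. f x * indicator A x)" if "A \<in> sets lebesgue" "A \<subseteq> U" for A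
    using integrable_mult_indicator[OF sub[of A] f] that U by (simp add: mult.commute)
  have "AE x in ?M. f x * indicator ?P x = 0"
    using integral_nonneg_eq_0_iff_AE[OF int[OF P(1)]] zero[OF P(1)] by (auto simp: indicator_def)
  moreover have "AE x in ?M. - (f x * indicator ?N x) = 0"
  proof -
    have "integrable ?M (\<lambda>x. - (f x * indicator ?N x))" using int[OF P(2)] by simp
    moreover have "(LINT x|?M. - (f x * indicator ?N x)) = 0" using zero[OF P(2)] by simp
    moreover have "AE x in ?M. 0 \<le> - (f x * indicator ?N x)" by (auto simp: indicator_def)
    ultimately show ?thesis using integral_nonneg_eq_0_iff_AE by blast
  qed
  moreover have "AE x in ?M. x \<notin> S - U"
    by (rule AE_not_in) (use U S in \<open>auto simp: null_sets_restrict_space\<close>)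
  moreover have "AE x in ?M. x \<in> S" by (rule AE_I2) simp
  ultimately show ?thesis
    by eventually_elim (auto simp: indicator_def split: if_splits)
qed

text \<open>
  Completeness of the exponentials on the torus.
\<close>

lemma annihilates_exponentials_AE_zero:
  fixes g :: "'a::euclidean_space \<Rightarrow> complex"
  assumes L: "L > 0" and g: "annihilates_exponentials L g"
  shows "AE x in lebesgue_on (cube L). g x = 0"
proof -
  let ?M = "lebesgue_on (cube L :: 'a set)" and ?U = "box (- L *\<^sub>R One) (L *\<^sub>R One) :: 'a set"
  have gi: "integrable ?M g" using g by (simp add: annihilates_exponentials_def)
  have S: "(cube L :: 'a set) \<in> sets lebesgue" by (simp add: cube_def)
  have U: "open ?U" "?U \<subseteq> cube L" "cube L - ?U \<in> null_sets lebesgue"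
    using negligible_frontier_interval[of "- L *\<^sub>R One" "L *\<^sub>R One :: 'a"]
    by (auto simp: cube_def negligible_iff_null_sets intro: subsetD[OF box_subset_cbox])
  have C: "(LINT x|?M. g x * indicator C x) = 0 \<and> integrable ?M (\<lambda>x. g x * indicator C x)" if "compact C" "C \<subseteq> ?U" for C
  proof
    show "(LINT x|?M. g x * indicator C x) = 0" by (rule annihilates_exponentials_compact[OF L g that])
    have "C \<in> sets lebesgue" using that by (simp add: lmeasurable_compact fmeasurableD)
    then have "C \<in> sets ?M" using that U S by (auto simp: sets_restrict_space_iff)
    from integrable_mult_indicator[OF this gi]
    have "integrable ?M (\<lambda>x. indicator C x *\<^sub>R g x)" .
    also have "(\<lambda>x. indicator C x *\<^sub>R g x) = (\<lambda>x. g x * indicator C x)" by (auto simp: indicator_def)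
    finally show "integrable ?M (\<lambda>x. g x * indicator C x)" .
  qed
  have "AE x in ?M. Re (g x) = 0"
  proof (rule AE_zero_if_integrals_over_compacts_zero[OF S _ U])
    fix C assume "compact C" "C \<subseteq> ?U"
    note c = C[OF this]
    have "(LINT x|?M. Re (g x) * indicator C x) = (LINT x|?M. Re (g x * indicator C x))"
      by (intro Bochner_Integration.integral_cong) (auto simp: indicator_def)
    also have "\<dots> = 0" by (subst integral_Re) (use c in auto)
    finally show "(LINT x|?M. Re (g x) * indicator C x) = 0" .
  qed (use gi in auto)
  moreover have "AE x in ?M. Im (g x) = 0"
  proof (rule AE_zero_if_integrals_over_compacts_zero[OF S _ U])
    fix C assume "compact C" "C \<subseteq> ?U"
    note c = C[OF this]
    have "(LINT x|?M. Im (g x) * indicator C x) = (LINT x|?M. Im (g x * indicator C x))"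
      by (intro Bochner_Integration.integral_cong) (auto simp: indicator_def)
    also have "\<dots> = 0" by (subst integral_Im) (use c in auto)
    finally show "(LINT x|?M. Im (g x) * indicator C x) = 0" .
  qed (use gi in auto)
  ultimately show ?thesis by eventually_elim (simp add: complex_eq_iff)
qed

text \<open>
  Shifting all frequencies by \<open>s\<close> multiplies the exponentials by a common function of modulus one, so
  they remain orthogonal and complete. The shift serves to keep the frequencies away from the zeros of
  a symbol.
\<close>

abbreviation shifted_lattice :: "real \<Rightarrow> 'a::euclidean_space \<Rightarrow> 'a set" where
  "shifted_lattice L s \<equiv> (+) s ` torus_lattice L"

lemma shifted_lattice_diff: "k \<in> shifted_lattice L s \<Longrightarrow> l \<in> shifted_lattice L s \<Longrightarrow> k - l \<in> torus_lattice L"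
  using torus_lattice_diff by fastforce

text \<open>
  The square of the distance is completed in the coefficients \<open>a\<close>. It is smallest for the Fourier
  coefficients, which gives Bessel's inequality, and any good approximant gives a lower bound for the
  sum of the squares of the coefficients, which gives Parseval's.
\<close>

lemma L2_trig_polynomial_distance:
  fixes f :: "'a::euclidean_space \<Rightarrow> complex" and L :: real
  defines "M \<equiv> lebesgue_on (cube L :: 'a set)" and "vol \<equiv> (2 * L) ^ DIM('a)"
  assumes L: "L > 0" and f: "f \<in> L2 M" and F: "finite F" "F \<subseteq> shifted_lattice L s"
  defines "c \<equiv> \<lambda>k. LINT x|M. f x * cexp 0 (- k) x"
  shows "vol * (LINT x|M. (cmod (f x - (\<Sum>k\<in>F. a k * cexp 0 k x)))\<^sup>2)
    = vol * (LINT x|M. (cmod (f x))\<^sup>2) - (\<Sum>k\<in>F. (cmod (c k))\<^sup>2) + (\<Sum>k\<in>F. (cmod (of_real vol * a k - c k))\<^sup>2)"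
proof -
  have fm: "finite_measure M" unfolding M_def by (rule finite_measure_lebesgue_on) simp
  have vol: "vol > 0" using L by (simp add: vol_def)
  define p where "p x = (\<Sum>k\<in>F. a k * cexp 0 k x)" for x
  have e2: "cexp 0 k \<in> L2 M" for k
    by (rule L2_bounded[OF fm _ , where C = 1]) (auto simp: M_def smooth_measurable_lebesgue_on smooth_cexp)
  have p2: "p \<in> L2 M" unfolding p_def by (intro L2_sum L2_cmult e2)
  have orth: "(LINT x|M. cexp 0 k x * cexp 0 (- l) x) = (if k = l then of_real vol else 0)" if "k \<in> F" "l \<in> F" for k l
  proof -
    have "k - l \<in> torus_lattice L" using that F(2) shifted_lattice_diff by blast
    then show ?thesis using integral_cexp_cube[OF L, of "k - l"] by (simp add: cexp_mult M_def vol_def)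
  qed
  have cp: "cnj (p x) = (\<Sum>k\<in>F. cnj (a k) * cexp 0 (- k) x)" for x
    by (simp add: p_def cnj_cexp)
  have fp: "(LINT x|M. f x * cnj (p x)) = (\<Sum>k\<in>F. cnj (a k) * c k)"
  proof -
    have "(LINT x|M. f x * cnj (p x)) = (LINT x|M. (\<Sum>k\<in>F. cnj (a k) * (f x * cexp 0 (- k) x)))"
      unfolding cp by (simp add: sum_distrib_left mult.left_commute)
    also have "\<dots> = (\<Sum>k\<in>F. cnj (a k) * c k)"
      unfolding c_def by (subst Bochner_Integration.integral_sum) (intro integrable_mult_right L2_integrable_mult f e2, simp)
    finally show ?thesis .
  qed
  have pp: "(LINT x|M. p x * cnj (p x)) = (\<Sum>k\<in>F. of_real vol * (a k * cnj (a k)))"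
  proof -
    have "(LINT x|M. p x * cnj (p x)) = (LINT x|M. (\<Sum>k\<in>F. \<Sum>l\<in>F. a k * cnj (a l) * (cexp 0 k x * cexp 0 (- l) x)))"
      unfolding cp unfolding p_def by (simp add: sum_product mult_ac)
    also have "\<dots> = (\<Sum>k\<in>F. \<Sum>l\<in>F. a k * cnj (a l) * (LINT x|M. cexp 0 k x * cexp 0 (- l) x))"
      by (subst Bochner_Integration.integral_sum,
          intro Bochner_Integration.integrable_sum integrable_mult_right L2_integrable_mult e2,
          intro sum.cong refl, subst Bochner_Integration.integral_sum,
          intro integrable_mult_right L2_integrable_mult e2, simp)
    also have "\<dots> = (\<Sum>k\<in>F. \<Sum>l\<in>F. if k = l then of_real vol * (a k * cnj (a k)) else 0)"
      by (intro sum.cong refl) (auto simp: orth)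
    also have "\<dots> = (\<Sum>k\<in>F. of_real vol * (a k * cnj (a k)))" using F(1) by (simp add: sum.delta)
    finally show ?thesis .
  qed
  have "(LINT x|M. (cmod (f x - p x))\<^sup>2) = L2_ip M (\<lambda>x. f x - p x) (\<lambda>x. f x - p x)"
    using L2_ip_self[OF L2_diff[OF f p2]] by simp
  also have "\<dots> = Re (LINT x|M. f x * cnj (f x) - f x * cnj (p x) - (cnj (f x * cnj (p x)) - p x * cnj (p x)))"
    unfolding L2_ip_def
    by (intro arg_cong[where f = Re] Bochner_Integration.integral_cong refl) (simp add: algebra_simps)
  also have "(LINT x|M. f x * cnj (f x) - f x * cnj (p x) - (cnj (f x * cnj (p x)) - p x * cnj (p x)))
     = (LINT x|M. f x * cnj (f x)) - (LINT x|M. f x * cnj (p x)) - (cnj (LINT x|M. f x * cnj (p x)) - (LINT x|M. p x * cnj (p x)))"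
    using f p2 by (simp add: L2_integrable_mult L2_cnj del: complex_cnj_mult)
  also have "Re \<dots> = (LINT x|M. (cmod (f x))\<^sup>2) - 2 * Re (\<Sum>k\<in>F. cnj (a k) * c k) + Re (\<Sum>k\<in>F. of_real vol * (a k * cnj (a k)))"
    using L2_ip_self[OF f] unfolding L2_ip_def fp pp by simp
  finally have eq: "(LINT x|M. (cmod (f x - p x))\<^sup>2) = \<dots>" .
  have "vol * (- 2 * Re (cnj (a k) * c k) + Re (of_real vol * (a k * cnj (a k))))
     = (cmod (of_real vol * a k - c k))\<^sup>2 - (cmod (c k))\<^sup>2" for k
  proof -
    obtain u v where a: "a k = Complex u v" by (cases "a k")
    obtain y z where c: "c k = Complex y z" by (cases "c k")
    show ?thesis unfolding a c cmod_power2 by (simp add: power2_eq_square algebra_simps)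
  qed
  then have "vol * (\<Sum>k\<in>F. - 2 * Re (cnj (a k) * c k) + Re (of_real vol * (a k * cnj (a k))))
     = (\<Sum>k\<in>F. (cmod (of_real vol * a k - c k))\<^sup>2) - (\<Sum>k\<in>F. (cmod (c k))\<^sup>2)"
    by (simp only: sum_distrib_left sum_subtractf)
  then have "vol * (- 2 * Re (\<Sum>k\<in>F. cnj (a k) * c k) + Re (\<Sum>k\<in>F. of_real vol * (a k * cnj (a k))))
     = (\<Sum>k\<in>F. (cmod (of_real vol * a k - c k))\<^sup>2) - (\<Sum>k\<in>F. (cmod (c k))\<^sup>2)"
    by (simp only: Re_sum sum.distrib sum_distrib_left)
  then show ?thesis unfolding eq[unfolded p_def] by (simp add: algebra_simps)
qed

lemma bessel_cube:
  fixes f :: "'a::euclidean_space \<Rightarrow> complex"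
  assumes L: "L > 0" and f: "f \<in> L2 (lebesgue_on (cube L))" and F: "finite F" "F \<subseteq> shifted_lattice L s"
  shows "(\<Sum>k\<in>F. (cmod (LINT x|lebesgue_on (cube L). f x * cexp 0 (- k) x))\<^sup>2)
    \<le> (2 * L) ^ DIM('a) * (LINT x|lebesgue_on (cube L). (cmod (f x))\<^sup>2)"
proof -
  let ?a = "\<lambda>k. (LINT x|lebesgue_on (cube L). f x * cexp 0 (- k) x) / of_real ((2 * L) ^ DIM('a))"
  have "0 \<le> (2 * L) ^ DIM('a) * (LINT x|lebesgue_on (cube L). (cmod (f x - (\<Sum>k\<in>F. ?a k * cexp 0 k x)))\<^sup>2)"
    using L by (intro mult_nonneg_nonneg) auto
  then show ?thesis
    unfolding L2_trig_polynomial_distance[OF L f F] using L by simp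
qed

lemma parseval_cube:
  fixes f :: "'a::euclidean_space \<Rightarrow> complex"
  assumes L: "L > 0" and f: "f \<in> L2 (lebesgue_on (cube L))" and e: "e > 0"
  obtains F where "finite F" "F \<subseteq> shifted_lattice L s"
    "(2 * L) ^ DIM('a) * (LINT x|lebesgue_on (cube L). (cmod (f x))\<^sup>2)
      \<le> (\<Sum>k\<in>F. (cmod (LINT x|lebesgue_on (cube L). f x * cexp 0 (- k) x))\<^sup>2) + e"
proof -
  let ?M = "lebesgue_on (cube L :: 'a set)" and ?vol = "(2 * L) ^ DIM('a)"
  have vol: "?vol > 0" using L by simp
  have fm: "finite_measure ?M" by (rule finite_measure_lebesgue_on) simp
  interpret hilbert_on "L2 ?M" "L2_ip ?M" by (rule hilbert_on_L2[OF fm])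
  have e2: "cexp 0 k \<in> L2 ?M" for k
    by (rule L2_bounded[OF fm _ , where C = 1]) (auto simp: smooth_measurable_lebesgue_on smooth_cexp)
  define U where "U = {\<lambda>x. \<Sum>k\<in>F. a k * cexp 0 k x | F a. finite F \<and> F \<subseteq> shifted_lattice L s}"
  have U: "subspace U" "U \<subseteq> L2 ?M"
  proof -
    show "U \<subseteq> L2 ?M" unfolding U_def by (auto intro!: L2_sum L2_cmult e2)
    show "subspace U"
      unfolding subspace_def
    proof (intro conjI allI ballI)
      show "0 \<in> U" unfolding U_def by (auto simp: zero_fun_def intro!: exI[of _ "{}"])
      fix u v c assume "u \<in> U" "v \<in> U"
      then obtain F a G b where F: "finite F" "F \<subseteq> shifted_lattice L s" "u = (\<lambda>x. \<Sum>k\<in>F. a k * cexp 0 k x)"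
        and G: "finite G" "G \<subseteq> shifted_lattice L s" "v = (\<lambda>x. \<Sum>k\<in>G. b k * cexp 0 k x)"
        unfolding U_def by blast
      have "u + v = (\<lambda>x. \<Sum>k\<in>F \<union> G. ((if k \<in> F then a k else 0) + (if k \<in> G then b k else 0)) * cexp 0 k x)"
      proof
        fix x
        have "(\<Sum>k\<in>F \<union> G. (if k \<in> F then a k else 0) * cexp 0 k x) = (\<Sum>k\<in>F. a k * cexp 0 k x)"
          using F(1) G(1) by (intro sum.mono_neutral_cong_right) auto
        moreover have "(\<Sum>k\<in>F \<union> G. (if k \<in> G then b k else 0) * cexp 0 k x) = (\<Sum>k\<in>G. b k * cexp 0 k x)"
          using F(1) G(1) by (intro sum.mono_neutral_cong_right) auto
        ultimately show "(u + v) x = (\<Sum>k\<in>F \<union> G. ((if k \<in> F then a k else 0) + (if k \<in> G then b k else 0)) * cexp 0 k x)"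
          using F(3) G(3) by (simp add: distrib_right sum.distrib)
      qed
      then show "u + v \<in> U"
        unfolding U_def using F(1,2) G(1,2)
        by (intro CollectI exI[of _ "F \<union> G"] exI[of _ "\<lambda>k. (if k \<in> F then a k else 0) + (if k \<in> G then b k else 0)"]) auto
    next
      fix u and c :: real assume "u \<in> U"
      then obtain F a where F: "finite F" "F \<subseteq> shifted_lattice L s" "u = (\<lambda>x. \<Sum>k\<in>F. a k * cexp 0 k x)"
        unfolding U_def by blast
      then have "c *\<^sub>R u = (\<lambda>x. \<Sum>k\<in>F. (c *\<^sub>R a k) * cexp 0 k x)"
        by (simp add: fun_eq_iff scaleR_sum_right)
      then show "c *\<^sub>R u \<in> U"
        unfolding U_def using F by (intro CollectI exI[of _ F] exI[of _ "\<lambda>k. c *\<^sub>R a k"]) auto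
    qed
  qed
  have orth: "\<bar>L2_ip ?M f g\<bar> \<le> 0 * nrm g" if g: "g \<in> L2 ?M" and g0: "\<And>u. u \<in> U \<Longrightarrow> L2_ip ?M g u = 0" for g
  proof -
    have z: "(LINT x|?M. g x * cexp 0 (- k) x) = 0" if "k \<in> shifted_lattice L s" for k
    proof -
      have "(\<lambda>x. c * cexp 0 k x) \<in> U" for c
        unfolding U_def using that by (intro CollectI exI[of _ "{k}"] exI[of _ "\<lambda>_. c"]) auto
      then have "Re (LINT x|?M. g x * cnj (c * cexp 0 k x)) = 0" for c
        using g0[of "\<lambda>x. c * cexp 0 k x"] unfolding L2_ip_def by blast
      then have "Re (cnj c * (LINT x|?M. g x * cexp 0 (- k) x)) = 0" for c
        by (simp add: cnj_cexp mult.left_commute)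
      from this[of 1] this[of \<i>] show ?thesis by (simp add: complex_eq_iff)
    qed
    have "annihilates_exponentials L (\<lambda>x. g x * cexp 0 (- s) x)"
      unfolding annihilates_exponentials_def
    proof (intro conjI ballI)
      show "integrable ?M (\<lambda>x. g x * cexp 0 (- s) x)" by (rule L2_integrable_mult[OF g e2])
      fix k :: 'a assume "k \<in> torus_lattice L"
      then have "s - k \<in> shifted_lattice L s" using torus_lattice_uminus by (intro image_eqI[of _ _ "- k"]) auto
      from z[OF this] show "(LINT x|?M. g x * cexp 0 (- s) x * cexp 0 k x) = 0"
        by (simp add: mult.assoc cexp_mult)
    qed
    then have "AE x in ?M. g x * cexp 0 (- s) x = 0" by (rule annihilates_exponentials_AE_zero[OF L])
    then have "AE x in ?M. g x = 0" by simp
    then have "L2_ip ?M f g = Re (LINT x|?M. 0)"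
      unfolding L2_ip_def using f L2_cnj[OF g] by (intro arg_cong[where f = Re] integral_cong_AE) (auto dest: L2_measurable)
    then show ?thesis by simp
  qed
  have "sqrt (e / ?vol) > 0" using e vol by simp
  then obtain u where u: "u \<in> U" "nrm (f - u) < 0 + sqrt (e / ?vol)"
    using approximable_by_annihilator_bound[OF U f order_refl orth \<open>sqrt (e / ?vol) > 0\<close>] by blast
  obtain F a where F: "finite F" "F \<subseteq> shifted_lattice L s" "u = (\<lambda>x. \<Sum>k\<in>F. a k * cexp 0 k x)"
    using u(1) unfolding U_def by blast
  have u2: "u \<in> L2 ?M" using u U by blast
  have "(nrm (f - u))\<^sup>2 = (LINT x|?M. (cmod (f x - u x))\<^sup>2)"
    using nrm_sq[of "f - u"] f u2 L2_ip_self[of "f - u" ?M] V_diff[OF f u2] by simp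
  moreover have "(nrm (f - u))\<^sup>2 \<le> (sqrt (e / ?vol))\<^sup>2"
    using u(2) nrm_nonneg[OF V_diff[OF f u2]] by (intro power_mono) auto
  ultimately have "(LINT x|?M. (cmod (f x - u x))\<^sup>2) \<le> e / ?vol" using e vol by simp
  then have "?vol * (LINT x|?M. (cmod (f x - u x))\<^sup>2) \<le> e"
    using vol by (simp add: field_simps)
  then have "?vol * (LINT x|?M. (cmod (f x))\<^sup>2) - (\<Sum>k\<in>F. (cmod (LINT x|?M. f x * cexp 0 (- k) x))\<^sup>2)
      + (\<Sum>k\<in>F. (cmod (of_real ?vol * a k - (LINT x|?M. f x * cexp 0 (- k) x)))\<^sup>2) \<le> e"
    unfolding F(3) L2_trig_polynomial_distance[OF L f F(1,2)] .
  moreover have "0 \<le> (\<Sum>k\<in>F. (cmod (of_real ?vol * a k - (LINT x|?M. f x * cexp 0 (- k) x)))\<^sup>2)"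
    by (intro sum_nonneg) simp
  ultimately show ?thesis using that[OF F(1,2)] by linarith
qed

lemma finite_shifted_lattice_cball: "L > 0 \<Longrightarrow> finite (shifted_lattice L s \<inter> cball (0::'a::euclidean_space) r)"
proof -
  assume L: "L > 0"
  define R where "R = (r + norm s) * L / pi"
  define T where "T = (\<lambda>n. s + (\<Sum>b\<in>Basis. (pi / L * of_int (n b)) *\<^sub>R b)) ` (Basis \<rightarrow>\<^sub>E {- \<lceil>R\<rceil>..\<lceil>R\<rceil>} :: ('a \<Rightarrow> int) set)"
  have "shifted_lattice L s \<inter> cball 0 r \<subseteq> T"
  proof
    fix x assume "x \<in> shifted_lattice L s \<inter> cball (0::'a) r"
    then obtain k where k: "k \<in> torus_lattice L" "x = s + k" "norm x \<le> r" by auto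
    obtain n :: "'a \<Rightarrow> int" where n: "\<And>b. b \<in> Basis \<Longrightarrow> k \<bullet> b = pi / L * of_int (n b)"
      using k(1) unfolding torus_lattice_def mem_Collect_eq by metis
    have "norm k \<le> r + norm s" using norm_triangle_ineq4[of x s] k by simp
    have nR: "\<bar>real_of_int (n b)\<bar> \<le> R" if b: "b \<in> Basis" for b
    proof -
      have "\<bar>pi / L * of_int (n b)\<bar> \<le> r + norm s"
        using Basis_le_norm[OF b, of k] n[OF b] \<open>norm k \<le> r + norm s\<close> by simp
      then show ?thesis using L by (simp add: R_def abs_mult field_simps)
    qed
    then have "n b \<in> {- \<lceil>R\<rceil>..\<lceil>R\<rceil>}" if "b \<in> Basis" for b
    proof -
      have "real_of_int (n b) \<le> of_int \<lceil>R\<rceil>" "- real_of_int (n b) \<le> of_int \<lceil>R\<rceil>"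
        using nR[OF that] le_of_int_ceiling[of R] by linarith+
      then show ?thesis unfolding atLeastAtMost_iff by linarith
    qed
    then have "restrict n Basis \<in> Basis \<rightarrow>\<^sub>E {- \<lceil>R\<rceil>..\<lceil>R\<rceil>}" by auto
    moreover have "x = s + (\<Sum>b\<in>Basis. (pi / L * of_int (restrict n Basis b)) *\<^sub>R b)"
      using k(2) euclidean_representation[of k] n by (simp cong: sum.cong)
    ultimately show "x \<in> T" unfolding T_def by blast
  qed
  moreover have "finite T" unfolding T_def by (intro finite_imageI finite_PiE) auto
  ultimately show ?thesis by (rule finite_subset)
qed

lemma integral_extend_by_zero:
  fixes f :: "'a::euclidean_space \<Rightarrow> 'b::{banach, second_countable_topology}"
  assumes "S \<in> sets lebesgue" "T \<in> sets lebesgue" "S \<subseteq> T"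
  shows "(LINT x|lebesgue_on T. (if x \<in> S then f x else 0)) = (LINT x|lebesgue_on S. f x)"
  using assms by (auto simp: integral_restrict_space indicator_def intro!: Bochner_Integration.integral_cong)

lemma integrable_extend_by_zero:
  fixes f :: "'a::euclidean_space \<Rightarrow> 'b::{banach, second_countable_topology}"
  assumes "S \<in> sets lebesgue" "T \<in> sets lebesgue" "S \<subseteq> T"
  shows "integrable (lebesgue_on T) (\<lambda>x. if x \<in> S then f x else 0) \<longleftrightarrow> integrable (lebesgue_on S) f"
proof -
  have "(\<lambda>x. indicator T x *\<^sub>R (if x \<in> S then f x else 0)) = (\<lambda>x. indicator S x *\<^sub>R f x)"
    using assms by (auto simp: fun_eq_iff indicator_def)
  then show ?thesis using assms by (simp add: integrable_restrict_space)
qed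

lemma L2_extend_by_zero:
  fixes f :: "'a::euclidean_space \<Rightarrow> complex"
  assumes S: "S \<in> sets lebesgue" "T \<in> sets lebesgue" "S \<subseteq> T" and f: "f \<in> L2 (lebesgue_on S)"
  shows "(\<lambda>x. if x \<in> S then f x else 0) \<in> L2 (lebesgue_on T)"
proof -
  have "(\<lambda>x. indicator T x *\<^sub>R (if x \<in> S then f x else 0)) = (\<lambda>x. indicator S x *\<^sub>R f x)"
    using S by (auto simp: fun_eq_iff indicator_def)
  then have "(\<lambda>x. if x \<in> S then f x else 0) \<in> borel_measurable (lebesgue_on T)"
    using L2_measurable[OF f] S by (simp add: borel_measurable_restrict_space_iff)
  moreover have "(\<lambda>x. (cmod (if x \<in> S then f x else 0))\<^sup>2) = (\<lambda>x. if x \<in> S then (cmod (f x))\<^sup>2 else 0)" by auto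
  ultimately show ?thesis
    using integrable_extend_by_zero[OF S, of "\<lambda>x. (cmod (f x))\<^sup>2"] L2_integrable_square[OF f] by (simp add: L2_def)
qed

context
  fixes L :: real and S :: "'a::euclidean_space set"
  assumes L: "L > 0" and S: "S \<in> sets lebesgue" "S \<subseteq> cube L"
begin

lemma bessel:
  assumes f: "f \<in> L2 (lebesgue_on S)" and F: "finite F" "F \<subseteq> shifted_lattice L s"
  shows "(\<Sum>k\<in>F. (cmod (LINT x|lebesgue_on S. f x * cexp 0 (- k) x))\<^sup>2)
    \<le> (2 * L) ^ DIM('a) * (LINT x|lebesgue_on S. (cmod (f x))\<^sup>2)"
proof -
  have Q: "(cube L :: 'a set) \<in> sets lebesgue" by (simp add: cube_def)
  have 1: "(if x \<in> S then f x else 0) * h x = (if x \<in> S then f x * h x else 0)"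
    and 2: "(cmod (if x \<in> S then f x else 0))\<^sup>2 = (if x \<in> S then (cmod (f x))\<^sup>2 else 0)" for h x by auto
  show ?thesis
    using bessel_cube[OF L L2_extend_by_zero[OF S(1) Q S(2) f] F] unfolding 1 2
    by (simp only: integral_extend_by_zero[OF S(1) Q S(2)])
qed

lemma parseval:
  assumes f: "f \<in> L2 (lebesgue_on S)" and e: "e > 0"
  obtains F where "finite F" "F \<subseteq> shifted_lattice L s"
    "(2 * L) ^ DIM('a) * (LINT x|lebesgue_on S. (cmod (f x))\<^sup>2)
      \<le> (\<Sum>k\<in>F. (cmod (LINT x|lebesgue_on S. f x * cexp 0 (- k) x))\<^sup>2) + e"
proof -
  have Q: "(cube L :: 'a set) \<in> sets lebesgue" by (simp add: cube_def)
  have 1: "(if x \<in> S then f x else 0) * h x = (if x \<in> S then f x * h x else 0)"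
    and 2: "(cmod (if x \<in> S then f x else 0))\<^sup>2 = (if x \<in> S then (cmod (f x))\<^sup>2 else 0)" for h x by auto
  show ?thesis
    by (rule parseval_cube[OF L L2_extend_by_zero[OF S(1) Q S(2) f] e, of s], rule that, assumption, assumption)
       (simp only: 1 2 integral_extend_by_zero[OF S(1) Q S(2)])
qed

lemma AE_zero_if_annihilates_exponentials:
  assumes f: "integrable (lebesgue_on S) f"
    and 0: "\<And>k. k \<in> torus_lattice L \<Longrightarrow> (LINT x|lebesgue_on S. f x * cexp 0 k x) = 0"
  shows "AE x in lebesgue_on S. f x = 0"
proof -
  have Q: "(cube L :: 'a set) \<in> sets lebesgue" by (simp add: cube_def)
  have 1: "(if x \<in> S then f x else 0) * h x = (if x \<in> S then f x * h x else 0)" for h x by auto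
  have "annihilates_exponentials L (\<lambda>x. if x \<in> S then f x else 0)"
    unfolding annihilates_exponentials_def 1
    using f 0 by (simp add: integral_extend_by_zero[OF S(1) Q S(2)] integrable_extend_by_zero[OF S(1) Q S(2)])
  then have "AE x in lebesgue_on (cube L). (if x \<in> S then f x else 0) = 0"
    by (rule annihilates_exponentials_AE_zero[OF L])
  then have "AE x in lebesgue. x \<in> cube L \<longrightarrow> (if x \<in> S then f x else 0) = 0"
    using AE_restrict_space_iff[of "cube L" lebesgue "\<lambda>x. (if x \<in> S then f x else 0) = 0"] Q by simp
  then have "AE x in lebesgue. x \<in> S \<longrightarrow> f x = 0"
    by eventually_elim (use S in auto)
  then show ?thesis using S(1) AE_restrict_space_iff[of S lebesgue "\<lambda>x. f x = 0"] by simp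
qed

end

section \<open>Weak derivatives and Sobolev spaces\<close>

lemma test_fun_bounded:
  assumes "test_fun S \<phi>" shows "\<exists>C. \<forall>x. cmod (\<phi> x) \<le> C"
proof -
  obtain K where K: "compact K" "\<And>x. x \<notin> K \<Longrightarrow> \<phi> x = 0" using assms by (auto simp: test_fun_def)
  have "bounded (\<phi> ` K)"
    using compact_continuous_image[OF smooth_continuous[OF test_fun_smooth[OF assms]] K(1)] by (rule compact_imp_bounded)
  then obtain C where C: "\<And>x. x \<in> K \<Longrightarrow> cmod (\<phi> x) \<le> C" unfolding bounded_iff by auto
  have "cmod (\<phi> x) \<le> max C 0" for x using C[of x] K(2)[of x] by (cases "x \<in> K") auto
  then show ?thesis by blast
qed

lemma test_fun_directional_bound:
  assumes \<phi>: "test_fun S \<phi>" and b: "b \<in> Basis" and C: "\<And>x. cmod (pd b \<phi> x) \<le> C"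
  shows "cmod (\<phi> (x + h *\<^sub>R b) - \<phi> x) \<le> C * \<bar>h\<bar>"
proof -
  have d: "((\<lambda>t. \<phi> (x + t *\<^sub>R b)) has_derivative (\<lambda>t. t *\<^sub>R pd b \<phi> (x + s *\<^sub>R b))) (at s within UNIV)" for s
  proof -
    have 1: "(\<phi> has_derivative frechet_derivative \<phi> (at (x + s *\<^sub>R b))) (at (x + s *\<^sub>R b))"
      by (rule smooth_has_derivative[OF test_fun_smooth[OF \<phi>]])
    have 2: "((\<lambda>t. x + t *\<^sub>R b) has_derivative (\<lambda>t. t *\<^sub>R b)) (at s)" by (auto intro!: derivative_eq_intros)
    have "((\<lambda>t. \<phi> (x + t *\<^sub>R b)) has_derivative (\<lambda>t. frechet_derivative \<phi> (at (x + s *\<^sub>R b)) (t *\<^sub>R b))) (at s)"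
      by (rule has_derivative_compose[OF 2 1])
    then show ?thesis by (simp add: linear_frechet_derivative[OF differentiableI[OF 1], THEN linear_scale])
  qed
  have "norm (\<phi> (x + h *\<^sub>R b) - \<phi> (x + 0 *\<^sub>R b)) \<le> C * norm (h - 0)"
  proof (rule differentiable_bound[OF convex_UNIV d])
    fix s :: real
    show "onorm (\<lambda>t::real. t *\<^sub>R pd b \<phi> (x + s *\<^sub>R b)) \<le> C"
    proof (rule onorm_bound)
      show "0 \<le> C" using C[of x] norm_ge_zero order_trans by blast
      show "norm (t *\<^sub>R pd b \<phi> (x + s *\<^sub>R b)) \<le> C * norm t" for t :: real
        using mult_right_mono[OF C[of "x + s *\<^sub>R b"], of "\<bar>t\<bar>"] by (simp add: mult.commute)
    qed
  qed auto
  then show ?thesis by simp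
qed

text \<open>
  The integrals of the difference quotients vanish by translation invariance, and they converge by
  dominated convergence.
\<close>

lemma integral_pd_test_fun:
  fixes \<phi> :: "'a::euclidean_space \<Rightarrow> complex"
  assumes \<phi>: "test_fun S \<phi>" and b: "b \<in> Basis"
  shows "(LINT x|lborel. pd b \<phi> x) = 0"
proof -
  obtain K where K: "compact K" "\<And>x. x \<notin> K \<Longrightarrow> \<phi> x = 0" using \<phi> by (auto simp: test_fun_def)
  obtain R where R: "\<And>x. x \<in> K \<Longrightarrow> norm x \<le> R" using compact_imp_bounded[OF K(1)] unfolding bounded_iff by auto
  obtain C where C: "\<And>x. cmod (pd b \<phi> x) \<le> C" using test_fun_bounded[OF test_fun_pd[OF \<phi> b]] by blast
  obtain D where D: "\<And>x. cmod (\<phi> x) \<le> D" using test_fun_bounded[OF \<phi>] by blast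
  have meas: "\<phi> \<in> borel_measurable borel" "pd b \<phi> \<in> borel_measurable borel"
    by (auto intro!: smooth_measurable smooth_pd b test_fun_smooth[OF \<phi>])
  have ball: "integrable lborel (\<lambda>x::'a. B * indicator (cball 0 r) x)" for B r :: real
    by (intro integrable_mult_right integrable_real_indicator) (use emeasure_bounded_finite[OF bounded_cball] in \<open>auto simp: infinity_ennreal_def\<close>)
  have \<phi>int: "integrable lborel \<phi>"
  proof (rule Bochner_Integration.integrable_bound[OF ball[of D R]])
    have "cmod (\<phi> x) \<le> norm (D * indicator (cball 0 R) x)" for x
      using D[of x] K(2)[of x] R[of x] by (cases "x \<in> K") auto
    then show "AE x in lborel. norm (\<phi> x) \<le> norm (D * indicator (cball 0 R) x)" by simp
  qed (use meas in auto)
  define h where "h n = inverse (real (Suc n))" for n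
  have h: "h n > 0" "h n \<le> 1" for n by (auto simp: h_def divide_simps)
  have hlim: "h \<longlonglongrightarrow> 0" unfolding h_def by (rule LIMSEQ_inverse_real_of_nat)
  define F where "F n x = (1 / h n) *\<^sub>R (\<phi> (x + h n *\<^sub>R b) - \<phi> x)" for n x
  have shift: "integrable lborel (\<lambda>x. \<phi> (x + c)) \<and> (LINT x|lborel. \<phi> (x + c)) = (LINT x|lborel. \<phi> x)" for c
  proof -
    have d: "lborel = distr lborel borel ((+) c)" by (rule lborel_distr_plus[symmetric])
    have "(LINT x|lborel. \<phi> x) = (LINT x|distr lborel borel ((+) c). \<phi> x)" using d by simp
    also have "\<dots> = (LINT x|lborel. \<phi> (c + x))" by (rule integral_distr) (use meas in auto)
    finally have 1: "(LINT x|lborel. \<phi> x) = (LINT x|lborel. \<phi> (c + x))" .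
    have "integrable (distr lborel borel ((+) c)) \<phi>" using d \<phi>int by simp
    then have "integrable lborel (\<lambda>x. \<phi> (c + x))" by (subst (asm) integrable_distr_eq) (use meas in auto)
    with 1 show ?thesis by (simp add: add.commute)
  qed
  have "(\<lambda>n. LINT x|lborel. F n x) \<longlonglongrightarrow> (LINT x|lborel. pd b \<phi> x)"
  proof (rule integral_dominated_convergence[where w = "\<lambda>x. C * indicator (cball 0 (R + 1)) x"])
    show "(\<lambda>x. F n x) \<in> borel_measurable lborel" for n
    proof -
      have [measurable]: "\<phi> \<in> borel_measurable borel" by fact
      show ?thesis unfolding F_def by measurable
    qed
    show "AE x in lborel. (\<lambda>n. F n x) \<longlonglongrightarrow> pd b \<phi> x"
    proof (rule AE_I2)
      fix x
      let ?D = "frechet_derivative \<phi> (at x)"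
      have 1: "(\<phi> has_derivative ?D) (at x)"
        by (rule smooth_has_derivative[OF test_fun_smooth[OF \<phi>]])
      then have "((\<lambda>v. norm (\<phi> (x + v) - \<phi> x - ?D v) / norm v) \<longlongrightarrow> 0) (at 0)"
        by (simp add: has_derivative_at)
      moreover have "filterlim (\<lambda>n. h n *\<^sub>R b) (at 0) sequentially"
        unfolding filterlim_at
      proof
        show "\<forall>\<^sub>F n in sequentially. h n *\<^sub>R b \<in> UNIV \<and> h n *\<^sub>R b \<noteq> 0"
        proof (rule always_eventually, rule allI)
          fix n show "h n *\<^sub>R b \<in> UNIV \<and> h n *\<^sub>R b \<noteq> 0" using h[of n] nonzero_Basis[OF b] by simp
        qed
        show "(\<lambda>n. h n *\<^sub>R b) \<longlonglongrightarrow> 0" using tendsto_scaleR[OF hlim tendsto_const, of b] by simp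
      qed
      ultimately have "(\<lambda>n. norm (\<phi> (x + h n *\<^sub>R b) - \<phi> x - ?D (h n *\<^sub>R b)) / norm (h n *\<^sub>R b)) \<longlonglongrightarrow> 0"
        by (rule filterlim_compose)
      moreover have "norm (\<phi> (x + h n *\<^sub>R b) - \<phi> x - ?D (h n *\<^sub>R b)) / norm (h n *\<^sub>R b) = norm (F n x - ?D b)" for n
      proof -
        have "?D (h n *\<^sub>R b) = h n *\<^sub>R ?D b"
          by (rule linear_scale[OF linear_frechet_derivative[OF differentiableI[OF 1]]])
        then have "\<phi> (x + h n *\<^sub>R b) - \<phi> x - ?D (h n *\<^sub>R b) = h n *\<^sub>R (F n x - ?D b)"
          using h[of n] by (simp add: F_def scaleR_diff_right)
        then show ?thesis using h[of n] b by simp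
      qed
      ultimately have "(\<lambda>n. norm (F n x - ?D b)) \<longlonglongrightarrow> 0" by simp
      then show "(\<lambda>n. F n x) \<longlonglongrightarrow> ?D b"
        by (rule LIM_zero_cancel[OF tendsto_norm_zero_cancel])
    qed
    show "AE x in lborel. norm (F n x) \<le> C * indicator (cball 0 (R + 1)) x" for n
    proof (rule AE_I2)
      fix x
      show "norm (F n x) \<le> C * indicator (cball 0 (R + 1)) x"
      proof (cases "x \<in> cball 0 (R + 1)")
        case True
        have "norm (F n x) = cmod (\<phi> (x + h n *\<^sub>R b) - \<phi> x) / h n"
          using h[of n] by (simp add: F_def divide_inverse mult.commute)
        also have "\<dots> \<le> C * \<bar>h n\<bar> / h n"
          using h[of n] by (intro divide_right_mono test_fun_directional_bound[OF \<phi> b C]) auto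
        also have "\<dots> = C" using h[of n] by simp
        finally show ?thesis using True by simp
      next
        case False
        then have nx: "norm x > R + 1" by simp
        have "norm x \<le> norm (x + h n *\<^sub>R b) + norm (h n *\<^sub>R b)"
          using norm_triangle_ineq4[of "x + h n *\<^sub>R b" "h n *\<^sub>R b"] by simp
        also have "norm (h n *\<^sub>R b) \<le> 1" using h[of n] b by simp
        finally have "norm (x + h n *\<^sub>R b) > R" using nx by simp
        then have "\<phi> (x + h n *\<^sub>R b) = 0" "\<phi> x = 0" using K(2) R nx by fastforce+
        then show ?thesis using False by (simp add: F_def)
      qed
    qed
  qed (use meas ball in auto)
  moreover have "(LINT x|lborel. F n x) = 0" for n
    unfolding F_def using shift \<phi>int by simp
  ultimately show ?thesis by (simp add: LIMSEQ_const_iff)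
qed

context hilbert_on
begin

lemma hilbert_on_closure:
  assumes U: "subspace U" "U \<subseteq> V"
  shows "hilbert_on {v \<in> V. \<forall>e>0. \<exists>u\<in>U. nrm (u - v) < e} ip"
proof
  let ?W = "{v \<in> V. \<forall>e>0. \<exists>u\<in>U. nrm (u - v) < e}"
  have UV: "u \<in> V" if "u \<in> U" for u using that U by blast
  have nrm0: "nrm 0 = 0" using nrm_scale[of 0 0] by simp
  show "subspace ?W"
    unfolding subspace_def
  proof (intro conjI allI ballI)
    show "0 \<in> ?W" using subspace_0[OF U(1)] nrm0 by force
    fix x y assume xy: "x \<in> ?W" "y \<in> ?W"
    show "x + y \<in> ?W"
    proof (intro CollectI conjI allI impI)
      fix e :: real assume "e > 0"
      then have "e/2 > 0" by simp
      then obtain u v where u: "u \<in> U" "nrm (u - x) < e/2" and v: "v \<in> U" "nrm (v - y) < e/2"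
        using xy by blast
      have "nrm ((u - x) + (v - y)) \<le> nrm (u - x) + nrm (v - y)"
        using u v xy UV by (intro nrm_triangle) auto
      also have "(u - x) + (v - y) = (u + v) - (x + y)" by simp
      finally have "nrm ((u + v) - (x + y)) < e" using u v by argo
      then show "\<exists>u\<in>U. nrm (u - (x + y)) < e" using subspace_add[OF U(1) u(1) v(1)] by blast
    qed (use xy in auto)
  next
    fix c x assume x: "x \<in> ?W"
    show "c *\<^sub>R x \<in> ?W"
    proof (intro CollectI conjI allI impI)
      fix e :: real assume "e > 0"
      then have "e / (\<bar>c\<bar> + 1) > 0" by (simp add: add_nonneg_pos)
      then obtain u where u: "u \<in> U" "nrm (u - x) < e / (\<bar>c\<bar> + 1)" using x by blast
      have "nrm (c *\<^sub>R u - c *\<^sub>R x) = \<bar>c\<bar> * nrm (u - x)"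
        using nrm_scale[of "u - x" c] u x UV by (simp add: scaleR_diff_right)
      also have "\<dots> \<le> (\<bar>c\<bar> + 1) * nrm (u - x)" using u x UV by (intro mult_right_mono) auto
      also have "\<dots> < e" using u(2) by (simp add: field_simps add_nonneg_pos)
      finally show "\<exists>u\<in>U. nrm (u - c *\<^sub>R x) < e" using subspace_scale[OF U(1) u(1)] by blast
    qed (use x in auto)
  qed
  fix X :: "nat \<Rightarrow> _" assume X: "\<And>n. X n \<in> ?W"
    and C: "\<And>e. e > 0 \<Longrightarrow> \<exists>N. \<forall>m\<ge>N. \<forall>n\<ge>N. ip (X m - X n) (X m - X n) < e"
  have XV: "X n \<in> V" for n using X by blast
  obtain l where l: "l \<in> V" "(\<lambda>n. ip (X n - l) (X n - l)) \<longlonglongrightarrow> 0" using complete[OF XV C] by blast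
  have "l \<in> ?W"
  proof (intro CollectI conjI allI impI)
    fix e :: real assume "e > 0"
    have "(\<lambda>n. nrm (X n - l)) \<longlonglongrightarrow> 0" unfolding nrm_def using tendsto_real_sqrt[OF l(2)] by simp
    then obtain n where n: "nrm (X n - l) < e/2"
      using order_tendstoD(2)[of _ 0 sequentially "e/2"] \<open>e > 0\<close> by (auto simp: eventually_sequentially)
    obtain u where u: "u \<in> U" "nrm (u - X n) < e/2" using X[of n] \<open>e > 0\<close> half_gt_zero by blast
    have "nrm (u - l) < e"
      using nrm_triangle[of "u - X n" "X n - l"] n u l XV UV by simp
    then show "\<exists>u\<in>U. nrm (u - l) < e" using u by blast
  qed (rule l)
  then show "\<exists>l\<in>?W. (\<lambda>n. ip (X n - l) (X n - l)) \<longlonglongrightarrow> 0" using l by blast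
qed (auto simp: ip_simps ip_nonneg intro: ip_commute)

end

locale bounded_open =
  fixes \<Omega> :: "'a::euclidean_space set" and L :: real
  assumes open_\<Omega>: "open \<Omega>" and L_pos: "L > 0" and \<Omega>_sub: "\<Omega> \<subseteq> cube L"
begin

abbreviation M :: "'a measure" where "M \<equiv> lebesgue_on \<Omega>"

lemma \<Omega>_lebesgue [simp]: "\<Omega> \<in> sets lebesgue" using open_\<Omega> by simp

lemma \<Omega>_lmeasurable: "\<Omega> \<in> lmeasurable"
  using bounded_set_imp_lmeasurable[OF bounded_subset[OF compact_imp_bounded[OF compact_cube] \<Omega>_sub] \<Omega>_lebesgue] .

lemma finite_M: "finite_measure M"
  by (rule finite_measure_lebesgue_on[OF \<Omega>_lmeasurable])

lemma smooth_bounded: assumes "smooth \<psi>" shows "\<exists>C. \<forall>x\<in>\<Omega>. cmod (\<psi> x) \<le> C"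
proof -
  have "bounded (\<psi> ` cube L)"
    using compact_continuous_image[OF smooth_continuous[OF assms] compact_cube] by (rule compact_imp_bounded)
  then show ?thesis using \<Omega>_sub unfolding bounded_iff by auto
qed

lemma smooth_measurable_M: "smooth \<psi> \<Longrightarrow> \<psi> \<in> borel_measurable M"
  by (rule smooth_measurable_lebesgue_on)

lemma smooth_L2: assumes "smooth \<psi>" shows "\<psi> \<in> L2 M"
proof -
  obtain C where "\<forall>x\<in>\<Omega>. cmod (\<psi> x) \<le> C" using smooth_bounded[OF assms] by blast
  then show ?thesis by (intro L2_bounded[OF finite_M smooth_measurable_M[OF assms], of C] AE_I2) auto
qed

lemma smooth_mult_L2: assumes "smooth \<psi>" "u \<in> L2 M" shows "(\<lambda>x. \<psi> x * u x) \<in> L2 M"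
proof -
  obtain C where "\<forall>x\<in>\<Omega>. cmod (\<psi> x) \<le> C" using smooth_bounded[OF assms(1)] by blast
  then show ?thesis by (intro L2_mult_bounded[OF assms(2) smooth_measurable_M[OF assms(1)], of C] AE_I2) auto
qed

lemma integral_M_eq_lborel:
  fixes f :: "'a \<Rightarrow> complex"
  assumes "f \<in> borel_measurable borel" "\<And>x. x \<notin> \<Omega> \<Longrightarrow> f x = 0"
  shows "(LINT x|M. f x) = (LINT x|lborel. f x)"
proof -
  have "(\<lambda>x. indicator \<Omega> x *\<^sub>R f x) = f" using assms(2) by (auto simp: fun_eq_iff indicator_def)
  then show ?thesis using assms(1) by (simp add: integral_restrict_space integral_completion)
qed

lemma integration_by_parts_smooth:
  assumes \<phi>: "test_fun \<Omega> \<phi>" and \<psi>: "smooth \<psi>" and b: "b \<in> Basis"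
  shows "(LINT x|M. \<psi> x * pd b \<phi> x) = - (LINT x|M. pd b \<psi> x * \<phi> x)"
proof -
  have t: "test_fun \<Omega> (\<lambda>x. \<psi> x * \<phi> x)" by (rule test_fun_mult[OF \<phi> \<psi>])
  have s: "smooth \<phi>" by (rule test_fun_smooth[OF \<phi>])
  obtain K where K: "K \<subseteq> \<Omega>" "\<And>x. x \<notin> K \<Longrightarrow> pd b (\<lambda>x. \<psi> x * \<phi> x) x = 0"
    using test_fun_pd[OF t b] by (auto simp: test_fun_def)
  have "(LINT x|M. pd b (\<lambda>x. \<psi> x * \<phi> x) x) = (LINT x|lborel. pd b (\<lambda>x. \<psi> x * \<phi> x) x)"
    using K by (intro integral_M_eq_lborel smooth_measurable smooth_pd b test_fun_smooth[OF t]) auto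
  also have "\<dots> = 0" by (rule integral_pd_test_fun[OF t b])
  finally have "(LINT x|M. \<psi> x * pd b \<phi> x + pd b \<psi> x * \<phi> x) = 0"
    by (simp only: pd_mult[OF \<psi> s])
  moreover have "integrable M (\<lambda>x. \<psi> x * pd b \<phi> x)" "integrable M (\<lambda>x. pd b \<psi> x * \<phi> x)"
    by (intro L2_integrable_mult smooth_L2 smooth_pd s \<psi> b)+
  ultimately show ?thesis by (simp add: eq_neg_iff_add_eq_0)
qed

text \<open>
  The fundamental lemma of the calculus of variations. A bump function times an exponential is a test
  function, so completeness of the exponentials shows that \<open>g\<close> vanishes where the bump function does not.
\<close>

lemma AE_zero_if_test_integrals_zero:
  assumes g: "g \<in> L2 M" and 0: "\<And>\<phi>. test_fun \<Omega> \<phi> \<Longrightarrow> (LINT x|M. g x * \<phi> x) = 0"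
  shows "AE x in M. g x = 0"
proof -
  have gm: "g \<in> borel_measurable M" using g by (rule L2_measurable)
  have N: "{x \<in> \<Omega>. g x \<noteq> 0} \<in> sets lebesgue"
  proof -
    have "{x \<in> space M. g x \<noteq> 0} \<in> sets M" using gm by measurable
    then show ?thesis by (simp add: sets_restrict_space_iff)
  qed
  have "negligible {x \<in> \<Omega>. g x \<noteq> 0}"
  proof (rule locally_negligible_alt[THEN iffD2], rule ballI)
    fix a assume a: "a \<in> {x \<in> \<Omega>. g x \<noteq> 0}"
    then obtain r where r: "r > 0" "cball a r \<subseteq> \<Omega>" using open_\<Omega> open_contains_cball[of \<Omega>] by blast
    obtain \<theta> where \<theta>: "test_fun \<Omega> \<theta>" "\<And>x. x \<in> ball a r \<Longrightarrow> \<theta> x \<noteq> 0" using test_fun_bump[OF r] by blast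
    have "AE x in M. \<theta> x * g x = 0"
    proof (rule AE_zero_if_annihilates_exponentials[OF L_pos \<Omega>_lebesgue \<Omega>_sub])
      show "integrable M (\<lambda>x. \<theta> x * g x)"
        by (intro L2_integrable_mult g smooth_L2 test_fun_smooth[OF \<theta>(1)])
      fix k :: 'a
      have "test_fun \<Omega> (\<lambda>x. cexp 0 k x * \<theta> x)" by (rule test_fun_mult[OF \<theta>(1) smooth_cexp])
      from 0[OF this] show "(LINT x|M. \<theta> x * g x * cexp 0 k x) = 0" by (simp add: mult_ac)
    qed
    then have "AE x in lebesgue. x \<in> \<Omega> \<longrightarrow> \<theta> x * g x = 0" by (simp add: AE_restrict_space_iff)
    then have "AE x in lebesgue. x \<notin> {x \<in> \<Omega>. g x \<noteq> 0} \<inter> ball a r"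
      by eventually_elim (use \<theta>(2) in auto)
    moreover have "{x \<in> \<Omega>. g x \<noteq> 0} \<inter> ball a r \<in> sets lebesgue" using N by auto
    ultimately have "{x \<in> \<Omega>. g x \<noteq> 0} \<inter> ball a r \<in> null_sets lebesgue"
      by (simp add: AE_iff_null_sets)
    then show "\<exists>U. openin (top_of_set {x \<in> \<Omega>. g x \<noteq> 0}) U \<and> a \<in> U \<and> negligible U"
      using a r by (intro exI[of _ "{x \<in> \<Omega>. g x \<noteq> 0} \<inter> ball a r"]) (auto simp: negligible_iff_null_sets intro: openin_open_Int)
  qed
  then have "{x \<in> \<Omega>. g x \<noteq> 0} \<in> null_sets lebesgue" by (simp add: negligible_iff_null_sets)
  then have "AE x in lebesgue. x \<notin> {x \<in> \<Omega>. g x \<noteq> 0}" by (rule AE_not_in)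
  then show ?thesis by (simp add: AE_restrict_space_iff)
qed

end

context bounded_open
begin

abbreviation wd :: "'a \<Rightarrow> ('a \<Rightarrow> complex) \<Rightarrow> 'a \<Rightarrow> complex" where
  "wd b u \<equiv> weak_deriv \<Omega> b u"

lemma test_fun_L2: "test_fun \<Omega> \<phi> \<Longrightarrow> \<phi> \<in> L2 M"
  by (rule smooth_L2[OF test_fun_smooth])

lemma test_fun_pd_L2: "test_fun \<Omega> \<phi> \<Longrightarrow> b \<in> Basis \<Longrightarrow> pd b \<phi> \<in> L2 M"
  by (rule test_fun_L2[OF test_fun_pd])

lemma H1_L2: "u \<in> H1 \<Omega> \<Longrightarrow> u \<in> L2 M"
  by (simp add: H1_def)

lemma wd_works: assumes "u \<in> H1 \<Omega>" "b \<in> Basis" shows "wd b u \<in> L2 M" "has_weak_deriv \<Omega> b u (wd b u)"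
proof -
  have "\<exists>g. g \<in> L2 M \<and> has_weak_deriv \<Omega> b u g" using assms by (auto simp: H1_def)
  then have "wd b u \<in> L2 M \<and> has_weak_deriv \<Omega> b u (wd b u)"
    unfolding weak_deriv_def by (rule someI_ex)
  then show "wd b u \<in> L2 M" "has_weak_deriv \<Omega> b u (wd b u)" by auto
qed

lemma weak_deriv_unique:
  assumes "has_weak_deriv \<Omega> b u g" "has_weak_deriv \<Omega> b u h" "g \<in> L2 M" "h \<in> L2 M"
  shows "AE x in M. g x = h x"
proof -
  have "AE x in M. g x - h x = 0"
  proof (rule AE_zero_if_test_integrals_zero)
    show "(\<lambda>x. g x - h x) \<in> L2 M" by (rule L2_diff[OF assms(3,4)])
    fix \<phi> assume \<phi>: "test_fun \<Omega> \<phi>"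
    then have "(LINT x|M. g x * \<phi> x) = (LINT x|M. h x * \<phi> x)"
      using assms(1,2) unfolding has_weak_deriv_def by (metis neg_equal_iff_equal)
    then show "(LINT x|M. (g x - h x) * \<phi> x) = 0"
      by (simp add: left_diff_distrib L2_integrable_mult assms test_fun_L2[OF \<phi>])
  qed
  then show ?thesis by simp
qed

lemma H1_I:
  assumes "u \<in> L2 M" "\<And>b. b \<in> Basis \<Longrightarrow> g b \<in> L2 M" "\<And>b. b \<in> Basis \<Longrightarrow> has_weak_deriv \<Omega> b u (g b)"
  shows "u \<in> H1 \<Omega>"
  using assms by (auto simp: H1_def)

lemma wd_eq:
  assumes "u \<in> H1 \<Omega>" "b \<in> Basis" "has_weak_deriv \<Omega> b u g" "g \<in> L2 M"
  shows "AE x in M. wd b u x = g x"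
  using weak_deriv_unique[OF wd_works(2)[OF assms(1,2)] assms(3) wd_works(1)[OF assms(1,2)] assms(4)] .

lemma has_weak_deriv_add:
  assumes "u \<in> L2 M" "v \<in> L2 M" "g \<in> L2 M" "h \<in> L2 M" "b \<in> Basis"
    "has_weak_deriv \<Omega> b u g" "has_weak_deriv \<Omega> b v h"
  shows "has_weak_deriv \<Omega> b (\<lambda>x. u x + v x) (\<lambda>x. g x + h x)"
  using assms unfolding has_weak_deriv_def
  by (simp add: distrib_right L2_integrable_mult test_fun_L2 test_fun_pd_L2)

lemma has_weak_deriv_cmult:
  assumes "has_weak_deriv \<Omega> b u g"
  shows "has_weak_deriv \<Omega> b (\<lambda>x. c * u x) (\<lambda>x. c * g x)"
  using assms unfolding has_weak_deriv_def by (simp add: mult.assoc)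

lemma has_weak_deriv_cnj:
  assumes "has_weak_deriv \<Omega> b u g"
  shows "has_weak_deriv \<Omega> b (\<lambda>x. cnj (u x)) (\<lambda>x. cnj (g x))"
  unfolding has_weak_deriv_def
proof (intro allI impI)
  fix \<phi> assume \<phi>: "test_fun \<Omega> \<phi>"
  have "(LINT x|M. u x * pd b (\<lambda>x. cnj (\<phi> x)) x) = - (LINT x|M. g x * cnj (\<phi> x))"
    using assms test_fun_cnj[OF \<phi>] by (simp add: has_weak_deriv_def)
  then have "(LINT x|M. u x * cnj (pd b \<phi> x)) = - (LINT x|M. g x * cnj (\<phi> x))"
    by (simp only: pd_cnj[OF test_fun_smooth[OF \<phi>]])
  then have "cnj (LINT x|M. u x * cnj (pd b \<phi> x)) = cnj (- (LINT x|M. g x * cnj (\<phi> x)))" by simp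
  then show "(LINT x|M. cnj (u x) * pd b \<phi> x) = - (LINT x|M. cnj (g x) * \<phi> x)"
    unfolding complex_cnj_minus Bochner_Integration.integral_cnj[symmetric] by simp
qed

lemma has_weak_deriv_smooth:
  assumes "smooth \<psi>" "b \<in> Basis" shows "has_weak_deriv \<Omega> b \<psi> (pd b \<psi>)"
  unfolding has_weak_deriv_def using integration_by_parts_smooth assms by blast

lemma smooth_H1: "smooth \<psi> \<Longrightarrow> \<psi> \<in> H1 \<Omega>"
  by (rule H1_I[where g = "\<lambda>b. pd b \<psi>"]) (auto intro: smooth_L2 smooth_pd has_weak_deriv_smooth)

lemma wd_smooth: "smooth \<psi> \<Longrightarrow> b \<in> Basis \<Longrightarrow> AE x in M. wd b \<psi> x = pd b \<psi> x"
  by (rule wd_eq) (auto intro: smooth_H1 has_weak_deriv_smooth smooth_L2 smooth_pd)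

lemma H1_add: assumes "u \<in> H1 \<Omega>" "v \<in> H1 \<Omega>" shows "(\<lambda>x. u x + v x) \<in> H1 \<Omega>"
  by (rule H1_I[where g = "\<lambda>b x. wd b u x + wd b v x"])
     (use assms in \<open>auto intro: L2_add wd_works H1_L2 has_weak_deriv_add\<close>)

lemma wd_add: assumes "u \<in> H1 \<Omega>" "v \<in> H1 \<Omega>" "b \<in> Basis"
  shows "AE x in M. wd b (\<lambda>x. u x + v x) x = wd b u x + wd b v x"
  by (rule wd_eq) (use assms in \<open>auto intro: H1_add L2_add wd_works H1_L2 has_weak_deriv_add\<close>)

lemma H1_cmult: assumes "u \<in> H1 \<Omega>" shows "(\<lambda>x. c * u x) \<in> H1 \<Omega>"
  by (rule H1_I[where g = "\<lambda>b x. c * wd b u x"])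
     (use assms in \<open>auto intro: L2_cmult wd_works H1_L2 has_weak_deriv_cmult\<close>)

lemma wd_cmult: assumes "u \<in> H1 \<Omega>" "b \<in> Basis" shows "AE x in M. wd b (\<lambda>x. c * u x) x = c * wd b u x"
  by (rule wd_eq) (use assms in \<open>auto intro: H1_cmult L2_cmult wd_works H1_L2 has_weak_deriv_cmult\<close>)

lemma H1_diff: assumes "u \<in> H1 \<Omega>" "v \<in> H1 \<Omega>" shows "(\<lambda>x. u x - v x) \<in> H1 \<Omega>"
  using H1_add[OF assms(1) H1_cmult[OF assms(2), of "-1"]] by simp

lemma wd_diff: assumes "u \<in> H1 \<Omega>" "v \<in> H1 \<Omega>" "b \<in> Basis"
  shows "AE x in M. wd b (\<lambda>x. u x - v x) x = wd b u x - wd b v x"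
proof -
  have "AE x in M. wd b (\<lambda>x. u x + (- 1) * v x) x = wd b u x + wd b (\<lambda>x. (- 1) * v x) x"
    by (rule wd_add[OF assms(1) H1_cmult[OF assms(2)] assms(3)])
  with wd_cmult[OF assms(2,3), of "-1"] show ?thesis by eventually_elim simp
qed

lemma H1_cnj: assumes "u \<in> H1 \<Omega>" shows "(\<lambda>x. cnj (u x)) \<in> H1 \<Omega>"
  by (rule H1_I[where g = "\<lambda>b x. cnj (wd b u x)"])
     (use assms in \<open>auto intro: L2_cnj wd_works H1_L2 has_weak_deriv_cnj\<close>)

lemma wd_cnj: assumes "u \<in> H1 \<Omega>" "b \<in> Basis" shows "AE x in M. wd b (\<lambda>x. cnj (u x)) x = cnj (wd b u x)"
  by (rule wd_eq) (use assms in \<open>auto intro: H1_cnj L2_cnj wd_works H1_L2 has_weak_deriv_cnj\<close>)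

lemma has_weak_deriv_cong_AE:
  assumes "AE x in M. u x = v x" "u \<in> borel_measurable M" "v \<in> borel_measurable M" "b \<in> Basis"
  shows "has_weak_deriv \<Omega> b u g \<longleftrightarrow> has_weak_deriv \<Omega> b v g"
proof -
  have "(LINT x|M. u x * pd b \<phi> x) = (LINT x|M. v x * pd b \<phi> x)" if "test_fun \<Omega> \<phi>" for \<phi>
  proof (rule integral_cong_AE)
    show "AE x in M. u x * pd b \<phi> x = v x * pd b \<phi> x" using assms(1) by eventually_elim simp
    have "pd b \<phi> \<in> borel_measurable M" using test_fun_pd_L2[OF that assms(4)] by (rule L2_measurable)
    then show "(\<lambda>x. u x * pd b \<phi> x) \<in> borel_measurable M" "(\<lambda>x. v x * pd b \<phi> x) \<in> borel_measurable M"
      using assms by auto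
  qed
  then show ?thesis by (auto simp: has_weak_deriv_def)
qed

lemma wd_cong_AE:
  assumes "AE x in M. u x = v x" "u \<in> borel_measurable M" "v \<in> borel_measurable M" "b \<in> Basis"
  shows "wd b u = wd b v"
  unfolding weak_deriv_def using has_weak_deriv_cong_AE[OF assms] by simp

definition H1_ip :: "('a \<Rightarrow> complex) \<Rightarrow> ('a \<Rightarrow> complex) \<Rightarrow> real" where
  "H1_ip u v = L2_ip M u v + (\<Sum>b\<in>Basis. L2_ip M (wd b u) (wd b v))"

lemma L2_ip_cong_AE:
  assumes "AE x in M. u x = u' x" "AE x in M. v x = v' x" "u \<in> L2 M" "u' \<in> L2 M" "v \<in> L2 M" "v' \<in> L2 M"
  shows "L2_ip M u v = L2_ip M u' v'"
  unfolding L2_ip_def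
  by (intro arg_cong[where f = Re] integral_cong_AE)
     (use assms L2_cnj[OF assms(5)] L2_cnj[OF assms(6)] in \<open>auto dest!: L2_measurable\<close>)

lemma H1_ip_self: "u \<in> H1 \<Omega> \<Longrightarrow> H1_ip u u = (LINT x|M. (cmod (u x))\<^sup>2) + (\<Sum>b\<in>Basis. LINT x|M. (cmod (wd b u x))\<^sup>2)"
  unfolding H1_ip_def by (simp add: L2_ip_self H1_L2 wd_works)

lemma H1_norm_eq: "u \<in> H1 \<Omega> \<Longrightarrow> H1_norm \<Omega> u = sqrt (H1_ip u u)"
  by (simp add: H1_ip_self H1_norm_def)

lemma H1_norm_square: "(H1_norm \<Omega> u)\<^sup>2 = (L2_norm M u)\<^sup>2 + (\<Sum>b\<in>Basis. (L2_norm M (wd b u))\<^sup>2)"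
  unfolding H1_norm_def L2_norm_square by (intro real_sqrt_pow2 add_nonneg_nonneg sum_nonneg) auto

lemma H1_norm_nonneg [simp]: "0 \<le> H1_norm \<Omega> u"
  unfolding H1_norm_def by (intro real_sqrt_ge_zero add_nonneg_nonneg sum_nonneg) auto

lemma L2_norm_le_H1_norm: "L2_norm M u \<le> H1_norm \<Omega> u"
proof (rule power2_le_imp_le)
  show "(L2_norm M u)\<^sup>2 \<le> (H1_norm \<Omega> u)\<^sup>2" unfolding H1_norm_square by (simp add: sum_nonneg)
qed simp

lemma L2_norm_wd_le_H1_norm: assumes "b \<in> Basis" shows "L2_norm M (wd b u) \<le> H1_norm \<Omega> u"
proof (rule power2_le_imp_le)
  have "(L2_norm M (wd b u))\<^sup>2 \<le> (\<Sum>b\<in>Basis. (L2_norm M (wd b u))\<^sup>2)"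
    using assms by (intro member_le_sum) auto
  then show "(L2_norm M (wd b u))\<^sup>2 \<le> (H1_norm \<Omega> u)\<^sup>2"
    unfolding H1_norm_square using zero_le_power2[of "L2_norm M u"] by linarith
qed simp

text \<open>
  Completeness holds because the defining identity of a weak derivative passes to \<open>L\<^sup>2\<close> limits.
\<close>

lemma hilbert_on_H1: "hilbert_on (H1 \<Omega>) H1_ip"
proof
  interpret L: hilbert_on "L2 M" "L2_ip M" by (rule hilbert_on_L2[OF finite_M])
  show "subspace (H1 \<Omega>)"
    unfolding subspace_def
  proof (intro conjI ballI allI)
    show "0 \<in> H1 \<Omega>" using smooth_H1[OF smooth_const[of 0]] by (simp add: zero_fun_def)
    show "u + v \<in> H1 \<Omega>" if "u \<in> H1 \<Omega>" "v \<in> H1 \<Omega>" for u v using H1_add[OF that] by (simp add: plus_fun_def)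
    show "c *\<^sub>R u \<in> H1 \<Omega>" if "u \<in> H1 \<Omega>" for c u
      using H1_cmult[OF that, of "complex_of_real c"] by (simp add: scaleR_fun_def scaleR_conv_of_real)
  qed
  show "H1_ip u w = H1_ip w u" if "u \<in> H1 \<Omega>" "w \<in> H1 \<Omega>" for u w
    unfolding H1_ip_def using that by (simp add: L2_ip_commute H1_L2 wd_works cong: sum.cong)
  show "0 \<le> H1_ip u u" if "u \<in> H1 \<Omega>" for u
    using that by (simp add: H1_ip_self sum_nonneg)
  show "H1_ip (u + v) w = H1_ip u w + H1_ip v w" if "u \<in> H1 \<Omega>" "v \<in> H1 \<Omega>" "w \<in> H1 \<Omega>" for u v w
  proof -
    have "L2_ip M (wd b (\<lambda>x. u x + v x)) (wd b w) = L2_ip M (wd b u) (wd b w) + L2_ip M (wd b v) (wd b w)"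
      if b: "b \<in> Basis" for b
    proof -
      have "L2_ip M (wd b (\<lambda>x. u x + v x)) (wd b w) = L2_ip M (\<lambda>x. wd b u x + wd b v x) (wd b w)"
        using \<open>u \<in> _\<close> \<open>v \<in> _\<close> \<open>w \<in> _\<close> b
        by (intro L2_ip_cong_AE wd_add) (auto intro!: wd_works L2_add H1_add)
      then show ?thesis using \<open>u \<in> _\<close> \<open>v \<in> _\<close> \<open>w \<in> _\<close> b by (simp add: L2_ip_add wd_works)
    qed
    then show ?thesis
      using that unfolding H1_ip_def plus_fun_def by (simp add: L2_ip_add H1_L2 sum.distrib)
  qed
  show "H1_ip (c *\<^sub>R u) w = c * H1_ip u w" if "u \<in> H1 \<Omega>" "w \<in> H1 \<Omega>" for c u w
  proof -
    have eq: "c *\<^sub>R u = (\<lambda>x. of_real c * u x)" by (simp add: fun_eq_iff scaleR_conv_of_real)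
    have s: "L2_ip M (\<lambda>x. of_real c * f x) g = c * L2_ip M f g" for f g
      using L2_ip_scaleR[of M c f g] by (simp add: scaleR_conv_of_real)
    have "L2_ip M (wd b (\<lambda>x. of_real c * u x)) (wd b w) = c * L2_ip M (wd b u) (wd b w)" if b: "b \<in> Basis" for b
    proof -
      have "L2_ip M (wd b (\<lambda>x. of_real c * u x)) (wd b w) = L2_ip M (\<lambda>x. of_real c * wd b u x) (wd b w)"
        using \<open>u \<in> _\<close> \<open>w \<in> _\<close> b
        by (intro L2_ip_cong_AE wd_cmult) (auto intro!: wd_works L2_cmult H1_cmult)
      then show ?thesis by (simp add: s)
    qed
    then show ?thesis unfolding H1_ip_def eq by (simp add: s distrib_left sum_distrib_left)
  qed
  fix X :: "nat \<Rightarrow> 'a \<Rightarrow> complex" assume X: "\<And>n. X n \<in> H1 \<Omega>"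
    and C: "\<And>e. e > 0 \<Longrightarrow> \<exists>N. \<forall>m\<ge>N. \<forall>n\<ge>N. H1_ip (X m - X n) (X m - X n) < e"
  have ip: "H1_ip (u - v) (u - v) = (LINT x|M. (cmod (u x - v x))\<^sup>2) + (\<Sum>b\<in>Basis. LINT x|M. (cmod (wd b u x - wd b v x))\<^sup>2)"
    if "u \<in> H1 \<Omega>" "v \<in> H1 \<Omega>" for u v
  proof -
    have "u - v = (\<lambda>x. u x - v x)" by (simp add: fun_eq_iff)
    moreover have "(LINT x|M. (cmod (wd b (\<lambda>x. u x - v x) x))\<^sup>2) = (LINT x|M. (cmod (wd b u x - wd b v x))\<^sup>2)" if b: "b \<in> Basis" for b
    proof (rule integral_cong_AE)
      show "AE x in M. (cmod (wd b (\<lambda>x. u x - v x) x))\<^sup>2 = (cmod (wd b u x - wd b v x))\<^sup>2"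
        using wd_diff[OF \<open>u \<in> _\<close> \<open>v \<in> _\<close> b] by eventually_elim simp
    qed (use L2_measurable[OF wd_works(1)[OF H1_diff[OF \<open>u \<in> _\<close> \<open>v \<in> _\<close>] b]]
        L2_measurable[OF wd_works(1)[OF \<open>u \<in> _\<close> b]] L2_measurable[OF wd_works(1)[OF \<open>v \<in> _\<close> b]] in auto)
    ultimately show ?thesis using H1_ip_self[OF H1_diff[OF that]] by simp
  qed
  have le1: "(LINT x|M. (cmod (u x - v x))\<^sup>2) \<le> H1_ip (u - v) (u - v)"
    and le2: "b \<in> Basis \<Longrightarrow> (LINT x|M. (cmod (wd b u x - wd b v x))\<^sup>2) \<le> H1_ip (u - v) (u - v)"
    if "u \<in> H1 \<Omega>" "v \<in> H1 \<Omega>" for u v b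
  proof -
    show "(LINT x|M. (cmod (u x - v x))\<^sup>2) \<le> H1_ip (u - v) (u - v)" unfolding ip[OF that] by (simp add: sum_nonneg)
    show "(LINT x|M. (cmod (wd b u x - wd b v x))\<^sup>2) \<le> H1_ip (u - v) (u - v)" if "b \<in> Basis"
    proof -
      have "(LINT x|M. (cmod (wd b u x - wd b v x))\<^sup>2) \<le> (\<Sum>b\<in>Basis. LINT x|M. (cmod (wd b u x - wd b v x))\<^sup>2)"
        using that by (intro member_le_sum) auto
      moreover have "0 \<le> (LINT x|M. (cmod (u x - v x))\<^sup>2)" by simp
      ultimately show ?thesis unfolding ip[OF \<open>u \<in> _\<close> \<open>v \<in> _\<close>] by linarith
    qed
  qed
  have "\<exists>l\<in>L2 M. (\<lambda>n. LINT x|M. (cmod (X n x - l x))\<^sup>2) \<longlonglongrightarrow> 0"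
  proof (rule L2_complete[OF finite_M H1_L2[OF X]])
    fix e :: real assume "e > 0"
    from C[OF this] show "\<exists>N. \<forall>m\<ge>N. \<forall>n\<ge>N. (LINT x|M. (cmod (X m x - X n x))\<^sup>2) < e"
      using le1[OF X X] by (meson order_le_less_trans)
  qed
  then obtain l where l: "l \<in> L2 M" "(\<lambda>n. LINT x|M. (cmod (X n x - l x))\<^sup>2) \<longlonglongrightarrow> 0" by blast
  have "\<forall>b\<in>Basis. \<exists>g\<in>L2 M. (\<lambda>n. LINT x|M. (cmod (wd b (X n) x - g x))\<^sup>2) \<longlonglongrightarrow> 0"
  proof
    fix b :: 'a assume b: "b \<in> Basis"
    show "\<exists>g\<in>L2 M. (\<lambda>n. LINT x|M. (cmod (wd b (X n) x - g x))\<^sup>2) \<longlonglongrightarrow> 0"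
    proof (rule L2_complete[OF finite_M wd_works(1)[OF X b]])
      fix e :: real assume "e > 0"
      from C[OF this] show "\<exists>N. \<forall>m\<ge>N. \<forall>n\<ge>N. (LINT x|M. (cmod (wd b (X m) x - wd b (X n) x))\<^sup>2) < e"
        using le2[OF X X b] by (meson order_le_less_trans)
    qed
  qed
  then have "\<forall>b\<in>Basis. \<exists>g. g \<in> L2 M \<and> (\<lambda>n. LINT x|M. (cmod (wd b (X n) x - g x))\<^sup>2) \<longlonglongrightarrow> 0"
    by (simp add: Bex_def)
  from bchoice[OF this] obtain g where g: "\<And>b. b \<in> Basis \<Longrightarrow> g b \<in> L2 M"
    "\<And>b. b \<in> Basis \<Longrightarrow> (\<lambda>n. LINT x|M. (cmod (wd b (X n) x - g b x))\<^sup>2) \<longlonglongrightarrow> 0" by blast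
  have nl: "(\<lambda>n. L2_norm M (\<lambda>x. X n x - l x)) \<longlonglongrightarrow> 0"
    unfolding L2_norm_def using tendsto_real_sqrt[OF l(2)] by simp
  have ng: "(\<lambda>n. L2_norm M (\<lambda>x. wd b (X n) x - g b x)) \<longlonglongrightarrow> 0" if "b \<in> Basis" for b
    unfolding L2_norm_def using tendsto_real_sqrt[OF g(2)[OF that]] by simp
  have w: "has_weak_deriv \<Omega> b l (g b)" if b: "b \<in> Basis" for b
    unfolding has_weak_deriv_def
  proof (intro allI impI)
    fix \<phi> assume \<phi>: "test_fun \<Omega> \<phi>"
    have lim1: "(\<lambda>n. LINT x|M. X n x * pd b \<phi> x) \<longlonglongrightarrow> (LINT x|M. l x * pd b \<phi> x)"
      by (rule tendsto_integral_mult_L2[OF finite_M H1_L2[OF X] l(1) test_fun_pd_L2[OF \<phi> b] nl])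
    have lim2: "(\<lambda>n. - (LINT x|M. wd b (X n) x * \<phi> x)) \<longlonglongrightarrow> - (LINT x|M. g b x * \<phi> x)"
      by (intro tendsto_minus tendsto_integral_mult_L2[OF finite_M wd_works(1)[OF X b] g(1)[OF b] test_fun_L2[OF \<phi>] ng[OF b]])
    have "(\<lambda>n. LINT x|M. X n x * pd b \<phi> x) = (\<lambda>n. - (LINT x|M. wd b (X n) x * \<phi> x))"
      using wd_works(2)[OF X b] \<phi> unfolding has_weak_deriv_def by blast
    from lim1[unfolded this] lim2 show "(LINT x|M. l x * pd b \<phi> x) = - (LINT x|M. g b x * \<phi> x)"
      by (rule LIMSEQ_unique)
  qed
  have lH: "l \<in> H1 \<Omega>" by (rule H1_I[OF l(1) g(1) w])
  have "(LINT x|M. (cmod (wd b (X n) x - wd b l x))\<^sup>2) = (LINT x|M. (cmod (wd b (X n) x - g b x))\<^sup>2)" if b: "b \<in> Basis" for b n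
  proof (rule integral_cong_AE)
    show "AE x in M. (cmod (wd b (X n) x - wd b l x))\<^sup>2 = (cmod (wd b (X n) x - g b x))\<^sup>2"
      using wd_eq[OF lH b w[OF b] g(1)[OF b]] by eventually_elim simp
  qed (use L2_measurable[OF wd_works(1)[OF X b]] L2_measurable[OF wd_works(1)[OF lH b]] L2_measurable[OF g(1)[OF b]] in auto)
  then have "H1_ip (X n - l) (X n - l) = (LINT x|M. (cmod (X n x - l x))\<^sup>2) + (\<Sum>b\<in>Basis. LINT x|M. (cmod (wd b (X n) x - g b x))\<^sup>2)" for n
    unfolding ip[OF X lH] by simp
  moreover have "(\<lambda>n. (LINT x|M. (cmod (X n x - l x))\<^sup>2) + (\<Sum>b\<in>Basis. LINT x|M. (cmod (wd b (X n) x - g b x))\<^sup>2)) \<longlonglongrightarrow> 0 + (\<Sum>b\<in>(Basis::'a set). 0)"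
    by (intro tendsto_add tendsto_sum l g)
  ultimately have "(\<lambda>n. H1_ip (X n - l) (X n - l)) \<longlonglongrightarrow> 0" by simp
  then show "\<exists>l\<in>H1 \<Omega>. (\<lambda>n. H1_ip (X n - l) (X n - l)) \<longlonglongrightarrow> 0" using lH by blast
qed

text \<open>
  The closure of the test functions in \<open>H\<^sup>1(\<Omega>)\<close>, in which Dirichlet problems are solved.
\<close>

definition H10 :: "('a \<Rightarrow> complex) set" where
  "H10 = {u \<in> H1 \<Omega>. \<forall>e>0. \<exists>\<phi>. test_fun \<Omega> \<phi> \<and> H1_norm \<Omega> (\<lambda>x. \<phi> x - u x) < e}"

lemma hilbert_on_H10: "hilbert_on H10 H1_ip"
proof -
  interpret H: hilbert_on "H1 \<Omega>" H1_ip by (rule hilbert_on_H1)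
  have n: "H.nrm (\<phi> - u) = H1_norm \<Omega> (\<lambda>x. \<phi> x - u x)" if "test_fun \<Omega> \<phi>" "u \<in> H1 \<Omega>" for \<phi> u
    using H1_norm_eq[OF H1_diff[OF smooth_H1[OF test_fun_smooth[OF that(1)]] that(2)]]
    by (simp add: H.nrm_def fun_diff_def)
  have "subspace (Collect (test_fun \<Omega>))"
    unfolding subspace_def
    using test_fun_0 test_fun_add test_fun_cmult[where c = "complex_of_real _"]
    by (auto simp: zero_fun_def plus_fun_def scaleR_fun_def scaleR_conv_of_real)
  moreover have "Collect (test_fun \<Omega>) \<subseteq> H1 \<Omega>" using smooth_H1[OF test_fun_smooth] by blast
  ultimately have "hilbert_on {v \<in> H1 \<Omega>. \<forall>e>0. \<exists>u\<in>Collect (test_fun \<Omega>). H.nrm (u - v) < e} H1_ip"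
    by (rule H.hilbert_on_closure)
  also have "{v \<in> H1 \<Omega>. \<forall>e>0. \<exists>u\<in>Collect (test_fun \<Omega>). H.nrm (u - v) < e} = H10"
    unfolding H10_def by (rule Collect_cong) (simp add: Bex_def n cong: conj_cong)
  finally show ?thesis .
qed

end

section \<open>Finiteness of the surface measure\<close>

text \<open>
  A packing argument. About \<open>1 / \<rho>\<close> copies of the separated points are stacked in the direction
  \<open>e\<close>. The balls of radius \<open>\<rho> / 2\<close> around all of them are disjoint: those of one layer because the points are
  separated, those of different layers because the Lipschitz function \<open>y \<bullet> e - \<gamma> y\<close> separates the
  layers. Comparing volumes bounds the number of balls.
\<close>

lemma separated_subset_of_graph_card_bound:
  fixes \<gamma> :: "'a::euclidean_space \<Rightarrow> real" and p e :: 'a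
  assumes \<gamma>: "K-lipschitz_on UNIV \<gamma>" "\<And>x t. \<gamma> (x + t *\<^sub>R e) = \<gamma> x" and e: "norm e = 1"
    and A: "A \<subseteq> ball p r" "\<And>x. x \<in> A \<Longrightarrow> \<gamma> x = x \<bullet> e"
    and \<rho>: "0 < \<rho>" "\<rho> \<le> 1"
    and F: "finite F" "F \<subseteq> A" "\<And>x y. x \<in> F \<Longrightarrow> y \<in> F \<Longrightarrow> x \<noteq> y \<Longrightarrow> \<rho> \<le> dist x y"
  shows "real (card F) * \<rho> ^ (DIM('a) - 1) \<le> (2 * (\<bar>r\<bar> + 4 * (1 + K) + 1)) ^ DIM('a)"
proof -
  have K: "K \<ge> 0" using lipschitz_on_nonneg[OF \<gamma>(1)] .
  define J where "J = nat \<lceil>1 / \<rho>\<rceil>"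
  have J: "1 / \<rho> \<le> real J" "real J \<le> 1 / \<rho> + 1"
    using \<rho> unfolding J_def by (auto simp: of_nat_nat ceiling_le_iff le_of_int_ceiling) 
  \<comment> \<open>The distance of consecutive layers exceeds twice the oscillation of \<open>y \<bullet> e - \<gamma> y\<close> on a ball.\<close>
  define s where "s = 2 * (1 + K) * \<rho>"
  define D where "D = (\<lambda>(x, j). ball (x + (real j * s) *\<^sub>R e) (\<rho> / 2))"
  define h where "h y = y \<bullet> e - \<gamma> y" for y
  have h_lip: "\<bar>h y - h z\<bar> \<le> (1 + K) * dist y z" for y z
  proof -
    have "\<bar>(y - z) \<bullet> e\<bar> \<le> dist y z" using Cauchy_Schwarz_ineq2[of "y - z" e] e by (simp add: dist_norm)
    moreover have "\<bar>\<gamma> y - \<gamma> z\<bar> \<le> K * dist y z" using lipschitz_onD[OF \<gamma>(1)] by (simp add: dist_real_def)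
    moreover have "h y - h z = (y - z) \<bullet> e - (\<gamma> y - \<gamma> z)" by (simp add: h_def inner_diff_left)
    ultimately show ?thesis unfolding distrib_right by argo
  qed
  have h_D: "\<bar>h y - real j * s\<bar> < (1 + K) * \<rho>" if "x \<in> F" "y \<in> D (x, j)" for x j y
  proof -
    have "h (x + (real j * s) *\<^sub>R e) = real j * s"
      using A(2)[of x] F(2) that(1) \<gamma>(2) e by (auto simp: h_def inner_add_left norm_eq_1)
    then have "\<bar>h y - real j * s\<bar> \<le> (1 + K) * dist y (x + (real j * s) *\<^sub>R e)" using h_lip by metis
    also have "\<dots> \<le> (1 + K) * (\<rho> / 2)" using that(2) K by (intro mult_left_mono) (auto simp: D_def dist_commute)
    also have "\<dots> < (1 + K) * \<rho>" using K \<rho> by simp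
    finally show ?thesis .
  qed
  have disj: "disjoint_family_on D (F \<times> {..<J})"
    unfolding disjoint_family_on_def
  proof (clarify, rule ccontr)
    fix x i y j assume *: "x \<in> F" "y \<in> F" "\<not> (x = y \<and> i = j)" "D (x, i) \<inter> D (y, j) \<noteq> {}"
    then obtain z where z: "z \<in> D (x, i)" "z \<in> D (y, j)" by blast
    show False
    proof (cases "i = j")
      case True
      then have "dist (x + (real i * s) *\<^sub>R e) z < \<rho> / 2" "dist (y + (real i * s) *\<^sub>R e) z < \<rho> / 2"
        using z by (auto simp: D_def)
      then have "dist (x + (real i * s) *\<^sub>R e) (y + (real i * s) *\<^sub>R e) < \<rho>"
        using dist_triangle2[of "x + (real i * s) *\<^sub>R e" "y + (real i * s) *\<^sub>R e" z] by simp
      then show False using F(3)[of x y] * True by simp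
    next
      case False
      have s2: "s = 2 * ((1 + K) * \<rho>)" by (simp add: s_def)
      have "\<bar>real i * s - real j * s\<bar> < s"
        using h_D[OF *(1) z(1)] h_D[OF *(2) z(2)] abs_triangle_ineq4[of "h z - real j * s" "h z - real i * s"] s2
        by simp
      moreover have "\<bar>real i * s - real j * s\<bar> = \<bar>real i - real j\<bar> * s"
        using K \<rho> by (simp add: abs_mult left_diff_distrib[symmetric] s_def)
      moreover have "1 * s \<le> \<bar>real i - real j\<bar> * s" using False K \<rho> by (intro mult_right_mono) (auto simp: s_def)
      ultimately show False by simp
    qed
  qed
  define R where "R = \<bar>r\<bar> + 4 * (1 + K) + 1"
  have sub: "(\<Union>i\<in>F \<times> {..<J}. D i) \<subseteq> ball p R"
  proof clarify
    fix x j z assume *: "x \<in> F" "j < J" "z \<in> D (x, j)"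
    have "real j * s \<le> (1 / \<rho> + 1) * s" using * J K \<rho> by (intro mult_right_mono) (auto simp: s_def)
    also have "\<dots> = 2 * (1 + K) + 2 * (1 + K) * \<rho>" using \<rho> by (simp add: s_def field_simps)
    also have "\<dots> \<le> 2 * (1 + K) + 2 * (1 + K) * 1" using \<rho> K by (intro add_left_mono mult_left_mono) auto
    finally have js: "real j * s \<le> 4 * (1 + K)" by simp
    have "dist p z \<le> dist p x + dist x z" by (rule dist_triangle)
    also have "dist x z \<le> dist x (x + (real j * s) *\<^sub>R e) + dist (x + (real j * s) *\<^sub>R e) z" by (rule dist_triangle)
    also have "dist x (x + (real j * s) *\<^sub>R e) = real j * s" using e K \<rho> by (simp add: dist_norm s_def)
    finally have "dist p z \<le> dist p x + (real j * s + dist (x + (real j * s) *\<^sub>R e) z)" by simp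
    moreover have "dist p x < r" using * F A(1) by auto
    moreover have "dist (x + (real j * s) *\<^sub>R e) z < 1" using * \<rho> by (auto simp: D_def)
    ultimately show "z \<in> ball p R" using js unfolding R_def mem_ball by argo
  qed
  have "(\<Sum>i\<in>F \<times> {..<J}. measure lborel (D i)) = measure lborel (\<Union>i\<in>F \<times> {..<J}. D i)"
    using F(1) disj
    by (intro measure_finite_Union[symmetric]) (use emeasure_bounded_finite[OF bounded_ball] in \<open>auto simp: D_def infinity_ennreal_def less_top\<close>)
  also have "\<dots> \<le> measure lborel (ball p R)"
    using sub F(1) by (intro measure_mono_fmeasurable)
      (use emeasure_bounded_finite[OF bounded_ball] in \<open>auto simp: D_def infinity_ennreal_def intro!: fmeasurableI\<close>)
  also have "\<dots> = unit_ball_vol (real DIM('a)) * R ^ DIM('a)"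
    using K by (intro content_ball) (auto simp: R_def)
  also have "(\<Sum>i\<in>F \<times> {..<J}. measure lborel (D i)) = (\<Sum>i\<in>F \<times> {..<J}. unit_ball_vol (real DIM('a)) * (\<rho> / 2) ^ DIM('a))"
    using \<rho> by (intro sum.cong) (auto simp: D_def content_ball)
  also have "\<dots> = unit_ball_vol (real DIM('a)) * (real (card F) * real J * (\<rho> / 2) ^ DIM('a))"
    by (simp add: card_cartesian_product)
  finally have le: "real (card F) * real J * (\<rho> / 2) ^ DIM('a) \<le> R ^ DIM('a)"
    by (simp add: unit_ball_vol_pos)
  have "real (card F) * \<rho> ^ (DIM('a) - 1) = 2 ^ DIM('a) * (real (card F) * (1 / \<rho>) * (\<rho> / 2) ^ DIM('a))"
    using \<rho> power_minus_mult[of "DIM('a)" \<rho>] by (simp add: power_divide field_simps)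
  also have "\<dots> \<le> 2 ^ DIM('a) * (real (card F) * real J * (\<rho> / 2) ^ DIM('a))"
    using J \<rho> by (intro mult_left_mono mult_right_mono) auto
  also have "\<dots> \<le> 2 ^ DIM('a) * R ^ DIM('a)" using le by simp
  also have "\<dots> = (2 * R) ^ DIM('a)" by (rule power_mult_distrib[symmetric])
  finally show ?thesis unfolding R_def .
qed

text \<open>
  The balls of radius \<open>\<rho>\<close> around a separated subset of maximal cardinality cover \<open>A\<close>, and the packing
  bound is exactly what makes the sum of the powers of their radii independent of \<open>\<rho>\<close>.
\<close>

lemma hausdorff_outer_graph_finite:
  fixes \<gamma> :: "'a::euclidean_space \<Rightarrow> real" and p e :: 'a
  assumes d: "DIM('a) \<ge> 2"
    and \<gamma>: "K-lipschitz_on UNIV \<gamma>" "\<And>x t. \<gamma> (x + t *\<^sub>R e) = \<gamma> x" and e: "norm e = 1"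
    and A: "A \<subseteq> ball p r" "\<And>x. x \<in> A \<Longrightarrow> \<gamma> x = x \<bullet> e"
  shows "hausdorff_outer (DIM('a) - 1) A < \<infinity>"
proof -
  let ?s = "DIM('a) - 1"
  define C0 where "C0 = (2 * (\<bar>r\<bar> + 4 * (1 + K) + 1)) ^ DIM('a)"
  have small: "hausdorff_pre ?s \<delta> A \<le> ennreal (unit_ball_vol (real ?s) * C0)" if \<delta>: "0 < \<delta>" "\<delta> \<le> 2" for \<delta>
  proof -
    define \<rho> where "\<rho> = \<delta> / 2"
    have \<rho>: "0 < \<rho>" "\<rho> \<le> 1" using \<delta> by (auto simp: \<rho>_def)
    define sep where "sep F \<longleftrightarrow> finite F \<and> F \<subseteq> A \<and> (\<forall>x\<in>F. \<forall>y\<in>F. x \<noteq> y \<longrightarrow> \<rho> \<le> dist x y)" for F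
    have bound: "real (card F) * \<rho> ^ ?s \<le> C0" if "sep F" for F
      unfolding C0_def
      by (rule separated_subset_of_graph_card_bound[OF \<gamma> e A \<rho>]) (use that in \<open>auto simp: sep_def\<close>)
    have "card F \<le> nat \<lfloor>C0 / \<rho> ^ ?s\<rfloor>" if "sep F" for F
      using bound[OF that] \<rho> by (simp add: le_nat_floor field_simps)
    moreover have "sep {}" by (simp add: sep_def)
    ultimately have "\<exists>F. sep F \<and> (\<forall>G. sep G \<longrightarrow> card G \<le> card F)"
      by (intro ex_has_greatest_nat[of sep "{}" card "Suc (nat \<lfloor>C0 / \<rho> ^ ?s\<rfloor>)"]) (auto simp: less_Suc_eq_le)
    then obtain F where F: "sep F" "\<And>G. sep G \<Longrightarrow> card G \<le> card F" by blast
    have cov: "A \<subseteq> (\<Union>x\<in>F. cball x \<rho>)"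
    proof (rule ccontr)
      assume "\<not> ?thesis"
      then obtain a where a: "a \<in> A" "\<And>x. x \<in> F \<Longrightarrow> \<rho> < dist x a" by force
      have "a \<notin> F" using a(2)[of a] \<rho> by auto
      have "sep (insert a F)"
        using F(1) a unfolding sep_def by (auto simp: dist_commute intro: less_imp_le)
      then have "card (insert a F) \<le> card F" by (rule F(2))
      then show False using F(1) \<open>a \<notin> F\<close> by (simp add: sep_def)
    qed
    obtain f where f: "F = f ` {..<card F}"
      using F(1) ex_bij_betw_nat_finite[of F] by (auto simp: sep_def bij_betw_def atLeast0LessThan)
    define C where "C i = (if i < card F then cball (f i) \<rho> else {})" for i
    have "hausdorff_pre ?s \<delta> A \<le> (\<Sum>i. ennreal (unit_ball_vol (real ?s) * (diameter (C i) / 2) ^ ?s))"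
      unfolding hausdorff_pre_def
    proof (rule INF_lower, intro CollectI conjI allI)
      show "A \<subseteq> (\<Union>i. C i)"
      proof
        fix a assume "a \<in> A"
        then obtain x where x: "x \<in> F" "a \<in> cball x \<rho>" using cov by blast
        then obtain i where "i < card F" "x = f i" using f by blast
        then have "a \<in> C i" using x by (simp add: C_def)
        then show "a \<in> (\<Union>i. C i)" by blast
      qed
      show "bounded (C i)" "diameter (C i) \<le> \<delta>" for i
        using \<rho> \<delta> by (auto simp: C_def \<rho>_def)
    qed
    also have "\<dots> = (\<Sum>i<card F. ennreal (unit_ball_vol (real ?s) * (diameter (C i) / 2) ^ ?s))"
      using d by (intro suminf_finite) (auto simp: C_def power_0_left)
    also have "\<dots> = (\<Sum>i<card F. ennreal (unit_ball_vol (real ?s) * \<rho> ^ ?s))"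
      using \<rho> by (intro sum.cong) (auto simp: C_def)
    also have "\<dots> = ennreal (\<Sum>i<card F. unit_ball_vol (real ?s) * \<rho> ^ ?s)"
      using \<rho> by (intro sum_ennreal) (auto intro!: mult_nonneg_nonneg)
    also have "\<dots> = ennreal (unit_ball_vol (real ?s) * (real (card F) * \<rho> ^ ?s))" by (simp add: mult_ac)
    also have "\<dots> \<le> ennreal (unit_ball_vol (real ?s) * C0)"
      using bound[OF F(1)] by (intro ennreal_leI mult_left_mono) auto
    finally show ?thesis .
  qed
  have "hausdorff_outer ?s A \<le> ennreal (unit_ball_vol (real ?s) * C0)"
    unfolding hausdorff_outer_def
  proof (rule SUP_least)
    fix \<delta> :: real assume "\<delta> \<in> {0<..}"
    then show "hausdorff_pre ?s \<delta> A \<le> ennreal (unit_ball_vol (real ?s) * C0)"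
      using small[of "min \<delta> 2"] hausdorff_pre_antimono[of "min \<delta> 2" \<delta> ?s A] by (auto intro: order_trans)
  qed
  also have "\<dots> < \<infinity>" by simp
  finally show ?thesis .
qed

lemma hausdorff_outer_frontier_finite:
  fixes \<Omega> :: "'a::euclidean_space set"
  assumes d: "DIM('a) \<ge> 2" and lip: "lipschitz_domain \<Omega>" and bd: "bounded \<Omega>"
  shows "hausdorff_outer (DIM('a) - 1) (frontier \<Omega>) < \<infinity>"
proof -
  let ?H = "hausdorff_outer (DIM('a) - 1) :: 'a set \<Rightarrow> ennreal"
  have op: "open \<Omega>" using lip by (simp add: lipschitz_domain_def)
  have "\<exists>V. open V \<and> p \<in> V \<and> ?H (frontier \<Omega> \<inter> V) < \<infinity>" if p: "p \<in> frontier \<Omega>" for p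
  proof -
    obtain U e \<gamma> K where U: "open U" "p \<in> U" and e: "norm e = 1" and \<gamma>: "K-lipschitz_on UNIV \<gamma>"
      "\<And>x t. \<gamma> (x + t *\<^sub>R e) = \<gamma> x" and eq: "\<Omega> \<inter> U = {x \<in> U. \<gamma> x < x \<bullet> e}"
      using lip p unfolding lipschitz_domain_def by meson
    have graph: "\<gamma> x = x \<bullet> e" if x: "x \<in> frontier \<Omega>" "x \<in> U" for x
    proof (rule ccontr)
      assume ne: "\<gamma> x \<noteq> x \<bullet> e"
      have "x \<notin> \<Omega>" using x(1) op by (simp add: frontier_def interior_open)
      then have gt: "x \<bullet> e < \<gamma> x" using eq x(2) ne by force
      have "continuous_on UNIV \<gamma>" using \<gamma>(1) by (rule lipschitz_on_continuous_on)
      then have "open {y. y \<bullet> e < \<gamma> y}" by (intro open_Collect_less continuous_intros)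
      then have "open (U \<inter> {y. y \<bullet> e < \<gamma> y})" using U by auto
      moreover have "x \<in> U \<inter> {y. y \<bullet> e < \<gamma> y}" using x gt by simp
      moreover have "(U \<inter> {y. y \<bullet> e < \<gamma> y}) \<inter> \<Omega> = {}"
      proof (rule equals0I)
        fix y assume y: "y \<in> (U \<inter> {y. y \<bullet> e < \<gamma> y}) \<inter> \<Omega>"
        then have "y \<in> {x \<in> U. \<gamma> x < x \<bullet> e}" unfolding eq[symmetric] by blast
        then show False using y by simp
      qed
      ultimately have "x \<notin> closure \<Omega>" by (meson disjoint_iff open_Int_closure_eq_empty)
      then show False using x(1) by (simp add: frontier_def)
    qed
    have "?H (frontier \<Omega> \<inter> (U \<inter> ball p 1)) < \<infinity>"
      by (rule hausdorff_outer_graph_finite[OF d \<gamma> e, of _ p 1]) (use graph in auto)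
    then show ?thesis using U by (intro exI[of _ "U \<inter> ball p 1"]) auto
  qed
  then obtain V where V: "\<And>p. p \<in> frontier \<Omega> \<Longrightarrow> open (V p) \<and> p \<in> V p \<and> ?H (frontier \<Omega> \<inter> V p) < \<infinity>" by metis
  have "compact (frontier \<Omega>)" using bd by (rule compact_frontier_bounded)
  then obtain P where P: "P \<subseteq> frontier \<Omega>" "finite P" "frontier \<Omega> \<subseteq> (\<Union>p\<in>P. V p)"
    by (rule compactE_image[of _ "frontier \<Omega>" V]) (use V in auto)
  have "?H (frontier \<Omega> \<inter> (\<Union>p\<in>P. V p)) < \<infinity>"
    using P(2,1)
  proof (induction rule: finite_induct)
    case empty
    show ?case using d by (simp add: hausdorff_outer_empty)
  next
    case (insert p P)
    have "?H (frontier \<Omega> \<inter> (\<Union>p\<in>insert p P. V p)) = ?H ((frontier \<Omega> \<inter> V p) \<union> (frontier \<Omega> \<inter> (\<Union>p\<in>P. V p)))"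
      by (rule arg_cong[where f = ?H]) auto
    also have "\<dots> \<le> ?H (frontier \<Omega> \<inter> V p) + ?H (frontier \<Omega> \<inter> (\<Union>p\<in>P. V p))"
      using d by (intro hausdorff_outer_Un) auto
    also have "\<dots> < \<infinity>" using insert V[of p] by (simp add: ennreal_add_less_top)
    finally show ?case .
  qed
  moreover have "frontier \<Omega> \<inter> (\<Union>p\<in>P. V p) = frontier \<Omega>" using P by auto
  ultimately show ?thesis by simp
qed

lemma finite_surface_measure:
  fixes \<Omega> :: "'a::euclidean_space set"
  assumes "DIM('a) \<ge> 2" "lipschitz_domain \<Omega>" "bounded \<Omega>"
  shows "finite_measure (surface_measure \<Omega>)"
proof
  have f: "frontier \<Omega> \<in> sets borel" by simp
  have "emeasure (surface_measure \<Omega>) (space (surface_measure \<Omega>)) = hausdorff_outer (DIM('a) - 1) (frontier \<Omega>)"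
    using assms(1) f
    by (simp add: surface_measure_def space_restrict_space emeasure_restrict_space emeasure_hausdorff_measure)
  then show "emeasure (surface_measure \<Omega>) (space (surface_measure \<Omega>)) \<noteq> \<infinity>"
    using hausdorff_outer_frontier_finite[OF assms] by simp
qed

lemma smooth_L2_surface:
  fixes \<Omega> :: "'a::euclidean_space set"
  assumes "DIM('a) \<ge> 2" "lipschitz_domain \<Omega>" "bounded \<Omega>" "smooth \<psi>"
  shows "\<psi> \<in> L2 (surface_measure \<Omega>)"
proof -
  have "bounded (\<psi> ` frontier \<Omega>)"
    using compact_continuous_image[OF smooth_continuous[OF assms(4)] compact_frontier_bounded[OF assms(3)]]
    by (rule compact_imp_bounded)
  then obtain C where C: "\<And>x. x \<in> frontier \<Omega> \<Longrightarrow> cmod (\<psi> x) \<le> C" unfolding bounded_iff by auto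
  have "\<psi> \<in> borel_measurable (hausdorff_measure (DIM('a) - 1))"
    using smooth_measurable[OF assms(4)] by (simp cong: measurable_cong_sets)
  then have "\<psi> \<in> borel_measurable (surface_measure \<Omega>)"
    unfolding surface_measure_def by (rule measurable_restrict_space1)
  then show ?thesis
    by (rule L2_bounded[OF finite_surface_measure[OF assms(1-3)], of _ C])
       (use C in \<open>auto intro!: AE_I2 simp: surface_measure_def space_restrict_space\<close>)
qed

section \<open>The Schroedinger form\<close>

context bounded_open
begin

definition bounded_potential :: "('a \<Rightarrow> complex) \<Rightarrow> real \<Rightarrow> bool" where
  "bounded_potential q R \<longleftrightarrow> q \<in> borel_measurable M \<and> 0 \<le> R \<and> (AE x in M. cmod (q x) \<le> R)"

definition dirichlet_form :: "('a \<Rightarrow> complex) \<Rightarrow> ('a \<Rightarrow> complex) \<Rightarrow> complex" where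
  "dirichlet_form u v = (\<Sum>b\<in>Basis. LINT x|M. wd b u x * wd b v x)"

abbreviation form :: "('a \<Rightarrow> complex) \<Rightarrow> ('a \<Rightarrow> complex) \<Rightarrow> ('a \<Rightarrow> complex) \<Rightarrow> complex" where
  "form q u v \<equiv> schroedinger_form \<Omega> q u v"

lemma potential_mult_L2: "bounded_potential q R \<Longrightarrow> u \<in> L2 M \<Longrightarrow> (\<lambda>x. q x * u x) \<in> L2 M"
  unfolding bounded_potential_def using L2_mult_bounded by blast

lemma L2_norm_potential_mult: "bounded_potential q R \<Longrightarrow> u \<in> L2 M \<Longrightarrow> L2_norm M (\<lambda>x. q x * u x) \<le> R * L2_norm M u"
  unfolding bounded_potential_def using L2_norm_mult_bounded by blast

lemma form_eq:
  assumes q: "bounded_potential q R" and u: "u \<in> H1 \<Omega>" and v: "v \<in> H1 \<Omega>"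
  shows "form q u v = dirichlet_form u v + (LINT x|M. q x * u x * v x)"
proof -
  have "integrable M (\<lambda>x. wd b u x * wd b v x)" if "b \<in> Basis" for b
    using that by (intro L2_integrable_mult wd_works u v)
  moreover have "integrable M (\<lambda>x. q x * u x * v x)"
    by (intro L2_integrable_mult potential_mult_L2[OF q] H1_L2 u v)
  ultimately show ?thesis unfolding schroedinger_form_def dirichlet_form_def
    by (simp add: Bochner_Integration.integral_sum)
qed

lemma integral_mult_cong_AE:
  assumes "AE x in M. f x = f' x" "f \<in> L2 M" "f' \<in> L2 M" "g \<in> L2 M"
  shows "(LINT x|M. f x * g x) = (LINT x|M. f' x * g x)"
  by (rule integral_cong_AE) (use assms in \<open>auto dest!: L2_measurable\<close>)

lemma dirichlet_form_commute: "dirichlet_form u v = dirichlet_form v u"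
  unfolding dirichlet_form_def by (simp add: mult.commute)

lemma dirichlet_form_add:
  assumes "u \<in> H1 \<Omega>" "v \<in> H1 \<Omega>" "w \<in> H1 \<Omega>"
  shows "dirichlet_form (\<lambda>x. u x + v x) w = dirichlet_form u w + dirichlet_form v w"
proof -
  have "(LINT x|M. wd b (\<lambda>x. u x + v x) x * wd b w x) = (LINT x|M. wd b u x * wd b w x) + (LINT x|M. wd b v x * wd b w x)"
    if b: "b \<in> Basis" for b
  proof -
    have "(LINT x|M. wd b (\<lambda>x. u x + v x) x * wd b w x) = (LINT x|M. (wd b u x + wd b v x) * wd b w x)"
      by (intro integral_mult_cong_AE wd_add assms b wd_works H1_add L2_add)
    then show ?thesis by (simp add: distrib_right L2_integrable_mult wd_works assms b)
  qed
  then show ?thesis unfolding dirichlet_form_def by (simp add: sum.distrib)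
qed

lemma dirichlet_form_cmult:
  assumes "u \<in> H1 \<Omega>" "w \<in> H1 \<Omega>"
  shows "dirichlet_form (\<lambda>x. c * u x) w = c * dirichlet_form u w"
proof -
  have "(LINT x|M. wd b (\<lambda>x. c * u x) x * wd b w x) = c * (LINT x|M. wd b u x * wd b w x)"
    if b: "b \<in> Basis" for b
  proof -
    have "(LINT x|M. wd b (\<lambda>x. c * u x) x * wd b w x) = (LINT x|M. (c * wd b u x) * wd b w x)"
      by (intro integral_mult_cong_AE wd_cmult assms b wd_works H1_cmult L2_cmult)
    then show ?thesis by (simp add: mult.assoc)
  qed
  then show ?thesis unfolding dirichlet_form_def by (simp add: sum_distrib_left)
qed

lemma dirichlet_form_bound:
  assumes "u \<in> H1 \<Omega>" "v \<in> H1 \<Omega>"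
  shows "cmod (dirichlet_form u v) \<le> real DIM('a) * (H1_norm \<Omega> u * H1_norm \<Omega> v)"
proof -
  have "cmod (dirichlet_form u v) \<le> (\<Sum>b\<in>(Basis::'a set). H1_norm \<Omega> u * H1_norm \<Omega> v)"
    unfolding dirichlet_form_def
  proof (rule sum_norm_le)
    fix b :: 'a assume b: "b \<in> Basis"
    have "cmod (LINT x|M. wd b u x * wd b v x) \<le> L2_norm M (wd b u) * L2_norm M (wd b v)"
      by (intro L2_cauchy_schwarz finite_M wd_works assms b)
    also have "\<dots> \<le> H1_norm \<Omega> u * H1_norm \<Omega> v" by (intro mult_mono L2_norm_wd_le_H1_norm b) auto
    finally show "cmod (LINT x|M. wd b u x * wd b v x) \<le> H1_norm \<Omega> u * H1_norm \<Omega> v" .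
  qed
  then show ?thesis by simp
qed

lemma dirichlet_form_smooth:
  assumes u: "u \<in> H1 \<Omega>" and \<psi>: "smooth \<psi>"
  shows "dirichlet_form u \<psi> = (\<Sum>b\<in>Basis. LINT x|M. wd b u x * pd b \<psi> x)"
  unfolding dirichlet_form_def
proof (rule sum.cong[OF refl])
  fix b :: 'a assume b: "b \<in> Basis"
  have "(LINT x|M. wd b \<psi> x * wd b u x) = (LINT x|M. pd b \<psi> x * wd b u x)"
    by (intro integral_mult_cong_AE wd_smooth wd_works smooth_H1 smooth_L2 smooth_pd u \<psi> b)
  then show "(LINT x|M. wd b u x * wd b \<psi> x) = (LINT x|M. wd b u x * pd b \<psi> x)" by (simp add: mult.commute)
qed

context
  fixes q R
  assumes q: "bounded_potential q R"
begin

lemma form_commute: "u \<in> H1 \<Omega> \<Longrightarrow> v \<in> H1 \<Omega> \<Longrightarrow> form q u v = form q v u"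
  by (simp add: form_eq[OF q] dirichlet_form_commute[of u v] mult_ac)

lemma form_add:
  assumes "u \<in> H1 \<Omega>" "v \<in> H1 \<Omega>" "w \<in> H1 \<Omega>"
  shows "form q (\<lambda>x. u x + v x) w = form q u w + form q v w"
proof -
  have i: "integrable M (\<lambda>x. q x * f x * w x)" if "f \<in> H1 \<Omega>" for f
    by (intro L2_integrable_mult potential_mult_L2[OF q] H1_L2 that assms(3))
  have "(LINT x|M. q x * (u x + v x) * w x) = (LINT x|M. q x * u x * w x) + (LINT x|M. q x * v x * w x)"
    using i[OF assms(1)] i[OF assms(2)] by (simp add: distrib_left distrib_right)
  then show ?thesis using assms by (simp add: form_eq[OF q] H1_add dirichlet_form_add)
qed

lemma form_cmult:
  assumes "u \<in> H1 \<Omega>" "w \<in> H1 \<Omega>"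
  shows "form q (\<lambda>x. c * u x) w = c * form q u w"
proof -
  have "(LINT x|M. q x * (c * u x) * w x) = (LINT x|M. c * (q x * u x * w x))"
    by (simp add: mult_ac)
  then show ?thesis using assms by (simp add: form_eq[OF q] H1_cmult dirichlet_form_cmult distrib_left)
qed

lemma form_diff:
  assumes "u \<in> H1 \<Omega>" "v \<in> H1 \<Omega>" "w \<in> H1 \<Omega>"
  shows "form q (\<lambda>x. u x - v x) w = form q u w - form q v w"
  using form_add[OF assms(1) H1_cmult[OF assms(2), of "-1"] assms(3)] form_cmult[OF assms(2,3), of "-1"] by simp

lemma form_add_right:
  assumes "u \<in> H1 \<Omega>" "v \<in> H1 \<Omega>" "w \<in> H1 \<Omega>"
  shows "form q w (\<lambda>x. u x + v x) = form q w u + form q w v"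
  using form_add[OF assms] form_commute assms H1_add by simp

lemma form_cmult_right:
  assumes "u \<in> H1 \<Omega>" "w \<in> H1 \<Omega>"
  shows "form q w (\<lambda>x. c * u x) = c * form q w u"
  using form_cmult[OF assms] form_commute assms H1_cmult by simp

lemma form_diff_right:
  assumes "u \<in> H1 \<Omega>" "v \<in> H1 \<Omega>" "w \<in> H1 \<Omega>"
  shows "form q w (\<lambda>x. u x - v x) = form q w u - form q w v"
  using form_diff[OF assms] form_commute assms H1_diff by simp

lemma form_bound:
  assumes "u \<in> H1 \<Omega>" "v \<in> H1 \<Omega>"
  shows "cmod (form q u v) \<le> (real DIM('a) + R) * H1_norm \<Omega> u * H1_norm \<Omega> v"
proof -
  have "cmod (LINT x|M. q x * u x * v x) \<le> L2_norm M (\<lambda>x. q x * u x) * L2_norm M v"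
    by (intro L2_cauchy_schwarz finite_M potential_mult_L2[OF q] H1_L2 assms)
  also have "\<dots> \<le> (R * H1_norm \<Omega> u) * H1_norm \<Omega> v"
  proof (intro mult_mono)
    show "L2_norm M (\<lambda>x. q x * u x) \<le> R * H1_norm \<Omega> u"
      using L2_norm_potential_mult[OF q H1_L2[OF assms(1)]] mult_left_mono[OF L2_norm_le_H1_norm, of R u] q
      unfolding bounded_potential_def by linarith
  qed (use q in \<open>auto simp: L2_norm_le_H1_norm bounded_potential_def\<close>)
  finally have "cmod (LINT x|M. q x * u x * v x) \<le> R * H1_norm \<Omega> u * H1_norm \<Omega> v" .
  then show ?thesis
    using dirichlet_form_bound[OF assms] norm_triangle_ineq[of "dirichlet_form u v" "LINT x|M. q x * u x * v x"]
    unfolding form_eq[OF q assms] by (simp add: algebra_simps)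
qed

end

lemma H10_H1: "u \<in> H10 \<Longrightarrow> u \<in> H1 \<Omega>"
  by (simp add: H10_def)

lemma test_fun_H10: "test_fun \<Omega> \<phi> \<Longrightarrow> \<phi> \<in> H10"
proof -
  assume \<phi>: "test_fun \<Omega> \<phi>"
  interpret H: hilbert_on "H1 \<Omega>" H1_ip by (rule hilbert_on_H1)
  have "H1_norm \<Omega> (\<lambda>x. \<phi> x - \<phi> x) = 0"
    using H1_norm_eq[OF H.V_0] H.ip_scale[OF H.V_0 H.V_0, of 0] by (simp add: zero_fun_def)
  then show ?thesis using \<phi> smooth_H1[OF test_fun_smooth[OF \<phi>]] by (auto simp: H10_def)
qed

text \<open>
  Used for quantities \<open>a\<close> that depend linearly and continuously on \<open>u\<close> and vanish on test functions.
\<close>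

lemma zero_by_density:
  assumes u: "u \<in> H10" and "\<And>\<phi>. test_fun \<Omega> \<phi> \<Longrightarrow> cmod a \<le> C * H1_norm \<Omega> (\<lambda>x. \<phi> x - u x)"
  shows "a = 0"
proof -
  have "cmod a \<le> 0 + e" if "e > 0" for e
  proof -
    have "e / (\<bar>C\<bar> + 1) > 0" using that by (simp add: add_nonneg_pos)
    then obtain \<phi> where \<phi>: "test_fun \<Omega> \<phi>" "H1_norm \<Omega> (\<lambda>x. \<phi> x - u x) < e / (\<bar>C\<bar> + 1)"
      using u by (auto simp: H10_def)
    have "cmod a \<le> C * H1_norm \<Omega> (\<lambda>x. \<phi> x - u x)" by (rule assms(2)[OF \<phi>(1)])
    also have "\<dots> \<le> (\<bar>C\<bar> + 1) * H1_norm \<Omega> (\<lambda>x. \<phi> x - u x)" by (intro mult_right_mono) auto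
    also have "\<dots> \<le> (\<bar>C\<bar> + 1) * (e / (\<bar>C\<bar> + 1))" using \<phi>(2) by (intro mult_left_mono) auto
    also have "\<dots> = e" by (simp add: add_nonneg_pos order_less_imp_not_eq2)
    finally show ?thesis by simp
  qed
  then have "cmod a \<le> 0" by (rule field_le_epsilon)
  then show ?thesis by simp
qed

lemma form_zero_on_H10:
  assumes q: "bounded_potential q R" and u: "u \<in> H1 \<Omega>" and v: "v \<in> H10"
    and 0: "\<And>\<phi>. test_fun \<Omega> \<phi> \<Longrightarrow> form q u \<phi> = 0"
  shows "form q u v = 0"
proof (rule zero_by_density[OF v])
  fix \<phi> assume \<phi>: "test_fun \<Omega> \<phi>"
  have H: "\<phi> \<in> H1 \<Omega>" "v \<in> H1 \<Omega>" using smooth_H1[OF test_fun_smooth[OF \<phi>]] H10_H1[OF v] by auto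
  have "cmod (form q u v) = cmod (form q u (\<lambda>x. \<phi> x - v x))"
    using 0[OF \<phi>] by (simp add: form_diff_right[OF q H u])
  also have "\<dots> \<le> ((real DIM('a) + R) * H1_norm \<Omega> u) * H1_norm \<Omega> (\<lambda>x. \<phi> x - v x)"
    by (rule form_bound[OF q u H1_diff[OF H]])
  finally show "cmod (form q u v) \<le> ((real DIM('a) + R) * H1_norm \<Omega> u) * H1_norm \<Omega> (\<lambda>x. \<phi> x - v x)" .
qed

text \<open>
  The function \<open>\<psi>\<close> need not vanish on the boundary: this is how elements of \<open>H10\<close>, extended by zero, satisfy
  equations in the whole space.
\<close>

lemma integration_by_parts_H10:
  assumes z: "z \<in> H10" and \<psi>: "smooth \<psi>" and b: "b \<in> Basis"
  shows "(LINT x|M. wd b z x * \<psi> x) = - (LINT x|M. z x * pd b \<psi> x)"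
proof -
  have zH: "z \<in> H1 \<Omega>" by (rule H10_H1[OF z])
  have p2: "pd b \<psi> \<in> L2 M" "\<psi> \<in> L2 M" by (intro smooth_L2 smooth_pd \<psi> b)+
  have "(LINT x|M. wd b z x * \<psi> x) + (LINT x|M. z x * pd b \<psi> x) = 0"
  proof (rule zero_by_density[OF z])
    fix \<phi> assume \<phi>: "test_fun \<Omega> \<phi>"
    have s: "smooth \<phi>" by (rule test_fun_smooth[OF \<phi>])
    have H: "\<phi> \<in> H1 \<Omega>" using smooth_H1[OF s] .
    let ?w = "\<lambda>x. \<phi> x - z x"
    have wH: "?w \<in> H1 \<Omega>" by (rule H1_diff[OF H zH])
    have "(LINT x|M. wd b \<phi> x * \<psi> x) = (LINT x|M. pd b \<phi> x * \<psi> x)"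
      by (intro integral_mult_cong_AE wd_smooth s b wd_works H p2 test_fun_pd_L2[OF \<phi>])
    also have "\<dots> = - (LINT x|M. \<phi> x * pd b \<psi> x)"
      using integration_by_parts_smooth[OF \<phi> \<psi> b] by (simp add: mult.commute)
    finally have 1: "(LINT x|M. wd b \<phi> x * \<psi> x) + (LINT x|M. \<phi> x * pd b \<psi> x) = 0" by simp
    have "(LINT x|M. wd b ?w x * \<psi> x) = (LINT x|M. (wd b \<phi> x - wd b z x) * \<psi> x)"
      by (intro integral_mult_cong_AE wd_diff H zH b wd_works wH p2 L2_diff)
    also have "\<dots> = (LINT x|M. wd b \<phi> x * \<psi> x) - (LINT x|M. wd b z x * \<psi> x)"
      by (simp add: left_diff_distrib L2_integrable_mult wd_works H zH b p2)
    finally have 2: "(LINT x|M. wd b ?w x * \<psi> x) = (LINT x|M. wd b \<phi> x * \<psi> x) - (LINT x|M. wd b z x * \<psi> x)" .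
    have 3: "(LINT x|M. ?w x * pd b \<psi> x) = (LINT x|M. \<phi> x * pd b \<psi> x) - (LINT x|M. z x * pd b \<psi> x)"
      by (simp add: left_diff_distrib L2_integrable_mult H1_L2 H zH p2)
    have "cmod ((LINT x|M. wd b z x * \<psi> x) + (LINT x|M. z x * pd b \<psi> x))
      = cmod ((LINT x|M. wd b ?w x * \<psi> x) + (LINT x|M. ?w x * pd b \<psi> x))"
    proof -
      have "(LINT x|M. wd b ?w x * \<psi> x) + (LINT x|M. ?w x * pd b \<psi> x)
        = - ((LINT x|M. wd b z x * \<psi> x) + (LINT x|M. z x * pd b \<psi> x))"
        unfolding 2 3 using 1 by (simp add: algebra_simps eq_neg_iff_add_eq_0)
      then show ?thesis by (simp only: norm_minus_cancel)
    qed
    also have "\<dots> \<le> L2_norm M (wd b ?w) * L2_norm M \<psi> + L2_norm M ?w * L2_norm M (pd b \<psi>)"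
      by (intro norm_triangle_le add_mono L2_cauchy_schwarz finite_M wd_works wH b p2 H1_L2)
    also have "\<dots> \<le> H1_norm \<Omega> ?w * L2_norm M \<psi> + H1_norm \<Omega> ?w * L2_norm M (pd b \<psi>)"
      by (intro add_mono mult_right_mono L2_norm_wd_le_H1_norm L2_norm_le_H1_norm b) auto
    finally show "cmod ((LINT x|M. wd b z x * \<psi> x) + (LINT x|M. z x * pd b \<psi> x))
      \<le> (L2_norm M \<psi> + L2_norm M (pd b \<psi>)) * H1_norm \<Omega> ?w" by (simp add: algebra_simps)
  qed
  then show ?thesis by (simp add: eq_neg_iff_add_eq_0)
qed

lemma H10_add: "u \<in> H10 \<Longrightarrow> v \<in> H10 \<Longrightarrow> (\<lambda>x. u x + v x) \<in> H10"
  using subspace_add[OF hilbert_on.V[OF hilbert_on_H10]] by (simp add: plus_fun_def)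

lemma H1_norm_cmult: assumes "u \<in> H1 \<Omega>" shows "H1_norm \<Omega> (\<lambda>x. c * u x) = cmod c * H1_norm \<Omega> u"
proof -
  have "L2_norm M (wd b (\<lambda>x. c * u x)) = cmod c * L2_norm M (wd b u)" if b: "b \<in> Basis" for b
  proof -
    have "L2_norm M (wd b (\<lambda>x. c * u x)) = L2_norm M (\<lambda>x. c * wd b u x)"
      using wd_cmult[OF assms b, of c] L2_measurable[OF wd_works(1)[OF H1_cmult[OF assms] b]] L2_measurable[OF wd_works(1)[OF assms b]]
      by (intro L2_norm_cong_AE) auto
    then show ?thesis by (simp add: L2_norm_cmult)
  qed
  then have "(H1_norm \<Omega> (\<lambda>x. c * u x))\<^sup>2 = (cmod c * H1_norm \<Omega> u)\<^sup>2"
    by (simp add: H1_norm_square power_mult_distrib L2_norm_cmult distrib_left sum_distrib_left)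
  then show ?thesis by (simp add: power2_eq_iff_nonneg)
qed

lemma H1_norm_cnj: assumes "u \<in> H1 \<Omega>" shows "H1_norm \<Omega> (\<lambda>x. cnj (u x)) = H1_norm \<Omega> u"
proof -
  have "L2_norm M (wd b (\<lambda>x. cnj (u x))) = L2_norm M (wd b u)" if b: "b \<in> Basis" for b
    using wd_cnj[OF assms b] L2_measurable[OF wd_works(1)[OF H1_cnj[OF assms] b]] L2_measurable[OF wd_works(1)[OF assms b]]
    by (intro L2_norm_cong_AE) auto
  moreover have "L2_norm M (\<lambda>x. cnj (u x)) = L2_norm M u" by (simp add: L2_norm_def)
  ultimately have "(H1_norm \<Omega> (\<lambda>x. cnj (u x)))\<^sup>2 = (H1_norm \<Omega> u)\<^sup>2"
    by (simp add: H1_norm_square)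
  then show ?thesis by (simp add: power2_eq_iff_nonneg)
qed

lemma H10_cmult: assumes u: "u \<in> H10" shows "(\<lambda>x. c * u x) \<in> H10"
  unfolding H10_def
proof (intro CollectI conjI allI impI)
  show "(\<lambda>x. c * u x) \<in> H1 \<Omega>" by (rule H1_cmult[OF H10_H1[OF u]])
  fix e :: real assume "e > 0"
  then have "e / (cmod c + 1) > 0" by (simp add: add_nonneg_pos)
  then obtain \<phi> where \<phi>: "test_fun \<Omega> \<phi>" "H1_norm \<Omega> (\<lambda>x. \<phi> x - u x) < e / (cmod c + 1)"
    using u by (auto simp: H10_def)
  have H: "(\<lambda>x. \<phi> x - u x) \<in> H1 \<Omega>" by (intro H1_diff H10_H1 u test_fun_H10[OF \<phi>(1)])
  have "H1_norm \<Omega> (\<lambda>x. c * \<phi> x - c * u x) = cmod c * H1_norm \<Omega> (\<lambda>x. \<phi> x - u x)"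
    using H1_norm_cmult[OF H, of c] by (simp add: right_diff_distrib)
  also have "\<dots> \<le> (cmod c + 1) * H1_norm \<Omega> (\<lambda>x. \<phi> x - u x)" by (intro mult_right_mono) auto
  also have "\<dots> < e"
  proof -
    have "0 < cmod c + 1" by (simp add: add_nonneg_pos)
    from \<phi>(2)[unfolded pos_less_divide_eq[OF this]] show ?thesis by (simp only: mult.commute)
  qed
  finally show "\<exists>\<phi>. test_fun \<Omega> \<phi> \<and> H1_norm \<Omega> (\<lambda>x. \<phi> x - c * u x) < e"
    using test_fun_cmult[OF \<phi>(1)] by (intro exI[of _ "\<lambda>x. c * \<phi> x"]) simp
qed

lemma H10_diff: "u \<in> H10 \<Longrightarrow> v \<in> H10 \<Longrightarrow> (\<lambda>x. u x - v x) \<in> H10"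
  using H10_add[of u "\<lambda>x. (-1) * v x"] H10_cmult[of v "-1"] by simp

lemma H10_cnj: assumes u: "u \<in> H10" shows "(\<lambda>x. cnj (u x)) \<in> H10"
  unfolding H10_def
proof (intro CollectI conjI allI impI)
  show "(\<lambda>x. cnj (u x)) \<in> H1 \<Omega>" by (rule H1_cnj[OF H10_H1[OF u]])
  fix e :: real assume "e > 0"
  then obtain \<phi> where \<phi>: "test_fun \<Omega> \<phi>" "H1_norm \<Omega> (\<lambda>x. \<phi> x - u x) < e"
    using u by (auto simp: H10_def)
  have H: "(\<lambda>x. \<phi> x - u x) \<in> H1 \<Omega>" by (intro H1_diff H10_H1 u test_fun_H10[OF \<phi>(1)])
  show "\<exists>\<phi>. test_fun \<Omega> \<phi> \<and> H1_norm \<Omega> (\<lambda>x. \<phi> x - cnj (u x)) < e"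
    using H1_norm_cnj[OF H] \<phi> test_fun_cnj[OF \<phi>(1)] by (intro exI[of _ "\<lambda>x. cnj (\<phi> x)"]) simp
qed

text \<open>
  A quantitative form of Rellich's theorem. By Parseval's identity the frequencies with \<open>norm k > m\<close>
  contribute at most \<open>m\<^sup>-\<^sup>2\<close> times the Dirichlet integral, and only finitely many others remain.
\<close>

lemma low_frequency_bound:
  assumes u: "u \<in> H10" and m: "m > 0"
  shows "(2 * L) ^ DIM('a) * (LINT x|M. (cmod (u x))\<^sup>2)
    \<le> (\<Sum>k\<in>torus_lattice L \<inter> cball 0 m. (cmod (LINT x|M. u x * cexp 0 (- k) x))\<^sup>2)
      + (2 * L) ^ DIM('a) / m\<^sup>2 * (\<Sum>b\<in>Basis. LINT x|M. (cmod (wd b u x))\<^sup>2)"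
proof (rule field_le_epsilon)
  fix e :: real assume e: "e > 0"
  let ?vol = "(2 * L) ^ DIM('a)"
  have s0: "shifted_lattice L 0 = (torus_lattice L :: 'a set)" by (simp add: image_def)
  have uH: "u \<in> H1 \<Omega>" by (rule H10_H1[OF u])
  define c where "c k = (LINT x|M. u x * cexp 0 (- k) x)" for k
  obtain F where F: "finite F" "F \<subseteq> shifted_lattice L 0" "?vol * (LINT x|M. (cmod (u x))\<^sup>2) \<le> (\<Sum>k\<in>F. (cmod (c k))\<^sup>2) + e"
    using parseval[OF L_pos \<Omega>_lebesgue \<Omega>_sub H1_L2[OF uH] e, of 0] unfolding c_def by blast
  have deriv: "(cmod (LINT x|M. wd b u x * cexp 0 (- k) x))\<^sup>2 = (k \<bullet> b)\<^sup>2 * (cmod (c k))\<^sup>2" if b: "b \<in> Basis" for b k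
  proof -
    have "(LINT x|M. wd b u x * cexp 0 (- k) x) = - (LINT x|M. u x * pd b (cexp 0 (- k)) x)"
      by (rule integration_by_parts_H10[OF u smooth_cexp b])
    also have "(LINT x|M. u x * pd b (cexp 0 (- k)) x) = Complex 0 (- (k \<bullet> b)) * c k"
      unfolding c_def pd_cexp by (simp only: mult.left_commute[of "u _"] integral_mult_right_zero) simp
    finally show ?thesis by (simp add: norm_mult power_mult_distrib cmod_def algebra_simps)
  qed
  have "(\<Sum>k\<in>F - cball 0 m. (cmod (c k))\<^sup>2) \<le> (\<Sum>k\<in>F - cball 0 m. 1 / m\<^sup>2 * ((norm k)\<^sup>2 * (cmod (c k))\<^sup>2))"
  proof (rule sum_mono)
    fix k :: 'a assume "k \<in> F - cball 0 m"
    then have "m\<^sup>2 \<le> (norm k)\<^sup>2" using m by (intro power_mono) auto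
    then have "1 * (cmod (c k))\<^sup>2 \<le> (1 / m\<^sup>2 * (norm k)\<^sup>2) * (cmod (c k))\<^sup>2"
      using m by (intro mult_right_mono) (auto simp: field_simps)
    then show "(cmod (c k))\<^sup>2 \<le> 1 / m\<^sup>2 * ((norm k)\<^sup>2 * (cmod (c k))\<^sup>2)" by simp
  qed
  also have "\<dots> \<le> (\<Sum>k\<in>F. 1 / m\<^sup>2 * ((norm k)\<^sup>2 * (cmod (c k))\<^sup>2))"
    using F(1) by (intro sum_mono2) auto
  also have "\<dots> = 1 / m\<^sup>2 * (\<Sum>k\<in>F. \<Sum>b\<in>Basis. (cmod (LINT x|M. wd b u x * cexp 0 (- k) x))\<^sup>2)"
    unfolding sum_distrib_left[symmetric]
  proof (intro arg_cong[where f = "\<lambda>t. 1 / m\<^sup>2 * t"] sum.cong refl)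
    fix k :: 'a
    have "(norm k)\<^sup>2 = (\<Sum>b\<in>Basis. (k \<bullet> b)\<^sup>2)"
      unfolding power2_norm_eq_inner euclidean_inner[of k k] by (simp add: power2_eq_square)
    then show "(norm k)\<^sup>2 * (cmod (c k))\<^sup>2 = (\<Sum>b\<in>Basis. (cmod (LINT x|M. wd b u x * cexp 0 (- k) x))\<^sup>2)"
      by (simp add: deriv sum_distrib_right)
  qed
  also have "\<dots> = 1 / m\<^sup>2 * (\<Sum>b\<in>Basis. \<Sum>k\<in>F. (cmod (LINT x|M. wd b u x * cexp 0 (- k) x))\<^sup>2)"
    by (subst sum.swap) simp
  also have "\<dots> \<le> 1 / m\<^sup>2 * (\<Sum>b\<in>Basis. ?vol * (LINT x|M. (cmod (wd b u x))\<^sup>2))"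
    using m by (intro mult_left_mono sum_mono bessel[OF L_pos \<Omega>_lebesgue \<Omega>_sub _ F(1,2)] wd_works uH) auto
  finally have high: "(\<Sum>k\<in>F - cball 0 m. (cmod (c k))\<^sup>2) \<le> ?vol / m\<^sup>2 * (\<Sum>b\<in>Basis. LINT x|M. (cmod (wd b u x))\<^sup>2)"
    by (simp add: sum_distrib_left)
  have "(\<Sum>k\<in>F \<inter> cball 0 m. (cmod (c k))\<^sup>2) \<le> (\<Sum>k\<in>torus_lattice L \<inter> cball 0 m. (cmod (c k))\<^sup>2)"
    using F(2) finite_shifted_lattice_cball[OF L_pos, of 0 m] unfolding s0 by (intro sum_mono2) auto
  moreover have "(\<Sum>k\<in>F. (cmod (c k))\<^sup>2) = (\<Sum>k\<in>F \<inter> cball 0 m. (cmod (c k))\<^sup>2) + (\<Sum>k\<in>F - cball 0 m. (cmod (c k))\<^sup>2)"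
    using F(1) by (rule sum.Int_Diff)
  ultimately show "?vol * (LINT x|M. (cmod (u x))\<^sup>2)
    \<le> (\<Sum>k\<in>torus_lattice L \<inter> cball 0 m. (cmod (LINT x|M. u x * cexp 0 (- k) x))\<^sup>2)
      + ?vol / m\<^sup>2 * (\<Sum>b\<in>Basis. LINT x|M. (cmod (wd b u x))\<^sup>2) + e"
    using F(3) high unfolding c_def by linarith
qed

end

section \<open>The Dirichlet problem and the Dirichlet-to-Neumann map\<close>

text \<open>
  Smooth functions have traces as soon as they are square-integrable on the boundary; for a bounded
  Lipschitz domain this follows from the finiteness of its surface measure.
\<close>

locale bounded_domain = bounded_open +
  assumes smooth_L2_surface: "\<And>\<psi>. smooth \<psi> \<Longrightarrow> \<psi> \<in> L2 (surface_measure \<Omega>)"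
begin

lemma H1_norm_triangle:
  assumes "u \<in> H1 \<Omega>" "v \<in> H1 \<Omega>"
  shows "H1_norm \<Omega> (\<lambda>x. u x + v x) \<le> H1_norm \<Omega> u + H1_norm \<Omega> v"
proof -
  interpret H: hilbert_on "H1 \<Omega>" H1_ip by (rule hilbert_on_H1)
  have n: "H.nrm f = H1_norm \<Omega> f" if "f \<in> H1 \<Omega>" for f using that by (simp add: H.nrm_def H1_norm_eq)
  show ?thesis
    using H.nrm_triangle[OF assms] n[OF assms(1)] n[OF assms(2)] n[OF H1_add[OF assms]] by (simp add: plus_fun_def)
qed

text \<open>
  Adding test functions, which vanish on the boundary, to \<open>\<psi>\<close> does not change its boundary values.
\<close>

lemma has_trace_smooth_plus_H10:
  assumes \<psi>: "smooth \<psi>" and w: "w \<in> H10"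
  shows "has_trace \<Omega> (\<lambda>x. \<psi> x + w x) \<psi>"
proof -
  have "\<exists>\<phi>. test_fun \<Omega> \<phi> \<and> H1_norm \<Omega> (\<lambda>x. \<phi> x - w x) < inverse (real (Suc n))" for n
    using w by (auto simp: H10_def)
  then obtain \<phi> where \<phi>: "\<And>n. test_fun \<Omega> (\<phi> n)" "\<And>n. H1_norm \<Omega> (\<lambda>x. \<phi> n x - w x) < inverse (real (Suc n))"
    by metis
  have zero: "\<phi> n x = 0" if x: "x \<in> frontier \<Omega>" for n x
  proof -
    have "x \<notin> \<Omega>" using x open_\<Omega> by (simp add: frontier_def interior_open)
    then show ?thesis using \<phi>(1)[of n] by (auto simp: test_fun_def)
  qed
  show ?thesis
    unfolding has_trace_def
  proof (intro conjI exI[of _ "\<lambda>n x. \<psi> x + \<phi> n x"] allI)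
    show "(\<lambda>x. \<psi> x + w x) \<in> H1 \<Omega>" by (intro H1_add smooth_H1 \<psi> H10_H1 w)
    show "\<psi> \<in> L2 (surface_measure \<Omega>)" by (rule smooth_L2_surface[OF \<psi>])
    show "smooth (\<lambda>x. \<psi> x + \<phi> n x)" for n by (intro smooth_add \<psi> test_fun_smooth[OF \<phi>(1)])
    show "(\<lambda>n. H1_norm \<Omega> (\<lambda>x. \<psi> x + \<phi> n x - (\<psi> x + w x))) \<longlonglongrightarrow> 0"
    proof (rule Lim_null_comparison)
      show "\<forall>\<^sub>F n in sequentially. norm (H1_norm \<Omega> (\<lambda>x. \<psi> x + \<phi> n x - (\<psi> x + w x))) \<le> inverse (real (Suc n))"
        using \<phi>(2) by (intro always_eventually) (auto intro: less_imp_le)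
    qed (rule LIMSEQ_inverse_real_of_nat)
    have "(\<integral>\<^sup>+ x. ennreal ((cmod (\<psi> x + \<phi> n x - \<psi> x))\<^sup>2) \<partial>surface_measure \<Omega>) = (\<integral>\<^sup>+ x. 0 \<partial>surface_measure \<Omega>)" for n
      by (rule nn_integral_cong) (use zero in \<open>auto simp: surface_measure_def space_restrict_space\<close>)
    then show "(\<lambda>n. \<integral>\<^sup>+ x. ennreal ((cmod (\<psi> x + \<phi> n x - \<psi> x))\<^sup>2) \<partial>surface_measure \<Omega>) \<longlonglongrightarrow> 0" by simp
  qed
qed

lemma zero_H10: "(\<lambda>x. 0) \<in> H10"
  by (rule test_fun_H10[OF test_fun_0])

lemma has_trace_smooth: "smooth \<psi> \<Longrightarrow> has_trace \<Omega> \<psi> \<psi>"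
  using has_trace_smooth_plus_H10[OF _ zero_H10] by simp

lemma has_trace_H10: "w \<in> H10 \<Longrightarrow> has_trace \<Omega> w (\<lambda>x. 0)"
  using has_trace_smooth_plus_H10[OF smooth_const[of 0]] by simp

lemma smooth_H_half: "smooth \<psi> \<Longrightarrow> \<psi> \<in> H_half \<Omega>"
  unfolding H_half_def using has_trace_smooth smooth_H1 by blast

lemma has_trace_diff:
  assumes "has_trace \<Omega> u f" "has_trace \<Omega> v f" shows "has_trace \<Omega> (\<lambda>x. u x - v x) (\<lambda>x. 0)"
proof -
  let ?S = "surface_measure \<Omega>"
  from assms(1) obtain \<phi> where u: "u \<in> H1 \<Omega>" and f: "f \<in> L2 ?S" and \<phi>: "\<And>n. smooth (\<phi> n)"
    "(\<lambda>n. H1_norm \<Omega> (\<lambda>x. \<phi> n x - u x)) \<longlonglongrightarrow> 0" "(\<lambda>n. \<integral>\<^sup>+ x. ennreal ((cmod (\<phi> n x - f x))\<^sup>2) \<partial>?S) \<longlonglongrightarrow> 0"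
    unfolding has_trace_def by blast
  from assms(2) obtain \<theta> where v: "v \<in> H1 \<Omega>" and \<theta>: "\<And>n. smooth (\<theta> n)"
    "(\<lambda>n. H1_norm \<Omega> (\<lambda>x. \<theta> n x - v x)) \<longlonglongrightarrow> 0" "(\<lambda>n. \<integral>\<^sup>+ x. ennreal ((cmod (\<theta> n x - f x))\<^sup>2) \<partial>?S) \<longlonglongrightarrow> 0"
    unfolding has_trace_def by blast
  have s: "smooth (\<lambda>x. \<phi> n x - \<theta> n x)" for n
    using smooth_add[OF \<phi>(1)[of n] smooth_cmult[OF \<theta>(1)[of n], of "-1"]] by simp
  show ?thesis
    unfolding has_trace_def
  proof (intro conjI exI[of _ "\<lambda>n x. \<phi> n x - \<theta> n x"] allI s)
    show "(\<lambda>x. u x - v x) \<in> H1 \<Omega>" by (rule H1_diff[OF u v])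
    show "(\<lambda>x. 0) \<in> L2 ?S" by (rule L2_zero)
    show "(\<lambda>n. H1_norm \<Omega> (\<lambda>x. \<phi> n x - \<theta> n x - (u x - v x))) \<longlonglongrightarrow> 0"
    proof (rule Lim_null_comparison)
      have "H1_norm \<Omega> (\<lambda>x. \<phi> n x - \<theta> n x - (u x - v x)) \<le> H1_norm \<Omega> (\<lambda>x. \<phi> n x - u x) + H1_norm \<Omega> (\<lambda>x. \<theta> n x - v x)" for n
      proof -
        have H: "(\<lambda>x. \<phi> n x - u x) \<in> H1 \<Omega>" "(\<lambda>x. \<theta> n x - v x) \<in> H1 \<Omega>"
          by (intro H1_diff smooth_H1 \<phi> \<theta> u v)+
        have "(\<lambda>x. \<phi> n x - \<theta> n x - (u x - v x)) = (\<lambda>x. (\<phi> n x - u x) + (- 1) * (\<theta> n x - v x))"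
          by (simp add: fun_eq_iff)
        then show ?thesis
          using H1_norm_triangle[OF H(1) H1_cmult[OF H(2), of "-1"]] H1_norm_cmult[OF H(2), of "-1"] by simp
      qed
      then show "\<forall>\<^sub>F n in sequentially. norm (H1_norm \<Omega> (\<lambda>x. \<phi> n x - \<theta> n x - (u x - v x)))
        \<le> H1_norm \<Omega> (\<lambda>x. \<phi> n x - u x) + H1_norm \<Omega> (\<lambda>x. \<theta> n x - v x)" by simp
      show "(\<lambda>n. H1_norm \<Omega> (\<lambda>x. \<phi> n x - u x) + H1_norm \<Omega> (\<lambda>x. \<theta> n x - v x)) \<longlonglongrightarrow> 0"
        using tendsto_add[OF \<phi>(2) \<theta>(2)] by simp
    qed
    show "(\<lambda>n. \<integral>\<^sup>+ x. ennreal ((cmod (\<phi> n x - \<theta> n x - 0))\<^sup>2) \<partial>?S) \<longlonglongrightarrow> 0"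
    proof (rule tendsto_sandwich[OF _ _ tendsto_const])
      show "\<forall>\<^sub>F n in sequentially. 0 \<le> (\<integral>\<^sup>+ x. ennreal ((cmod (\<phi> n x - \<theta> n x - 0))\<^sup>2) \<partial>?S)" by simp
      have meas: "(\<lambda>x. ennreal ((cmod (g x - f x))\<^sup>2)) \<in> borel_measurable ?S" if "smooth g" for g
        using L2_measurable[OF f] L2_measurable[OF smooth_L2_surface[OF that]] by measurable
      have "(\<integral>\<^sup>+ x. ennreal ((cmod (\<phi> n x - \<theta> n x - 0))\<^sup>2) \<partial>?S)
          \<le> 2 * (\<integral>\<^sup>+ x. ennreal ((cmod (\<phi> n x - f x))\<^sup>2) \<partial>?S) + 2 * (\<integral>\<^sup>+ x. ennreal ((cmod (\<theta> n x - f x))\<^sup>2) \<partial>?S)" for n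
      proof -
        have le: "(cmod (a - b))\<^sup>2 \<le> 2 * (cmod (a - c))\<^sup>2 + 2 * (cmod (b - c))\<^sup>2" for a b c :: complex
        proof -
          have "(cmod ((a - c) - (b - c)))\<^sup>2 \<le> (cmod (a - c) + cmod (b - c))\<^sup>2"
            by (intro power_mono norm_triangle_ineq4) auto
          also have "\<dots> \<le> 2 * (cmod (a - c))\<^sup>2 + 2 * (cmod (b - c))\<^sup>2"
            using sum_squares_bound[of "cmod (a - c)" "cmod (b - c)"] by (simp add: power2_sum)
          finally show ?thesis by simp
        qed
        have "(\<integral>\<^sup>+ x. ennreal ((cmod (\<phi> n x - \<theta> n x - 0))\<^sup>2) \<partial>?S)
          \<le> (\<integral>\<^sup>+ x. 2 * ennreal ((cmod (\<phi> n x - f x))\<^sup>2) + 2 * ennreal ((cmod (\<theta> n x - f x))\<^sup>2) \<partial>?S)"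
        proof (rule nn_integral_mono)
          fix x
          have "ennreal ((cmod (\<phi> n x - \<theta> n x - 0))\<^sup>2) \<le> ennreal (2 * (cmod (\<phi> n x - f x))\<^sup>2 + 2 * (cmod (\<theta> n x - f x))\<^sup>2)"
            using le[of "\<phi> n x" "\<theta> n x" "f x"] by (intro ennreal_leI) simp
          then show "ennreal ((cmod (\<phi> n x - \<theta> n x - 0))\<^sup>2) \<le> 2 * ennreal ((cmod (\<phi> n x - f x))\<^sup>2) + 2 * ennreal ((cmod (\<theta> n x - f x))\<^sup>2)"
            by (simp add: ennreal_plus ennreal_mult)
        qed
        also have "\<dots> = 2 * (\<integral>\<^sup>+ x. ennreal ((cmod (\<phi> n x - f x))\<^sup>2) \<partial>?S) + 2 * (\<integral>\<^sup>+ x. ennreal ((cmod (\<theta> n x - f x))\<^sup>2) \<partial>?S)"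
          using meas[OF \<phi>(1)] meas[OF \<theta>(1)] by (simp add: nn_integral_add nn_integral_cmult)
        finally show ?thesis .
      qed
      then show "\<forall>\<^sub>F n in sequentially. (\<integral>\<^sup>+ x. ennreal ((cmod (\<phi> n x - \<theta> n x - 0))\<^sup>2) \<partial>?S)
          \<le> 2 * (\<integral>\<^sup>+ x. ennreal ((cmod (\<phi> n x - f x))\<^sup>2) \<partial>?S) + 2 * (\<integral>\<^sup>+ x. ennreal ((cmod (\<theta> n x - f x))\<^sup>2) \<partial>?S)"
        by (intro always_eventually allI)
      have "(\<lambda>n. 2 * (\<integral>\<^sup>+ x. ennreal ((cmod (\<phi> n x - f x))\<^sup>2) \<partial>?S) + 2 * (\<integral>\<^sup>+ x. ennreal ((cmod (\<theta> n x - f x))\<^sup>2) \<partial>?S)) \<longlonglongrightarrow> 2 * 0 + 2 * 0"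
        by (intro tendsto_add ennreal_tendsto_cmult \<phi>(3) \<theta>(3)) auto
      then show "(\<lambda>n. 2 * (\<integral>\<^sup>+ x. ennreal ((cmod (\<phi> n x - f x))\<^sup>2) \<partial>?S) + 2 * (\<integral>\<^sup>+ x. ennreal ((cmod (\<theta> n x - f x))\<^sup>2) \<partial>?S)) \<longlonglongrightarrow> 0"
        by simp
    qed
  qed
qed

lemma H10_cong_AE:
  assumes w: "w \<in> H10" and z: "z \<in> H1 \<Omega>" and eq: "AE x in M. z x = w x"
  shows "z \<in> H10"
  unfolding H10_def
proof (intro CollectI conjI allI impI z)
  fix e :: real assume "e > 0"
  then obtain \<phi> where \<phi>: "test_fun \<Omega> \<phi>" "H1_norm \<Omega> (\<lambda>x. \<phi> x - w x) < e"
    using w by (auto simp: H10_def)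
  have H: "(\<lambda>x. \<phi> x - z x) \<in> H1 \<Omega>" "(\<lambda>x. \<phi> x - w x) \<in> H1 \<Omega>"
    by (intro H1_diff H10_H1 test_fun_H10[OF \<phi>(1)] z w)+
  have ae: "AE x in M. \<phi> x - z x = \<phi> x - w x" using eq by eventually_elim simp
  have m: "(\<lambda>x. \<phi> x - z x) \<in> borel_measurable M" "(\<lambda>x. \<phi> x - w x) \<in> borel_measurable M"
    using L2_measurable[OF H1_L2[OF H(1)]] L2_measurable[OF H1_L2[OF H(2)]] by auto
  have "L2_norm M (\<lambda>x. \<phi> x - z x) = L2_norm M (\<lambda>x. \<phi> x - w x)"
    using ae by (intro L2_norm_cong_AE m) (auto elim: eventually_mono)
  moreover have "wd b (\<lambda>x. \<phi> x - z x) = wd b (\<lambda>x. \<phi> x - w x)" if "b \<in> Basis" for b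
    by (rule wd_cong_AE[OF ae m that])
  ultimately have "(H1_norm \<Omega> (\<lambda>x. \<phi> x - z x))\<^sup>2 = (H1_norm \<Omega> (\<lambda>x. \<phi> x - w x))\<^sup>2"
    by (simp add: H1_norm_square)
  then have "H1_norm \<Omega> (\<lambda>x. \<phi> x - z x) = H1_norm \<Omega> (\<lambda>x. \<phi> x - w x)" by (simp add: power2_eq_iff_nonneg)
  then show "\<exists>\<phi>. test_fun \<Omega> \<phi> \<and> H1_norm \<Omega> (\<lambda>x. \<phi> x - z x) < e" using \<phi> by auto
qed

context
  fixes q R
  assumes q: "bounded_potential q R" and not_ev: "\<not> dirichlet_eigenvalue \<Omega> q 0"
begin

lemma AE_zero_if_solves_with_zero_trace:
  assumes "u \<in> H1 \<Omega>" "\<And>\<phi>. test_fun \<Omega> \<phi> \<Longrightarrow> form q u \<phi> = 0" "has_trace \<Omega> u (\<lambda>x. 0)"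
  shows "AE x in M. u x = 0"
  using assms not_ev unfolding dirichlet_eigenvalue_def solves_schroedinger_def by auto

text \<open>
  The \<open>L\<^sup>2\<close> norm, with the factor \<open>R + 1\<close>, is estimated by \<open>low_frequency_bound\<close>; the
  threshold \<open>m\<close> is such that the term from the high frequencies is half of the Dirichlet integral.
\<close>

lemma garding:
  assumes u: "u \<in> H10"
  defines "c \<equiv> 2 + 2 * (R + 1) / (2 * L) ^ DIM('a)" and "m \<equiv> sqrt (2 * (R + 1))"
  shows "(H1_norm \<Omega> u)\<^sup>2 \<le> c * \<bar>Re (form q u (\<lambda>x. cnj (u x)))\<bar>
    + c * (\<Sum>k\<in>torus_lattice L \<inter> cball 0 m. (cmod (LINT x|M. u x * cexp 0 (- k) x))\<^sup>2)"
proof -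
  have R: "R \<ge> 0" using q by (simp add: bounded_potential_def)
  have uH: "u \<in> H1 \<Omega>" by (rule H10_H1[OF u])
  let ?vol = "(2 * L) ^ DIM('a)"
  have vol: "?vol > 0" using L_pos by simp
  define G where "G = (\<Sum>b\<in>Basis. LINT x|M. (cmod (wd b u x))\<^sup>2)"
  define U where "U = (LINT x|M. (cmod (u x))\<^sup>2)"
  define S where "S = (\<Sum>k\<in>torus_lattice L \<inter> cball 0 m. (cmod (LINT x|M. u x * cexp 0 (- k) x))\<^sup>2)"
  have S0: "S \<ge> 0" unfolding S_def by (intro sum_nonneg) auto
  have G0: "G \<ge> 0" unfolding G_def by (intro sum_nonneg) auto
  have H: "(H1_norm \<Omega> u)\<^sup>2 = U + G" unfolding H1_norm_square L2_norm_square U_def G_def by simp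
  have D: "dirichlet_form u (\<lambda>x. cnj (u x)) = complex_of_real G"
  proof -
    have "(LINT x|M. wd b u x * wd b (\<lambda>x. cnj (u x)) x) = complex_of_real (LINT x|M. (cmod (wd b u x))\<^sup>2)" if b: "b \<in> Basis" for b
    proof -
      have "(LINT x|M. wd b (\<lambda>x. cnj (u x)) x * wd b u x) = (LINT x|M. cnj (wd b u x) * wd b u x)"
        by (intro integral_mult_cong_AE wd_cnj uH b wd_works H1_cnj L2_cnj)
      also have "\<dots> = (LINT x|M. complex_of_real ((cmod (wd b u x))\<^sup>2))"
        by (simp only: complex_norm_square mult.commute)
      also have "\<dots> = complex_of_real (LINT x|M. (cmod (wd b u x))\<^sup>2)" by (rule integral_complex_of_real)
      finally show ?thesis by (simp only: mult.commute)
    qed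
    then show ?thesis unfolding dirichlet_form_def G_def by simp
  qed
  have Q: "cmod (LINT x|M. q x * u x * cnj (u x)) \<le> R * U"
  proof -
    have "cmod (LINT x|M. q x * u x * cnj (u x)) \<le> L2_norm M (\<lambda>x. q x * u x) * L2_norm M (\<lambda>x. cnj (u x))"
      by (intro L2_cauchy_schwarz finite_M potential_mult_L2[OF q] H1_L2 uH L2_cnj)
    also have "L2_norm M (\<lambda>x. cnj (u x)) = L2_norm M u" by (simp add: L2_norm_def)
    also have "L2_norm M (\<lambda>x. q x * u x) * L2_norm M u \<le> (R * L2_norm M u) * L2_norm M u"
      by (intro mult_right_mono L2_norm_potential_mult[OF q] H1_L2 uH) auto
    finally show ?thesis unfolding U_def L2_norm_square[symmetric] by (simp add: power2_eq_square mult.assoc)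
  qed
  have "Re (form q u (\<lambda>x. cnj (u x))) = G + Re (LINT x|M. q x * u x * cnj (u x))"
    unfolding form_eq[OF q uH H1_cnj[OF uH]] D by simp
  then have 1: "G \<le> \<bar>Re (form q u (\<lambda>x. cnj (u x)))\<bar> + R * U"
    using Q abs_Re_le_cmod[of "LINT x|M. q x * u x * cnj (u x)"] by linarith
  have m2: "m > 0" "m\<^sup>2 = 2 * (R + 1)" using R by (auto simp: m_def)
  have "?vol * U \<le> S + ?vol / m\<^sup>2 * G"
    using low_frequency_bound[OF u m2(1)] unfolding U_def G_def S_def .
  then have "U \<le> (S + ?vol / m\<^sup>2 * G) / ?vol"
    unfolding pos_le_divide_eq[OF vol] by (simp only: mult.commute)
  also have "\<dots> = S / ?vol + G / m\<^sup>2" using vol L_pos by (simp add: add_divide_distrib)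
  finally have "U \<le> S / ?vol + G / m\<^sup>2" .
  then have "(R + 1) * U \<le> (R + 1) * (S / ?vol + G / m\<^sup>2)" using R by (intro mult_left_mono) auto
  also have "\<dots> = (R + 1) / ?vol * S + G / 2" using R unfolding m2 by (simp add: field_simps)
  finally have 2: "(R + 1) * U \<le> (R + 1) / ?vol * S + G / 2" .
  have "U + G \<le> 2 * \<bar>Re (form q u (\<lambda>x. cnj (u x)))\<bar> + 2 * ((R + 1) / ?vol * S)"
  proof -
    have "U \<ge> 0" by (simp add: U_def)
    have "(R + 1) * U = R * U + U" by (simp add: algebra_simps)
    then show ?thesis using 1 2 \<open>U \<ge> 0\<close> G0 by argo
  qed
  also have "\<dots> \<le> c * \<bar>Re (form q u (\<lambda>x. cnj (u x)))\<bar> + c * S"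
  proof (rule add_mono)
    show "2 * \<bar>Re (form q u (\<lambda>x. cnj (u x)))\<bar> \<le> c * \<bar>Re (form q u (\<lambda>x. cnj (u x)))\<bar>"
      using R vol by (intro mult_right_mono) (auto simp: c_def)
    have "(2 * (R + 1) / ?vol) * S \<le> c * S" using S0 by (intro mult_right_mono) (auto simp: c_def)
    then show "2 * ((R + 1) / ?vol * S) \<le> c * S" by (simp add: field_simps)
  qed
  finally show ?thesis unfolding H S_def .
qed

text \<open>
  The Fredholm alternative for the real part of the form, which is real bilinear and symmetric.
  Injectivity is the hypothesis on the eigenvalue, because elements of \<open>H10\<close> have zero trace. Testing with
  \<open>\<i> v\<close> as well recovers the complex identity.
\<close>

lemma solvability:
  assumes G_add: "\<And>u v. u \<in> H10 \<Longrightarrow> v \<in> H10 \<Longrightarrow> G (\<lambda>x. u x + v x) = G u + G v"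
    and G_cmult: "\<And>c u. u \<in> H10 \<Longrightarrow> G (\<lambda>x. c * u x) = c * G u"
    and G_bound: "\<And>u. u \<in> H10 \<Longrightarrow> cmod (G u) \<le> D * H1_norm \<Omega> u"
  obtains w where "w \<in> H10" "\<And>v. v \<in> H10 \<Longrightarrow> form q w v = G v"
proof -
  interpret H: hilbert_on H10 H1_ip by (rule hilbert_on_H10)
  have n: "H.nrm f = H1_norm \<Omega> f" if "f \<in> H10" for f using that H10_H1 by (simp add: H.nrm_def H1_norm_eq)
  have sc: "c *\<^sub>R u = (\<lambda>x. complex_of_real c * u x)" for c and u :: "'a \<Rightarrow> complex"
    by (simp add: fun_eq_iff scaleR_conv_of_real)
  let ?c = "2 + 2 * (R + 1) / (2 * L) ^ DIM('a)" and ?K = "torus_lattice L \<inter> cball 0 (sqrt (2 * (R + 1))) :: 'a set"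
  let ?l = "\<lambda>(k, r) u. (if r then Re else Im) (LINT x|M. u x * cexp 0 (- k) x)"
  have fK: "finite ?K" using finite_shifted_lattice_cball[OF L_pos, of 0] by (simp add: image_def)
  have e2: "cexp 0 k \<in> L2 M" for k by (rule smooth_L2[OF smooth_cexp])
  have e1: "L2_norm M (cexp 0 k) = L2_norm M (\<lambda>_. 1)" for k by (simp add: L2_norm_def)
  obtain w where w: "w \<in> H10" "\<And>v. v \<in> H10 \<Longrightarrow> Re (form q w v) = Re (G v)"
  proof (rule H.fredholm_alternative[where B = "\<lambda>u v. Re (form q u v)" and \<beta> = "real DIM('a) + R"
        and S = "\<lambda>u x. cnj (u x)" and J = "?K \<times> (UNIV :: bool set)" and C = ?c and l = ?l
        and K = "L2_norm M (\<lambda>_. 1)" and F = "\<lambda>v. Re (G v)" and D = D])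
    show "Re (form q (u + v) w) = Re (form q u w) + Re (form q v w)" if "u \<in> H10" "v \<in> H10" "w \<in> H10" for u v w
      using form_add[OF q] that H10_H1 by (simp add: plus_fun_def)
    show "Re (form q (c *\<^sub>R u) w) = c * Re (form q u w)" if "u \<in> H10" "w \<in> H10" for c u w
      unfolding sc using form_cmult[OF q] that H10_H1 by simp
    show "Re (form q u w) = Re (form q w u)" if "u \<in> H10" "w \<in> H10" for u w
      using form_commute[OF q] that H10_H1 by simp
    show "\<bar>Re (form q u w)\<bar> \<le> (real DIM('a) + R) * H.nrm u * H.nrm w" if "u \<in> H10" "w \<in> H10" for u w
      unfolding n[OF that(1)] n[OF that(2)]
      by (rule order_trans[OF abs_Re_le_cmod form_bound[OF q]]) (use that H10_H1 in auto)
    show "(\<lambda>x. cnj (u x)) \<in> H10" if "u \<in> H10" for u by (rule H10_cnj[OF that])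
    show "H.nrm (\<lambda>x. cnj (u x)) \<le> H.nrm u" if "u \<in> H10" for u
      using that by (simp add: n H10_cnj H1_norm_cnj H10_H1)
    show "finite (?K \<times> (UNIV :: bool set))" using fK by simp
    show "0 \<le> ?c" using q L_pos by (simp add: bounded_potential_def)
    show "?l j (u - v) = ?l j u - ?l j v" if "u \<in> H10" "v \<in> H10" for j u v
    proof -
      obtain k r where j: "j = (k, r)" by (cases j)
      have "(LINT x|M. (u x - v x) * cexp 0 (- k) x) = (LINT x|M. u x * cexp 0 (- k) x) - (LINT x|M. v x * cexp 0 (- k) x)"
        using that by (simp add: left_diff_distrib L2_integrable_mult H1_L2 H10_H1 e2)
      then show ?thesis unfolding j by simp
    qed
    show "\<bar>?l j u\<bar> \<le> L2_norm M (\<lambda>_. 1) * H.nrm u" if "u \<in> H10" for j u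
    proof -
      obtain k r where j: "j = (k, r)" by (cases j)
      have "\<bar>?l j u\<bar> \<le> cmod (LINT x|M. u x * cexp 0 (- k) x)"
        unfolding j by (simp add: abs_Re_le_cmod abs_Im_le_cmod)
      also have "\<dots> \<le> L2_norm M u * L2_norm M (cexp 0 (- k))"
        using that by (intro L2_cauchy_schwarz finite_M H1_L2 H10_H1 e2)
      also have "\<dots> \<le> H1_norm \<Omega> u * L2_norm M (\<lambda>_. 1)" unfolding e1 by (intro mult_right_mono L2_norm_le_H1_norm) auto
      finally show ?thesis by (simp add: n[OF that] mult.commute)
    qed
    show "(H.nrm u)\<^sup>2 \<le> ?c * \<bar>Re (form q u (\<lambda>x. cnj (u x)))\<bar> + ?c * (\<Sum>j\<in>?K \<times> UNIV. (?l j u)\<^sup>2)" if "u \<in> H10" for u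
    proof -
      have "(\<Sum>j\<in>?K \<times> UNIV. (?l j u)\<^sup>2) = (\<Sum>k\<in>?K. \<Sum>r\<in>UNIV. (?l (k, r) u)\<^sup>2)"
        by (rule sum.cartesian_product')
      also have "\<dots> = (\<Sum>k\<in>?K. (cmod (LINT x|M. u x * cexp 0 (- k) x))\<^sup>2)"
        by (simp add: UNIV_bool cmod_power2 add.commute)
      finally show ?thesis using garding[OF that] unfolding n[OF that] by simp
    qed
    show "H.nrm u = 0" if u: "u \<in> H10" and 0: "\<And>v. v \<in> H10 \<Longrightarrow> Re (form q u v) = 0" for u
    proof -
      have "form q u \<phi> = 0" if \<phi>: "test_fun \<Omega> \<phi>" for \<phi>
      proof -
        have "Re (form q u (\<lambda>x. \<i> * \<phi> x)) = 0" by (rule 0[OF H10_cmult[OF test_fun_H10[OF \<phi>]]])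
        then have "Im (form q u \<phi>) = 0"
          using form_cmult_right[OF q H10_H1[OF test_fun_H10[OF \<phi>]] H10_H1[OF u], of \<i>] by simp
        then show ?thesis using 0[OF test_fun_H10[OF \<phi>]] by (simp add: complex_eq_iff)
      qed
      then have ae: "AE x in M. u x = 0"
        by (rule AE_zero_if_solves_with_zero_trace[OF H10_H1[OF u] _ has_trace_H10[OF u]])
      have "wd b u = wd b (\<lambda>x. 0)" if "b \<in> Basis" for b
        using ae L2_measurable[OF H1_L2[OF H10_H1[OF u]]] that by (intro wd_cong_AE) auto
      moreover have "L2_norm M u = L2_norm M (\<lambda>x. 0)"
        using ae L2_measurable[OF H1_L2[OF H10_H1[OF u]]] by (intro L2_norm_cong_AE) (auto elim: eventually_mono)
      ultimately have "(H1_norm \<Omega> u)\<^sup>2 = (H1_norm \<Omega> (\<lambda>x. 0))\<^sup>2" by (simp add: H1_norm_square)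
      also have "H1_norm \<Omega> (\<lambda>x. 0) = 0"
        using H1_norm_cmult[OF H10_H1[OF zero_H10], of 0] by simp
      finally show ?thesis by (simp add: n[OF u])
    qed
    show "Re (G (u + v)) = Re (G u) + Re (G v)" if "u \<in> H10" "v \<in> H10" for u v
      using G_add[OF that] by (simp add: plus_fun_def)
    show "Re (G (c *\<^sub>R u)) = c * Re (G u)" if "u \<in> H10" for c u
      unfolding sc using G_cmult[OF that] by simp
    show "\<bar>Re (G u)\<bar> \<le> D * H.nrm u" if "u \<in> H10" for u
      unfolding n[OF that] by (rule order_trans[OF abs_Re_le_cmod G_bound[OF that]])
  qed blast
  have "form q w v = G v" if v: "v \<in> H10" for v
  proof -
    have "Re (form q w (\<lambda>x. \<i> * v x)) = Re (G (\<lambda>x. \<i> * v x))" by (rule w(2)[OF H10_cmult[OF v]])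
    then have "Im (form q w v) = Im (G v)"
      using form_cmult_right[OF q H10_H1[OF v] H10_H1[OF w(1)], of \<i>] G_cmult[OF v, of \<i>] by simp
    then show ?thesis using w(2)[OF v] by (simp add: complex_eq_iff)
  qed
  then show ?thesis using that w(1) by blast
qed

lemma solvability_form:
  assumes z: "z \<in> H1 \<Omega>"
  obtains w where "w \<in> H10" "\<And>v. v \<in> H10 \<Longrightarrow> form q w v = form q z v"
proof (rule solvability[where G = "form q z" and D = "(real DIM('a) + R) * H1_norm \<Omega> z"])
  show "form q z (\<lambda>x. u x + v x) = form q z u + form q z v" if "u \<in> H10" "v \<in> H10" for u v
    by (intro form_add_right[OF q] H10_H1 that z)
  show "form q z (\<lambda>x. c * u x) = c * form q z u" if "u \<in> H10" for c u
    by (intro form_cmult_right[OF q] H10_H1 that z)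
  show "cmod (form q z u) \<le> (real DIM('a) + R) * H1_norm \<Omega> z * H1_norm \<Omega> u" if "u \<in> H10" for u
    by (intro form_bound[OF q] H10_H1 that z)
qed (use that in blast)

lemma solvability_L2:
  assumes g: "g \<in> L2 M"
  obtains w where "w \<in> H10" "\<And>v. v \<in> H10 \<Longrightarrow> form q w v = (LINT x|M. g x * v x)"
proof (rule solvability[where G = "\<lambda>v. LINT x|M. g x * v x" and D = "L2_norm M g"])
  show "(LINT x|M. g x * (u x + v x)) = (LINT x|M. g x * u x) + (LINT x|M. g x * v x)" if "u \<in> H10" "v \<in> H10" for u v
    by (simp add: distrib_left L2_integrable_mult g H1_L2 H10_H1 that)
  show "(LINT x|M. g x * (c * u x)) = c * (LINT x|M. g x * u x)" for c u
    by (simp only: mult.left_commute[of "g _"] integral_mult_right_zero)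
  show "cmod (LINT x|M. g x * u x) \<le> L2_norm M g * H1_norm \<Omega> u" if "u \<in> H10" for u
    by (rule order_trans[OF L2_cauchy_schwarz[OF finite_M g H1_L2[OF H10_H1[OF that]]]])
       (intro mult_left_mono L2_norm_le_H1_norm, simp)
qed (use that in blast)

text \<open>
  The hypothesis on the eigenvalue makes \<open>z\<close> a limit of test functions. Let \<open>w\<close> in \<open>H10\<close> solve
  the same weak equation as \<open>z\<close>; then \<open>z - w\<close> is a solution with zero trace of the homogeneous equation,
  so it vanishes.
\<close>

lemma zero_trace_imp_H10:
  assumes tr: "has_trace \<Omega> z (\<lambda>x. 0)" shows "z \<in> H10"
proof -
  have z: "z \<in> H1 \<Omega>" using tr by (simp add: has_trace_def)
  obtain w where w: "w \<in> H10" "\<And>v. v \<in> H10 \<Longrightarrow> form q w v = form q z v"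
    using solvability_form[OF z] by blast
  have "AE x in M. z x - w x = 0"
  proof (rule AE_zero_if_solves_with_zero_trace)
    show "(\<lambda>x. z x - w x) \<in> H1 \<Omega>" by (intro H1_diff z H10_H1 w)
    show "has_trace \<Omega> (\<lambda>x. z x - w x) (\<lambda>x. 0)" by (rule has_trace_diff[OF tr has_trace_H10[OF w(1)]])
    fix \<phi> assume "test_fun \<Omega> \<phi>"
    then have \<phi>: "\<phi> \<in> H10" by (rule test_fun_H10)
    show "form q (\<lambda>x. z x - w x) \<phi> = 0"
      using form_diff[OF q z H10_H1[OF w(1)] H10_H1[OF \<phi>]] w(2)[OF \<phi>] by simp
  qed
  then show ?thesis by (intro H10_cong_AE[OF w(1) z]) simp
qed

lemma dirichlet_solution_smooth:
  assumes \<psi>: "smooth \<psi>"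
  defines "u \<equiv> dirichlet_solution \<Omega> q \<psi>"
  shows "u \<in> H1 \<Omega>" "(\<lambda>x. u x - \<psi> x) \<in> H10" "\<And>v. v \<in> H10 \<Longrightarrow> form q u v = 0"
proof -
  have \<psi>H: "\<psi> \<in> H1 \<Omega>" by (rule smooth_H1[OF \<psi>])
  obtain w where w: "w \<in> H10" "\<And>v. v \<in> H10 \<Longrightarrow> form q w v = form q \<psi> v"
    using solvability_form[OF \<psi>H] by blast
  let ?w = "\<lambda>x. (-1) * w x"
  have w': "?w \<in> H10" by (rule H10_cmult[OF w(1)])
  have "solves_schroedinger \<Omega> q (\<lambda>x. \<psi> x + ?w x)"
    unfolding solves_schroedinger_def
  proof (intro conjI allI impI)
    show "(\<lambda>x. \<psi> x + ?w x) \<in> H1 \<Omega>" by (intro H1_add \<psi>H H10_H1 w')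
    fix \<phi> assume "test_fun \<Omega> \<phi>"
    then have \<phi>: "\<phi> \<in> H10" by (rule test_fun_H10)
    show "form q (\<lambda>x. \<psi> x + ?w x) \<phi> = 0"
      using form_add[OF q \<psi>H H10_H1[OF w'] H10_H1[OF \<phi>]] form_cmult[OF q H10_H1[OF w(1)] H10_H1[OF \<phi>], of "-1"] w(2)[OF \<phi>]
      by simp
  qed
  moreover have "has_trace \<Omega> (\<lambda>x. \<psi> x + ?w x) \<psi>" by (rule has_trace_smooth_plus_H10[OF \<psi> w'])
  ultimately have "\<exists>u. solves_schroedinger \<Omega> q u \<and> has_trace \<Omega> u \<psi>" by blast
  from someI_ex[OF this] have u: "solves_schroedinger \<Omega> q u" "has_trace \<Omega> u \<psi>"
    unfolding u_def dirichlet_solution_def by simp_all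
  show uH: "u \<in> H1 \<Omega>" using u(1) by (simp add: solves_schroedinger_def)
  show "(\<lambda>x. u x - \<psi> x) \<in> H10" by (rule zero_trace_imp_H10[OF has_trace_diff[OF u(2) has_trace_smooth[OF \<psi>]]])
  show "form q u v = 0" if "v \<in> H10" for v
    by (rule form_zero_on_H10[OF q uH that]) (use u(1) in \<open>auto simp: solves_schroedinger_def\<close>)
qed

text \<open>
  The definition evaluates the form at an arbitrary function with trace \<open>\<theta>\<close>. It differs from
  \<open>\<theta>\<close> by an element of \<open>H10\<close>, on which the form of a solution vanishes.
\<close>

lemma dn_map_smooth:
  assumes \<psi>: "smooth \<psi>" and \<theta>: "smooth \<theta>"
  shows "dn_map \<Omega> q \<psi> \<theta> = form q (dirichlet_solution \<Omega> q \<psi>) \<theta>"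
proof -
  let ?u = "dirichlet_solution \<Omega> q \<psi>"
  define v where "v = (SOME v. has_trace \<Omega> v \<theta>)"
  have v: "has_trace \<Omega> v \<theta>" unfolding v_def by (rule someI[where P = "\<lambda>v. has_trace \<Omega> v \<theta>"], rule has_trace_smooth[OF \<theta>])
  then have vH: "v \<in> H1 \<Omega>" by (simp add: has_trace_def)
  have "(\<lambda>x. v x - \<theta> x) \<in> H10" by (rule zero_trace_imp_H10[OF has_trace_diff[OF v has_trace_smooth[OF \<theta>]]])
  then have "form q ?u (\<lambda>x. v x - \<theta> x) = 0" by (rule dirichlet_solution_smooth(3)[OF \<psi>])
  then have "form q ?u v = form q ?u \<theta>"
    using form_diff_right[OF q vH smooth_H1[OF \<theta>] dirichlet_solution_smooth(1)[OF \<psi>]] by simp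
  then show ?thesis unfolding dn_map_def using smooth_H_half[OF \<theta>] by (simp add: v_def)
qed

end

text \<open>
  The difference \<open>z\<close> of the two solutions has zero Cauchy data. The equation holds for all smooth
  \<open>\<theta>\<close>, not only for test functions, which says that \<open>z\<close> extended by zero solves
  \<open>(-\<Delta> + q2) z = (q2 - q1) u\<close> in the whole space.
\<close>

lemma dn_map_eq_imp_difference_equation:
  assumes q1: "bounded_potential q1 R" "\<not> dirichlet_eigenvalue \<Omega> q1 0"
    and q2: "bounded_potential q2 R" "\<not> dirichlet_eigenvalue \<Omega> q2 0"
    and \<psi>: "smooth \<psi>" and eq: "dn_map \<Omega> q1 \<psi> = dn_map \<Omega> q2 \<psi>"
  defines "u \<equiv> dirichlet_solution \<Omega> q1 \<psi>"
  obtains z where "z \<in> H10"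
    "\<And>\<theta>. smooth \<theta> \<Longrightarrow> form q2 z \<theta> = (LINT x|M. ((q2 x - q1 x) * u x) * \<theta> x)"
proof
  define u2 where "u2 = dirichlet_solution \<Omega> q2 \<psi>"
  note u = dirichlet_solution_smooth[OF q1 \<psi>, folded u_def]
  note u2 = dirichlet_solution_smooth[OF q2 \<psi>, folded u2_def]
  have "(\<lambda>x. (u x - \<psi> x) - (u2 x - \<psi> x)) \<in> H10" by (rule H10_diff[OF u(2) u2(2)])
  then show "(\<lambda>x. u x - u2 x) \<in> H10" by simp
  fix \<theta> :: "'a \<Rightarrow> complex" assume \<theta>: "smooth \<theta>"
  have \<theta>H: "\<theta> \<in> H1 \<Omega>" by (rule smooth_H1[OF \<theta>])
  have "form q1 u \<theta> = form q2 u2 \<theta>"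
    using dn_map_smooth[OF q1 \<psi> \<theta>] dn_map_smooth[OF q2 \<psi> \<theta>] eq by (simp add: u_def u2_def)
  then have "form q2 (\<lambda>x. u x - u2 x) \<theta> = form q2 u \<theta> - form q1 u \<theta>"
    using form_diff[OF q2(1) u(1) u2(1) \<theta>H] by simp
  also have "\<dots> = (LINT x|M. q2 x * u x * \<theta> x) - (LINT x|M. q1 x * u x * \<theta> x)"
    unfolding form_eq[OF q2(1) u(1) \<theta>H] form_eq[OF q1(1) u(1) \<theta>H] by simp
  also have "\<dots> = (LINT x|M. q2 x * u x * \<theta> x - q1 x * u x * \<theta> x)"
    by (intro Bochner_Integration.integral_diff[symmetric] L2_integrable_mult potential_mult_L2[OF q2(1)]
        potential_mult_L2[OF q1(1)] H1_L2 u(1) \<theta>H)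
  finally show "form q2 (\<lambda>x. u x - u2 x) \<theta> = (LINT x|M. ((q2 x - q1 x) * u x) * \<theta> x)"
    by (simp add: left_diff_distrib)
qed

end

section \<open>Exponential weights\<close>

lemma sum_symbol_square:
  "(\<Sum>b\<in>Basis. (Complex (a \<bullet> b) (c \<bullet> b))\<^sup>2) = Complex (a \<bullet> a - c \<bullet> c) (2 * (a \<bullet> c))"
  unfolding euclidean_inner[of a a] euclidean_inner[of c c] euclidean_inner[of a c]
  by (simp add: complex_eq_iff power2_eq_square sum_subtractf sum_distrib_left mult.commute mult.left_commute)

context bounded_open
begin

text \<open>
  Testing with exponentials replaces \<open>-\<Delta>\<close> by multiplication with minus the square of the complex
  frequency \<open>a + \<i> c\<close>.
\<close>

lemma exponential_identity:
  assumes q: "bounded_potential q R" and z: "z \<in> H10" and g: "g \<in> L2 M"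
    and eq: "\<And>a c. form q z (cexp a c) = (LINT x|M. g x * cexp a c x)"
  shows "(LINT x|M. (g x - q x * z x) * cexp a c x)
    = - (Complex (a \<bullet> a - c \<bullet> c) (2 * (a \<bullet> c)) * (LINT x|M. z x * cexp a c x))"
proof -
  have zH: "z \<in> H1 \<Omega>" by (rule H10_H1[OF z])
  have e: "smooth (cexp a c)" by (rule smooth_cexp)
  have e2: "cexp a c \<in> L2 M" by (rule smooth_L2[OF e])
  have "dirichlet_form z (cexp a c) = (\<Sum>b\<in>Basis. - ((Complex (a \<bullet> b) (c \<bullet> b))\<^sup>2 * (LINT x|M. z x * cexp a c x)))"
    unfolding dirichlet_form_smooth[OF zH e]
  proof (rule sum.cong[OF refl])
    fix b :: 'a assume b: "b \<in> Basis"
    let ?\<eta> = "Complex (a \<bullet> b) (c \<bullet> b)"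
    have "(LINT x|M. wd b z x * pd b (cexp a c) x) = ?\<eta> * (LINT x|M. wd b z x * cexp a c x)"
      unfolding pd_cexp by (simp only: mult.left_commute[of "wd b z _"] integral_mult_right_zero)
    also have "(LINT x|M. wd b z x * cexp a c x) = - (LINT x|M. z x * pd b (cexp a c) x)"
      by (rule integration_by_parts_H10[OF z e b])
    also have "(LINT x|M. z x * pd b (cexp a c) x) = ?\<eta> * (LINT x|M. z x * cexp a c x)"
      unfolding pd_cexp by (simp only: mult.left_commute[of "z _"] integral_mult_right_zero)
    finally show "(LINT x|M. wd b z x * pd b (cexp a c) x) = - (?\<eta>\<^sup>2 * (LINT x|M. z x * cexp a c x))"
      by (simp add: power2_eq_square mult.assoc)
  qed
  also have "\<dots> = - (Complex (a \<bullet> a - c \<bullet> c) (2 * (a \<bullet> c)) * (LINT x|M. z x * cexp a c x))"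
    by (simp only: sum_negf sum_distrib_right[symmetric] sum_symbol_square)
  finally have D: "dirichlet_form z (cexp a c) = \<dots>" .
  have "(LINT x|M. (g x - q x * z x) * cexp a c x) = (LINT x|M. g x * cexp a c x) - (LINT x|M. q x * z x * cexp a c x)"
    by (simp add: left_diff_distrib L2_integrable_mult g e2 potential_mult_L2[OF q] H1_L2[OF zH])
  also have "\<dots> = dirichlet_form z (cexp a c)"
    by (simp only: eq[of a c, symmetric] form_eq[OF q zH smooth_H1[OF e]] add_diff_cancel_right')
  finally show ?thesis using D by simp
qed

text \<open>
  Conjugating the Laplacian with the weight \<open>cexp a c\<close> gives, in Fourier variables, a symbol whose imaginary
  part is \<open>2 * (a \<bullet> k)\<close> up to sign. On the shifted lattice this is at least \<open>T\<close>, so that Bessel's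
  inequality for \<open>h\<close> and Parseval's identity for \<open>z\<close> compare the two weighted norms.
\<close>

lemma carleman_estimate:
  assumes z: "z \<in> L2 M" and h: "h \<in> L2 M"
    and eq: "\<And>a c. (LINT x|M. h x * cexp a c x) = - (Complex (a \<bullet> a - c \<bullet> c) (2 * (a \<bullet> c)) * (LINT x|M. z x * cexp a c x))"
    and null: "a \<bullet> c = 0" and T: "0 \<le> T" "\<And>k. k \<in> shifted_lattice L s \<Longrightarrow> T \<le> \<bar>2 * (a \<bullet> k)\<bar>"
  shows "T * L2_norm M (\<lambda>x. cexp a c x * z x) \<le> L2_norm M (\<lambda>x. cexp a c x * h x)"
proof -
  let ?vol = "(2 * L) ^ DIM('a)"
  have vol: "?vol > 0" using L_pos by simp
  have z2: "(\<lambda>x. cexp a c x * z x) \<in> L2 M" and h2: "(\<lambda>x. cexp a c x * h x) \<in> L2 M"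
    by (intro smooth_mult_L2 smooth_cexp z h)+
  have shift: "(LINT x|M. cexp a c x * f x * cexp 0 (- k) x) = (LINT x|M. f x * cexp a (c - k) x)" for f k
    by (intro Bochner_Integration.integral_cong refl) (simp add: cexp_mult mult.assoc mult.left_commute[of _ "f _"])
  have coeff: "T\<^sup>2 * (cmod (LINT x|M. cexp a c x * z x * cexp 0 (- k) x))\<^sup>2 \<le> (cmod (LINT x|M. cexp a c x * h x * cexp 0 (- k) x))\<^sup>2"
    if k: "k \<in> shifted_lattice L s" for k
  proof -
    let ?p = "Complex (a \<bullet> a - (c - k) \<bullet> (c - k)) (2 * (a \<bullet> (c - k)))"
    have "T \<le> \<bar>Im ?p\<bar>" using T(2)[OF k] null by (simp add: inner_diff_right)
    also have "\<dots> \<le> cmod ?p" by (rule abs_Im_le_cmod)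
    finally have "T * cmod (LINT x|M. z x * cexp a (c - k) x) \<le> cmod ?p * cmod (LINT x|M. z x * cexp a (c - k) x)"
      by (rule mult_right_mono) simp
    also have "\<dots> = cmod (LINT x|M. h x * cexp a (c - k) x)" by (simp add: eq norm_mult)
    finally have "(T * cmod (LINT x|M. z x * cexp a (c - k) x))\<^sup>2 \<le> (cmod (LINT x|M. h x * cexp a (c - k) x))\<^sup>2"
      using T(1) by (intro power_mono) auto
    then show ?thesis unfolding shift by (simp add: power_mult_distrib)
  qed
  have "?vol * (T * L2_norm M (\<lambda>x. cexp a c x * z x))\<^sup>2 \<le> ?vol * (L2_norm M (\<lambda>x. cexp a c x * h x))\<^sup>2"
  proof (rule field_le_epsilon)
    fix e :: real assume e: "e > 0"
    then have e': "e / (T\<^sup>2 + 1) > 0" by (simp add: add_nonneg_pos)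
    obtain F where F: "finite F" "F \<subseteq> shifted_lattice L s"
      "?vol * (LINT x|M. (cmod (cexp a c x * z x))\<^sup>2) \<le> (\<Sum>k\<in>F. (cmod (LINT x|M. cexp a c x * z x * cexp 0 (- k) x))\<^sup>2) + e / (T\<^sup>2 + 1)"
      using parseval[OF L_pos \<Omega>_lebesgue \<Omega>_sub z2 e', of s] by blast
    have "?vol * (T * L2_norm M (\<lambda>x. cexp a c x * z x))\<^sup>2 = T\<^sup>2 * (?vol * (LINT x|M. (cmod (cexp a c x * z x))\<^sup>2))"
      by (simp add: power_mult_distrib L2_norm_square)
    also have "\<dots> \<le> T\<^sup>2 * ((\<Sum>k\<in>F. (cmod (LINT x|M. cexp a c x * z x * cexp 0 (- k) x))\<^sup>2) + e / (T\<^sup>2 + 1))"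
      by (intro mult_left_mono F(3)) auto
    also have "\<dots> = (\<Sum>k\<in>F. T\<^sup>2 * (cmod (LINT x|M. cexp a c x * z x * cexp 0 (- k) x))\<^sup>2) + T\<^sup>2 * (e / (T\<^sup>2 + 1))"
      by (simp only: distrib_left sum_distrib_left)
    also have "\<dots> \<le> ?vol * (LINT x|M. (cmod (cexp a c x * h x))\<^sup>2) + e"
    proof (rule add_mono)
      have "(\<Sum>k\<in>F. T\<^sup>2 * (cmod (LINT x|M. cexp a c x * z x * cexp 0 (- k) x))\<^sup>2)
        \<le> (\<Sum>k\<in>F. (cmod (LINT x|M. cexp a c x * h x * cexp 0 (- k) x))\<^sup>2)"
        using F(2) by (intro sum_mono coeff) auto
      also have "\<dots> \<le> ?vol * (LINT x|M. (cmod (cexp a c x * h x))\<^sup>2)"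
        by (rule bessel[OF L_pos \<Omega>_lebesgue \<Omega>_sub h2 F(1,2)])
      finally show "(\<Sum>k\<in>F. T\<^sup>2 * (cmod (LINT x|M. cexp a c x * z x * cexp 0 (- k) x))\<^sup>2) \<le> \<dots>" .
      have "T\<^sup>2 * (e / (T\<^sup>2 + 1)) \<le> (T\<^sup>2 + 1) * (e / (T\<^sup>2 + 1))" using e' by (intro mult_right_mono) auto
      also have "\<dots> = e"
      proof -
        have "T\<^sup>2 + 1 \<noteq> 0" using zero_le_power2[of T] by linarith
        then show ?thesis by simp
      qed
      finally show "T\<^sup>2 * (e / (T\<^sup>2 + 1)) \<le> e" .
    qed
    finally show "?vol * (T * L2_norm M (\<lambda>x. cexp a c x * z x))\<^sup>2 \<le> ?vol * (L2_norm M (\<lambda>x. cexp a c x * h x))\<^sup>2 + e"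
      by (simp only: L2_norm_square)
  qed
  then have "(T * L2_norm M (\<lambda>x. cexp a c x * z x))\<^sup>2 \<le> (L2_norm M (\<lambda>x. cexp a c x * h x))\<^sup>2"
    using vol by (simp only: mult_le_cancel_left_pos)
  then show ?thesis by (rule power2_le_imp_le) simp
qed

text \<open>
  For a frequency of square zero the exponential is harmonic, so the moment of \<open>g - q z\<close> vanishes and
  that of \<open>g\<close> equals that of \<open>q z\<close>. The latter is small by the Carleman estimate, in which the term
  \<open>q z\<close> on the right-hand side is absorbed since \<open>2 R \<le> T\<close>.
\<close>

lemma exponential_moment_bound:
  assumes q: "bounded_potential q R" and z: "z \<in> H10" and g: "g \<in> L2 M"
    and eq: "\<And>\<theta>. smooth \<theta> \<Longrightarrow> form q z \<theta> = (LINT x|M. g x * \<theta> x)"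
    and null: "a \<bullet> a = c \<bullet> c" "a \<bullet> c = 0"
    and T: "0 < T" "2 * R \<le> T" "\<And>k. k \<in> shifted_lattice L s \<Longrightarrow> T \<le> \<bar>2 * (a \<bullet> k)\<bar>"
  shows "cmod (LINT x|M. g x * cexp a c x) \<le> 2 * R / T * L2_norm M (\<lambda>x. 1) * L2_norm M (\<lambda>x. cexp a c x * g x)"
proof -
  have R: "R \<ge> 0" using q by (simp add: bounded_potential_def)
  have zL: "z \<in> L2 M" by (rule H1_L2[OF H10_H1[OF z]])
  define h where "h x = g x - q x * z x" for x
  have qz: "(\<lambda>x. q x * z x) \<in> L2 M" by (rule potential_mult_L2[OF q zL])
  have h2: "h \<in> L2 M" unfolding h_def by (rule L2_diff[OF g qz])
  have e: "smooth (cexp a c)" by (rule smooth_cexp)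
  have id: "(LINT x|M. h x * cexp a c x) = - (Complex (a \<bullet> a - c \<bullet> c) (2 * (a \<bullet> c)) * (LINT x|M. z x * cexp a c x))" for a c
    unfolding h_def by (rule exponential_identity[OF q z g]) (rule eq[OF smooth_cexp])
  define X where "X = L2_norm M (\<lambda>x. cexp a c x * z x)"
  define Y where "Y = L2_norm M (\<lambda>x. cexp a c x * g x)"
  have X0: "X \<ge> 0" by (simp add: X_def)
  have ez: "(\<lambda>x. cexp a c x * z x) \<in> L2 M" and eg: "(\<lambda>x. cexp a c x * g x) \<in> L2 M"
    by (intro smooth_mult_L2 e zL g)+
  have "T * X \<le> L2_norm M (\<lambda>x. cexp a c x * h x)"
    unfolding X_def using T by (intro carleman_estimate[OF zL h2 id null(2)]) auto
  also have "(\<lambda>x. cexp a c x * h x) = (\<lambda>x. cexp a c x * g x + (-1) * (q x * (cexp a c x * z x)))"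
    by (simp add: h_def fun_eq_iff algebra_simps)
  also have "L2_norm M \<dots> \<le> Y + L2_norm M (\<lambda>x. (-1) * (q x * (cexp a c x * z x)))"
    unfolding Y_def by (intro L2_norm_triangle eg L2_cmult potential_mult_L2[OF q] ez finite_M)
  also have "L2_norm M (\<lambda>x. (-1) * (q x * (cexp a c x * z x))) = L2_norm M (\<lambda>x. q x * (cexp a c x * z x))"
    by (subst L2_norm_cmult) simp
  also have "\<dots> \<le> R * X" unfolding X_def by (rule L2_norm_potential_mult[OF q ez])
  finally have "T * X \<le> Y + R * X" by simp
  moreover have "R * X \<le> T / 2 * X" using T(2) X0 by (intro mult_right_mono) auto
  ultimately have "T * X \<le> 2 * Y" by simp
  then have X: "X \<le> 2 * Y / T" using T(1) by (simp add: pos_le_divide_eq mult.commute)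
  have "(LINT x|M. h x * cexp a c x) = 0" unfolding id using null by (simp flip: zero_complex.code)
  moreover have "(LINT x|M. h x * cexp a c x) = (LINT x|M. g x * cexp a c x) - (LINT x|M. q x * z x * cexp a c x)"
    unfolding h_def by (simp add: left_diff_distrib L2_integrable_mult g qz smooth_L2[OF e])
  ultimately have "(LINT x|M. g x * cexp a c x) = (LINT x|M. (q x * 1) * (cexp a c x * z x))"
    by (simp add: mult_ac)
  also have "cmod \<dots> \<le> L2_norm M (\<lambda>x. q x * 1) * X"
    unfolding X_def by (intro L2_cauchy_schwarz finite_M potential_mult_L2[OF q] smooth_L2 smooth_const ez)
  also have "\<dots> \<le> (R * L2_norm M (\<lambda>x. 1)) * (2 * Y / T)"
    using R by (intro mult_mono X X0 L2_norm_potential_mult[OF q] smooth_L2 smooth_const) auto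
  finally show ?thesis unfolding Y_def by (simp add: mult_ac)
qed

end

context bounded_domain
begin

text \<open>
  Complex geometrical optics solutions \<open>cexp a c * (1 + r)\<close> with \<open>r\<close> of size \<open>1 / T\<close>, obtained by
  duality. If \<open>g\<close> annihilates all solutions with smooth Dirichlet data, the solution \<open>z\<close> of the Dirichlet problem
  with right-hand side \<open>g\<close> satisfies its equation in the whole space, and the preceding bound shows that
  \<open>g\<close> nearly annihilates the exponential. Hence the exponential is close to the space of these solutions.
\<close>

lemma approximate_cgo_solution:
  assumes q: "bounded_potential q R" and nev: "\<not> dirichlet_eigenvalue \<Omega> q 0"
    and null: "a \<bullet> a = c \<bullet> c" "a \<bullet> c = 0"
    and T: "0 < T" "2 * R \<le> T" "\<And>k. k \<in> shifted_lattice L s \<Longrightarrow> T \<le> \<bar>2 * (a \<bullet> k)\<bar>"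
    and "e > 0"
  obtains \<psi> where "smooth \<psi>"
    "L2_norm M (\<lambda>x. cexp (- a) (- c) x * dirichlet_solution \<Omega> q \<psi> x - 1) < 2 * R / T * L2_norm M (\<lambda>x. 1) + e"
proof -
  have R: "R \<ge> 0" using q by (simp add: bounded_potential_def)
  interpret H: hilbert_on "L2 M" "L2_ip M" by (rule hilbert_on_L2[OF finite_M])
  have nrm: "H.nrm f = L2_norm M f" if "f \<in> L2 M" for f using that by (simp add: H.nrm_def L2_norm_def L2_ip_self)
  let ?E = "cexp (- a) (- c)"
  have E: "smooth ?E" by (rule smooth_cexp)
  define Sol where "Sol = {v \<in> H1 \<Omega>. (\<exists>\<psi>. smooth \<psi> \<and> (\<lambda>x. v x - \<psi> x) \<in> H10) \<and> (\<forall>w\<in>H10. form q v w = 0)}"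
  have Sol_L2: "v \<in> L2 M" if "v \<in> Sol" for v using that H1_L2 by (auto simp: Sol_def)
  have Sol_add: "(\<lambda>x. u x + v x) \<in> Sol" if uv: "u \<in> Sol" "v \<in> Sol" for u v
  proof -
    obtain \<psi> \<theta> where s: "smooth \<psi>" "(\<lambda>x. u x - \<psi> x) \<in> H10" "smooth \<theta>" "(\<lambda>x. v x - \<theta> x) \<in> H10"
      using uv by (auto simp: Sol_def)
    have "(\<lambda>x. (u x - \<psi> x) + (v x - \<theta> x)) \<in> H10" by (rule H10_add[OF s(2,4)])
    also have "(\<lambda>x. (u x - \<psi> x) + (v x - \<theta> x)) = (\<lambda>x. u x + v x - (\<psi> x + \<theta> x))" by (simp add: fun_eq_iff)
    finally have "\<exists>\<psi>. smooth \<psi> \<and> (\<lambda>x. u x + v x - \<psi> x) \<in> H10"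
      using smooth_add[OF s(1,3)] by (intro exI[of _ "\<lambda>x. \<psi> x + \<theta> x"]) simp
    then show ?thesis using uv form_add[OF q] H10_H1 H1_add by (auto simp: Sol_def)
  qed
  have Sol_cmult: "(\<lambda>x. d * u x) \<in> Sol" if u: "u \<in> Sol" for d u
  proof -
    obtain \<psi> where s: "smooth \<psi>" "(\<lambda>x. u x - \<psi> x) \<in> H10" using u by (auto simp: Sol_def)
    have "(\<lambda>x. d * (u x - \<psi> x)) \<in> H10" by (rule H10_cmult[OF s(2)])
    then have "\<exists>\<psi>. smooth \<psi> \<and> (\<lambda>x. d * u x - \<psi> x) \<in> H10"
      using smooth_cmult[OF s(1), of d] by (intro exI[of _ "\<lambda>x. d * \<psi> x"]) (simp add: right_diff_distrib)
    then show ?thesis using u form_cmult[OF q] H10_H1 H1_cmult by (auto simp: Sol_def)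
  qed
  have ds_Sol: "dirichlet_solution \<Omega> q \<theta> \<in> Sol" if "smooth \<theta>" for \<theta>
    using dirichlet_solution_smooth[OF q nev that] that by (auto simp: Sol_def)
  define U where "U = (\<lambda>v x. ?E x * v x) ` Sol"
  have U: "subspace U" "U \<subseteq> L2 M"
  proof -
    show "U \<subseteq> L2 M" unfolding U_def using Sol_L2 smooth_mult_L2[OF E] by auto
    have "(\<lambda>x. 0) \<in> Sol" using Sol_cmult[OF ds_Sol[OF smooth_const[of 0]], of 0] by simp
    then have "0 \<in> U" unfolding U_def by (auto simp: zero_fun_def image_iff intro!: bexI[of _ "\<lambda>x. 0"])
    moreover have "u + v \<in> U" if "u \<in> U" "v \<in> U" for u v
    proof -
      obtain u' v' where "u' \<in> Sol" "v' \<in> Sol" "u = (\<lambda>x. ?E x * u' x)" "v = (\<lambda>x. ?E x * v' x)"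
        using \<open>u \<in> U\<close> \<open>v \<in> U\<close> by (auto simp: U_def)
      then show ?thesis unfolding U_def
        by (intro image_eqI[OF _ Sol_add[of u' v']]) (auto simp: fun_eq_iff distrib_left)
    qed
    moreover have "r *\<^sub>R u \<in> U" if "u \<in> U" for u r
    proof -
      obtain u' where "u' \<in> Sol" "u = (\<lambda>x. ?E x * u' x)" using \<open>u \<in> U\<close> by (auto simp: U_def)
      then show ?thesis unfolding U_def
        by (intro image_eqI[OF _ Sol_cmult[of u' "of_real r"]]) (auto simp: fun_eq_iff scaleR_conv_of_real)
    qed
    ultimately show "subspace U" by (simp add: subspace_def)
  qed
  have one: "(\<lambda>x. 1) \<in> L2 M" by (rule smooth_L2[OF smooth_const])
  define \<delta> where "\<delta> = 2 * R / T * L2_norm M (\<lambda>x. 1)"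
  have \<delta>: "\<delta> \<ge> 0" using R T by (simp add: \<delta>_def)
  have orth: "\<bar>L2_ip M (\<lambda>x. 1) g0\<bar> \<le> \<delta> * H.nrm g0" if g0: "g0 \<in> L2 M" and perp: "\<And>u. u \<in> U \<Longrightarrow> L2_ip M g0 u = 0" for g0
  proof -
    define g where "g x = ?E x * cnj (g0 x)" for x
    have g: "g \<in> L2 M" unfolding g_def by (rule smooth_mult_L2[OF E L2_cnj[OF g0]])
    have gv: "(LINT x|M. g x * v x) = 0" if v: "v \<in> Sol" for v
    proof -
      have "Re (d * (LINT x|M. g x * v x)) = 0" for d
      proof -
        have "(\<lambda>x. ?E x * (d * v x)) \<in> U" unfolding U_def using Sol_cmult[OF v] by auto
        then have "L2_ip M (\<lambda>x. ?E x * (d * v x)) g0 = 0"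
          using perp[of "\<lambda>x. ?E x * (d * v x)"] L2_ip_commute[OF g0, of "\<lambda>x. ?E x * (d * v x)"] U(2) by auto
        moreover have "(LINT x|M. ?E x * (d * v x) * cnj (g0 x)) = (LINT x|M. d * (g x * v x))"
          by (simp add: g_def mult_ac)
        ultimately show ?thesis by (simp add: L2_ip_def)
      qed
      from this[of 1] this[of "- \<i>"] show ?thesis by (simp add: complex_eq_iff)
    qed
    obtain z where z: "z \<in> H10" "\<And>v. v \<in> H10 \<Longrightarrow> form q z v = (LINT x|M. g x * v x)"
      using solvability_L2[OF q nev g] by blast
    have zH: "z \<in> H1 \<Omega>" by (rule H10_H1[OF z(1)])
    have eq: "form q z \<theta> = (LINT x|M. g x * \<theta> x)" if \<theta>: "smooth \<theta>" for \<theta>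
    proof -
      let ?v = "dirichlet_solution \<Omega> q \<theta>"
      note v = dirichlet_solution_smooth[OF q nev \<theta>]
      have \<theta>H: "\<theta> \<in> H1 \<Omega>" by (rule smooth_H1[OF \<theta>])
      have "form q z ?v - form q z \<theta> = (LINT x|M. g x * (?v x - \<theta> x))"
        using z(2)[OF v(2)] form_diff_right[OF q v(1) \<theta>H zH] by simp
      also have "\<dots> = (LINT x|M. g x * ?v x) - (LINT x|M. g x * \<theta> x)"
        by (simp add: right_diff_distrib L2_integrable_mult g H1_L2 v(1) \<theta>H)
      also have "(LINT x|M. g x * ?v x) = 0" by (rule gv[OF ds_Sol[OF \<theta>]])
      finally show ?thesis using v(3)[OF z(1)] form_commute[OF q v(1) zH] by simp
    qed
    have gE: "cexp a c x * g x = cnj (g0 x)" for x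
      unfolding g_def using cexp_mult[of a c x "- a" "- c"] by (simp flip: mult.assoc)
    have "cmod (LINT x|M. cexp a c x * g x) \<le> \<delta> * L2_norm M (\<lambda>x. cexp a c x * g x)"
      using exponential_moment_bound[OF q z(1) g eq null T] unfolding \<delta>_def by (simp only: mult.commute)
    then have "cmod (LINT x|M. cnj (g0 x)) \<le> \<delta> * L2_norm M g0"
      unfolding gE by (simp add: L2_norm_def)
    then show ?thesis
      unfolding L2_ip_def nrm[OF g0] using abs_Re_le_cmod[of "LINT x|M. cnj (g0 x)"] by simp
  qed
  obtain u where u: "u \<in> U" "H.nrm ((\<lambda>x. 1) - u) < \<delta> + e"
    using H.approximable_by_annihilator_bound[OF U one \<delta> orth \<open>e > 0\<close>] by blast
  obtain v where v: "v \<in> Sol" "u = (\<lambda>x. ?E x * v x)" using u(1) by (auto simp: U_def)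
  then obtain \<psi> where \<psi>: "smooth \<psi>" "(\<lambda>x. v x - \<psi> x) \<in> H10" "v \<in> H1 \<Omega>" "\<And>w. w \<in> H10 \<Longrightarrow> form q v w = 0"
    by (auto simp: Sol_def)
  let ?d = "dirichlet_solution \<Omega> q \<psi>"
  note d = dirichlet_solution_smooth[OF q nev \<psi>(1)]
  have "(\<lambda>x. (?d x - \<psi> x) - (v x - \<psi> x)) \<in> H10" by (rule H10_diff[OF d(2) \<psi>(2)])
  then have dv: "(\<lambda>x. ?d x - v x) \<in> H10" by simp
  have "AE x in M. ?d x - v x = 0"
  proof (rule AE_zero_if_solves_with_zero_trace[OF q nev H10_H1[OF dv] _ has_trace_H10[OF dv]])
    fix \<phi> assume "test_fun \<Omega> \<phi>"
    then have "\<phi> \<in> H10" by (rule test_fun_H10)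
    then show "form q (\<lambda>x. ?d x - v x) \<phi> = 0" using form_diff[OF q d(1) \<psi>(3) H10_H1] d(3) \<psi>(4) by simp
  qed
  then have ae: "AE x in M. cmod (?E x * ?d x - 1) = cmod (((\<lambda>x. 1) - u) x)"
    by eventually_elim (simp add: v(2) norm_minus_commute)
  have "u \<in> L2 M" using u(1) U(2) by blast
  have m: "(\<lambda>x. ?E x * ?d x - 1) \<in> L2 M" by (intro L2_diff smooth_mult_L2 E H1_L2 d(1) one)
  have "L2_norm M (\<lambda>x. ?E x * ?d x - 1) = L2_norm M ((\<lambda>x. 1) - u)"
    by (rule L2_norm_cong_AE[OF L2_measurable[OF m] L2_measurable[OF H.V_diff[OF one \<open>u \<in> L2 M\<close>]] ae])
  also have "\<dots> < \<delta> + e" using u(2) nrm[OF H.V_diff[OF one \<open>u \<in> L2 M\<close>]] by simp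
  finally show ?thesis using that[OF \<psi>(1)] unfolding \<delta>_def by blast
qed

text \<open>
  Let \<open>u = cexp (- a) c1 * U\<close> be an approximate complex geometrical optics solution for \<open>q1\<close>, with
  \<open>U\<close> close to \<open>1\<close>. The moment of \<open>(q2 - q1) u\<close> against \<open>cexp a c2\<close> is small by the difference
  equation, and it equals the Fourier coefficient of \<open>(q2 - q1) U\<close> at \<open>c1 + c2\<close>.
\<close>

lemma fourier_coefficient_bound:
  assumes q1: "bounded_potential q1 R" "\<not> dirichlet_eigenvalue \<Omega> q1 0"
    and q2: "bounded_potential q2 R" "\<not> dirichlet_eigenvalue \<Omega> q2 0"
    and w: "bounded_potential (\<lambda>x. q2 x - q1 x) P"
    and \<psi>: "smooth \<psi>" and dn: "dn_map \<Omega> q1 \<psi> = dn_map \<Omega> q2 \<psi>"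
    and null: "a \<bullet> a = c2 \<bullet> c2" "a \<bullet> c2 = 0"
    and T: "0 < T" "2 * R \<le> T" "\<And>k. k \<in> shifted_lattice L s \<Longrightarrow> T \<le> \<bar>2 * (a \<bullet> k)\<bar>"
    and \<delta>: "L2_norm M (\<lambda>x. cexp a (- c1) x * dirichlet_solution \<Omega> q1 \<psi> x - 1) \<le> \<delta>"
  defines "V \<equiv> L2_norm M (\<lambda>x. 1)"
  shows "cmod (LINT x|M. (q2 x - q1 x) * cexp 0 (c1 + c2) x) \<le> (2 * R / T * V * (V + \<delta>) + V * \<delta>) * P"
proof -
  have R: "R \<ge> 0" "P \<ge> 0" using q1 w by (auto simp: bounded_potential_def)
  let ?w = "\<lambda>x. q2 x - q1 x" and ?u = "dirichlet_solution \<Omega> q1 \<psi>" and ?e = "cexp 0 (c1 + c2)"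
  note u = dirichlet_solution_smooth[OF q1 \<psi>]
  obtain z where z: "z \<in> H10" "\<And>\<theta>. smooth \<theta> \<Longrightarrow> form q2 z \<theta> = (LINT x|M. (?w x * ?u x) * \<theta> x)"
    using dn_map_eq_imp_difference_equation[OF q1 q2 \<psi> dn] by blast
  have wu: "(\<lambda>x. ?w x * ?u x) \<in> L2 M" by (rule potential_mult_L2[OF w H1_L2[OF u(1)]])
  define U where "U x = cexp a (- c1) x * ?u x" for x
  define \<rho> where "\<rho> x = U x - 1" for x
  have one: "(\<lambda>x. 1) \<in> L2 M" by (rule smooth_L2[OF smooth_const])
  have U2: "U \<in> L2 M" unfolding U_def by (intro smooth_mult_L2 smooth_cexp H1_L2 u(1))
  have \<rho>2: "\<rho> \<in> L2 M" unfolding \<rho>_def by (rule L2_diff[OF U2 one])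
  have \<rho>n: "L2_norm M \<rho> \<le> \<delta>" using \<delta> unfolding \<rho>_def U_def .
  have Un: "L2_norm M U \<le> V + \<delta>"
    using L2_norm_triangle[OF one \<rho>2 finite_M] \<rho>n by (simp add: \<rho>_def V_def)
  have key: "cexp a c2 x * (?w x * ?u x) = ?e x * (?w x * U x)" for x
  proof -
    have "?e x * cexp a (- c1) x = cexp a c2 x" by (simp add: cexp_mult)
    then show ?thesis unfolding U_def by (metis mult.assoc mult.commute)
  qed
  have wU: "(\<lambda>x. ?w x * U x) \<in> L2 M" by (rule potential_mult_L2[OF w U2])
  have 1: "cmod (LINT x|M. ?e x * (?w x * U x)) \<le> 2 * R / T * V * (P * (V + \<delta>))"
  proof -
    have "cmod (LINT x|M. cexp a c2 x * (?w x * ?u x)) \<le> 2 * R / T * V * L2_norm M (\<lambda>x. cexp a c2 x * (?w x * ?u x))"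
      using exponential_moment_bound[OF q2(1) z(1) wu z(2) null T] unfolding V_def by (simp only: mult.commute)
    then have "cmod (LINT x|M. ?e x * (?w x * U x)) \<le> 2 * R / T * V * L2_norm M (\<lambda>x. ?e x * (?w x * U x))"
      unfolding key .
    also have "L2_norm M (\<lambda>x. ?e x * (?w x * U x)) = L2_norm M (\<lambda>x. ?w x * U x)"
      by (simp add: L2_norm_def norm_mult)
    also have "2 * R / T * V * L2_norm M (\<lambda>x. ?w x * U x) \<le> 2 * R / T * V * (P * (V + \<delta>))"
    proof (intro mult_left_mono)
      show "L2_norm M (\<lambda>x. ?w x * U x) \<le> P * (V + \<delta>)"
        using L2_norm_potential_mult[OF w U2] mult_left_mono[OF Un R(2)] by linarith
    qed (use R T in \<open>auto simp: V_def\<close>)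
    finally show ?thesis .
  qed
  have we: "(\<lambda>x. ?w x * 1) \<in> L2 M" by (rule potential_mult_L2[OF w one])
  have e\<rho>: "(\<lambda>x. ?e x * \<rho> x) \<in> L2 M" by (rule smooth_mult_L2[OF smooth_cexp \<rho>2])
  have 2: "cmod (LINT x|M. (?w x * 1) * (?e x * \<rho> x)) \<le> P * V * \<delta>"
  proof -
    have "cmod (LINT x|M. (?w x * 1) * (?e x * \<rho> x)) \<le> L2_norm M (\<lambda>x. ?w x * 1) * L2_norm M (\<lambda>x. ?e x * \<rho> x)"
      by (rule L2_cauchy_schwarz[OF finite_M we e\<rho>])
    also have "L2_norm M (\<lambda>x. ?e x * \<rho> x) = L2_norm M \<rho>" by (simp add: L2_norm_def norm_mult)
    also have "L2_norm M (\<lambda>x. ?w x * 1) * L2_norm M \<rho> \<le> (P * V) * \<delta>"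
      unfolding V_def using R by (intro mult_mono \<rho>n L2_norm_potential_mult[OF w one]) auto
    finally show ?thesis .
  qed
  have "(LINT x|M. ?w x * ?e x) = (LINT x|M. ?e x * (?w x * U x) - (?w x * 1) * (?e x * \<rho> x))"
    by (intro Bochner_Integration.integral_cong refl) (simp add: \<rho>_def algebra_simps)
  also have "\<dots> = (LINT x|M. ?e x * (?w x * U x)) - (LINT x|M. (?w x * 1) * (?e x * \<rho> x))"
    by (intro Bochner_Integration.integral_diff L2_integrable_mult smooth_L2 smooth_cexp wU we e\<rho>)
  finally have "cmod (LINT x|M. ?w x * ?e x) \<le> 2 * R / T * V * (P * (V + \<delta>)) + P * V * \<delta>"
    using 1 2 norm_triangle_ineq4[of "LINT x|M. ?e x * (?w x * U x)" "LINT x|M. (?w x * 1) * (?e x * \<rho> x)"] by simp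
  then show ?thesis by (simp add: algebra_simps)
qed

end

text \<open>
  The vector \<open>a\<close> is a multiple of an integer vector \<open>m\<close> orthogonal to \<open>\<xi>\<close>, supported on two
  coordinates. Its product with lattice vectors takes values in a discrete group, and the shift \<open>s\<close> moves these
  values half a step away from zero. A unit vector \<open>\<omega>\<close> orthogonal to both \<open>\<xi>\<close> and \<open>m\<close>, which exists
  since the dimension is at least three, serves to give \<open>c1\<close> and \<open>c2\<close> the length of \<open>a\<close>.
\<close>

lemma phase_vectors:
  fixes \<xi> :: "'a::euclidean_space"
  assumes d: "DIM('a) \<ge> 3" and L: "L > 0" and \<xi>: "\<xi> \<in> torus_lattice L" and T: "T > 0"
  obtains a c1 c2 s where "a \<bullet> a = c1 \<bullet> c1" "a \<bullet> c1 = 0" "a \<bullet> a = c2 \<bullet> c2" "a \<bullet> c2 = 0" "c1 + c2 = \<xi>"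
    "\<And>k. k \<in> shifted_lattice L s \<Longrightarrow> T \<le> \<bar>2 * (a \<bullet> k)\<bar>"
proof -
  define \<kappa> where "\<kappa> = pi / L"
  have \<kappa>: "\<kappa> > 0" using L by (simp add: \<kappa>_def)
  obtain n :: "'a \<Rightarrow> int" where n: "\<And>b. b \<in> Basis \<Longrightarrow> \<xi> \<bullet> b = \<kappa> * of_int (n b)"
    using \<xi> unfolding torus_lattice_def mem_Collect_eq \<kappa>_def by metis
  obtain b1 b2 :: 'a where b: "b1 \<in> Basis" "b2 \<in> Basis" "b1 \<noteq> b2"
  proof -
    have "\<not> card (Basis :: 'a set) \<le> Suc 0" using d by simp
    then show ?thesis using that by (auto simp: card_le_Suc0_iff_eq)
  qed
  define i j :: int where "i = (if n b1 = 0 \<and> n b2 = 0 then 1 else n b2)" and "j = (if n b1 = 0 \<and> n b2 = 0 then 0 else - n b1)"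
  define m where "m = of_int i *\<^sub>R b1 + of_int j *\<^sub>R b2"
  have mb: "m \<bullet> b1 = of_int i" "m \<bullet> b2 = of_int j"
    using b by (auto simp: m_def inner_add_left inner_Basis)
  have m0: "m \<noteq> 0"
  proof
    assume "m = 0"
    then have "i = 0" "j = 0" using mb by auto
    then show False by (auto simp: i_def j_def split: if_splits)
  qed
  have m\<xi>: "m \<bullet> \<xi> = 0"
    using n[OF b(1)] n[OF b(2)] unfolding m_def
    by (auto simp: inner_add_left inner_diff_left inner_diff_right inner_commute[of _ \<xi>] i_def j_def)
  define s where "s = (\<kappa> / (2 * (m \<bullet> m))) *\<^sub>R m"
  have ms: "m \<bullet> s = \<kappa> / 2" using m0 by (simp add: s_def)
  have low: "\<kappa> / 2 \<le> \<bar>m \<bullet> k\<bar>" if k: "k \<in> shifted_lattice L s" for k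
  proof -
    obtain l where l: "l \<in> torus_lattice L" "k = s + l" using k by blast
    obtain n1 n2 :: int where "l \<bullet> b1 = \<kappa> * of_int n1" "l \<bullet> b2 = \<kappa> * of_int n2"
      using l(1) b unfolding torus_lattice_def \<kappa>_def by blast
    then have "m \<bullet> l = \<kappa> * of_int (i * n1 + j * n2)"
      unfolding m_def by (simp add: inner_add_left inner_commute[of _ l] algebra_simps)
    then have "m \<bullet> k = \<kappa> * (of_int (i * n1 + j * n2) + 1/2)"
      using ms l(2) by (simp add: inner_add_right algebra_simps)
    moreover have half: "1/2 \<le> \<bar>real_of_int (i * n1 + j * n2) + 1/2\<bar>"
    proof (cases "0 \<le> i * n1 + j * n2")
      case True
      then have "0 \<le> real_of_int (i * n1 + j * n2)" by (simp only: of_int_0_le_iff)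
      then show ?thesis by linarith
    next
      case False
      then have "i * n1 + j * n2 \<le> - 1" by simp
      then have "real_of_int (i * n1 + j * n2) \<le> real_of_int (- 1)" by (simp only: of_int_le_iff)
      then show ?thesis by simp
    qed
    from half have "\<kappa> * (1/2) \<le> \<kappa> * \<bar>real_of_int (i * n1 + j * n2) + 1/2\<bar>"
      using \<kappa> by (intro mult_left_mono) auto
    ultimately show ?thesis using \<kappa> by (simp only: abs_mult abs_of_pos)
  qed
  have "dim {\<xi>, m} < DIM('a)"
  proof -
    have "dim {\<xi>, m} \<le> card {\<xi>, m}" by (rule dim_le_card') simp
    also have "\<dots> \<le> 2" by (simp add: card_insert_if)
    finally show ?thesis using d by simp
  qed
  then obtain w where w: "w \<noteq> 0" "\<And>y. y \<in> span {\<xi>, m} \<Longrightarrow> orthogonal w y"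
    using orthogonal_to_subspace_exists[of "{\<xi>, m}"] by blast
  define \<omega> where "\<omega> = (1 / norm w) *\<^sub>R w"
  have \<omega>: "\<omega> \<bullet> \<omega> = 1" "\<omega> \<bullet> \<xi> = 0" "\<omega> \<bullet> m = 0"
    using w by (auto simp: \<omega>_def orthogonal_def span_base dot_square_norm power2_eq_square)
  \<comment> \<open>The first bound makes \<open>|2 a \<bullet> k|\<close> at least \<open>T\<close>; the second one makes \<open>a\<close> long enough for \<open>\<sigma>\<close> to be real.\<close>
  define t where "t = max (T / \<kappa>) (norm \<xi> / norm m)"
  have t: "T \<le> t * \<kappa>" "norm \<xi> \<le> t * norm m" "t > 0"
  proof -
    have "T / \<kappa> \<le> t" "norm \<xi> / norm m \<le> t" by (auto simp: t_def)
    then show "T \<le> t * \<kappa>" "norm \<xi> \<le> t * norm m" using \<kappa> m0 by (auto simp: pos_divide_le_eq)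
    have "0 < T / \<kappa>" using T \<kappa> by simp
    then show "t > 0" using \<open>T / \<kappa> \<le> t\<close> by linarith
  qed
  define \<sigma> where "\<sigma> = sqrt ((t * norm m)\<^sup>2 - (norm \<xi>)\<^sup>2 / 4)"
  have "(norm \<xi>)\<^sup>2 \<le> (t * norm m)\<^sup>2" using t(2) by (intro power_mono) auto
  moreover have "0 \<le> (norm \<xi>)\<^sup>2" by simp
  ultimately have "0 \<le> (t * norm m)\<^sup>2 - (norm \<xi>)\<^sup>2 / 4" by linarith
  then have \<sigma>: "\<sigma> * \<sigma> = t * t * (m \<bullet> m) - (\<xi> \<bullet> \<xi>) / 4"
    unfolding \<sigma>_def by (simp add: power_mult_distrib power2_eq_square flip: power2_norm_eq_inner)
  show ?thesis
  proof (rule that[of "t *\<^sub>R m" "(1/2) *\<^sub>R \<xi> - \<sigma> *\<^sub>R \<omega>" "(1/2) *\<^sub>R \<xi> + \<sigma> *\<^sub>R \<omega>" s])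
    show "(t *\<^sub>R m) \<bullet> (t *\<^sub>R m) = ((1/2) *\<^sub>R \<xi> - \<sigma> *\<^sub>R \<omega>) \<bullet> ((1/2) *\<^sub>R \<xi> - \<sigma> *\<^sub>R \<omega>)"
      "(t *\<^sub>R m) \<bullet> (t *\<^sub>R m) = ((1/2) *\<^sub>R \<xi> + \<sigma> *\<^sub>R \<omega>) \<bullet> ((1/2) *\<^sub>R \<xi> + \<sigma> *\<^sub>R \<omega>)"
      using \<sigma> \<omega> by (simp_all add: inner_diff_left inner_diff_right inner_add_left inner_add_right inner_commute[of \<xi> \<omega>])
    show "(t *\<^sub>R m) \<bullet> ((1/2) *\<^sub>R \<xi> - \<sigma> *\<^sub>R \<omega>) = 0" "(t *\<^sub>R m) \<bullet> ((1/2) *\<^sub>R \<xi> + \<sigma> *\<^sub>R \<omega>) = 0"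
      using m\<xi> \<omega>(3) by (simp_all add: inner_diff_right inner_add_right inner_commute[of m \<omega>])
    show "(1/2) *\<^sub>R \<xi> - \<sigma> *\<^sub>R \<omega> + ((1/2) *\<^sub>R \<xi> + \<sigma> *\<^sub>R \<omega>) = \<xi>"
      by (simp add: scaleR_left_distrib[symmetric])
    fix k assume "k \<in> shifted_lattice L s"
    then have "t * \<kappa> \<le> t * (2 * \<bar>m \<bullet> k\<bar>)"
      using low[of k] t(3) by (intro mult_left_mono) auto
    from order_trans[OF t(1) this] show "T \<le> \<bar>2 * ((t *\<^sub>R m) \<bullet> k)\<bar>"
      using t(3) by (simp add: abs_mult mult.left_commute)
  qed
qed

section \<open>Potentials in a finite-dimensional space\<close>

context bounded_domain
begin

definition Linf_seminorm :: "('a \<Rightarrow> complex) \<Rightarrow> real" where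
  "Linf_seminorm w = real_of_ereal (Linf_norm \<Omega> w)"

lemma Linf_measurable: "w \<in> Linf \<Omega> \<Longrightarrow> w \<in> borel_measurable M"
  by (simp add: Linf_def)

lemma AE_le_Linf_norm: "AE x in M. ereal (cmod (w x)) \<le> Linf_norm \<Omega> w"
  unfolding Linf_norm_def by (rule esssup_AE)

lemma Linf_norm_leI:
  assumes "w \<in> borel_measurable M" "AE x in M. cmod (w x) \<le> C" shows "Linf_norm \<Omega> w \<le> ereal C"
  unfolding Linf_norm_def
proof (rule esssup_I)
  show "(\<lambda>x. ereal (cmod (w x))) \<in> borel_measurable M" using assms(1) by measurable
  show "AE x in M. ereal (cmod (w x)) \<le> ereal C" using assms(2) by simp
qed

lemma LinfI: "w \<in> borel_measurable M \<Longrightarrow> AE x in M. cmod (w x) \<le> C \<Longrightarrow> w \<in> Linf \<Omega>"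
  using Linf_norm_leI[of w C] by (auto simp: Linf_def intro: le_less_trans)

lemma bounded_potential_if_Linf_norm_le:
  assumes "w \<in> Linf \<Omega>" "Linf_norm \<Omega> w \<le> ereal R" "R \<ge> 0" shows "bounded_potential w R"
proof -
  have "AE x in M. cmod (w x) \<le> R"
    using AE_le_Linf_norm[of w] by eventually_elim (use assms(2) in \<open>auto dest: order_trans\<close>)
  then show ?thesis using assms by (simp add: bounded_potential_def Linf_def)
qed

context
  assumes nonempty: "\<Omega> \<noteq> {}"
begin

text \<open>
  A nonempty open set has positive measure.
\<close>

lemma AE_const_M: "(AE x in M. P) \<longleftrightarrow> P"
proof -
  have "\<not> negligible \<Omega>" using open_not_negligible[OF open_\<Omega> nonempty] .
  then have "emeasure M (space M) \<noteq> 0"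
    by (auto simp: emeasure_restrict_space negligible_iff_null_sets null_sets_def)
  then have "\<not> (AE x in M. False)" by (simp only: eventually_False ae_filter_eq_bot_iff not_False_eq_True)
  then show ?thesis by (cases P) auto
qed

lemma Linf_norm_nonneg: "0 \<le> Linf_norm \<Omega> w"
proof -
  have "AE x in M. 0 \<le> Linf_norm \<Omega> w"
    using AE_le_Linf_norm[of w]
  proof eventually_elim
    case (elim x)
    have "0 \<le> ereal (cmod (w x))" by simp
    then show ?case using elim by (rule order_trans)
  qed
  then show ?thesis by (simp add: AE_const_M)
qed

lemma Linf_seminorm_nonneg: "0 \<le> Linf_seminorm w"
  unfolding Linf_seminorm_def using Linf_norm_nonneg by (rule real_of_ereal_pos)

lemma ereal_Linf_seminorm: "w \<in> Linf \<Omega> \<Longrightarrow> ereal (Linf_seminorm w) = Linf_norm \<Omega> w"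
  unfolding Linf_seminorm_def using Linf_norm_nonneg[of w] by (intro ereal_real') (auto simp: Linf_def)

lemma bounded_potential_Linf: "w \<in> Linf \<Omega> \<Longrightarrow> bounded_potential w (Linf_seminorm w)"
  by (rule bounded_potential_if_Linf_norm_le) (simp_all add: ereal_Linf_seminorm Linf_seminorm_nonneg)

lemma Linf_seminorm_le:
  assumes "w \<in> borel_measurable M" "AE x in M. cmod (w x) \<le> C" shows "Linf_seminorm w \<le> C"
proof -
  have "ereal (Linf_seminorm w) \<le> ereal C"
    using ereal_Linf_seminorm[OF LinfI[OF assms]] Linf_norm_leI[OF assms] by simp
  then show ?thesis by simp
qed

lemma AE_le_Linf_seminorm: "w \<in> Linf \<Omega> \<Longrightarrow> AE x in M. cmod (w x) \<le> Linf_seminorm w"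
  using bounded_potential_Linf by (simp add: bounded_potential_def)

lemma Linf_add:
  assumes "u \<in> Linf \<Omega>" "v \<in> Linf \<Omega>"
  shows "u + v \<in> Linf \<Omega>" "Linf_seminorm (u + v) \<le> Linf_seminorm u + Linf_seminorm v"
proof -
  have m: "u + v \<in> borel_measurable M" using Linf_measurable[OF assms(1)] Linf_measurable[OF assms(2)] by (simp add: plus_fun_def)
  have ae: "AE x in M. cmod ((u + v) x) \<le> Linf_seminorm u + Linf_seminorm v"
    using AE_le_Linf_seminorm[OF assms(1)] AE_le_Linf_seminorm[OF assms(2)]
  proof eventually_elim
    case (elim x)
    then show ?case using norm_triangle_ineq[of "u x" "v x"] by simp
  qed
  show "u + v \<in> Linf \<Omega>" "Linf_seminorm (u + v) \<le> Linf_seminorm u + Linf_seminorm v"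
    by (rule LinfI[OF m ae], rule Linf_seminorm_le[OF m ae])
qed

lemma Linf_scaleR_le:
  assumes "u \<in> Linf \<Omega>"
  shows "c *\<^sub>R u \<in> Linf \<Omega>" "Linf_seminorm (c *\<^sub>R u) \<le> \<bar>c\<bar> * Linf_seminorm u"
proof -
  have m: "c *\<^sub>R u \<in> borel_measurable M" using Linf_measurable[OF assms] by (simp add: scaleR_fun_def)
  have ae: "AE x in M. cmod ((c *\<^sub>R u) x) \<le> \<bar>c\<bar> * Linf_seminorm u"
    using AE_le_Linf_seminorm[OF assms] by eventually_elim (auto intro: mult_left_mono)
  show "c *\<^sub>R u \<in> Linf \<Omega>" "Linf_seminorm (c *\<^sub>R u) \<le> \<bar>c\<bar> * Linf_seminorm u"
    by (rule LinfI[OF m ae], rule Linf_seminorm_le[OF m ae])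
qed

lemma Linf_seminorm_scaleR:
  assumes "u \<in> Linf \<Omega>" shows "Linf_seminorm (c *\<^sub>R u) = \<bar>c\<bar> * Linf_seminorm u"
proof (cases "c = 0")
  case True
  then show ?thesis using Linf_scaleR_le(2)[OF assms, of c] Linf_seminorm_nonneg[of "c *\<^sub>R u"] by simp
next
  case False
  have "Linf_seminorm u \<le> \<bar>1/c\<bar> * Linf_seminorm (c *\<^sub>R u)"
    using Linf_scaleR_le(2)[OF Linf_scaleR_le(1)[OF assms, of c], of "1/c"] False by simp
  then have "\<bar>c\<bar> * Linf_seminorm u \<le> Linf_seminorm (c *\<^sub>R u)"
    using False by (simp add: field_simps)
  then show ?thesis using Linf_scaleR_le(2)[OF assms, of c] by simp
qed

lemma subspace_Linf: "subspace (Linf \<Omega>)"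
proof -
  have "(0 :: 'a \<Rightarrow> complex) \<in> Linf \<Omega>" by (rule LinfI[of _ 0]) (simp_all add: zero_fun_def)
  then show ?thesis using Linf_add(1) Linf_scaleR_le(1) by (simp add: subspace_def)
qed

lemma Linf_L2: "w \<in> Linf \<Omega> \<Longrightarrow> w \<in> L2 M"
  using L2_bounded[OF finite_M Linf_measurable AE_le_Linf_seminorm] by blast

text \<open>
  A bounded function is determined by its Fourier coefficients at the lattice, and on a space of finite
  dimension finitely many of them suffice, with a norm estimate. Real and imaginary parts of the coefficients
  are separate functionals, since \<open>W\<close> is a real vector space.
\<close>

lemma Linf_norm_le_finitely_many_fourier_coefficients:
  assumes W: "finite_dim_subspace_Linf \<Omega> W"
  obtains K C where "finite K" "K \<subseteq> torus_lattice L" "C \<ge> 0"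
    "\<And>w. w \<in> W \<Longrightarrow> Linf_seminorm w \<le> C * (\<Sum>k\<in>K. cmod (LINT x|M. w x * cexp 0 k x))"
proof -
  obtain B where WL: "W \<subseteq> Linf \<Omega>" and B: "finite B" "B \<subseteq> W"
    "\<And>w. w \<in> W \<Longrightarrow> \<exists>c::('a \<Rightarrow> complex) \<Rightarrow> real. AE x in M. w x = (\<Sum>b\<in>B. c b *\<^sub>R b x)"
    using W unfolding finite_dim_subspace_Linf_def by blast
  define l where "l i w = (case i of (k, r) \<Rightarrow> if k \<in> torus_lattice L
      then (if r then Re else Im) (LINT x|M. w x * cexp 0 k x) else 0)" for i :: "'a \<times> bool" and w
  have e2: "cexp 0 k \<in> L2 M" for k by (rule smooth_L2[OF smooth_cexp])
  have "\<exists>J C. finite J \<and> C \<ge> 0 \<and> (\<forall>x\<in>span B. Linf_seminorm x \<le> C * (\<Sum>i\<in>J. \<bar>l i x\<bar>))"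
  proof (rule seminorm_le_finitely_many_functionals[where X = "Linf \<Omega>" and p = Linf_seminorm and l = l])
    show "subspace (Linf \<Omega>)" by (rule subspace_Linf)
    show "Linf_seminorm (x + y) \<le> Linf_seminorm x + Linf_seminorm y" if "x \<in> Linf \<Omega>" "y \<in> Linf \<Omega>" for x y
      by (rule Linf_add(2)[OF that])
    show "Linf_seminorm (c *\<^sub>R x) = \<bar>c\<bar> * Linf_seminorm x" if "x \<in> Linf \<Omega>" for c x
      by (rule Linf_seminorm_scaleR[OF that])
    fix i :: "'a \<times> bool" and x y :: "'a \<Rightarrow> complex" and c :: real
    obtain k r where i: "i = (k, r)" by (cases i)
    assume x: "x \<in> Linf \<Omega>"
    have "(LINT t|M. (c *\<^sub>R x) t * cexp 0 k t) = c *\<^sub>R (LINT t|M. x t * cexp 0 k t)" by simp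
    then show "l i (c *\<^sub>R x) = c * l i x" unfolding i l_def by (auto simp del: scaleR_fun_apply)
    assume y: "y \<in> Linf \<Omega>"
    have "(LINT t|M. (x + y) t * cexp 0 k t) = (LINT t|M. x t * cexp 0 k t) + (LINT t|M. y t * cexp 0 k t)"
      by (simp add: distrib_right L2_integrable_mult Linf_L2 x y e2)
    then show "l i (x + y) = l i x + l i y" unfolding i l_def by (auto simp del: plus_fun_apply)
  next
    fix x :: "'a \<Rightarrow> complex" assume x: "x \<in> Linf \<Omega>" and 0: "\<And>i. l i x = 0"
    have "AE t in M. x t = 0"
    proof (rule AE_zero_if_annihilates_exponentials[OF L_pos \<Omega>_lebesgue \<Omega>_sub])
      show "integrable M x" by (rule L2_integrable[OF finite_M Linf_L2[OF x]])
      show "(LINT t|M. x t * cexp 0 k t) = 0" if "k \<in> torus_lattice L" for k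
        using 0[of "(k, True)"] 0[of "(k, False)"] that by (simp add: l_def complex_eq_iff)
    qed
    then have "AE t in M. cmod (x t) \<le> 0" by eventually_elim simp
    from Linf_seminorm_le[OF Linf_measurable[OF x] this]
    show "Linf_seminorm x = 0" using Linf_seminorm_nonneg[of x] by simp
  qed (use B WL in auto)
  then obtain J C where J: "finite J" "C \<ge> 0" "\<And>x. x \<in> span B \<Longrightarrow> Linf_seminorm x \<le> C * (\<Sum>i\<in>J. \<bar>l i x\<bar>)"
    by blast
  define K where "K = fst ` J \<inter> torus_lattice L"
  show ?thesis
  proof (rule that[of K "2 * C"])
    show "finite K" "K \<subseteq> torus_lattice L" "2 * C \<ge> 0" using J by (auto simp: K_def)
    fix w assume w: "w \<in> W"
    obtain c :: "('a \<Rightarrow> complex) \<Rightarrow> real" where c: "AE x in M. w x = (\<Sum>b\<in>B. c b *\<^sub>R b x)" using B(3)[OF w] by blast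
    define v where "v = (\<Sum>b\<in>B. c b *\<^sub>R b)"
    have v: "v \<in> span B" unfolding v_def by (intro span_sum span_scale span_base)
    have "v x = (\<Sum>b\<in>B. c b *\<^sub>R b x)" for x
    proof -
      have "(\<Sum>b\<in>A. c b *\<^sub>R b) x = (\<Sum>b\<in>A. c b *\<^sub>R b x)" for A :: "('a \<Rightarrow> complex) set"
        by (induction A rule: infinite_finite_induct) auto
      then show ?thesis by (simp add: v_def)
    qed
    then have ae: "AE x in M. w x = v x" using c by simp
    have vL: "v \<in> Linf \<Omega>" using v span_minimal[OF _ subspace_Linf, of B] B WL by blast
    have wL: "w \<in> Linf \<Omega>" using w WL by blast
    have eqi: "(LINT x|M. v x * cexp 0 k x) = (LINT x|M. w x * cexp 0 k x)" for k
      using ae by (intro integral_mult_cong_AE Linf_L2 vL wL e2) (auto elim: eventually_mono)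
    have "AE x in M. cmod (w x) \<le> Linf_seminorm v"
      using ae AE_le_Linf_seminorm[OF vL] by eventually_elim simp
    then have "Linf_seminorm w \<le> Linf_seminorm v" by (rule Linf_seminorm_le[OF Linf_measurable[OF wL]])
    also have "\<dots> \<le> C * (\<Sum>i\<in>J. \<bar>l i v\<bar>)" by (rule J(3)[OF v])
    also have "(\<Sum>i\<in>J. \<bar>l i v\<bar>) \<le> (\<Sum>i\<in>K \<times> (UNIV :: bool set). cmod (LINT x|M. w x * cexp 0 (fst i) x))"
    proof -
      have "(\<Sum>i\<in>J. \<bar>l i v\<bar>) = (\<Sum>i\<in>{i \<in> J. fst i \<in> torus_lattice L}. \<bar>l i v\<bar>)"
        using J(1) by (intro sum.mono_neutral_right) (auto simp: l_def split: if_splits)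
      also have "\<dots> \<le> (\<Sum>i\<in>{i \<in> J. fst i \<in> torus_lattice L}. cmod (LINT x|M. w x * cexp 0 (fst i) x))"
        by (intro sum_mono) (auto simp: l_def eqi abs_Re_le_cmod abs_Im_le_cmod split: prod.splits)
      also have "\<dots> \<le> (\<Sum>i\<in>K \<times> (UNIV :: bool set). cmod (LINT x|M. w x * cexp 0 (fst i) x))"
        using J(1) by (intro sum_mono2) (force simp: K_def image_iff)+
      finally show ?thesis .
    qed
    also have "(\<Sum>i\<in>K \<times> (UNIV :: bool set). cmod (LINT x|M. w x * cexp 0 (fst i) x)) = 2 * (\<Sum>k\<in>K. cmod (LINT x|M. w x * cexp 0 k x))"
      by (simp add: sum.cartesian_product' UNIV_bool sum_distrib_left)
    finally show "Linf_seminorm w \<le> 2 * C * (\<Sum>k\<in>K. cmod (LINT x|M. w x * cexp 0 k x))"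
      using J(2) by (simp add: mult_left_mono mult.left_commute mult.assoc)
  qed
qed

text \<open>
  At every frequency in \<open>K\<close> the Fourier coefficient of \<open>q2 - q1\<close> is at most \<open>A / T\<close> times its norm.
  The number \<open>T\<close> may depend on \<open>R\<close>, whereas \<open>K\<close> and \<open>C\<close> are determined by \<open>W\<close>; for large \<open>T\<close> the estimate
  of the norm by the coefficients at \<open>K\<close> forces the norm to vanish.
\<close>

lemma finitely_many_measurements_determine_potential:
  assumes d: "DIM('a) \<ge> 3" and W: "finite_dim_subspace_Linf \<Omega> W"
    and K: "finite K" "K \<subseteq> torus_lattice L" "C \<ge> 0"
      "\<And>w. w \<in> W \<Longrightarrow> Linf_seminorm w \<le> C * (\<Sum>k\<in>K. cmod (LINT x|M. w x * cexp 0 k x))"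
    and R: "R > 0" and q1: "q1 \<in> W" "Linf_norm \<Omega> q1 \<le> ereal R" "\<not> dirichlet_eigenvalue \<Omega> q1 0"
  obtains \<psi> where "\<And>k. k \<in> K \<Longrightarrow> smooth (\<psi> k)"
    "\<And>q2. q2 \<in> W \<Longrightarrow> Linf_norm \<Omega> q2 \<le> ereal R \<Longrightarrow> \<not> dirichlet_eigenvalue \<Omega> q2 0 \<Longrightarrow>
      (\<And>k. k \<in> K \<Longrightarrow> dn_map \<Omega> q1 (\<psi> k) = dn_map \<Omega> q2 (\<psi> k)) \<Longrightarrow> AE x in M. q1 x = q2 x"
proof -
  have WL: "W \<subseteq> Linf \<Omega>" and W_add: "\<And>u v. u \<in> W \<Longrightarrow> v \<in> W \<Longrightarrow> (\<lambda>x. u x + v x) \<in> W"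
    and W_scale: "\<And>(c::real) u. u \<in> W \<Longrightarrow> (\<lambda>x. c *\<^sub>R u x) \<in> W"
    using W unfolding finite_dim_subspace_Linf_def by auto
  have bp: "bounded_potential q R" if "q \<in> W" "Linf_norm \<Omega> q \<le> ereal R" for q
    using that WL R by (intro bounded_potential_if_Linf_norm_le) auto
  define V where "V = L2_norm M (\<lambda>x. 1)"
  have V: "V \<ge> 0" by (simp add: V_def)
  \<comment> \<open>\<open>D / T\<close> bounds the error of the approximate solutions; \<open>A / T\<close> is the resulting factor in the bound for the Fourier coefficients.\<close>
  define D where "D = 2 * R * V + 1"
  define A where "A = 2 * R * V * (V + D) + V * D"
  have DA: "D \<ge> 0" "A \<ge> 0" using R V by (auto simp: D_def A_def intro!: add_nonneg_nonneg mult_nonneg_nonneg)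
  define T where "T = 1 + 2 * R + C * real (card K) * A"
  have CA: "0 \<le> C * real (card K) * A" using K(3) DA by (intro mult_nonneg_nonneg) auto
  have T: "T \<ge> 1" "2 * R \<le> T" "C * real (card K) * A < T" using CA R by (auto simp: T_def)
  define \<delta> where "\<delta> = D / T"
  have "D * 1 \<le> D * T" using T DA by (intro mult_left_mono) auto
  then have "D / T \<le> D" using T(1) by (simp add: pos_divide_le_eq)
  moreover have "D / T = 2 * R / T * V + 1 / T" by (simp add: D_def add_divide_distrib)
  ultimately have \<delta>: "\<delta> = 2 * R / T * V + 1 / T" "\<delta> \<le> D" by (simp_all only: \<delta>_def)
  define good where "good k \<psi> \<longleftrightarrow> smooth \<psi> \<and> (\<forall>q2\<in>W. Linf_norm \<Omega> q2 \<le> ereal R \<longrightarrow> \<not> dirichlet_eigenvalue \<Omega> q2 0 \<longrightarrow>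
      dn_map \<Omega> q1 \<psi> = dn_map \<Omega> q2 \<psi> \<longrightarrow>
      cmod (LINT x|M. (q2 x - q1 x) * cexp 0 k x) \<le> A / T * Linf_seminorm (\<lambda>x. q2 x - q1 x))" for k \<psi>
  have "\<exists>\<psi>. good k \<psi>" if k: "k \<in> K" for k
  proof -
    have T0: "0 < T" using T by simp
    have kL: "k \<in> torus_lattice L" using k K(2) by blast
    obtain a c1 c2 s where p: "a \<bullet> a = c1 \<bullet> c1" "a \<bullet> c1 = 0" "a \<bullet> a = c2 \<bullet> c2" "a \<bullet> c2 = 0" "c1 + c2 = k"
      "\<And>k. k \<in> shifted_lattice L s \<Longrightarrow> T \<le> \<bar>2 * (a \<bullet> k)\<bar>"
      using phase_vectors[OF d L_pos kL T0] by blast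
    obtain \<psi> where \<psi>: "smooth \<psi>"
      "L2_norm M (\<lambda>x. cexp (- (- a)) (- c1) x * dirichlet_solution \<Omega> q1 \<psi> x - 1) < 2 * R / T * L2_norm M (\<lambda>x. 1) + 1 / T"
      by (rule approximate_cgo_solution[OF bp[OF q1(1,2)] q1(3), of "- a" c1 T s "1 / T"]) (use p T T0 in auto)
    have "cmod (LINT x|M. (q2 x - q1 x) * cexp 0 k x) \<le> A / T * Linf_seminorm (\<lambda>x. q2 x - q1 x)"
      if q2: "q2 \<in> W" "Linf_norm \<Omega> q2 \<le> ereal R" "\<not> dirichlet_eigenvalue \<Omega> q2 0"
        and dn: "dn_map \<Omega> q1 \<psi> = dn_map \<Omega> q2 \<psi>" for q2
    proof -
      let ?P = "Linf_seminorm (\<lambda>x. q2 x - q1 x)"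
      have "(\<lambda>x. q2 x + (- 1) *\<^sub>R q1 x) \<in> W" by (rule W_add[OF q2(1) W_scale[OF q1(1)]])
      then have "bounded_potential (\<lambda>x. q2 x - q1 x) ?P" using WL by (intro bounded_potential_Linf) auto
      then have "cmod (LINT x|M. (q2 x - q1 x) * cexp 0 (c1 + c2) x) \<le> (2 * R / T * V * (V + \<delta>) + V * \<delta>) * ?P"
        unfolding V_def
        by (rule fourier_coefficient_bound[OF bp[OF q1(1,2)] q1(3) bp[OF q2(1,2)] q2(3) _ \<psi>(1) dn p(3,4) T0 T(2) p(6)])
           (use \<psi>(2) \<delta>(1) in \<open>auto simp: V_def\<close>)
      also have "\<dots> \<le> A / T * ?P"
      proof (rule mult_right_mono[OF _ Linf_seminorm_nonneg])
        have "2 * R / T * V * (V + \<delta>) \<le> 2 * R / T * V * (V + D)"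
          using R V T0 \<delta>(2) by (intro mult_left_mono) auto
        moreover have "A / T = 2 * R / T * V * (V + D) + V * \<delta>"
          by (simp add: A_def \<delta>_def add_divide_distrib)
        ultimately show "2 * R / T * V * (V + \<delta>) + V * \<delta> \<le> A / T" by linarith
      qed
      finally show ?thesis unfolding p(5) .
    qed
    then show ?thesis using \<psi>(1) unfolding good_def by blast
  qed
  then have "\<forall>k\<in>K. \<exists>\<psi>. good k \<psi>" by blast
  from bchoice[OF this] obtain \<psi> where "\<And>k. k \<in> K \<Longrightarrow> good k (\<psi> k)" by blast
  then have \<psi>: "\<And>k. k \<in> K \<Longrightarrow> smooth (\<psi> k)"
    "\<And>k q2. k \<in> K \<Longrightarrow> q2 \<in> W \<Longrightarrow> Linf_norm \<Omega> q2 \<le> ereal R \<Longrightarrow> \<not> dirichlet_eigenvalue \<Omega> q2 0 \<Longrightarrow>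
      dn_map \<Omega> q1 (\<psi> k) = dn_map \<Omega> q2 (\<psi> k) \<Longrightarrow>
      cmod (LINT x|M. (q2 x - q1 x) * cexp 0 k x) \<le> A / T * Linf_seminorm (\<lambda>x. q2 x - q1 x)"
    unfolding good_def by blast+
  show ?thesis
  proof (rule that[OF \<psi>(1)])
    fix q2 assume q2: "q2 \<in> W" "Linf_norm \<Omega> q2 \<le> ereal R" "\<not> dirichlet_eigenvalue \<Omega> q2 0"
      and dn: "\<And>k. k \<in> K \<Longrightarrow> dn_map \<Omega> q1 (\<psi> k) = dn_map \<Omega> q2 (\<psi> k)"
    let ?w = "\<lambda>x. q2 x - q1 x" and ?P = "Linf_seminorm (\<lambda>x. q2 x - q1 x)"
    have "(\<lambda>x. q2 x + (- 1) *\<^sub>R q1 x) \<in> W" by (rule W_add[OF q2(1) W_scale[OF q1(1)]])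
    then have w: "?w \<in> W" by simp
    have "(\<Sum>k\<in>K. cmod (LINT x|M. ?w x * cexp 0 k x)) \<le> real (card K) * (A / T * ?P)"
      by (rule sum_bounded_above) (rule \<psi>(2)[OF _ q2 dn])
    then have "?P \<le> C * (real (card K) * (A / T * ?P))"
      using K(4)[OF w] mult_left_mono[OF _ K(3)] order_trans by blast
    also have "\<dots> = (C * real (card K) * A / T) * ?P" by simp
    finally have le: "?P \<le> (C * real (card K) * A / T) * ?P" .
    have "C * real (card K) * A / T < 1" using T by (simp add: divide_less_eq)
    then have "?P = 0"
      using le Linf_seminorm_nonneg[of ?w] mult_strict_right_mono[of "C * real (card K) * A / T" 1 ?P] by fastforce
    moreover have "AE x in M. cmod (?w x) \<le> ?P" using w WL by (intro AE_le_Linf_seminorm) auto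
    ultimately show "AE x in M. q1 x = q2 x" by (auto elim!: eventually_mono)
  qed
qed

end

end

theorem theorem1:
  fixes \<Omega> :: "'a::euclidean_space set" and W :: "('a \<Rightarrow> complex) set"
  assumes "DIM('a) \<ge> 3"
    and "lipschitz_domain \<Omega>" and "bounded \<Omega>"
    and "finite_dim_subspace_Linf \<Omega> W"
  shows "\<exists>N::nat. \<forall>R::real. \<forall>q1\<in>W.
           R > 0 \<longrightarrow> Linf_norm \<Omega> q1 \<le> ereal R \<longrightarrow> \<not> dirichlet_eigenvalue \<Omega> q1 0 \<longrightarrow>
           (\<exists>f :: nat \<Rightarrow> 'a \<Rightarrow> complex.
              (\<forall>l\<in>{1..N}. f l \<in> H_half \<Omega>) \<and>
              (\<forall>q2\<in>W. Linf_norm \<Omega> q2 \<le> ereal R \<longrightarrow> \<not> dirichlet_eigenvalue \<Omega> q2 0 \<longrightarrow>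
                 (\<forall>l\<in>{1..N}. dn_map \<Omega> q1 (f l) = dn_map \<Omega> q2 (f l)) \<longrightarrow>
                 (AE x in lebesgue_on \<Omega>. q1 x = q2 x)))"
proof -
  obtain r where r: "r > 0" "\<And>x. x \<in> \<Omega> \<Longrightarrow> norm x \<le> r" using assms(3) unfolding bounded_pos by blast
  have op: "open \<Omega>" and ne: "\<Omega> \<noteq> {}" using assms(2) by (auto simp: lipschitz_domain_def)
  interpret bounded_domain \<Omega> r
  proof
    show "\<Omega> \<subseteq> cube r"
    proof
      fix x assume "x \<in> \<Omega>"
      then have "\<bar>x \<bullet> b\<bar> \<le> r" if "b \<in> Basis" for b using Basis_le_norm[OF that, of x] r(2)[of x] by simp
      then show "x \<in> cube r" by (simp add: mem_cube abs_le_iff minus_le_iff)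
    qed
    show "\<psi> \<in> L2 (surface_measure \<Omega>)" if "smooth \<psi>" for \<psi>
      by (rule smooth_L2_surface[OF _ assms(2,3) that]) (use assms(1) in simp)
  qed (use r op in auto)
  obtain K C where K: "finite K" "K \<subseteq> torus_lattice r" "C \<ge> 0"
    "\<And>w. w \<in> W \<Longrightarrow> Linf_seminorm w \<le> C * (\<Sum>k\<in>K. cmod (LINT x|M. w x * cexp 0 k x))"
    using Linf_norm_le_finitely_many_fourier_coefficients[OF ne assms(4)] by blast
  obtain \<kappa> where \<kappa>: "bij_betw \<kappa> {1..card K} K" using ex_bij_betw_nat_finite_1[OF K(1)] by blast
  show ?thesis
  proof (intro exI[of _ "card K"] allI ballI impI)
    fix R :: real and q1
    assume q1: "q1 \<in> W" "R > 0" "Linf_norm \<Omega> q1 \<le> ereal R" "\<not> dirichlet_eigenvalue \<Omega> q1 0"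
    obtain \<psi> where \<psi>: "\<And>k. k \<in> K \<Longrightarrow> smooth (\<psi> k)"
      "\<And>q2. q2 \<in> W \<Longrightarrow> Linf_norm \<Omega> q2 \<le> ereal R \<Longrightarrow> \<not> dirichlet_eigenvalue \<Omega> q2 0 \<Longrightarrow>
        (\<And>k. k \<in> K \<Longrightarrow> dn_map \<Omega> q1 (\<psi> k) = dn_map \<Omega> q2 (\<psi> k)) \<Longrightarrow> AE x in M. q1 x = q2 x"
      using finitely_many_measurements_determine_potential[OF ne assms(1,4) K q1(2,1,3,4)] by blast
    show "\<exists>f :: nat \<Rightarrow> 'a \<Rightarrow> complex.
              (\<forall>l\<in>{1..card K}. f l \<in> H_half \<Omega>) \<and>
              (\<forall>q2\<in>W. Linf_norm \<Omega> q2 \<le> ereal R \<longrightarrow> \<not> dirichlet_eigenvalue \<Omega> q2 0 \<longrightarrow>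
                 (\<forall>l\<in>{1..card K}. dn_map \<Omega> q1 (f l) = dn_map \<Omega> q2 (f l)) \<longrightarrow>
                 (AE x in lebesgue_on \<Omega>. q1 x = q2 x))"
    proof (intro exI[of _ "\<lambda>l. \<psi> (\<kappa> l)"] conjI ballI impI)
      show "\<psi> (\<kappa> l) \<in> H_half \<Omega>" if "l \<in> {1..card K}" for l
        using that bij_betwE[OF \<kappa>] by (intro smooth_H_half \<psi>(1)) auto
      fix q2 assume q2: "q2 \<in> W" "Linf_norm \<Omega> q2 \<le> ereal R" "\<not> dirichlet_eigenvalue \<Omega> q2 0"
        and dn: "\<forall>l\<in>{1..card K}. dn_map \<Omega> q1 (\<psi> (\<kappa> l)) = dn_map \<Omega> q2 (\<psi> (\<kappa> l))"
      show "AE x in lebesgue_on \<Omega>. q1 x = q2 x"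
      proof (rule \<psi>(2)[OF q2])
        fix k assume "k \<in> K"
        then have "k \<in> \<kappa> ` {1..card K}" using bij_betw_imp_surj_on[OF \<kappa>] by (simp only:)
        then obtain l where "l \<in> {1..card K}" "k = \<kappa> l" by blast
        then show "dn_map \<Omega> q1 (\<psi> k) = dn_map \<Omega> q2 (\<psi> k)" using dn by blast
      qed
    qed
  qed
qed

end
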